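(* Consider the random skew plane partitions with staircase back wall, bounded floor and 2-periodic weights described in the context (parameters $0<u<v<\infty$, $\alpha>1$, $e^{-2u}\alpha<1$), in the limit $r\to0^+$. Let $(\tau,\chi)$ be a turning point with $\tau=\pm v$ and with $\chi=\chi_{bottom}$ or $\chi=\chi_{top}$, where $$\chi_{bottom}=-\frac v2-\frac12\ln\frac{(e^v-e^{-u})(\alpha e^v-e^u)}{(e^v-e^{-v})(\alpha e^v-e^{-v})},\qquad \chi_{top}=-\frac v2-\frac12\ln\frac{(e^v-e^{-u}\alpha)(e^v-e^u)}{(e^v-e^{-v}\alpha)(e^v-e^{-v})}.$$ Let $$t_i=\Big\lfloor\frac{\tau}{r}\Big\rfloor-\hat t_i,\qquad h_i=\Big\lfloor\frac{\chi}{r}\Big\rfloor+\frac{\tilde h_i}{r^{1/2}} .$$ If $\lfloor\tau/r\rfloor$ is odd, then the correlation functions of the system near the turning point $(\tau,\chi)$ are given by (up to factors of the form $f(t_1,h_1)/f(t_2,h_2)$, which cancel in the determinants giving the correlation functions) $$\lim_{r\to0}r^{-\frac12}K_{\lambda_r,\bar q}\big((t_1,h_1),(t_2,h_2)\big)=\frac1{(2\pi\mathrm i)^2}\iint e^{\frac{S''_{\tau,\chi}(z_{\tau,\chi})}{2}(\zeta^2-\omega^2)}\,\frac{e^{\tilde h_2\omega}}{e^{\tilde h_1\zeta}}\,\frac{\omega^{\lfloor\frac{\hat t_2+e}{2}\rfloor}}{\zeta^{\lfloor\frac{\hat t_1+e}{2}\rfloor}}\,\frac{d\zeta\,d\omega}{\zeta-\omega},$$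 where $e=1$ when $\chi=\chi_{top}$ and $e=2$ when $\chi=\chi_{bottom}$, and the contours are those described in the context. When $\lfloor\tau/r\rfloor$ is even, $e$ is replaced by $2-e$.
   Context: **Skew plane partitions.** For a partition $\lambda$ and positive integers $c,d$, a skew plane partition with boundary $\lambda$ confined to a $c\times d$ box is an array of non-negative integers $\pi=(\pi_{i,j})$, $1\le i\le c$, $\lambda_i<j\le d$, weakly decreasing in $i$ and $j$. For $-c<t<d$, $\pi(t)$ is the partition formed by the entries $\pi_{i,i+t}$ of the $t$-th diagonal, and $|\pi(t)|$ is their sum. For weights $\bar q=(q_t)$ the measure is $\mathbb P(\pi)=\frac1Z\prod_{-c<t<d}q_t^{|\pi(t)|}$. Viewing $\pi$ as stacks of cubes, one gets a lozenge tiling; axes are scaled so that the centers $(t,h)$ of horizontal lozenges lie in $\mathbb Z\times\frac12\mathbb Z$. The back wall is the graph of a piecewise linear function $b_\lambda(t)$ with slopes $\pm1$, with corners at $u_1<\dots<u_{n-1}$ (the corners of the boundary of $\lambda$) and end points $u_0=-c$, $u_n=d$. **Kernel.** The probability that there are horizontal lozenges at all of $(t_1,h_1),\dots,(t_k,h_k)$ is $\det\big(K_{\lambda,\bar q}((t_i,h_i),(t_j,h_j))\big)_{i,j}$ with $$K_{\lambda,\bar q}((t_1,h_1),(t_2,h_2))=\frac1{(2\pi\mathrm i)^2}\int_{C_z}\int_{C_w}\frac{\Phi(z,t_1)}{\Phi(w,t_2)}\frac{1}{z-w}z^{-h_1+\frac12b_\lambda(t_1)+\frac12}w^{h_2-\frac12b_\lambda(t_2)+\frac12}\frac{dz\,dw}{zw},$$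 $\Phi(z,t)=\prod_{m<t,\,m\in D^-}(1-z^{-1}x_m^-)\big/\prod_{m>t,\,m\in D^+}(1-zx_m^+)$, where $m$ runs over half-integers in $(u_0,u_n)$, $m\in D^{\pm}$ means that $b_\lambda$ has slope $\mp1$ at $m$, $x^+_m=a\,q_{u_0+1}q_{u_0+2}\cdots q_{m-\frac12}$ and $x_m^-=1/x_m^+$ (with $a>0$ an arbitrary parameter, chosen here so that $a\,e^{r(\frac12+u_0)}=\alpha^{1/2}$). $C_z$ is a simple positively oriented contour around $0$ containing no pole of $\Phi(\cdot,t_1)$ coming from the factors $1-zx_m^+$; $C_w$ is one containing all poles of $\Phi(\cdot,t_2)^{-1}$; $C_z$ is inside $C_w$ if $t_1<t_2$, and $C_w$ is inside $C_z$ otherwise. **The model.** For $r>0$, $q_t=e^{-r}\alpha$ for odd $t$ and $q_t=e^{-r}\alpha^{-1}$ for even $t$. The boundary $\lambda_r$ is a staircase with unit steps; its first and last corners $u_1,u_{n-1}$ are even. As $r\to0$, $ru_{n-1}\to u$, $ru_1\to-u$, $rc_r\to v$, $rd_r\to v$, and the scaled back walls $r\,b_{\lambda_r}(\tau/r)$ converge uniformly to $V(\tau)=-\frac12|\tau+u|-\frac12|\tau-u|$. The condition $e^{-2u}\alpha<1$ (together with the parity of the corners) makes the measure well defined. $u_0,u_n$ are taken odd, except where the even case is explicitly mentioned. At the right edge $u_n=\lfloor v/r\rfloor$, so for $\tau=v$ the coordinate $\hat t_i=u_n-t_i$ is the distance from the edge; the turning points at $\tau=-v$ are of the same nature. **The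 function $S$ and the turning points.** $$\begin{aligned}S_{\tau,\chi}(z)=&\tfrac12\int_{-v}^{\min(-u,\tau)}\big[\ln(1-e^M\alpha^{\frac12}z^{-1})+\ln(1-e^M\alpha^{-\frac12}z^{-1})\big]dM+\tfrac12\int_{\min(-u,\tau)}^{\min(u,\tau)}\ln(1-e^M\alpha^{-\frac12}z^{-1})dM\\&-\tfrac12\int_{\max(\tau,u)}^{v}\big[\ln(1-e^{-M}\alpha^{-\frac12}z)+\ln(1-e^{-M}\alpha^{\frac12}z)\big]dM-\tfrac12\int_{\max(\tau,-u)}^{\max(\tau,u)}\ln(1-e^{-M}\alpha^{-\frac12}z)dM\\&-(\chi-\tfrac12V(\tau))\ln z.\end{aligned}$$ The frozen boundary is the set of $(\tau,\chi)$ for which $S_{\tau,\chi}$ has a double real critical point; the turning points are the points where it reaches $\tau=\pm v$. $z_{\tau,\chi}$ denotes the limit of the double critical point at the turning point; for $\tau=v$ it is $e^v\alpha^{\frac12}$ for $\chi_{bottom}$ and $e^v\alpha^{-\frac12}$ for $\chi_{top}$, and $S''_{\tau,\chi}(z_{\tau,\chi})<0$. **Contours.** $\omega$ runs upward along a vertical line, and $\zeta$ runs along a contour to the right of that line going clockwise around $0$. When $t_1<t_2$, interchanging the contours produces an additional residue term $\frac1{2\pi\mathrm i}\int_{\mathrm i\infty}^{-\mathrm i\infty}e^{(\tilde h_2-\tilde h_1)\zeta}\,\zeta^{-\lfloor\frac{\hat t_1+e}2\rfloor+\lfloor\frac{\hat t_2+e}2\rfloor}d\zeta$ (contour crossing the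 real line in $(-\infty,0)$); it is understood as incorporated in the double integral, as the difference between two different expansions of $\omega^{\lfloor\frac{\hat t_2+e}2\rfloor}\zeta^{-\lfloor\frac{\hat t_1+e}2\rfloor}\frac1{\zeta-\omega}$ depending on the sign of $\lfloor\frac{\hat t_1+e}2\rfloor-\lfloor\frac{\hat t_2+e}2\rfloor$.
   Formalization: S'' is taken in ln z (factor z²); for odd ⌊τ/r⌋ the exponent has e−1 in place of e; corners and ends converge with error o(√r); at τ=−v, t̂ is the distance from the edge and the kernel is transposed with −S''; equal heights are excluded where the residue term diverges or jumps. *)

theory Defs
  imports "HOL-Complex_Analysis.Complex_Analysis"
begin

section \<open>Skew plane partitions\<close>

text \<open>A partition is a function \<open>mu\<close> giving the length of row \<open>i \<ge> 1\<close> (the value at \<open>0\<close> is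
  irrelevant). A skew plane partition is extended by \<open>0\<close> outside its cells, so that it is
  determined by its entries.\<close>

definition cells :: "(nat \<Rightarrow> nat) \<Rightarrow> nat \<Rightarrow> nat \<Rightarrow> (nat \<times> nat) set" where
  "cells mu c d = {(i, j). 1 \<le> i \<and> i \<le> c \<and> mu i < j \<and> j \<le> d}"

definition skew_plane_partitions ::
    "(nat \<Rightarrow> nat) \<Rightarrow> nat \<Rightarrow> nat \<Rightarrow> (nat \<Rightarrow> nat \<Rightarrow> nat) set" where
  "skew_plane_partitions mu c d =
    {p. (\<forall>i j. (i, j) \<notin> cells mu c d \<longrightarrow> p i j = 0) \<and>
        (\<forall>i j. (i, j) \<in> cells mu c d \<and> (i + 1, j) \<in> cells mu c d \<longrightarrow> p (i + 1) j \<le> p i j) \<and>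
        (\<forall>i j. (i, j) \<in> cells mu c d \<and> (i, j + 1) \<in> cells mu c d \<longrightarrow> p i (j + 1) \<le> p i j)}"

definition diagonal_size ::
    "(nat \<Rightarrow> nat) \<Rightarrow> nat \<Rightarrow> nat \<Rightarrow> (nat \<Rightarrow> nat \<Rightarrow> nat) \<Rightarrow> int \<Rightarrow> nat" where
  "diagonal_size mu c d p t = (\<Sum>(i, j)\<in>{(i, j)\<in>cells mu c d. int j - int i = t}. p i j)"

definition pp_weight ::
    "(nat \<Rightarrow> nat) \<Rightarrow> nat \<Rightarrow> nat \<Rightarrow> (int \<Rightarrow> real) \<Rightarrow> (nat \<Rightarrow> nat \<Rightarrow> nat) \<Rightarrow> real" where
  "pp_weight mu c d q p = (\<Prod>t\<in>{- int c<..<int d}. q t ^ diagonal_size mu c d p t)"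

definition pp_prob ::
    "(nat \<Rightarrow> nat) \<Rightarrow> nat \<Rightarrow> nat \<Rightarrow> (int \<Rightarrow> real) \<Rightarrow> ((nat \<Rightarrow> nat \<Rightarrow> nat) \<Rightarrow> bool) \<Rightarrow> real" where
  "pp_prob mu c d q A =
     infsum (pp_weight mu c d q) {p \<in> skew_plane_partitions mu c d. A p} /
     infsum (pp_weight mu c d q) (skew_plane_partitions mu c d)"

text \<open>The top face of the stack over the cell \<open>(i, j)\<close>, of height \<open>p i j\<close>, is a horizontal lozenge
  centred at \<open>(j - i, p i j - (i + j - 1) / 2)\<close>.\<close>

definition has_lozenge ::
    "(nat \<Rightarrow> nat) \<Rightarrow> nat \<Rightarrow> nat \<Rightarrow> (nat \<Rightarrow> nat \<Rightarrow> nat) \<Rightarrow> int \<times> real \<Rightarrow> bool" where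
  "has_lozenge mu c d p x \<longleftrightarrow>
     (\<exists>(i, j)\<in>cells mu c d. fst x = int j - int i \<and> snd x = real (p i j) - (real i + real j - 1) / 2)"

definition lozenge_correlation ::
    "(nat \<Rightarrow> nat) \<Rightarrow> nat \<Rightarrow> nat \<Rightarrow> (int \<Rightarrow> real) \<Rightarrow> ('n \<Rightarrow> int \<times> real) \<Rightarrow> real" where
  "lozenge_correlation mu c d q x = pp_prob mu c d q (\<lambda>p. \<forall>i. has_lozenge mu c d p (x i))"


section \<open>Back wall and correlation kernel\<close>

text \<open>The back wall at integer points: removing the cells of \<open>mu\<close> lowers the wall \<open>- \<bar>t\<bar>\<close> of the
  empty partition by \<open>2\<close> for each cell of \<open>mu\<close> on the diagonal \<open>t\<close>. It is linear between
  consecutive integers.\<close>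

definition back_wall :: "(nat \<Rightarrow> nat) \<Rightarrow> int \<Rightarrow> int" where
  "back_wall mu t =
     - \<bar>t\<bar> - 2 * int (card {(i, j). 1 \<le> i \<and> 1 \<le> j \<and> j \<le> mu i \<and> int j - int i = t})"

text \<open>The exponents of \<open>z\<close> and \<open>w\<close> in the kernel are integers exactly at the possible centres of
  horizontal lozenges.\<close>

definition lozenge_site :: "(nat \<Rightarrow> nat) \<Rightarrow> int \<times> real \<Rightarrow> bool" where
  "lozenge_site mu x \<longleftrightarrow> snd x - real_of_int (back_wall mu (fst x)) / 2 - 1 / 2 \<in> \<int>"

text \<open>A half-integer \<open>m\<close> is represented by the integer \<open>m - 1/2\<close>; thus \<open>m < t\<close> becomes \<open>m < t\<close>,
  while \<open>m > t\<close> becomes \<open>m \<ge> t\<close>, and \<open>-c < m < d\<close> becomes \<open>-c \<le> m < d\<close>.\<close>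

definition D_plus :: "(nat \<Rightarrow> nat) \<Rightarrow> nat \<Rightarrow> nat \<Rightarrow> int set" where
  "D_plus mu c d = {m \<in> {- int c..<int d}. back_wall mu (m + 1) - back_wall mu m = -1}"

definition D_minus :: "(nat \<Rightarrow> nat) \<Rightarrow> nat \<Rightarrow> nat \<Rightarrow> int set" where
  "D_minus mu c d = {m \<in> {- int c..<int d}. back_wall mu (m + 1) - back_wall mu m = 1}"

definition x_plus :: "nat \<Rightarrow> (int \<Rightarrow> real) \<Rightarrow> real \<Rightarrow> int \<Rightarrow> real" where
  "x_plus c q a m = a * (\<Prod>t\<in>{- int c + 1..m}. q t)"

definition x_minus :: "nat \<Rightarrow> (int \<Rightarrow> real) \<Rightarrow> real \<Rightarrow> int \<Rightarrow> real" where
  "x_minus c q a m = 1 / x_plus c q a m"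

definition Phi ::
    "(nat \<Rightarrow> nat) \<Rightarrow> nat \<Rightarrow> nat \<Rightarrow> (int \<Rightarrow> real) \<Rightarrow> real \<Rightarrow> complex \<Rightarrow> int \<Rightarrow> complex" where
  "Phi mu c d q a z t =
     (\<Prod>m\<in>{m \<in> D_minus mu c d. m < t}. 1 - inverse z * of_real (x_minus c q a m)) /
     (\<Prod>m\<in>{m \<in> D_plus mu c d. t \<le> m}. 1 - z * of_real (x_plus c q a m))"

text \<open>Admissible radii of circles centred at \<open>0\<close> serving as \<open>C_z\<close> and \<open>C_w\<close>. They exist whenever
  the partition function converges, and the kernel does not depend on their choice.\<close>

definition admissible_radii ::
    "(nat \<Rightarrow> nat) \<Rightarrow> nat \<Rightarrow> nat \<Rightarrow> (int \<Rightarrow> real) \<Rightarrow> real \<Rightarrow> int \<Rightarrow> int \<Rightarrow> real \<times> real \<Rightarrow> bool" where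
  "admissible_radii mu c d q a t1 t2 R \<longleftrightarrow>
     (case R of (Rz, Rw) \<Rightarrow>
       0 < Rz \<and> 0 < Rw \<and>
       (\<forall>m\<in>D_plus mu c d. t1 \<le> m \<longrightarrow> Rz < 1 / x_plus c q a m) \<and>
       (\<forall>m\<in>D_minus mu c d. m < t2 \<longrightarrow> x_minus c q a m < Rw) \<and>
       (if t1 < t2 then Rz < Rw else Rw < Rz))"

definition kernel_at_radii ::
    "(nat \<Rightarrow> nat) \<Rightarrow> nat \<Rightarrow> nat \<Rightarrow> (int \<Rightarrow> real) \<Rightarrow> real \<Rightarrow>
      int \<times> real \<Rightarrow> int \<times> real \<Rightarrow> real \<times> real \<Rightarrow> complex" where
  "kernel_at_radii mu c d q a x1 x2 R =
     (case (x1, x2, R) of ((t1, h1), (t2, h2), (Rz, Rw)) \<Rightarrow>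
       1 / (2 * of_real pi * \<i>)^2 *
       contour_integral (circlepath 0 Rz) (\<lambda>z. contour_integral (circlepath 0 Rw) (\<lambda>w.
         Phi mu c d q a z t1 / Phi mu c d q a w t2 * (1 / (z - w)) *
         z powr of_real (- h1 + real_of_int (back_wall mu t1) / 2 + 1 / 2) *
         w powr of_real (h2 - real_of_int (back_wall mu t2) / 2 + 1 / 2) *
         (1 / (z * w)))))"

definition corr_kernel ::
    "(nat \<Rightarrow> nat) \<Rightarrow> nat \<Rightarrow> nat \<Rightarrow> (int \<Rightarrow> real) \<Rightarrow> real \<Rightarrow> int \<times> real \<Rightarrow> int \<times> real \<Rightarrow> complex" where
  "corr_kernel mu c d q a x1 x2 =
     kernel_at_radii mu c d q a x1 x2
       (SOME R. admissible_radii mu c d q a (fst x1) (fst x2) R)"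


section \<open>The two-periodic model with staircase back wall\<close>

text \<open>The partition \<open>(k, k - 1, ..., 1)\<close>; the corners of its boundary are \<open>-k, -k + 1, ..., k\<close>.\<close>

definition staircase :: "nat \<Rightarrow> nat \<Rightarrow> nat" where
  "staircase k i = k + 1 - i"

definition two_periodic :: "real \<Rightarrow> real \<Rightarrow> int \<Rightarrow> real" where
  "two_periodic alpha r t = (if odd t then exp (- r) * alpha else exp (- r) * inverse alpha)"

text \<open>The kernel of the model, the parameter \<open>a\<close> being fixed by
  \<open>a * exp (r * (1/2 + u0)) = sqrt alpha\<close> with \<open>u0 = - c\<close>.\<close>

definition model_kernel ::
    "real \<Rightarrow> real \<Rightarrow> nat \<Rightarrow> nat \<Rightarrow> nat \<Rightarrow> int \<times> real \<Rightarrow> int \<times> real \<Rightarrow> complex" where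
  "model_kernel alpha r k c d =
     corr_kernel (staircase k) c d (two_periodic alpha r)
       (sqrt alpha * exp (- r * (1 / 2 - real c)))"

definition model_correlation ::
    "real \<Rightarrow> real \<Rightarrow> nat \<Rightarrow> nat \<Rightarrow> nat \<Rightarrow> ('n \<Rightarrow> int \<times> real) \<Rightarrow> real" where
  "model_correlation alpha r k c d =
     lozenge_correlation (staircase k) c d (two_periodic alpha r)"


section \<open>Turning points\<close>

definition chi_bottom :: "real \<Rightarrow> real \<Rightarrow> real \<Rightarrow> real" where
  "chi_bottom u v alpha = - v / 2 - 1 / 2 *
     ln ((exp v - exp (- u)) * (alpha * exp v - exp u) /
         ((exp v - exp (- v)) * (alpha * exp v - exp (- v))))"

definition chi_top :: "real \<Rightarrow> real \<Rightarrow> real \<Rightarrow> real" where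
  "chi_top u v alpha = - v / 2 - 1 / 2 *
     ln ((exp v - exp (- u) * alpha) * (exp v - exp u) /
         ((exp v - exp (- v) * alpha) * (exp v - exp (- v))))"

definition limit_wall :: "real \<Rightarrow> real \<Rightarrow> real" where
  "limit_wall u tau = - 1 / 2 * \<bar>tau + u\<bar> - 1 / 2 * \<bar>tau - u\<bar>"

definition S_fun :: "real \<Rightarrow> real \<Rightarrow> real \<Rightarrow> real \<Rightarrow> real \<Rightarrow> real \<Rightarrow> real" where
  "S_fun u v alpha tau chi z =
     1 / 2 * integral {- v..min (- u) tau} (\<lambda>M.
       ln (1 - exp M * sqrt alpha / z) + ln (1 - exp M / sqrt alpha / z))
   + 1 / 2 * integral {min (- u) tau..min u tau} (\<lambda>M. ln (1 - exp M / sqrt alpha / z))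
   - 1 / 2 * integral {max tau u..v} (\<lambda>M.
       ln (1 - exp (- M) / sqrt alpha * z) + ln (1 - exp (- M) * sqrt alpha * z))
   - 1 / 2 * integral {max tau (- u)..max tau u} (\<lambda>M. ln (1 - exp (- M) / sqrt alpha * z))
   - (chi - 1 / 2 * limit_wall u tau) * ln z"

text \<open>The limit of the double critical point, with \<open>e = 1\<close> for the top and \<open>e = 2\<close> for the bottom
  turning point. The values at \<open>tau = - v\<close> are the inverses of those at \<open>tau = v\<close>, because
  \<open>S_fun u v alpha (- v) chi z = - S_fun u v alpha v chi (1 / z)\<close>.\<close>

definition z_turning :: "real \<Rightarrow> real \<Rightarrow> real \<Rightarrow> nat \<Rightarrow> real" where
  "z_turning v alpha tau e =
     (let z = exp v * (if e = 1 then 1 / sqrt alpha else sqrt alpha)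
      in if tau = v then z else 1 / z)"

text \<open>The coefficient \<open>S''\<close> in the limit is taken in the variable \<open>ln z\<close>, since the limit arises from
  \<open>z = z_turning * exp (sqrt r * zeta)\<close>. As \<open>z_turning\<close> is a critical point, this is
  \<open>z_turning\<^sup>2\<close> times the second derivative in \<open>z\<close>.\<close>

definition S_second :: "real \<Rightarrow> real \<Rightarrow> real \<Rightarrow> real \<Rightarrow> real \<Rightarrow> nat \<Rightarrow> real" where
  "S_second u v alpha tau chi e =
     (z_turning v alpha tau e)\<^sup>2 *
     (deriv ^^ 2) (S_fun u v alpha tau chi) (z_turning v alpha tau e)"


section \<open>The limiting kernel\<close>

definition turning_integrand ::
    "real \<Rightarrow> nat \<Rightarrow> nat \<Rightarrow> real \<Rightarrow> real \<Rightarrow> complex \<Rightarrow> complex \<Rightarrow> complex" where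
  "turning_integrand s n1 n2 y1 y2 \<zeta> \<omega> =
     exp (of_real (s / 2) * (\<zeta>\<^sup>2 - \<omega>\<^sup>2)) * (exp (of_real y2 * \<omega>) / exp (of_real y1 * \<zeta>)) *
     (\<omega> ^ n2 / \<zeta> ^ n1) * (1 / (\<zeta> - \<omega>))"

text \<open>\<open>\<omega>\<close> runs upward along \<open>Re \<omega> = -2\<close> and \<open>\<zeta>\<close> clockwise along the unit circle. The
  residue term, present exactly when \<open>n1 > n2\<close>, is a principal value integral, because it
  converges only conditionally when \<open>n1 = n2 + 1\<close>.\<close>

definition residue_term :: "nat \<Rightarrow> nat \<Rightarrow> real \<Rightarrow> real \<Rightarrow> complex" where
  "residue_term n1 n2 y1 y2 =
     1 / (2 * of_real pi * \<i>) *
     Lim at_top (\<lambda>R::real. contour_integral (linepath (Complex (-1) R) (Complex (-1) (- R)))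
       (\<lambda>\<zeta>. exp (of_real (y2 - y1) * \<zeta>) * \<zeta> powi (- int n1 + int n2)))"

definition turning_kernel :: "real \<Rightarrow> nat \<Rightarrow> nat \<Rightarrow> real \<Rightarrow> real \<Rightarrow> complex" where
  "turning_kernel s n1 n2 y1 y2 =
     1 / (2 * of_real pi * \<i>)^2 *
       (\<integral>y. \<i> * contour_integral (reversepath (circlepath 0 1))
          (\<lambda>\<zeta>. turning_integrand s n1 n2 y1 y2 \<zeta> (Complex (-2) y)) \<partial>lborel)
     + (if n1 > n2 then residue_term n1 n2 y1 y2 else 0)"

text \<open>A point near the turning point is given by its distance \<open>s \<ge> 1\<close> from the edge and its rescaled
  height. The edge is at \<open>\<lfloor>tau / r\<rfloor>\<close>, and the system lies to the left of it if \<open>tau = v\<close> and to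
  the right of it if \<open>tau = - v\<close>.\<close>

definition edge_time :: "real \<Rightarrow> real \<Rightarrow> nat \<Rightarrow> int" where
  "edge_time tau r s = (if 0 < tau then \<lfloor>tau / r\<rfloor> - int s else \<lfloor>tau / r\<rfloor> + int s)"

text \<open>\<open>edge_power odd_edge e s\<close> is the number of half-integers \<open>m\<close> between the diagonal and the edge for
  which \<open>1 - z * x_plus m\<close> (for \<open>tau = - v\<close>: \<open>1 - x_minus m / z\<close>) vanishes near the turning point.
  These \<open>m\<close> have alternating types, the outermost one being of bottom type (\<open>e = 2\<close>) if the edge
  is odd and of top type (\<open>e = 1\<close>) if it is even. So the power is \<open>\<lfloor>(s + e') / 2\<rfloor>\<close> with
  \<open>e' = e - 1\<close> for an odd edge and \<open>e' = 2 - e\<close> for an even edge.\<close>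

definition edge_power :: "bool \<Rightarrow> nat \<Rightarrow> nat \<Rightarrow> nat" where
  "edge_power odd_edge e s = (s + (if odd_edge then e - 1 else 2 - e)) div 2"

text \<open>The reflection \<open>t \<mapsto> - t\<close>, \<open>z \<mapsto> 1 / z\<close> transposes the kernel and changes the sign of \<open>S\<close>,
  whence the case \<open>tau = - v\<close>.\<close>

definition edge_kernel ::
    "real \<Rightarrow> real \<Rightarrow> bool \<Rightarrow> nat \<Rightarrow> nat \<times> real \<Rightarrow> nat \<times> real \<Rightarrow> complex" where
  "edge_kernel tau s odd_edge e P1 P2 =
     (if 0 < tau
      then turning_kernel s (edge_power odd_edge e (fst P1)) (edge_power odd_edge e (fst P2))
             (snd P1) (snd P2)
      else turning_kernel (- s) (edge_power odd_edge e (fst P2)) (edge_power odd_edge e (fst P1))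
             (snd P2) (snd P1))"

text \<open>For \<open>t1 < t2\<close> the residue term is a delta function of the difference of the heights if the two
  powers agree and has a jump at equal heights if they differ by \<open>1\<close>; there the heights have
  to be different.\<close>

definition separated :: "real \<Rightarrow> bool \<Rightarrow> nat \<Rightarrow> nat \<times> real \<Rightarrow> nat \<times> real \<Rightarrow> bool" where
  "separated tau odd_edge e P1 P2 \<longleftrightarrow>
     snd P1 \<noteq> snd P2 \<or>
     (if 0 < tau then fst P1 \<le> fst P2 else fst P2 \<le> fst P1) \<or>
     2 \<le> \<bar>int (edge_power odd_edge e (fst P1)) - int (edge_power odd_edge e (fst P2))\<bar>"

text \<open>The heights \<open>h = \<lfloor>chi / r\<rfloor> + y / sqrt r\<close> have to be lozenge sites for the given \<open>r\<close>. Hence \<open>h\<close> is a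
  function of \<open>r\<close> with values in the sites whose rescaled offset from \<open>\<lfloor>chi / r\<rfloor>\<close> tends to \<open>y\<close>.\<close>

definition height_approximates ::
    "(real \<Rightarrow> nat) \<Rightarrow> real \<Rightarrow> real \<Rightarrow> real filter \<Rightarrow> nat \<times> real \<Rightarrow> (real \<Rightarrow> real) \<Rightarrow> bool" where
  "height_approximates k tau chi F P h \<longleftrightarrow>
     (\<forall>\<^sub>F r in F. lozenge_site (staircase (k r)) (edge_time tau r (fst P), h r)) \<and>
     ((\<lambda>r. sqrt r * (h r - real_of_int \<lfloor>chi / r\<rfloor>)) \<longlongrightarrow> snd P) F"

definition edge_parity :: "real \<Rightarrow> bool \<Rightarrow> real filter" where
  "edge_parity tau odd_edge = at 0 within {r. 0 < r \<and> odd \<lfloor>tau / r\<rfloor> = odd_edge}"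

end

theory Submission
  imports Defs "HOL-Probability.Sinc_Integral" "HOL-Real_Asymp.Real_Asymp"
begin

text \<open>After rescaling \<open>z\<close> by the critical point, the kernel at a turning point is a double integral over
  two circles, in which the factors \<open>1 - z * x_plus m\<close> between the diagonals and the edge vanish either at
  points tending to \<open>1\<close> or at points tending to another number. Blowing up the circle of \<open>z\<close> to infinity
  replaces it by small circles around these two points and, for \<open>t1 < t2\<close>, by the residue at \<open>z = w\<close>,
  integrated over the circle of \<open>w\<close>. Near \<open>1\<close> put \<open>z = 1 + sqrt r * \<zeta>\<close>. At the height of the turning point
  the linear term in the exponent cancels up to the contribution of the local height, and the quadratic
  term converges to \<open>S''\<close>; both are Riemann sums for the derivatives of \<open>S\<close>. The integral over
  \<open>\<bar>w\<bar> = 1 - 2 * sqrt r\<close> converges by dominated convergence, since \<open>1 / \<Phi>\<close> has a Gaussian bound in the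
  argument of \<open>w\<close>, and the circle around the other point contributes an exponentially small amount.
  The inversion \<open>z \<mapsto> 1 / z\<close> reduces \<open>tau = - v\<close> to \<open>tau = v\<close>: it exchanges \<open>c\<close> with \<open>d\<close> and the two arguments
  of the kernel.\<close>

section \<open>Circle integrals\<close>

text \<open>Three obstacles shape the argument. The kernel uses radii picked by \<open>SOME\<close>,
  so only admissibility is known of the circles, and they bear no relation to the critical point;
  every deformation is made by comparing finite sums of residues. The exponents are of order
  \<open>1 / r\<close> while local heights are resolved on the scale \<open>1 / sqrt r\<close>, so
  the Riemann sum for the first derivative of S is needed with error \<open>o(sqrt r)\<close>; this
  is the origin of the rates in the hypotheses, and for the second derivative plain convergence
  suffices. Finally, the factors of the other parity vanish near a point q that may lie on either
  side of the circle of w. Their part of the double integral is negligible because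
  \<open>ln q - 1 + 1 / q > 0\<close>: at the critical height the numerator times the power of z is
  exponentially smaller at q than at 1. In the diagonal integral the numerator has cancelled and
  this argument is lost; there the sign of the difference of the two exponents decides whether the
  circle is contracted or blown up, which produces the one-sided residue term.\<close>

abbreviation circle_integral :: "complex \<Rightarrow> real \<Rightarrow> (complex \<Rightarrow> complex) \<Rightarrow> complex" where
  "circle_integral z R f \<equiv> contour_integral (circlepath z R) f"

text \<open>Contours are not deformed by homotopy below; two circles are compared through their
  finite residue sums. \<open>A\<close> may contain regular points of \<open>f\<close>, since these
  have residue zero, so a superset of the poles is enough.\<close>

lemma circle_integral_residues:
  assumes A: "finite A" and f: "f holomorphic_on - A" and R: "0 < R"
    and avoid: "\<And>p. p \<in> A \<Longrightarrow> dist z p \<noteq> R"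
  shows "circle_integral z R f = 2 * pi * \<i> * (\<Sum>p | p \<in> A \<and> dist z p < R. residue f p)"
proof -
  have "circle_integral z R f = 2 * pi * \<i> * (\<Sum>p\<in>A. winding_number (circlepath z R) p * residue f p)"
  proof (rule Residue_theorem[of UNIV])
    show "path_image (circlepath z R) \<subseteq> UNIV - A"
      using R avoid by (auto simp: sphere_def)
  qed (use A f in \<open>auto simp: Compl_eq_Diff_UNIV\<close>)
  also have "(\<Sum>p\<in>A. winding_number (circlepath z R) p * residue f p) =
      (\<Sum>p\<in>A. if dist z p < R then residue f p else 0)"
  proof (rule sum.cong)
    fix p assume p: "p \<in> A"
    show "winding_number (circlepath z R) p * residue f p = (if dist z p < R then residue f p else 0)"
    proof (cases "dist z p < R")
      case True
      then show ?thesis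
        using winding_number_circlepath[of p z R] by (simp add: dist_norm norm_minus_commute)
    next
      case False
      then have "R < dist z p" using avoid[OF p] by simp
      then have "winding_number (circlepath z R) p = 0"
        using R by (intro winding_number_zero_outside[of _ "cball z R"]) auto
      then show ?thesis using False by simp
    qed
  qed simp
  also have "\<dots> = (\<Sum>p | p \<in> A \<and> dist z p < R. residue f p)"
    using A by (simp add: sum.If_cases Int_def)
  finally show ?thesis .
qed

lemma contour_integrable_circlepath:
  assumes "f holomorphic_on - A" "finite A" "0 < R" "\<And>p. p \<in> A \<Longrightarrow> dist z p \<noteq> R"
  shows "f contour_integrable_on circlepath z R"
proof (rule contour_integrable_continuous_circlepath)
  have "path_image (circlepath z R) \<subseteq> - A" using assms(3,4) by (auto simp: sphere_def)
  then show "continuous_on (path_image (circlepath z R)) f"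
    using assms(1) holomorphic_on_imp_continuous_on continuous_on_subset by blast
qed

text \<open>The residue at infinity vanishes: on a circle of radius R around all of \<open>A\<close>
  the integrand is at most \<open>e / R\<close>, while the length is \<open>2 * pi * R\<close>, so
  the residue sum is at most \<open>e\<close> for every positive \<open>e\<close>.\<close>

lemma sum_residues_zero:
  assumes A: "finite A" and f: "f holomorphic_on - A"
    and decay: "((\<lambda>z. z * f z) \<longlongrightarrow> 0) at_infinity"
  shows "(\<Sum>p\<in>A. residue f p) = 0"
proof -
  define s where "s = (\<Sum>p\<in>A. residue f p)"
  have bound: "2 * pi * norm s \<le> 2 * pi * e" if e: "0 < e" for e :: real
  proof -
    have "\<forall>\<^sub>F z in at_infinity. norm (z * f z) < e"
      using tendstoD[OF decay e] by (simp add: dist_norm)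
    then obtain b where b: "\<And>z. b \<le> norm z \<Longrightarrow> norm (z * f z) < e"
      unfolding eventually_at_infinity by blast
    define R where "R = Max (insert \<bar>b\<bar> (norm ` A)) + 1"
    have ins: "norm p < R" if "p \<in> A" for p
    proof -
      have "norm p \<le> Max (insert \<bar>b\<bar> (norm ` A))" using that A by (intro Max_ge) auto
      then show ?thesis by (simp add: R_def)
    qed
    have "\<bar>b\<bar> \<le> Max (insert \<bar>b\<bar> (norm ` A))" using A by (intro Max_ge) auto
    then have R: "0 < R" "b \<le> R" unfolding R_def by linarith+
    have avoid: "dist 0 p \<noteq> R" if "p \<in> A" for p
      using ins[OF that] by simp
    have int: "f contour_integrable_on circlepath 0 R"
      by (rule contour_integrable_circlepath[OF f A R(1) avoid])
    have "{p \<in> A. dist 0 p < R} = A" using ins by auto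
    then have eq: "circle_integral 0 R f = 2 * pi * \<i> * s"
      using circle_integral_residues[OF A f R(1) avoid] by (simp only: s_def)
    have "norm (circle_integral 0 R f) \<le> e / R * (2 * pi * R)"
    proof (rule has_contour_integral_bound_circlepath[OF has_contour_integral_integral[OF int]])
      fix x :: complex assume x: "norm (x - 0) = R"
      then have "norm (x * f x) < e" by (intro b) (use R in simp)
      then have "R * norm (f x) \<le> e" using x by (simp add: norm_mult)
      then show "norm (f x) \<le> e / R" using R by (simp add: pos_le_divide_eq mult.commute)
    qed (use R e in auto)
    then show ?thesis using R by (simp add: eq norm_mult)
  qed
  have "norm s \<le> e" if "0 < e" for e
    using bound[OF that] by simp
  then have "norm s \<le> 0" by (rule field_le_epsilon) simp
  then show ?thesis by (simp add: s_def)
qed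

section \<open>Parametrization and changes of variable on circles\<close>

lemma circle_integral_param:
  "circle_integral z R f =
     integral {0..1} (\<lambda>t. f (z + R * cis (2 * pi * t)) * (2 * pi * \<i> * R * cis (2 * pi * t)))"
  unfolding contour_integral_integral vector_derivative_circlepath
  by (intro integral_cong) (simp add: circlepath cis_conv_exp mult_ac)

lemma circle_integral_scale:
  fixes l :: real and z :: complex and f :: "complex \<Rightarrow> complex"
  shows "circle_integral (of_real l * z) (l * R) f = circle_integral z R (\<lambda>x. of_real l * f (of_real l * x))"
  unfolding circle_integral_param by (intro integral_cong) (simp add: algebra_simps)

lemma circle_integral_affine:
  "circle_integral z R f = circle_integral 0 1 (\<lambda>x. R * f (z + R * x))"
  unfolding circle_integral_param by (intro integral_cong) (simp add: algebra_simps)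

text \<open>Inversion reverses the orientation of the circle, which cancels the minus sign of
  \<open>d (1 / x) = - dx / x^2\<close>; hence the factor \<open>1 / x^2\<close> appears with a plus
  sign.\<close>

lemma circle_integral_inverse:
  assumes "0 < R"
  shows "circle_integral 0 R f = circle_integral 0 (1 / R) (\<lambda>x. f (1 / x) / x\<^sup>2)"
proof -
  let ?F = "\<lambda>t. f (R * cis (2 * pi * t)) * (2 * pi * \<i> * R * cis (2 * pi * t))"
  have "circle_integral 0 R f = integral {0..1} ?F" by (simp add: circle_integral_param)
  \<comment> \<open>The parameter \<open>t\<close> is replaced by \<open>1 - t\<close>, as a
    reflection followed by a translation by one period.\<close>
  also have "\<dots> = integral {-1..0} (\<lambda>t. ?F (- t))"
    using Henstock_Kurzweil_Integration.integral_reflect_real[of 1 0 ?F] by simp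
  also have "\<dots> = integral {0..1} (\<lambda>t. ?F (- (t + - 1)))"
  proof -
    have "integral {0 + (-1)..1 + (-1)} (\<lambda>t. ?F (- t)) = integral {0..1} (\<lambda>t. ?F (- (t + (-1))))"
      by (subst integral_shift_Icc_real[symmetric]) (simp add: o_def algebra_simps)
    then show ?thesis by simp
  qed
  also have "\<dots> = circle_integral 0 (1 / R) (\<lambda>x. f (1 / x) / x\<^sup>2)"
    unfolding circle_integral_param
  proof (intro integral_cong)
    fix t :: real
    have "cis (2 * pi * - (t + - 1)) = cis (2 * pi * (- t)) * cis (2 * pi)"
      by (simp only: cis_mult) (simp add: algebra_simps)
    then have c: "cis (2 * pi * - (t + - 1)) = inverse (cis (2 * pi * t))"
      by (simp add: cis_inverse)
    show "?F (- (t + - 1)) = f (1 / (0 + complex_of_real (1 / R) * cis (2 * pi * t))) /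
       (0 + complex_of_real (1 / R) * cis (2 * pi * t))\<^sup>2 * (2 * pi * \<i> * (1 / R) * cis (2 * pi * t))"
      unfolding c
    proof -
      define X where "X = cis (2 * pi * t)"
      have X: "X \<noteq> 0" by (simp add: X_def)
      have "1 / (0 + complex_of_real (1 / R) * X) = R * inverse X"
        by (simp add: divide_inverse)
      moreover have "2 * pi * \<i> * R * inverse X =
          1 / (0 + complex_of_real (1 / R) * X)\<^sup>2 * (2 * pi * \<i> * (1 / R) * X)"
        using assms X by (simp add: power2_eq_square field_simps)
      ultimately show "f (R * inverse (cis (2 * pi * t))) * (2 * pi * \<i> * R * inverse (cis (2 * pi * t))) =
         f (1 / (0 + complex_of_real (1 / R) * cis (2 * pi * t))) /
         (0 + complex_of_real (1 / R) * cis (2 * pi * t))\<^sup>2 * (2 * pi * \<i> * (1 / R) * cis (2 * pi * t))"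
        unfolding X_def[symmetric] by simp
    qed
  qed
  finally show ?thesis .
qed

lemma circle_integral_swap:
  assumes "continuous_on (sphere 0 R \<times> sphere 0 R') (\<lambda>(x, y). f x y)" "0 \<le> R" "0 \<le> R'"
  shows "circle_integral 0 R (\<lambda>x. circle_integral 0 R' (f x)) =
    circle_integral 0 R' (\<lambda>y. circle_integral 0 R (\<lambda>x. f x y))"
proof (rule contour_integral_swap)
  show "continuous_on (path_image (circlepath 0 R) \<times> path_image (circlepath 0 R')) (\<lambda>(x, y). f x y)"
    using assms by (simp only: path_image_circlepath abs_of_nonneg)
  have "continuous_on {0..1} (\<lambda>t. vector_derivative (circlepath 0 r) (at t))" for r
    unfolding vector_derivative_circlepath by (intro continuous_intros)
  then show "continuous_on {0..1} (\<lambda>t. vector_derivative (circlepath 0 R) (at t))"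
      "continuous_on {0..1} (\<lambda>t. vector_derivative (circlepath 0 R') (at t))"
    by auto
qed simp_all

lemma continuous_on_circle_integral_param:
  assumes "continuous_on (S \<times> sphere z R) (\<lambda>(x, y). f x y)" "0 \<le> R"
  shows "continuous_on S (\<lambda>x. circle_integral z R (f x))"
proof -
  have "continuous_on (S \<times> cbox 0 1)
      (\<lambda>(x, t). f x (z + R * cis (2 * pi * t)) * (2 * pi * \<i> * R * cis (2 * pi * t)))"
  proof -
    have "continuous_on (S \<times> cbox 0 1)
        (\<lambda>p. (\<lambda>(x, y). f x y) (fst p, z + R * cis (2 * pi * snd p)) * (2 * pi * \<i> * R * cis (2 * pi * snd p)))"
      by (intro continuous_intros continuous_on_compose2[OF assms(1)])
         (use assms(2) in \<open>auto simp: dist_norm norm_mult\<close>)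
    then show ?thesis by (simp add: case_prod_unfold)
  qed
  then show ?thesis
    unfolding circle_integral_param box_real(2)[symmetric] by (rule integral_continuous_on_param)
qed

section \<open>Decomposition of the kernel at an edge\<close>

definition N_prod :: "int set \<Rightarrow> (int \<Rightarrow> real) \<Rightarrow> complex \<Rightarrow> complex" where
  "N_prod I b z = (\<Prod>m\<in>I. 1 - of_real (b m) / z)"

definition P_prod :: "(nat \<Rightarrow> real) \<Rightarrow> nat \<Rightarrow> complex \<Rightarrow> complex" where
  "P_prod p s z = (\<Prod>j<s. 1 - z * of_real (p j))"

text \<open>On a diagonal to the right of all corners, \<open>Phi\<close> is
  \<open>N_prod / P_prod\<close> with a numerator common to both diagonals; \<open>s1\<close> and
  \<open>s2\<close> are the distances from the edge. \<open>H = h - b / 2 + 1 / 2\<close>, with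
  \<open>b\<close> the height of the wall, is an integer, and the factor \<open>1 / (z * w)\<close>
  of the kernel turns the exponents \<open>- H1 + 1\<close> and \<open>H2\<close> into
  \<open>- H1\<close> and \<open>H2 - 1\<close>.\<close>

definition edge_integrand ::
    "int set \<Rightarrow> (int \<Rightarrow> real) \<Rightarrow> (nat \<Rightarrow> real) \<Rightarrow> nat \<Rightarrow> nat \<Rightarrow> int \<Rightarrow> int \<Rightarrow> complex \<Rightarrow> complex \<Rightarrow> complex" where
  "edge_integrand I b p s1 s2 H1 H2 z w =
     N_prod I b z / N_prod I b w * (P_prod p s2 w / P_prod p s1 z) * (1 / (z - w)) *
     z powi (- H1) * w powi (H2 - 1)"

text \<open>Up to sign, the residue of \<open>edge_integrand\<close> at \<open>w = z\<close>.\<close>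

definition diagonal_integrand :: "(nat \<Rightarrow> real) \<Rightarrow> nat \<Rightarrow> nat \<Rightarrow> int \<Rightarrow> int \<Rightarrow> complex \<Rightarrow> complex" where
  "diagonal_integrand p s1 s2 H1 H2 z = P_prod p s2 z / P_prod p s1 z * z powi (H2 - H1 - 1)"

definition P_zeros :: "(nat \<Rightarrow> real) \<Rightarrow> nat \<Rightarrow> complex set" where
  "P_zeros p s = (\<lambda>j. of_real (1 / p j)) ` {..<s}"

lemma finite_P_zeros [simp]: "finite (P_zeros p s)"
  by (simp add: P_zeros_def)

lemma P_prod_nonzero:
  assumes "\<And>j. j < s \<Longrightarrow> 0 < p j" "z \<notin> P_zeros p s"
  shows "P_prod p s z \<noteq> 0"
proof -
  have "1 - z * of_real (p j) \<noteq> 0" if j: "j < s" for j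
  proof
    assume "1 - z * of_real (p j) = 0"
    then have "z = of_real (1 / p j)" using assms(1)[OF j] by (simp add: field_simps)
    then show False using assms(2) j unfolding P_zeros_def by blast
  qed
  then show ?thesis by (simp add: P_prod_def)
qed

lemma N_prod_nonzero:
  assumes "finite I" "z \<noteq> 0" "\<And>m. m \<in> I \<Longrightarrow> z \<noteq> of_real (b m)"
  shows "N_prod I b z \<noteq> 0"
  using assms by (auto simp: N_prod_def field_simps)

lemma N_prod_nonzero_norm:
  assumes "finite I" "0 < norm z" "\<And>m. m \<in> I \<Longrightarrow> \<bar>b m\<bar> < norm z"
  shows "N_prod I b z \<noteq> 0"
proof (rule N_prod_nonzero[OF assms(1)])
  show "z \<noteq> of_real (b m)" if "m \<in> I" for m
    using assms(3)[OF that] by auto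
qed (use assms(2) in auto)

lemma holomorphic_N_prod: "N_prod I b holomorphic_on - {0}"
  unfolding N_prod_def by (intro holomorphic_intros) auto

lemma holomorphic_P_prod: "P_prod p s holomorphic_on S"
  unfolding P_prod_def by (intro holomorphic_intros)

lemma continuous_on_N_prod:
  assumes "continuous_on S f" "\<And>x. x \<in> S \<Longrightarrow> f x \<noteq> 0"
  shows "continuous_on S (\<lambda>x. N_prod I b (f x))"
  unfolding N_prod_def using assms by (intro continuous_intros) auto

lemma continuous_on_P_prod:
  assumes "continuous_on S f"
  shows "continuous_on S (\<lambda>x. P_prod p s (f x))"
  unfolding P_prod_def using assms by (intro continuous_intros)

lemma continuous_on_edge_integrand:
  assumes "finite I" "\<And>j. j < s1 \<Longrightarrow> 0 < p j"
    and "\<And>z w. z \<in> S \<Longrightarrow> w \<in> T \<Longrightarrow> z \<noteq> 0 \<and> z \<notin> P_zeros p s1 \<and> w \<noteq> 0 \<and> w \<noteq> z \<and> (\<forall>m\<in>I. w \<noteq> of_real (b m))"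
  shows "continuous_on (S \<times> T) (\<lambda>(z, w). edge_integrand I b p s1 s2 H1 H2 z w)"
proof -
  have "N_prod I b w \<noteq> 0" "P_prod p s1 z \<noteq> 0" if "z \<in> S" "w \<in> T" for z w
    using assms(3)[OF that] N_prod_nonzero[OF assms(1), of w b] P_prod_nonzero[of s1 p z] assms(2) by blast+
  then show ?thesis
    unfolding edge_integrand_def case_prod_unfold
    by (intro continuous_intros continuous_on_N_prod continuous_on_P_prod)
       (use assms(3) in \<open>force simp: mem_Times_iff\<close>)+
qed

lemma contour_integrable_circle_param:
  assumes "continuous_on (sphere z R \<times> sphere z' R') (\<lambda>(x, y). f x y)" "0 \<le> R" "0 \<le> R'"
  shows "(\<lambda>x. circle_integral z' R' (f x)) contour_integrable_on circlepath z R"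
  using continuous_on_circle_integral_param[OF assms(1,3)] assms(2)
  by (intro contour_integrable_continuous_circlepath) simp

lemma continuous_on_swap_args:
  assumes "continuous_on (S \<times> T) (\<lambda>(x, y). f x y)"
  shows "continuous_on (T \<times> S) (\<lambda>(y, x). f x y)"
proof -
  have "continuous_on (T \<times> S) (\<lambda>p. (\<lambda>(x, y). f x y) (snd p, fst p))"
    by (rule continuous_on_compose2[OF assms]) (auto intro!: continuous_intros)
  then show ?thesis by (simp add: case_prod_unfold)
qed

text \<open>\<open>z / (z - w)\<close> and the numerator tend to 1, and the inverse of
  \<open>P_prod\<close> has a finite limit, also for \<open>s1 = 0\<close>. In all cases the decay
  is supplied by \<open>z powi (- H1)\<close>; this is why \<open>1 <= H1\<close> is carried through
  the decomposition.\<close>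

lemma tendsto_edge_integrand_at_infinity:
  assumes "1 \<le> H1" "\<And>j. j < s1 \<Longrightarrow> 0 < p j"
  shows "((\<lambda>z. z * edge_integrand I b p s1 s2 H1 H2 z w) \<longlongrightarrow> 0) at_infinity"
proof -
  have inv: "((\<lambda>z. inverse z) \<longlongrightarrow> (0::complex)) at_infinity"
    by (rule tendsto_inverse_0)
  have N: "(N_prod I b \<longlongrightarrow> 1) at_infinity"
  proof -
    have "((\<lambda>z. \<Prod>m\<in>I. 1 - of_real (b m) * inverse z) \<longlongrightarrow> (\<Prod>m\<in>I. 1 - of_real (b m) * (0::complex))) at_infinity"
      by (intro tendsto_intros inv)
    then show ?thesis by (simp add: N_prod_def[abs_def] divide_inverse)
  qed
  have P: "((\<lambda>z. inverse (P_prod p s1 z)) \<longlongrightarrow> (\<Prod>j<s1. 0)) at_infinity"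
    unfolding P_prod_def prod_inversef[symmetric] o_def
  proof (intro tendsto_prod)
    fix j assume j: "j \<in> {..<s1}"
    have "((\<lambda>z. inverse z * inverse (inverse z - of_real (p j))) \<longlongrightarrow> 0 * inverse (0 - complex_of_real (p j))) at_infinity"
      using assms(2)[of j] j by (intro tendsto_intros inv) auto
    moreover have "\<forall>\<^sub>F z in at_infinity. inverse z * inverse (inverse z - complex_of_real (p j)) =
        inverse (1 - z * of_real (p j))"
      using eventually_not_equal_at_infinity[of "0::complex"]
    proof eventually_elim
      fix z :: complex assume "z \<noteq> 0"
      then have "1 - z * of_real (p j) = z * (inverse z - of_real (p j))"
        by (simp add: right_diff_distrib)
      then show "inverse z * inverse (inverse z - of_real (p j)) = inverse (1 - z * of_real (p j))"
        by simp
    qed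
    ultimately show "((\<lambda>z. inverse (1 - z * complex_of_real (p j))) \<longlongrightarrow> 0) at_infinity"
      by (auto intro: Lim_transform_eventually)
  qed
  have Q: "((\<lambda>z. z * (1 / (z - w))) \<longlongrightarrow> 1) at_infinity"
  proof -
    have "((\<lambda>z. inverse (1 - w * inverse z)) \<longlongrightarrow> inverse (1 - w * 0)) at_infinity"
      by (intro tendsto_intros inv) auto
    moreover have "\<forall>\<^sub>F z in at_infinity. inverse (1 - w * inverse z) = z * (1 / (z - w))"
      using eventually_not_equal_at_infinity[of "0::complex"]
    proof eventually_elim
      fix z :: complex assume "z \<noteq> 0"
      then have "1 - w * inverse z = (z - w) * inverse z"
        by (simp add: left_diff_distrib)
      then show "inverse (1 - w * inverse z) = z * (1 / (z - w))"
        by (simp add: divide_inverse)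
    qed
    ultimately show ?thesis by (auto intro: Lim_transform_eventually)
  qed
  have H: "((\<lambda>z. z powi (- H1)) \<longlongrightarrow> (0::complex)) at_infinity"
  proof -
    have "((\<lambda>z. inverse z ^ nat H1) \<longlongrightarrow> (0::complex) ^ nat H1) at_infinity"
      by (intro tendsto_intros inv)
    moreover have "inverse z ^ nat H1 = z powi (- H1)" for z :: complex
      using assms(1) by (simp add: power_int_def)
    moreover have "(0::complex) ^ nat H1 = 0" using assms(1) by (simp add: zero_power)
    ultimately show ?thesis by simp
  qed
  have "((\<lambda>z. N_prod I b z * inverse (N_prod I b w) * (P_prod p s2 w * inverse (P_prod p s1 z)) * (z * (1 / (z - w))) *
     z powi (- H1) * w powi (H2 - 1)) \<longlongrightarrow> 1 * inverse (N_prod I b w) * (P_prod p s2 w * (\<Prod>j<s1. 0)) * 1 * 0 * w powi (H2 - 1)) at_infinity"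
    by (intro tendsto_intros N P Q H)
  then show ?thesis by (simp add: edge_integrand_def divide_inverse mult_ac)
qed

text \<open>The residues of a function decaying at infinity add up to zero, so the integral over the
  circle about 0 is minus the contribution of the poles outside it. These sit in the disks about 1
  and \<open>q\<close>, and at \<open>w\<close> if \<open>w\<close> is outside. The conditions on
  \<open>\<epsilon>\<close>, \<open>\<delta>\<close> and \<open>q\<close> keep these places
  disjoint.\<close>

lemma circle_integral_in_z:
  fixes w :: complex
  assumes I: "finite I" "\<And>m. m \<in> I \<Longrightarrow> \<bar>b m\<bar> < norm w" and w: "0 < norm w"
    and p: "\<And>j. j < s1 \<Longrightarrow> 0 < p j" and H1: "1 \<le> H1"
    and Rz: "0 < Rz" "\<And>j. j < s1 \<Longrightarrow> Rz < 1 / p j" "Rz \<noteq> norm w"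
    and eps: "0 < \<epsilon>" "norm w + \<epsilon> < 1"
    and q: "0 < \<delta>" "\<delta> < q" "\<delta> < \<bar>q - norm w\<bar>" "\<epsilon> + \<delta> < \<bar>q - 1\<bar>"
    and T: "\<And>j. j < s1 \<Longrightarrow> \<bar>1 / p j - 1\<bar> < \<epsilon> \<or> \<bar>1 / p j - q\<bar> < \<delta>"
  shows "circle_integral 0 Rz (\<lambda>z. edge_integrand I b p s1 s2 H1 H2 z w) =
     - (circle_integral 1 \<epsilon> (\<lambda>z. edge_integrand I b p s1 s2 H1 H2 z w) +
        circle_integral (of_real q) \<delta> (\<lambda>z. edge_integrand I b p s1 s2 H1 H2 z w)) -
     (if Rz < norm w then 2 * pi * \<i> * diagonal_integrand p s1 s2 H1 H2 w else 0)"
proof -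
  define f where "f = (\<lambda>z. edge_integrand I b p s1 s2 H1 H2 z w)"
  define A where "A = insert 0 (insert w (P_zeros p s1))"
  have fin: "finite A" by (simp add: A_def)
  have w0: "w \<noteq> 0" using w by auto
  have Nw: "N_prod I b w \<noteq> 0" by (rule N_prod_nonzero_norm[OF I(1) w I(2)])
  have Pz: "P_prod p s1 z \<noteq> 0" if "z \<notin> P_zeros p s1" for z
    by (rule P_prod_nonzero[OF p that])
  have hol: "f holomorphic_on - A"
    unfolding f_def edge_integrand_def A_def
    by (intro holomorphic_intros holomorphic_on_subset[OF holomorphic_N_prod] holomorphic_P_prod)
       (auto simp: Nw Pz)
  have zero: "(\<Sum>p\<in>A. residue f p) = 0"
    by (rule sum_residues_zero[OF fin hol]) (use tendsto_edge_integrand_at_infinity[OF H1 p] in \<open>simp add: f_def\<close>)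
  have wT: "\<epsilon> < dist 1 w" "\<delta> < dist (of_real q) w"
  proof -
    have "1 - norm w \<le> dist 1 w" using norm_triangle_ineq2[of 1 w] by (simp add: dist_norm)
    then show "\<epsilon> < dist 1 w" using eps by linarith
    have "\<bar>q - norm w\<bar> \<le> dist (of_real q) w"
      using norm_triangle_ineq3[of "of_real q" w] q by (simp add: dist_norm)
    then show "\<delta> < dist (of_real q) w" using q by linarith
  qed
  have zer: "Rz < dist 0 x \<and> (dist 1 x < \<epsilon> \<and> \<delta> < dist (of_real q) x \<or> \<epsilon> < dist 1 x \<and> dist (of_real q) x < \<delta>)"
    if "x \<in> P_zeros p s1" for x
  proof -
    from that obtain j where j: "j < s1" "x = of_real (1 / p j)" by (auto simp: P_zeros_def)
    have "dist 1 x = \<bar>1 / p j - 1\<bar>" "dist (of_real q) x = \<bar>1 / p j - q\<bar>" "dist 0 x = 1 / p j"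
      using p[OF j(1)] dist_of_real[of 1 "1 / p j", where 'a = complex]
        dist_of_real[of q "1 / p j", where 'a = complex] dist_of_real[of 0 "1 / p j", where 'a = complex]
      unfolding j(2) by (simp_all add: dist_real_def abs_minus_commute)
    then show ?thesis using T[OF j(1)] Rz(2)[OF j(1)] q by linarith
  qed
  have wz: "w \<notin> P_zeros p s1" using zer[of w] wT by auto
  \<comment> \<open>At \<open>z = w\<close> the two numerators cancel, which is why the diagonal
    integrand no longer contains \<open>I\<close> and \<open>b\<close>.\<close>
  have res: "residue f w = diagonal_integrand p s1 s2 H1 H2 w"
  proof -
    define G where "G = (\<lambda>z. N_prod I b z / N_prod I b w * (P_prod p s2 w / P_prod p s1 z) * z powi (- H1) * w powi (H2 - 1))"
    have G: "G holomorphic_on - insert 0 (P_zeros p s1)"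
      unfolding G_def
      by (intro holomorphic_intros holomorphic_on_subset[OF holomorphic_N_prod] holomorphic_P_prod)
         (auto simp: Nw Pz)
    have "f = (\<lambda>z. G z / (z - w))" by (auto simp: f_def G_def edge_integrand_def)
    moreover have "residue (\<lambda>z. G z / (z - w)) w = G w"
      by (rule residue_simple[OF _ _ G]) (use w0 wz in \<open>auto intro!: finite_imp_closed open_Compl\<close>)
    moreover have "w powi (- H1) * w powi (H2 - 1) = w powi (H2 - H1 - 1)"
      using w0 power_int_add[of w "- H1" "H2 - 1"] by (simp add: algebra_simps)
    ultimately show ?thesis using Nw by (simp add: G_def diagonal_integrand_def mult.assoc)
  qed
  have d0: "dist (of_real q) (0::complex) = q" using q by simp
  have sep: "dist 0 x \<noteq> Rz \<and> dist 1 x \<noteq> \<epsilon> \<and> dist (of_real q) x \<noteq> \<delta>" if "x \<in> A" for x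
    using that zer[of x] Rz eps wT q d0 by (auto simp: A_def)
  have I0: "circle_integral 0 Rz f = 2 * pi * \<i> * (\<Sum>p | p \<in> A \<and> dist 0 p < Rz. residue f p)"
    by (rule circle_integral_residues[OF fin hol Rz(1)]) (use sep in blast)
  have I1: "circle_integral 1 \<epsilon> f = 2 * pi * \<i> * (\<Sum>p | p \<in> A \<and> dist 1 p < \<epsilon>. residue f p)"
    by (rule circle_integral_residues[OF fin hol eps(1)]) (use sep in blast)
  have Iq: "circle_integral (of_real q) \<delta> f = 2 * pi * \<i> * (\<Sum>p | p \<in> A \<and> dist (of_real q) p < \<delta>. residue f p)"
    by (rule circle_integral_residues[OF fin hol q(1)]) (use sep in blast)
  \<comment> \<open>Every possible pole is counted exactly once: inside the circle, near 1, near
    \<open>q\<close>, or equal to an outer \<open>w\<close>.\<close>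
  have Aeq: "A = {p \<in> A. dist 0 p < Rz} \<union> ({p \<in> A. dist 1 p < \<epsilon>} \<union> ({p \<in> A. dist (of_real q) p < \<delta>} \<union>
      (if Rz < norm w then {w} else {})))" (is "_ = ?A0 \<union> (?A1 \<union> (?A2 \<union> ?A3))")
  proof (intro equalityI subsetI)
    fix x assume "x \<in> A"
    then show "x \<in> ?A0 \<union> (?A1 \<union> (?A2 \<union> ?A3))"
      using zer[of x] Rz by (auto simp: A_def)
  qed (auto simp: A_def split: if_splits)
  have norm_gt: "Rz \<le> dist 0 x" if "x \<in> A" "dist 1 x < \<epsilon> \<or> dist (of_real q) x < \<delta>" for x
  proof -
    have "\<epsilon> < 1" using eps norm_ge_zero[of w] by linarith
    then show ?thesis using that zer[of x] wT q d0 by (auto simp: A_def)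
  qed
  have "(\<Sum>p\<in>A. residue f p) = (\<Sum>p\<in>?A0. residue f p) + ((\<Sum>p\<in>?A1. residue f p) + ((\<Sum>p\<in>?A2. residue f p) + (\<Sum>p\<in>?A3. residue f p)))"
  proof -
    have d1: "?A0 \<inter> (?A1 \<union> (?A2 \<union> ?A3)) = {}" using norm_gt by (fastforce split: if_splits)
    have "\<not> (x \<in> ?A1 \<and> x \<in> ?A2 \<union> ?A3)" for x
      using zer[of x] wT eps q d0 by (auto simp: A_def split: if_splits)
    then have d2: "?A1 \<inter> (?A2 \<union> ?A3) = {}" by blast
    have d3: "?A2 \<inter> ?A3 = {}" using wT by auto
    have "(\<Sum>p\<in>A. residue f p) = (\<Sum>p\<in>?A0 \<union> (?A1 \<union> (?A2 \<union> ?A3)). residue f p)"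
      using Aeq by (rule arg_cong)
    also have "\<dots> = (\<Sum>p\<in>?A0. residue f p) + ((\<Sum>p\<in>?A1. residue f p) + ((\<Sum>p\<in>?A2. residue f p) + (\<Sum>p\<in>?A3. residue f p)))"
      using fin by (subst sum.union_disjoint[OF _ _ d1]; (subst sum.union_disjoint[OF _ _ d2])?;
        (subst sum.union_disjoint[OF _ _ d3])?) (auto intro: finite_subset[OF _ fin])
    finally show ?thesis .
  qed
  then have "circle_integral 0 Rz f + (circle_integral 1 \<epsilon> f + circle_integral (of_real q) \<delta> f) +
      2 * pi * \<i> * (\<Sum>p\<in>?A3. residue f p) = 0"
    unfolding I0 I1 Iq distrib_left[symmetric] using zero by (simp only: add.assoc mult_zero_right)
  then have "circle_integral 0 Rz f = - (circle_integral 1 \<epsilon> f + circle_integral (of_real q) \<delta> f) -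
      2 * pi * \<i> * (\<Sum>p\<in>?A3. residue f p)"
    by (simp add: algebra_simps eq_neg_iff_add_eq_0)
  then show ?thesis unfolding f_def[symmetric] using res by simp
qed

text \<open>The formula isolates what depends on the radius: the points 0 and \<open>b m\<close> are
  always enclosed, and only \<open>z\<close> may be inside or outside. Two radii thus differ by at
  most one diagonal term. Its minus sign comes from
  \<open>1 / (z - w) = - 1 / (w - z)\<close>.\<close>

lemma circle_integral_in_w:
  fixes z :: complex
  assumes I: "finite I" "\<And>m. m \<in> I \<Longrightarrow> \<bar>b m\<bar> < R" "\<And>m. m \<in> I \<Longrightarrow> \<bar>b m\<bar> < norm z"
    and z: "0 < norm z" "norm z \<noteq> R" and R: "0 < R"
  shows "circle_integral 0 R (edge_integrand I b p s1 s2 H1 H2 z) =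
    2 * pi * \<i> * ((\<Sum>x\<in>insert 0 (of_real ` b ` I). residue (edge_integrand I b p s1 s2 H1 H2 z) x) -
      (if norm z < R then diagonal_integrand p s1 s2 H1 H2 z else 0))"
proof -
  define f where "f = edge_integrand I b p s1 s2 H1 H2 z"
  define B where "B = insert (0::complex) (of_real ` b ` I)"
  have fin: "finite B" "finite (insert z B)" using I by (simp_all add: B_def)
  have z0: "z \<noteq> 0" using z by auto
  have zB: "z \<notin> B" using z0 by (auto simp: B_def dest: I(3))
  have nz: "N_prod I b w \<noteq> 0" if "w \<notin> B" for w
    using that by (intro N_prod_nonzero[OF I(1)]) (auto simp: B_def)
  have hol: "f holomorphic_on - insert z B"
    unfolding f_def edge_integrand_def
    by (intro holomorphic_intros holomorphic_on_subset[OF holomorphic_N_prod] holomorphic_P_prod)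
       (use nz in \<open>auto simp: B_def\<close>)
  have res: "residue f z = - diagonal_integrand p s1 s2 H1 H2 z"
  proof -
    define G where "G = (\<lambda>w. - (N_prod I b z / N_prod I b w * (P_prod p s2 w / P_prod p s1 z) * z powi (- H1) * w powi (H2 - 1)))"
    have G: "G holomorphic_on - B"
      unfolding G_def
      by (intro holomorphic_intros holomorphic_on_subset[OF holomorphic_N_prod] holomorphic_P_prod)
         (use nz in \<open>auto simp: B_def\<close>)
    have "f w = G w / (w - z)" for w
    proof -
      have "1 / (z - w) = - (1 / (w - z))" by (metis minus_diff_eq divide_minus_right)
      then show ?thesis by (simp add: f_def G_def edge_integrand_def)
    qed
    then have "f = (\<lambda>w. G w / (w - z))" by blast
    moreover have "residue (\<lambda>w. G w / (w - z)) z = G z"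
      by (rule residue_simple[OF _ _ G]) (use zB fin in \<open>auto intro!: finite_imp_closed open_Compl\<close>)
    moreover have "z powi (- H1) * z powi (H2 - 1) = z powi (H2 - H1 - 1)"
      using z0 power_int_add[of z "- H1" "H2 - 1"] by (simp add: algebra_simps)
    ultimately show ?thesis using nz[OF zB] by (simp add: G_def diagonal_integrand_def mult.assoc)
  qed
  have inB: "dist 0 x < R" if "x \<in> B" for x using that I(2) R by (auto simp: B_def)
  have "circle_integral 0 R f = 2 * pi * \<i> * (\<Sum>x | x \<in> insert z B \<and> dist 0 x < R. residue f x)"
    by (rule circle_integral_residues[OF fin(2) hol R]) (use inB z in auto)
  moreover have "{x. x \<in> insert z B \<and> dist 0 x < R} = (if norm z < R then insert z B else B)"
    using inB z by auto
  ultimately show ?thesis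
    using fin zB res unfolding f_def[symmetric] B_def[symmetric] by (auto simp: algebra_simps)
qed

text \<open>Inside all the zeros of \<open>P_prod p s1\<close> the origin is the only pole.\<close>

lemma circle_integral_diagonal_radius:
  assumes p: "\<And>j. j < s1 \<Longrightarrow> 0 < p j"
    and R: "0 < R" "\<And>j. j < s1 \<Longrightarrow> R < 1 / p j" and R': "0 < R'" "\<And>j. j < s1 \<Longrightarrow> R' < 1 / p j"
  shows "circle_integral 0 R (diagonal_integrand p s1 s2 H1 H2) =
    circle_integral 0 R' (diagonal_integrand p s1 s2 H1 H2)"
proof -
  define f where "f = diagonal_integrand p s1 s2 H1 H2"
  define A where "A = insert 0 (P_zeros p s1)"
  have hol: "f holomorphic_on - A"
    unfolding f_def diagonal_integrand_def A_def
    by (intro holomorphic_intros holomorphic_P_prod) (auto simp: P_prod_nonzero[OF p])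
  have *: "circle_integral 0 r f = 2 * pi * \<i> * residue f 0"
    if r: "0 < r" "\<And>j. j < s1 \<Longrightarrow> r < 1 / p j" for r
  proof -
    have gt: "r < dist 0 x" if "x \<in> P_zeros p s1" for x
      using that r(2) by (auto simp: P_zeros_def norm_divide abs_of_pos[OF p] p)
    have "circle_integral 0 r f = 2 * pi * \<i> * (\<Sum>x | x \<in> A \<and> dist 0 x < r. residue f x)"
      by (rule circle_integral_residues[OF _ hol r(1)]) (use gt r in \<open>force simp: A_def\<close>)+
    moreover have "{x. x \<in> A \<and> dist 0 x < r} = {0}"
      using gt r by (force simp: A_def)
    ultimately show ?thesis by simp
  qed
  show ?thesis using *[OF R] *[OF R'] by (simp add: f_def)
qed

text \<open>For \<open>s1 <= s2\<close> the quotient of products is a polynomial, so only the pole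
  at 0 remains and the radius may cross the zeros of the denominator. The circles themselves avoid
  those zeros, where division by zero makes the quotient 0 instead of its continuous
  extension.\<close>

lemma circle_integral_diagonal_entire:
  assumes "s1 \<le> s2" and p: "\<And>j. j < s1 \<Longrightarrow> 0 < p j"
    and R: "0 < R" "\<And>j. j < s1 \<Longrightarrow> R \<noteq> 1 / p j" and R': "0 < R'" "\<And>j. j < s1 \<Longrightarrow> R' \<noteq> 1 / p j"
  shows "circle_integral 0 R (diagonal_integrand p s1 s2 H1 H2) =
    circle_integral 0 R' (diagonal_integrand p s1 s2 H1 H2)"
proof -
  define h where "h = (\<lambda>z::complex. (\<Prod>j\<in>{s1..<s2}. 1 - z * of_real (p j)) * z powi (H2 - H1 - 1))"
  have hol: "h holomorphic_on - {0}"
    unfolding h_def by (intro holomorphic_intros) auto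
  have eq: "diagonal_integrand p s1 s2 H1 H2 z = h z" if "z \<notin> P_zeros p s1" for z
  proof -
    have "P_prod p s2 z = P_prod p s1 z * (\<Prod>j\<in>{s1..<s2}. 1 - z * of_real (p j))"
      using assms(1) unfolding P_prod_def
      by (subst prod.union_disjoint[symmetric]) (auto intro!: prod.cong)
    then show ?thesis
      using P_prod_nonzero[OF p that] by (simp add: diagonal_integrand_def h_def)
  qed
  have *: "circle_integral 0 r (diagonal_integrand p s1 s2 H1 H2) = 2 * pi * \<i> * residue h 0"
    if r: "0 < r" "\<And>j. j < s1 \<Longrightarrow> r \<noteq> 1 / p j" for r
  proof -
    have ne: "r \<noteq> dist 0 x" if x: "x \<in> P_zeros p s1" for x
    proof -
      from x obtain j where "j < s1" "x = of_real (1 / p j)" by (auto simp: P_zeros_def)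
      then show ?thesis using p[of j] r(2)[of j] by (simp add: norm_divide)
    qed
    have "circle_integral 0 r (diagonal_integrand p s1 s2 H1 H2) = circle_integral 0 r h"
      by (rule contour_integral_cong[OF refl]) (use ne eq r in \<open>force simp: dist_norm\<close>)
    also have "\<dots> = 2 * pi * \<i> * (\<Sum>x | x \<in> {0} \<and> dist 0 x < r. residue h x)"
      by (rule circle_integral_residues[OF _ hol r(1)]) (use r in auto)
    moreover have "{x. x \<in> {0::complex} \<and> dist 0 x < r} = {0}"
      using r by auto
    ultimately show ?thesis by simp
  qed
  show ?thesis using *[OF R] *[OF R'] by simp
qed

text \<open>Between two such radii only \<open>w\<close> could be crossed, and \<open>same\<close>
  excludes this.\<close>

lemma circle_integral_z_radius:
  assumes p: "\<And>j. j < s1 \<Longrightarrow> 0 < p j" and I: "finite I" "\<And>m. m \<in> I \<Longrightarrow> \<bar>b m\<bar> < norm w"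
    and w: "0 < norm w"
    and R: "0 < R" "R \<noteq> norm w" "\<And>j. j < s1 \<Longrightarrow> R < 1 / p j"
    and R': "0 < R'" "R' \<noteq> norm w" "\<And>j. j < s1 \<Longrightarrow> R' < 1 / p j"
    and same: "R < norm w \<longleftrightarrow> R' < norm w"
  shows "circle_integral 0 R (\<lambda>z. edge_integrand I b p s1 s2 H1 H2 z w) =
    circle_integral 0 R' (\<lambda>z. edge_integrand I b p s1 s2 H1 H2 z w)"
proof -
  define f where "f = (\<lambda>z. edge_integrand I b p s1 s2 H1 H2 z w)"
  define A where "A = insert 0 (insert w (P_zeros p s1))"
  have Nw: "N_prod I b w \<noteq> 0" by (rule N_prod_nonzero_norm[OF I(1) w I(2)])
  have hol: "f holomorphic_on - A"
    unfolding f_def edge_integrand_def A_def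
    by (intro holomorphic_intros holomorphic_on_subset[OF holomorphic_N_prod] holomorphic_P_prod)
       (auto simp: Nw P_prod_nonzero[OF p])
  have *: "circle_integral 0 r f = 2 * pi * \<i> * (\<Sum>x\<in>(if r < norm w then {0} else {0, w}). residue f x)"
    if r: "0 < r" "r \<noteq> norm w" "\<And>j. j < s1 \<Longrightarrow> r < 1 / p j" for r
  proof -
    have gt: "r < dist 0 x" if "x \<in> P_zeros p s1" for x
      using that r(3) by (auto simp: P_zeros_def norm_divide abs_of_pos[OF p] p)
    have "circle_integral 0 r f = 2 * pi * \<i> * (\<Sum>x | x \<in> A \<and> dist 0 x < r. residue f x)"
      by (rule circle_integral_residues[OF _ hol r(1)]) (use gt r in \<open>force simp: A_def\<close>)+
    moreover have "{x. x \<in> A \<and> dist 0 x < r} = (if r < norm w then {0} else {0, w})"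
      using gt r by (force simp: A_def)
    ultimately show ?thesis by simp
  qed
  show ?thesis using *[OF R] *[OF R'] same by (simp add: f_def)
qed

text \<open>The circle of \<open>w\<close> is moved to radius \<open>\<rho>\<close>, the integrals
  are exchanged, and the circle of \<open>z\<close> is blown up. Either move may pick up the residue
  at \<open>z = w\<close>; the point is that altogether it is counted once if \<open>s2 < s1\<close>
  and not at all otherwise.\<close>

lemma edge_integral_decomposition_aux:
  fixes \<rho> :: real and I b p s1 s2 H1 H2
  defines "f \<equiv> edge_integrand I b p s1 s2 H1 H2"
  assumes I: "finite I" "\<And>m. m \<in> I \<Longrightarrow> \<bar>b m\<bar> < Rw" "\<And>m. m \<in> I \<Longrightarrow> \<bar>b m\<bar> < Rz" "\<And>m. m \<in> I \<Longrightarrow> \<bar>b m\<bar> < \<rho>"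
    and p: "\<And>j. j < s1 \<Longrightarrow> 0 < p j" and H1: "1 \<le> H1"
    and Rz: "0 < Rz" "\<And>j. j < s1 \<Longrightarrow> Rz < 1 / p j" "Rz \<noteq> \<rho>"
    and Rw: "0 < Rw" "if s2 < s1 then Rz < Rw else Rw < Rz"
    and eps: "0 < \<epsilon>" "0 < \<rho>" "\<rho> + \<epsilon> < 1"
    and q: "0 < \<delta>" "\<delta> < q" "\<delta> < \<bar>q - \<rho>\<bar>" "\<epsilon> + \<delta> < \<bar>q - 1\<bar>"
    and T: "\<And>j. j < s1 \<Longrightarrow> \<bar>1 / p j - 1\<bar> < \<epsilon> \<or> \<bar>1 / p j - q\<bar> < \<delta>"
  shows "circle_integral 0 Rz (\<lambda>z. circle_integral 0 Rw (f z)) =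
     - circle_integral 0 \<rho> (\<lambda>w. circle_integral 1 \<epsilon> (\<lambda>z. f z w))
     - circle_integral 0 \<rho> (\<lambda>w. circle_integral (of_real q) \<delta> (\<lambda>z. f z w))
     - (if s2 < s1 then 2 * pi * \<i> * circle_integral 0 \<rho> (diagonal_integrand p s1 s2 H1 H2) else 0)"
proof -
  define D where "D = diagonal_integrand p s1 s2 H1 H2"
  have zer: "Rz < norm x \<and> norm x \<noteq> \<rho> \<and> dist 1 x \<noteq> \<epsilon> \<and> dist (of_real q) x \<noteq> \<delta>" if "x \<in> P_zeros p s1" for x
  proof -
    from that obtain j where j: "j < s1" "x = of_real (1 / p j)" by (auto simp: P_zeros_def)
    have "dist 1 x = \<bar>1 / p j - 1\<bar>" "dist (of_real q) x = \<bar>1 / p j - q\<bar>" "norm x = 1 / p j"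
      using p[OF j(1)] dist_of_real[of 1 "1 / p j", where 'a = complex]
        dist_of_real[of q "1 / p j", where 'a = complex]
      unfolding j(2) by (simp_all add: dist_real_def abs_minus_commute norm_divide)
    then show ?thesis using T[OF j(1)] Rz(2)[OF j(1)] q eps by linarith
  qed
  have wz: "norm z \<noteq> \<rho>" if "dist 1 z = \<epsilon> \<or> dist (of_real q) z = \<delta>" for z :: complex
    using that norm_triangle_ineq2[of 1 z] norm_triangle_ineq3[of "of_real q" z] q eps
    by (auto simp: dist_norm)
  have cont1: "continuous_on (sphere 0 Rz \<times> sphere 0 \<rho>) (\<lambda>(z, w). f z w)"
    unfolding f_def
    by (rule continuous_on_edge_integrand[OF I(1) p]) (use zer I(4) Rz eps in \<open>force dest: I(4)\<close>)+
  have cont2: "continuous_on (sphere 0 Rz \<times> sphere 0 Rw) (\<lambda>(z, w). f z w)"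
    unfolding f_def
    by (rule continuous_on_edge_integrand[OF I(1) p])
       (use zer Rz Rw in \<open>force dest: I(2) split: if_splits\<close>)+
  have cont3: "continuous_on (sphere 1 \<epsilon> \<times> sphere 0 \<rho>) (\<lambda>(z, w). f z w)"
    unfolding f_def
    by (rule continuous_on_edge_integrand[OF I(1) p]) (use zer wz eps in \<open>force dest: I(4)\<close>)+
  have cont4: "continuous_on (sphere (of_real q) \<delta> \<times> sphere 0 \<rho>) (\<lambda>(z, w). f z w)"
    unfolding f_def
    by (rule continuous_on_edge_integrand[OF I(1) p]) (use zer wz eps q in \<open>force dest: I(4)\<close>)+
  have contD: "continuous_on (sphere 0 r) D" if "0 < r" "\<And>x. x \<in> P_zeros p s1 \<Longrightarrow> norm x \<noteq> r" for r
    unfolding D_def diagonal_integrand_def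
    by (intro continuous_intros continuous_on_P_prod) (use that P_prod_nonzero[OF p] in force)+
  \<comment> \<open>The indicator that the circle of \<open>w\<close> encloses \<open>z\<close> at
    radius \<open>Rw\<close>, minus the same indicator at radius \<open>\<rho>\<close>.\<close>
  define c where "c = (if s2 < s1 then 1 else 0) - (if Rz < \<rho> then 1 else (0::complex))"
  have "circle_integral 0 Rz (\<lambda>z. circle_integral 0 Rw (f z)) =
      circle_integral 0 Rz (\<lambda>z. circle_integral 0 \<rho> (f z) - 2 * pi * \<i> * c * D z)"
  proof (rule contour_integral_cong[OF refl])
    fix z assume "z \<in> path_image (circlepath 0 Rz)"
    then have z: "norm z = Rz" using Rz by simp
    have zm: "\<And>m. m \<in> I \<Longrightarrow> \<bar>b m\<bar> < norm z" using I(3) z by simp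
    have "circle_integral 0 R (f z) = 2 * pi * \<i> * ((\<Sum>x\<in>insert 0 (of_real ` b ` I). residue (f z) x) -
        (if Rz < R then D z else 0))" if "R = Rw \<or> R = \<rho>" for R
    proof -
      have "0 < R" "Rz \<noteq> R" using that Rw Rz eps by (auto split: if_splits)
      then show ?thesis
        unfolding f_def D_def z[symmetric] using that I(2,4) z Rz zm
        by (intro circle_integral_in_w I(1)) auto
    qed
    note this[of Rw] this[of \<rho>]
    moreover have "Rz < Rw \<longleftrightarrow> s2 < s1" using Rw by (auto split: if_splits)
    ultimately show "circle_integral 0 Rw (f z) = circle_integral 0 \<rho> (f z) - 2 * pi * \<i> * c * D z"
      unfolding c_def by (cases "s2 < s1"; cases "Rz < \<rho>") (simp_all add: right_diff_distrib)
  qed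
  also have "\<dots> = circle_integral 0 Rz (\<lambda>z. circle_integral 0 \<rho> (f z)) - 2 * pi * \<i> * c * circle_integral 0 Rz D"
  proof -
    have i1: "(\<lambda>z. circle_integral 0 \<rho> (f z)) contour_integrable_on circlepath 0 Rz"
      by (rule contour_integrable_circle_param[OF cont1]) (use Rz eps in auto)
    have i2: "D contour_integrable_on circlepath 0 Rz"
      by (rule contour_integrable_continuous_circlepath) (use contD zer Rz in force)
    show ?thesis
      by (subst contour_integral_diff[OF i1 contour_integrable_lmul[OF i2]])
         (simp add: contour_integral_lmul[OF i2])
  qed
  also have "circle_integral 0 Rz (\<lambda>z. circle_integral 0 \<rho> (f z)) =
      circle_integral 0 \<rho> (\<lambda>w. circle_integral 0 Rz (\<lambda>z. f z w))"
    by (rule circle_integral_swap[OF cont1]) (use Rz eps in auto)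
  also have "\<dots> = circle_integral 0 \<rho> (\<lambda>w. - circle_integral 1 \<epsilon> (\<lambda>z. f z w)
      - circle_integral (of_real q) \<delta> (\<lambda>z. f z w) - (if Rz < \<rho> then 2 * pi * \<i> else 0) * D w)"
  proof (rule contour_integral_cong[OF refl])
    fix w assume "w \<in> path_image (circlepath 0 \<rho>)"
    then have w: "norm w = \<rho>" using eps by simp
    have "circle_integral 0 Rz (\<lambda>z. f z w) =
       - (circle_integral 1 \<epsilon> (\<lambda>z. f z w) + circle_integral (of_real q) \<delta> (\<lambda>z. f z w)) -
       (if Rz < norm w then 2 * pi * \<i> * diagonal_integrand p s1 s2 H1 H2 w else 0)"
      unfolding f_def
      by (rule circle_integral_in_z[OF I(1) _ _ p H1 Rz(1,2) _ eps(1) _ q(1,2) _ q(4) T])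
         (use I(4) Rz eps q w in auto)
    then show "circle_integral 0 Rz (\<lambda>z. f z w) = - circle_integral 1 \<epsilon> (\<lambda>z. f z w)
      - circle_integral (of_real q) \<delta> (\<lambda>z. f z w) - (if Rz < \<rho> then 2 * pi * \<i> else 0) * D w"
      by (simp add: w D_def)
  qed
  also have "\<dots> = - circle_integral 0 \<rho> (\<lambda>w. circle_integral 1 \<epsilon> (\<lambda>z. f z w))
     - circle_integral 0 \<rho> (\<lambda>w. circle_integral (of_real q) \<delta> (\<lambda>z. f z w))
     - (if Rz < \<rho> then 2 * pi * \<i> else 0) * circle_integral 0 \<rho> D"
  proof -
    have i1: "(\<lambda>w. circle_integral 1 \<epsilon> (\<lambda>z. f z w)) contour_integrable_on circlepath 0 \<rho>"
      by (rule contour_integrable_circle_param[OF continuous_on_swap_args[OF cont3]]) (use eps in auto)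
    have i2: "(\<lambda>w. circle_integral (of_real q) \<delta> (\<lambda>z. f z w)) contour_integrable_on circlepath 0 \<rho>"
      by (rule contour_integrable_circle_param[OF continuous_on_swap_args[OF cont4]]) (use eps q in auto)
    have i3: "D contour_integrable_on circlepath 0 \<rho>"
      by (rule contour_integrable_continuous_circlepath) (use contD zer eps in force)
    show ?thesis
      by (subst contour_integral_diff[OF contour_integrable_diff[OF contour_integrable_neg[OF i1] i2] contour_integrable_lmul[OF i3]],
          subst contour_integral_diff[OF contour_integrable_neg[OF i1] i2])
         (simp add: contour_integral_lmul[OF i3] contour_integral_neg)
  qed
  finally have main: "circle_integral 0 Rz (\<lambda>z. circle_integral 0 Rw (f z)) =
     - circle_integral 0 \<rho> (\<lambda>w. circle_integral 1 \<epsilon> (\<lambda>z. f z w))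
     - circle_integral 0 \<rho> (\<lambda>w. circle_integral (of_real q) \<delta> (\<lambda>z. f z w))
     - (if Rz < \<rho> then 2 * pi * \<i> else 0) * circle_integral 0 \<rho> D - 2 * pi * \<i> * c * circle_integral 0 Rz D" .
  \<comment> \<open>The residues of the two moves are integrals over different radii. These are
    compared only when exactly one of \<open>s2 < s1\<close> and \<open>Rz < \<rho>\<close> holds:
    in the first case both circles lie inside all zeros, in the second the integrand is a polynomial
    times a power of \<open>z\<close>.\<close>
  have eqD: "circle_integral 0 Rz D = circle_integral 0 \<rho> D" if "(s2 < s1) \<noteq> (Rz < \<rho>)"
  proof (cases "s2 < s1")
    case True
    then have "\<rho> < Rz" using that Rz by auto
    then have "\<And>j. j < s1 \<Longrightarrow> \<rho> < 1 / p j" using Rz(2) by fastforce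
    then show ?thesis
      unfolding D_def using Rz eps by (intro circle_integral_diagonal_radius p) auto
  next
    case False
    have "\<rho> \<noteq> 1 / p j \<and> Rz \<noteq> 1 / p j" if "j < s1" for j
      using zer[of "of_real (1 / p j)"] that p[OF that] by (auto simp: P_zeros_def norm_divide)
    then show ?thesis
      unfolding D_def using Rz eps False by (intro circle_integral_diagonal_entire p) auto
  qed
  show ?thesis
    unfolding main D_def[symmetric] using eqD by (cases "s2 < s1"; cases "Rz < \<rho>") (simp_all add: c_def)
qed

text \<open>The circle of \<open>z\<close> is blown up to infinity. Collecting the residues at \<open>z = w\<close> of both
  deformations leaves a single integral precisely when \<open>s2 < s1\<close>.\<close>

lemma edge_integral_decomposition:
  fixes \<rho> :: real and I b p s1 s2 H1 H2
  defines "f \<equiv> edge_integrand I b p s1 s2 H1 H2"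
  assumes I: "finite I" "\<And>m. m \<in> I \<Longrightarrow> \<bar>b m\<bar> < Rw" "\<And>m. m \<in> I \<Longrightarrow> \<bar>b m\<bar> < \<rho>"
      "\<And>m j. m \<in> I \<Longrightarrow> j < s1 \<Longrightarrow> \<bar>b m\<bar> < 1 / p j"
    and p: "\<And>j. j < s1 \<Longrightarrow> 0 < p j" and H1: "1 \<le> H1"
    and Rz: "0 < Rz" "\<And>j. j < s1 \<Longrightarrow> Rz < 1 / p j"
    and Rw: "0 < Rw" "if s2 < s1 then Rz < Rw else Rw < Rz"
    and eps: "0 < \<epsilon>" "0 < \<rho>" "\<rho> + \<epsilon> < 1"
    and q: "0 < \<delta>" "\<delta> < q" "\<delta> < \<bar>q - \<rho>\<bar>" "\<epsilon> + \<delta> < \<bar>q - 1\<bar>"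
    and T: "\<And>j. j < s1 \<Longrightarrow> \<bar>1 / p j - 1\<bar> < \<epsilon> \<or> \<bar>1 / p j - q\<bar> < \<delta>"
  shows "circle_integral 0 Rz (\<lambda>z. circle_integral 0 Rw (f z)) =
     - circle_integral 0 \<rho> (\<lambda>w. circle_integral 1 \<epsilon> (\<lambda>z. f z w))
     - circle_integral 0 \<rho> (\<lambda>w. circle_integral (of_real q) \<delta> (\<lambda>z. f z w))
     - (if s2 < s1 then 2 * pi * \<i> * circle_integral 0 \<rho> (diagonal_integrand p s1 s2 H1 H2) else 0)"
proof -
  \<comment> \<open>The auxiliary statement needs the circle of \<open>z\<close> to enclose the
    points \<open>b m\<close>, which admissibility does not give when \<open>Rz < Rw\<close>. Hence
    \<open>Rz\<close> is first replaced by a radius between \<open>L\<close> and \<open>U\<close>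
    that does so.\<close>
  have "\<exists>R. (\<forall>m\<in>I. \<bar>b m\<bar> < R) \<and> 0 < R \<and> (\<forall>j<s1. R < 1 / p j) \<and> (if s2 < s1 then R < Rw else Rw < R) \<and> R \<noteq> \<rho>"
  proof -
    define U where "U = (if s2 < s1 then Min (insert Rw ((\<lambda>j. 1 / p j) ` {..<s1})) else Rz)"
    define L where "L = (if s2 < s1 then Max (insert 0 ((\<lambda>m. \<bar>b m\<bar>) ` I)) else Rw)"
    have "L < U"
      using I Rw p unfolding L_def U_def by auto
    \<comment> \<open>Two candidates are kept because one of them might equal the excluded value
      \<open>\<rho>\<close>.\<close>
    then obtain x where x: "L < x" "x < U" using dense by blast
    then obtain y where y: "x < y" "y < U" using dense by blast
    have *: "(\<forall>m\<in>I. \<bar>b m\<bar> < r) \<and> 0 < r \<and> (\<forall>j<s1. r < 1 / p j) \<and> (if s2 < s1 then r < Rw else Rw < r)"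
      if "L < r" "r < U" for r
    proof (cases "s2 < s1")
      case True
      then show ?thesis using that I unfolding L_def U_def by auto
    next
      case False
      then show ?thesis using that I(2) Rw Rz(2) unfolding L_def U_def by fastforce
    qed
    show ?thesis
    proof (cases "x = \<rho>")
      case True
      then show ?thesis using *[of y] x y by (intro exI[of _ y]) auto
    next
      case False
      then show ?thesis using *[of x] x y by (intro exI[of _ x]) auto
    qed
  qed
  then obtain R where R: "\<And>m. m \<in> I \<Longrightarrow> \<bar>b m\<bar> < R" "0 < R" "\<And>j. j < s1 \<Longrightarrow> R < 1 / p j"
    "if s2 < s1 then R < Rw else Rw < R" "R \<noteq> \<rho>" by blast
  have swap: "circle_integral 0 r (\<lambda>z. circle_integral 0 Rw (f z)) = circle_integral 0 Rw (\<lambda>w. circle_integral 0 r (\<lambda>z. f z w))"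
    if r: "0 < r" "\<And>j. j < s1 \<Longrightarrow> r < 1 / p j" "if s2 < s1 then r < Rw else Rw < r" for r
  proof (rule circle_integral_swap)
    have "r < norm x" if "x \<in> P_zeros p s1" for x
      using that r(2) by (auto simp: P_zeros_def norm_divide abs_of_pos[OF p] p)
    then show "continuous_on (sphere 0 r \<times> sphere 0 Rw) (\<lambda>(z, w). f z w)"
      unfolding f_def
      by (intro continuous_on_edge_integrand[OF I(1) p]) (use r Rw in \<open>force dest: I(2) split: if_splits\<close>)+
  qed (use r Rw in auto)
  have "circle_integral 0 Rz (\<lambda>z. circle_integral 0 Rw (f z)) = circle_integral 0 Rw (\<lambda>w. circle_integral 0 Rz (\<lambda>z. f z w))"
    by (rule swap[OF Rz Rw(2)])
  also have "\<dots> = circle_integral 0 Rw (\<lambda>w. circle_integral 0 R (\<lambda>z. f z w))"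
  proof (rule contour_integral_cong[OF refl])
    fix w assume "w \<in> path_image (circlepath 0 Rw)"
    then have w: "norm w = Rw" using Rw by simp
    show "circle_integral 0 Rz (\<lambda>z. f z w) = circle_integral 0 R (\<lambda>z. f z w)"
      unfolding f_def
      by (rule circle_integral_z_radius[OF p I(1)]) (use w I(2) R Rz Rw in \<open>auto split: if_splits\<close>)
  qed
  also have "\<dots> = circle_integral 0 R (\<lambda>z. circle_integral 0 Rw (f z))"
    by (rule swap[OF R(2,3,4), symmetric])
  finally show ?thesis
    using edge_integral_decomposition_aux[OF I(1,2) R(1) I(3) p H1 R(2,3,5) Rw(1) R(4) eps q T, where ?H2.0 = H2]
    by (simp add: f_def)
qed

section \<open>Local asymptotics at the critical point\<close>

lemma norm_exp_diff_le:
  fixes x y :: complex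
  assumes "norm x \<le> B" "norm y \<le> B"
  shows "norm (exp x - exp y) \<le> exp B * norm (x - y)"
proof (rule field_differentiable_bound[where S = "cball 0 B" and f' = exp])
  fix z :: complex assume "z \<in> cball 0 B"
  then have "Re z \<le> B" using complex_Re_le_cmod[of z] by simp
  then show "norm (exp z) \<le> exp B" by simp
qed (use assms in \<open>auto intro!: derivative_eq_intros\<close>)

text \<open>The remainder has derivative \<open>y^2 / (1 + y)\<close>, of norm at most
  \<open>2 * norm x ^ 2\<close> on the disk of radius \<open>norm x <= 1 / 2\<close>; the mean value
  bound on this disk adds the third power.\<close>

lemma norm_Ln_quadratic_approx:
  fixes x :: complex
  assumes "norm x \<le> 1 / 2"
  shows "norm (Ln (1 + x) - x + x\<^sup>2 / 2) \<le> 2 * norm x ^ 3"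
proof -
  let ?f = "\<lambda>x. Ln (1 + x) - x + x\<^sup>2 / 2"
  have "norm (?f x - ?f 0) \<le> (2 * (norm x)\<^sup>2) * norm (x - 0)"
  proof (rule field_differentiable_bound[where S = "cball 0 (norm x)" and f' = "\<lambda>y. 1 / (1 + y) - 1 + y"])
    fix y :: complex assume y: "y \<in> cball 0 (norm x)"
    have "1 - norm y \<le> norm (1 + y)" using norm_triangle_ineq4[of "1 + y" y] by simp
    then have n: "1 / 2 \<le> norm (1 + y)" using y assms by simp
    then have nz: "1 + y \<noteq> 0" by auto
    have "1 + y \<notin> \<real>\<^sub>\<le>\<^sub>0"
    proof
      assume "1 + y \<in> \<real>\<^sub>\<le>\<^sub>0"
      then have "Re y \<le> - 1" by (auto simp: complex_nonpos_Reals_iff)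
      then show False using abs_Re_le_cmod[of y] y assms by simp
    qed
    then show "(?f has_field_derivative 1 / (1 + y) - 1 + y) (at y within cball 0 (norm x))"
      by (auto intro!: derivative_eq_intros) (simp add: inverse_eq_divide)
    have "1 / (1 + y) - 1 + y = y\<^sup>2 / (1 + y)" using nz by (simp add: field_simps power2_eq_square)
    also have "norm \<dots> \<le> norm y ^ 2 / (1 / 2)"
      unfolding norm_divide norm_power using n by (intro divide_left_mono) auto
    also have "\<dots> \<le> 2 * norm x ^ 2" using y by (simp add: power_mono)
    finally show "norm (1 / (1 + y) - 1 + y) \<le> 2 * (norm x)\<^sup>2" .
  qed auto
  then show ?thesis by (simp add: power3_eq_cube power2_eq_square)
qed

text \<open>For \<open>x = t / 2\<close> the Taylor remainder of the sine gives
  \<open>\<bar>x\<bar> / 2 <= \<bar>sin x\<bar>\<close> on the whole range, and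
  \<open>1 - cos t = 2 * (sin x)^2\<close>. A bound on all of \<open>[-pi, pi]\<close> is needed
  because the full circle of \<open>w\<close> is integrated over.\<close>

lemma one_minus_cos_ge:
  assumes "\<bar>t\<bar> \<le> pi"
  shows "t\<^sup>2 / 8 \<le> 1 - cos t"
proof -
  define x where "x = t / 2"
  \<comment> \<open>With this bound the half angle is at most \<open>8 / 5\<close>, and
    \<open>(8 / 5)^2 / 6 < 1 / 2\<close>.\<close>
  have "pi \<le> 16 / 5" using pi_approx by simp
  then have x: "\<bar>x\<bar> \<le> 8 / 5" using assms unfolding x_def by linarith
  have "\<bar>sin x - (\<Sum>m<3. sin_coeff m * x ^ m)\<bar> \<le> inverse (fact 3) * \<bar>x\<bar> ^ 3"
    by (rule Maclaurin_sin_bound)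
  then have 1: "\<bar>sin x - x\<bar> \<le> \<bar>x\<bar> ^ 3 / 6"
    by (simp add: numeral_3_eq_3 sin_coeff_def fact_numeral)
  have "\<bar>x\<bar> ^ 3 = \<bar>x\<bar> * \<bar>x\<bar>\<^sup>2" by (simp add: power3_eq_cube power2_eq_square)
  also have "\<dots> \<le> \<bar>x\<bar> * (8 / 5)\<^sup>2" using x by (intro mult_left_mono power_mono) auto
  finally have "\<bar>x\<bar> ^ 3 / 6 \<le> \<bar>x\<bar> / 2" by (simp add: power2_eq_square)
  with 1 have "\<bar>x\<bar> / 2 \<le> \<bar>sin x\<bar>" by linarith
  then have "(\<bar>x\<bar> / 2)\<^sup>2 \<le> \<bar>sin x\<bar>\<^sup>2" by (intro power_mono) auto
  then have "x\<^sup>2 / 4 \<le> (sin x)\<^sup>2" by (simp add: power_divide)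
  moreover have "cos t = 1 - 2 * (sin x)\<^sup>2" using cos_double_sin[of x] by (simp add: x_def)
  ultimately show ?thesis by (simp add: x_def power_divide)
qed

text \<open>With \<open>x = 2 * c * (1 - cos t)\<close> the square of the norm is
  \<open>1 - x / ((1 - c)^2 + x)\<close>. The denominator is at most 5 and
  \<open>x >= c * t^2 / 4\<close>, which gives the rate \<open>1 / 20\<close> for the square and
  \<open>1 / 40\<close> for the norm.\<close>

lemma factor_ratio_bound:
  fixes c t :: real
  assumes c: "0 \<le> c" "c < 1" and t: "\<bar>t\<bar> \<le> pi"
  shows "norm ((1 - of_real c) / (1 - of_real c * cis (- t))) \<le> exp (- (c * t\<^sup>2 / 40))"
proof -
  define x where "x = 2 * c * (1 - cos t)"
  have x0: "0 \<le> x" using c by (simp add: x_def)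
  have "x \<le> 2 * 1 * 2" unfolding x_def using c by (intro mult_mono) (auto simp: cos_ge_minus_one intro: order_trans)
  then have x4: "x \<le> 4" by simp
  have "(norm (1 - of_real c * cis (- t)))\<^sup>2 = (1 - c * cos t)\<^sup>2 + (c * sin t)\<^sup>2"
    by (simp add: cmod_power2)
  also have "\<dots> = (1 - c)\<^sup>2 + x + c\<^sup>2 * ((sin t)\<^sup>2 + (cos t)\<^sup>2 - 1)"
    unfolding x_def by algebra
  finally have n: "(norm (1 - of_real c * cis (- t)))\<^sup>2 = (1 - c)\<^sup>2 + x" by simp
  have "norm (1 - complex_of_real c) = 1 - c"
    using c norm_of_real[of "1 - c", where 'a = complex] by simp
  then have "(norm ((1 - of_real c) / (1 - of_real c * cis (- t))))\<^sup>2 = (1 - c)\<^sup>2 / ((1 - c)\<^sup>2 + x)"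
    by (simp add: norm_divide power_divide n)
  also have "\<dots> = 1 - x / ((1 - c)\<^sup>2 + x)"
  proof -
    have "(1 - c)\<^sup>2 + x \<noteq> 0" using c x0 by (metis add_pos_nonneg diff_gt_0_iff_gt less_irrefl zero_less_power)
    then show ?thesis by (simp add: field_simps)
  qed
  also have "\<dots> \<le> exp (- (x / ((1 - c)\<^sup>2 + x)))"
    using exp_ge_add_one_self[of "- (x / ((1 - c)\<^sup>2 + x))"] by simp
  also have "\<dots> \<le> exp (- (c * t\<^sup>2 / 20))"
  proof -
    have "(1 - c)\<^sup>2 \<le> 1" using c by (simp add: power_le_one)
    then have "x / 5 \<le> x / ((1 - c)\<^sup>2 + x)"
    proof (cases "x = 0")
      case False
      then have "0 < (1 - c)\<^sup>2 + x" "(1 - c)\<^sup>2 + x \<le> 5" using x0 x4 \<open>(1 - c)\<^sup>2 \<le> 1\<close> by (simp_all add: add_nonneg_pos)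
      then show ?thesis using x0 by (intro divide_left_mono) auto
    qed simp
    moreover have "2 * c * (t\<^sup>2 / 8) \<le> x"
      unfolding x_def using c one_minus_cos_ge[OF t] by (intro mult_left_mono) auto
    ultimately have "c * t\<^sup>2 / 20 \<le> x / ((1 - c)\<^sup>2 + x)" by linarith
    then show ?thesis by simp
  qed
  also have "\<dots> = (exp (- (c * t\<^sup>2 / 40)))\<^sup>2"
    by (simp add: exp_double[symmetric] power2_eq_square exp_add[symmetric])
  finally show ?thesis by (rule power2_le_imp_le) simp
qed

text \<open>This is the Gaussian decay of \<open>1 / N_prod\<close> in the argument: the rates of
  the factors add up. Since \<open>R <= 1\<close>, the rate \<open>b m / R\<close> of a factor may
  be lowered to \<open>b m\<close>, which no longer depends on the circle.\<close>

lemma N_prod_circle_bound: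
  assumes I: "finite I" "\<And>m. m \<in> I \<Longrightarrow> 0 \<le> b m" "\<And>m. m \<in> I \<Longrightarrow> b m < R"
    and R: "0 < R" "R \<le> 1" and t: "\<bar>t\<bar> \<le> pi"
  shows "norm (N_prod I b (of_real R) / N_prod I b (of_real R * cis t)) \<le> exp (- (t\<^sup>2 / 40 * (\<Sum>m\<in>I. b m)))"
proof -
  have "norm (N_prod I b (of_real R) / N_prod I b (of_real R * cis t)) =
      (\<Prod>m\<in>I. norm ((1 - of_real (b m / R)) / (1 - of_real (b m / R) * cis (- t))))"
  proof -
    have "of_real (b m) / (of_real R * cis t) = of_real (b m / R) * cis (- t)" for m
      by (simp add: divide_inverse cis_inverse)
    then show ?thesis
      unfolding N_prod_def prod_dividef[symmetric] prod_norm[symmetric] by simp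
  qed
  also have "\<dots> \<le> (\<Prod>m\<in>I. exp (- (b m * t\<^sup>2 / 40)))"
  proof (rule prod_mono, intro conjI)
    fix m assume m: "m \<in> I"
    have "norm ((1 - of_real (b m / R)) / (1 - of_real (b m / R) * cis (- t))) \<le> exp (- (b m / R * t\<^sup>2 / 40))"
      using I(2,3)[OF m] R t by (intro factor_ratio_bound) auto
    also have "\<dots> \<le> exp (- (b m * t\<^sup>2 / 40))"
    proof -
      have "b m * 1 \<le> b m * (1 / R)" using I(2)[OF m] R by (intro mult_left_mono) auto
      then have "b m * t\<^sup>2 \<le> b m / R * t\<^sup>2" by (intro mult_right_mono) auto
      then show ?thesis by simp
    qed
    finally show "norm ((1 - of_real (b m / R)) / (1 - of_real (b m / R) * cis (- t))) \<le> exp (- (b m * t\<^sup>2 / 40))" .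
  qed simp
  also have "\<dots> = exp (- (t\<^sup>2 / 40 * (\<Sum>m\<in>I. b m)))"
    using I(1) by (simp add: exp_sum[symmetric] sum_negf sum_distrib_left sum_distrib_right mult_ac)
  finally show ?thesis .
qed

text \<open>Since \<open>(1 - b / q + b * \<eta>) / (1 - b) = 1 + b / (1 - b) * (1 - 1 / q +
  \<eta>)\<close>, the exponent contains the same sum of \<open>b / (1 - b)\<close> that fixes the
  critical height; this makes the bound comparable with a power of \<open>z\<close>.\<close>

lemma N_prod_far_bound:
  fixes q :: real
  assumes I: "finite I" "\<And>m. m \<in> I \<Longrightarrow> 0 \<le> b m" "\<And>m. m \<in> I \<Longrightarrow> b m < 1" "\<And>m. m \<in> I \<Longrightarrow> b m < q"
    and q: "0 < q" and z: "z \<noteq> 0" "norm (1 / z - 1 / of_real q) \<le> \<eta>"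
  shows "norm (N_prod I b z / N_prod I b 1) \<le> exp ((\<Sum>m\<in>I. b m / (1 - b m)) * (1 - 1 / q + \<eta>))"
proof -
  have "norm (N_prod I b z / N_prod I b 1) = (\<Prod>m\<in>I. norm ((1 - of_real (b m) / z) / (1 - of_real (b m))))"
    unfolding N_prod_def prod_dividef[symmetric] prod_norm[symmetric] by simp
  also have "\<dots> \<le> (\<Prod>m\<in>I. exp (b m / (1 - b m) * (1 - 1 / q + \<eta>)))"
  proof (rule prod_mono, intro conjI)
    fix m assume m: "m \<in> I"
    have "norm (1 - of_real (b m) / z) \<le> norm (1 - of_real (b m) / of_real q :: complex) + norm (of_real (b m) * (1 / z - 1 / of_real q))"
      using norm_triangle_ineq4[of "1 - of_real (b m) / of_real q" "of_real (b m) * (1 / z - 1 / of_real q)"]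
      by (simp add: algebra_simps)
    also have "norm (1 - of_real (b m) / of_real q :: complex) = 1 - b m / q"
    proof -
      have "1 - of_real (b m) / of_real q = (of_real (1 - b m / q) :: complex)" by simp
      then show ?thesis using I(4)[OF m] q by (simp only: norm_of_real) simp
    qed
    also have "norm (of_real (b m) * (1 / z - 1 / of_real q)) \<le> b m * \<eta>"
      unfolding norm_mult using I(2)[OF m] z(2) by (simp add: mult_left_mono)
    finally have "norm (1 - of_real (b m) / z) \<le> 1 - b m / q + b m * \<eta>" by simp
    moreover have "norm (1 - complex_of_real (b m)) = 1 - b m"
      using I(3)[OF m] norm_of_real[of "1 - b m", where 'a = complex] by simp
    ultimately have "norm ((1 - of_real (b m) / z) / (1 - of_real (b m))) \<le> (1 - b m / q + b m * \<eta>) / (1 - b m)"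
      unfolding norm_divide using I(3)[OF m] by (simp add: divide_right_mono)
    also have "\<dots> = 1 + b m / (1 - b m) * (1 - 1 / q + \<eta>)"
      using I(3)[OF m] q by (simp add: field_simps)
    also have "\<dots> \<le> exp (b m / (1 - b m) * (1 - 1 / q + \<eta>))" by (rule exp_ge_add_one_self)
    finally show "norm ((1 - of_real (b m) / z) / (1 - of_real (b m))) \<le> exp (b m / (1 - b m) * (1 - 1 / q + \<eta>))" .
  qed simp
  also have "\<dots> = exp ((\<Sum>m\<in>I. b m / (1 - b m)) * (1 - 1 / q + \<eta>))"
    using I(1) by (simp add: exp_sum[symmetric] sum_distrib_right)
  finally show ?thesis .
qed

lemma tendsto_uniform_limit_compose:
  fixes f :: "nat \<Rightarrow> complex \<Rightarrow> complex"
  assumes "uniform_limit S f l sequentially" "\<And>n. x n \<in> S" "x \<longlonglongrightarrow> a" "isCont l a"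
  shows "(\<lambda>n. f n (x n)) \<longlonglongrightarrow> l a"
proof -
  have "(\<lambda>n. dist (f n (x n)) (l (x n))) \<longlonglongrightarrow> 0"
    unfolding tendsto_iff
  proof (intro allI impI)
    fix e :: real assume "0 < e"
    then have "\<forall>\<^sub>F n in sequentially. \<forall>x\<in>S. dist (f n x) (l x) < e"
      using assms(1) unfolding uniform_limit_iff by blast
    then show "\<forall>\<^sub>F n in sequentially. dist (dist (f n (x n)) (l (x n))) 0 < e"
      by eventually_elim (use assms(2) in auto)
  qed
  then have "(\<lambda>n. f n (x n) - l (x n)) \<longlonglongrightarrow> 0"
    by (simp add: dist_norm tendsto_norm_zero_iff)
  moreover have "(\<lambda>n. l (x n)) \<longlonglongrightarrow> l a" using assms(3,4) by (rule isCont_tendsto_compose[rotated])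
  ultimately show ?thesis using tendsto_add[of "\<lambda>n. f n (x n) - l (x n)" 0 sequentially "\<lambda>n. l (x n)" "l a"] by simp
qed

text \<open>\<open>\<epsilon>\<close> stands for \<open>sqrt r\<close> and \<open>b\<close> for the
  poles of \<open>1 / N_prod\<close> after the critical point has been scaled to 1. The bound
  \<open>\<beta> < 1\<close> keeps them away from it, and \<open>card_le\<close> allows of order
  \<open>1 / r\<close> of them. \<open>\<sigma>\<close> is the future second derivative of S, so
  \<open>second\<close> is the convergence of its Riemann sums.\<close>

locale edge_limit =
  fixes \<epsilon> :: "nat \<Rightarrow> real" and I :: "nat \<Rightarrow> int set" and b :: "nat \<Rightarrow> int \<Rightarrow> real"
    and \<beta> \<sigma> C :: real
  assumes eps_pos: "0 < \<epsilon> n" and eps_lim: "\<epsilon> \<longlonglongrightarrow> 0"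
    and finite_I: "finite (I n)" and b_nonneg: "m \<in> I n \<Longrightarrow> 0 \<le> b n m"
    and b_le: "m \<in> I n \<Longrightarrow> b n m \<le> \<beta>" and beta: "0 < \<beta>" "\<beta> < 1"
    and card_le: "(\<epsilon> n)\<^sup>2 * real (card (I n)) \<le> C"
    and second: "(\<lambda>n. (\<epsilon> n)\<^sup>2 * (\<Sum>m\<in>I n. b n m / (1 - b n m)\<^sup>2)) \<longlonglongrightarrow> - \<sigma>" and sigma: "\<sigma> < 0"
begin

text \<open>The logarithmic derivative of \<open>N_prod\<close> at 1. The point 1 is critical for
  \<open>N_prod * z powi (- H)\<close> when \<open>H = g\<close>.\<close>

definition g :: "nat \<Rightarrow> real" where
  "g n = (\<Sum>m\<in>I n. b n m / (1 - b n m))"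

text \<open>\<open>g n - H n\<close> is the coefficient of the linear term of the exponent at 1.
  Near the turning point it is of order \<open>1 / \<epsilon>\<close>, and its scaled limit is the
  local height with opposite sign.\<close>

definition scaled_height :: "(nat \<Rightarrow> int) \<Rightarrow> real \<Rightarrow> bool" where
  "scaled_height H y \<longleftrightarrow> (\<lambda>n. \<epsilon> n * (g n - H n)) \<longlonglongrightarrow> - y"

definition N_local :: "(nat \<Rightarrow> int) \<Rightarrow> nat \<Rightarrow> complex \<Rightarrow> complex" where
  "N_local H n \<zeta> = N_prod (I n) (b n) (1 + of_real (\<epsilon> n) * \<zeta>) / N_prod (I n) (b n) 1 *
     (1 + of_real (\<epsilon> n) * \<zeta>) powi (- H n)"

lemma g_bounds: "0 \<le> g n" "(\<epsilon> n)\<^sup>2 * g n \<le> C / (1 - \<beta>)"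
proof -
  show "0 \<le> g n" unfolding g_def using b_nonneg b_le beta by (intro sum_nonneg divide_nonneg_nonneg) fastforce+
  have "g n \<le> (\<Sum>m\<in>I n. 1 / (1 - \<beta>))"
    unfolding g_def
  proof (intro sum_mono)
    fix m assume m: "m \<in> I n"
    show "b n m / (1 - b n m) \<le> 1 / (1 - \<beta>)"
      using b_nonneg[OF m] b_le[OF m] beta by (intro frac_le) auto
  qed
  then have "(\<epsilon> n)\<^sup>2 * g n \<le> (\<epsilon> n)\<^sup>2 * (real (card (I n)) * (1 / (1 - \<beta>)))" by (intro mult_left_mono) auto
  also have "\<dots> = (\<epsilon> n)\<^sup>2 * real (card (I n)) * (1 / (1 - \<beta>))" by simp
  also have "\<dots> \<le> C * (1 / (1 - \<beta>))" using card_le beta by (intro mult_right_mono) auto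
  finally show "(\<epsilon> n)\<^sup>2 * g n \<le> C / (1 - \<beta>)" by simp
qed

text \<open>As \<open>1 - b >= 1 - \<beta>\<close>, the sum with squared denominators is at most a
  constant times the sum of the \<open>b\<close>. So \<open>\<sigma> < 0\<close> forces the latter
  to be at least of order \<open>1 / \<epsilon>^2\<close>, which supplies the rate of the Gaussian
  bound.\<close>

lemma sum_b_lower: "\<exists>c>0. \<forall>\<^sub>F n in sequentially. c \<le> (\<epsilon> n)\<^sup>2 * (\<Sum>m\<in>I n. b n m)"
proof -
  define c where "c = (1 - \<beta>)\<^sup>2 * (- \<sigma> / 2)"
  have "\<forall>\<^sub>F n in sequentially. - \<sigma> / 2 < (\<epsilon> n)\<^sup>2 * (\<Sum>m\<in>I n. b n m / (1 - b n m)\<^sup>2)"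
    using second sigma by (intro order_tendstoD(1)) auto
  then have "\<forall>\<^sub>F n in sequentially. c \<le> (\<epsilon> n)\<^sup>2 * (\<Sum>m\<in>I n. b n m)"
  proof eventually_elim
    case (elim n)
    have "(1 - \<beta>)\<^sup>2 * (\<Sum>m\<in>I n. b n m / (1 - b n m)\<^sup>2) \<le> (\<Sum>m\<in>I n. b n m)"
      unfolding sum_distrib_left
    proof (intro sum_mono)
      fix m assume m: "m \<in> I n"
      have "(1 - \<beta>)\<^sup>2 / (1 - b n m)\<^sup>2 \<le> 1"
        using b_le[OF m] beta by (simp add: power_mono)
      then have "b n m * ((1 - \<beta>)\<^sup>2 / (1 - b n m)\<^sup>2) \<le> b n m * 1"
        using b_nonneg[OF m] by (intro mult_left_mono) auto
      then show "(1 - \<beta>)\<^sup>2 * (b n m / (1 - b n m)\<^sup>2) \<le> b n m" by (simp add: mult.commute)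
    qed
    then have "(\<epsilon> n)\<^sup>2 * ((1 - \<beta>)\<^sup>2 * (\<Sum>m\<in>I n. b n m / (1 - b n m)\<^sup>2)) \<le> (\<epsilon> n)\<^sup>2 * (\<Sum>m\<in>I n. b n m)"
      by (intro mult_left_mono) auto
    moreover have "c \<le> (1 - \<beta>)\<^sup>2 * ((\<epsilon> n)\<^sup>2 * (\<Sum>m\<in>I n. b n m / (1 - b n m)\<^sup>2))"
      unfolding c_def using elim by (intro mult_left_mono) auto
    ultimately show ?case by (simp add: mult_ac)
  qed
  moreover have "0 < c" unfolding c_def using beta sigma by (intro mult_pos_pos) auto
  ultimately show ?thesis by blast
qed

lemma sum_b_le_g: "(\<Sum>m\<in>I n. b n m) \<le> g n"
  unfolding g_def
proof (intro sum_mono)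
  fix m assume m: "m \<in> I n"
  have "b n m * 1 \<le> b n m * (1 / (1 - b n m))"
    using b_nonneg[OF m] b_le[OF m] beta by (intro mult_left_mono) auto
  then show "b n m \<le> b n m / (1 - b n m)" by simp
qed

text \<open>With \<open>x = \<epsilon> * \<zeta>\<close>, a normalized factor of
  \<open>N_prod\<close> is \<open>(1 + x / (1 - b)) / (1 + x)\<close>. Expanding the logarithms to
  second order gives the exponent \<open>(x - x^2 / 2) * (g - H) - x^2 / 2 * S\<close> up to cubic
  remainders. These are \<open>O(\<epsilon>^3)\<close> each, and both their number and
  \<open>H\<close> are \<open>O(1 / \<epsilon>^2)\<close>.\<close>

lemma N_local_expansion:
  assumes H: "scaled_height H y"
  shows "\<exists>E. uniform_limit (cball (0::complex) M) E (\<lambda>\<zeta>::complex. \<sigma> / 2 * \<zeta>\<^sup>2 - y * \<zeta>) sequentially \<and>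
     (\<forall>\<^sub>F n in sequentially. \<forall>\<zeta>\<in>cball (0::complex) M. N_local H n \<zeta> = exp (E n \<zeta>))"
proof -
  define L where "L = (\<lambda>x::complex. Ln (1 + x) - x + x\<^sup>2 / 2)"
  define E where "E = (\<lambda>n (\<zeta>::complex). (\<Sum>m\<in>I n. Ln (1 + \<epsilon> n * \<zeta> / (1 - b n m)) - Ln (1 + \<epsilon> n * \<zeta>)) - H n * Ln (1 + \<epsilon> n * \<zeta>))"
  define S where "S = (\<lambda>n. (\<Sum>m\<in>I n. b n m / (1 - b n m)\<^sup>2))"
  define K where "K = \<bar>M\<bar> + 1"
  have K: "1 \<le> K" "\<And>\<zeta>::complex. \<zeta> \<in> cball (0::complex) M \<Longrightarrow> norm \<zeta> \<le> K" by (auto simp: K_def)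
  \<comment> \<open>One summand each for the limit of the linear coefficient, the quadratic term
    with \<open>g - H\<close>, the curvature, the cubic remainders of the factors, and the cubic
    remainder of the power of \<open>z\<close>.\<close>
  define D where "D = (\<lambda>n. K * \<bar>\<epsilon> n * (g n - H n) + y\<bar> + K\<^sup>2 / 2 * \<epsilon> n * \<bar>\<epsilon> n * (g n - H n)\<bar> +
     K\<^sup>2 / 2 * \<bar>(\<epsilon> n)\<^sup>2 * S n + \<sigma>\<bar> + \<epsilon> n * (2 * K ^ 3 * (C * (1 / (1 - \<beta>) ^ 3 + 1))) +
     \<epsilon> n * (2 * K ^ 3 * (C / (1 - \<beta>) + \<epsilon> n * \<bar>\<epsilon> n * (g n - H n)\<bar>)))"
  have "(\<lambda>n. D n) \<longlonglongrightarrow> K * \<bar>- y + y\<bar> + K\<^sup>2 / 2 * 0 * \<bar>- y\<bar> + K\<^sup>2 / 2 * \<bar>- \<sigma> + \<sigma>\<bar> + 0 * (2 * K ^ 3 * (C * (1 / (1 - \<beta>) ^ 3 + 1))) +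
     0 * (2 * K ^ 3 * (C / (1 - \<beta>) + 0 * \<bar>- y\<bar>))"
    unfolding D_def S_def using H[unfolded scaled_height_def] by (intro tendsto_intros eps_lim second) auto
  then have D: "D \<longlonglongrightarrow> 0" by simp
  \<comment> \<open>This smallness keeps \<open>x\<close> and every \<open>x / (1 - b)\<close> in
    the disk of radius \<open>1 / 2\<close> on which the logarithm bound holds.\<close>
  have ev: "\<forall>\<^sub>F n in sequentially. \<epsilon> n * K \<le> (1 - \<beta>) / 2"
  proof -
    have "(\<lambda>n. \<epsilon> n * K) \<longlonglongrightarrow> 0 * K" by (intro tendsto_intros eps_lim)
    then have "\<forall>\<^sub>F n in sequentially. \<epsilon> n * K < (1 - \<beta>) / 2" using beta by (intro order_tendstoD(2)) auto
    then show ?thesis by eventually_elim simp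
  qed
  have small: "norm (\<epsilon> n * \<zeta>) \<le> 1 / 2 \<and> (\<forall>m\<in>I n. norm (\<epsilon> n * \<zeta> / (1 - b n m)) \<le> 1 / 2) \<and> norm (\<epsilon> n * \<zeta>) \<le> \<epsilon> n * K"
    if "\<epsilon> n * K \<le> (1 - \<beta>) / 2" "norm \<zeta> \<le> K" for n and \<zeta> :: complex
  proof -
    have 1: "norm (\<epsilon> n * \<zeta>) \<le> \<epsilon> n * K" using that eps_pos[of n] by (simp add: norm_mult)
    have "norm (\<epsilon> n * \<zeta> / (1 - b n m)) \<le> 1 / 2" if m: "m \<in> I n" for m
    proof -
      have "norm (1 - complex_of_real (b n m)) = 1 - b n m"
        using b_le[OF m] beta norm_of_real[of "1 - b n m", where 'a = complex] by simp
      then have "norm (\<epsilon> n * \<zeta> / (1 - b n m)) = norm (\<epsilon> n * \<zeta>) / (1 - b n m)"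
        by (simp add: norm_divide)
      also have "\<dots> \<le> ((1 - \<beta>) / 2) / (1 - \<beta>)"
        using 1 that(1) \<open>\<epsilon> n * K \<le> (1 - \<beta>) / 2\<close> b_le[OF m] beta by (intro frac_le) auto
      also have "((1 - \<beta>) / 2) / (1 - \<beta>) = 1 / 2" using beta by (simp add: field_simps)
      finally show ?thesis .
    qed
    moreover have "norm (\<epsilon> n * \<zeta>) \<le> 1 / 2"
      using order_trans[OF 1 that(1)] beta by (simp add: field_simps)
    ultimately show ?thesis using 1 by blast
  qed
  have "\<forall>\<^sub>F n in sequentially. \<forall>\<zeta>\<in>cball (0::complex) M. N_local H n \<zeta> = exp (E n \<zeta>)"
    using ev
  proof (eventually_elim, intro ballI)
    fix n and \<zeta> :: complex assume n: "\<epsilon> n * K \<le> (1 - \<beta>) / 2" and "\<zeta> \<in> cball (0::complex) M"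
    note sm = small[OF n K(2)[OF this(2)]]
    define x where "x = \<epsilon> n * \<zeta>"
    have nz: "1 + w \<noteq> 0" if "norm w \<le> 1 / 2" for w :: complex
      using that norm_triangle_ineq4[of "1 + w" w] by auto
    have x0: "1 + x \<noteq> 0" using sm nz by (simp add: x_def)
    have "exp (E n \<zeta>) = (\<Prod>m\<in>I n. (1 + x / (1 - b n m)) / (1 + x)) * exp (- H n * Ln (1 + x))"
    proof -
      have "exp (\<Sum>m\<in>I n. Ln (1 + x / (1 - b n m)) - Ln (1 + x)) = (\<Prod>m\<in>I n. (1 + x / (1 - b n m)) / (1 + x))"
        unfolding exp_sum[OF finite_I]
      proof (intro prod.cong refl)
        fix m assume m: "m \<in> I n"
        show "exp (Ln (1 + x / (1 - b n m)) - Ln (1 + x)) = (1 + x / (1 - b n m)) / (1 + x)"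
          using nz[of "x / (1 - b n m)"] sm m x0 by (simp add: exp_diff x_def)
      qed
      then show ?thesis by (simp add: E_def x_def exp_diff exp_minus divide_inverse)
    qed
    also have "exp (- H n * Ln (1 + x)) = (1 + x) powi (- H n)"
      using exp_power_int[of "Ln (1 + x)" "- H n"] x0 by (simp add: exp_Ln)
    also have "(\<Prod>m\<in>I n. (1 + x / (1 - b n m)) / (1 + x)) = N_prod (I n) (b n) (1 + x) / N_prod (I n) (b n) 1"
      unfolding N_prod_def prod_dividef[symmetric]
    proof (intro prod.cong refl)
      fix m assume m: "m \<in> I n"
      have "1 - complex_of_real (b n m) \<noteq> 0" using b_le[OF m] beta by (metis eq_iff_diff_eq_0 linorder_not_le of_real_eq_1_iff)
      then show "(1 + x / (1 - b n m)) / (1 + x) = (1 - complex_of_real (b n m) / (1 + x)) / (1 - complex_of_real (b n m) / 1)"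
        using x0 by (simp add: field_simps)
    qed
    finally show "N_local H n \<zeta> = exp (E n \<zeta>)" by (simp add: N_local_def x_def)
  qed
  moreover have "\<forall>\<^sub>F n in sequentially. \<forall>\<zeta>\<in>cball (0::complex) M. norm (E n \<zeta> - (\<sigma> / 2 * \<zeta>\<^sup>2 - y * \<zeta>)) \<le> D n"
    using ev
  proof (eventually_elim, intro ballI)
    fix n and \<zeta> :: complex assume n: "\<epsilon> n * K \<le> (1 - \<beta>) / 2" and "\<zeta> \<in> cball (0::complex) M"
    note zK = K(2)[OF this(2)]
    note sm = small[OF n zK]
    define x where "x = \<epsilon> n * \<zeta>"
    define h where "h = \<epsilon> n * (g n - H n)"
    have b1: "1 - complex_of_real (b n m) \<noteq> 0" if "m \<in> I n" for m
      using b_le[OF that] beta by (metis eq_iff_diff_eq_0 linorder_not_le of_real_eq_1_iff)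
    have split: "Ln (1 + w) = w - w\<^sup>2 / 2 + L w" for w by (simp add: L_def)
    have "E n \<zeta> = (\<Sum>m\<in>I n. (x / (1 - b n m) - x) - ((x / (1 - b n m))\<^sup>2 / 2 - x\<^sup>2 / 2) + (L (x / (1 - b n m)) - L x))
        - H n * (x - x\<^sup>2 / 2 + L x)"
      unfolding E_def x_def[symmetric] split by (simp add: algebra_simps)
    also have "\<dots> = (\<Sum>m\<in>I n. (x - x\<^sup>2 / 2) * (b n m / (1 - b n m)) - x\<^sup>2 / 2 * (b n m / (1 - b n m)\<^sup>2) + (L (x / (1 - b n m)) - L x))
        - H n * (x - x\<^sup>2 / 2 + L x)"
    proof -
      have "(x / (1 - b n m) - x) - ((x / (1 - b n m))\<^sup>2 / 2 - x\<^sup>2 / 2) =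
          (x - x\<^sup>2 / 2) * (b n m / (1 - b n m)) - x\<^sup>2 / 2 * (b n m / (1 - b n m)\<^sup>2)" if m: "m \<in> I n" for m
      proof -
        \<comment> \<open>Here \<open>w = 1 - b\<close> and
          \<open>1 / w^2 - 1 = (1 - w) / w + (1 - w) / w^2\<close>, which splits the quadratic
          coefficient into the summands of \<open>g\<close> and \<open>S\<close>.\<close>
        have "(x / w - x) - ((x / w)\<^sup>2 / 2 - x\<^sup>2 / 2) = (x - x\<^sup>2 / 2) * ((1 - w) / w) - x\<^sup>2 / 2 * ((1 - w) / w\<^sup>2)"
          if "w \<noteq> 0" for w
          using that by (simp add: field_simps power2_eq_square)
        from this[OF b1[OF m]] show ?thesis by simp
      qed
      then show ?thesis by (simp cong: sum.cong)
    qed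
    also have "\<dots> = (x - x\<^sup>2 / 2) * g n - x\<^sup>2 / 2 * S n + (\<Sum>m\<in>I n. L (x / (1 - b n m)) - L x) - H n * (x - x\<^sup>2 / 2 + L x)"
      unfolding sum.distrib sum_subtractf sum_distrib_left[symmetric] by (simp add: g_def S_def)
    also have "\<dots> = \<zeta> * h - \<epsilon> n * \<zeta>\<^sup>2 / 2 * h - \<zeta>\<^sup>2 / 2 * ((\<epsilon> n)\<^sup>2 * S n) + (\<Sum>m\<in>I n. L (x / (1 - b n m)) - L x) - H n * L x"
      by (simp add: x_def h_def algebra_simps power2_eq_square)
    finally have "E n \<zeta> - (\<sigma> / 2 * \<zeta>\<^sup>2 - y * \<zeta>) = \<zeta> * (h + y) - \<epsilon> n * \<zeta>\<^sup>2 / 2 * h - \<zeta>\<^sup>2 / 2 * ((\<epsilon> n)\<^sup>2 * S n + \<sigma>)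
        + (\<Sum>m\<in>I n. L (x / (1 - b n m)) - L x) - H n * L x" (is "_ = ?a - ?b - ?c + ?d - ?e")
      by (simp add: algebra_simps)
    then have "norm (E n \<zeta> - (\<sigma> / 2 * \<zeta>\<^sup>2 - y * \<zeta>)) \<le> norm ?a + norm ?b + norm ?c + norm ?d + norm ?e"
      using norm_triangle_ineq4[of "?a - ?b - ?c + ?d" ?e] norm_triangle_ineq[of "?a - ?b - ?c" ?d]
        norm_triangle_ineq4[of "?a - ?b" ?c] norm_triangle_ineq4[of ?a ?b] by simp
    moreover have "norm ?a \<le> K * \<bar>h + y\<bar>"
      using zK norm_of_real[of "h + y", where 'a = complex] by (simp add: norm_mult mult_right_mono)
    moreover have "norm ?b \<le> K\<^sup>2 / 2 * \<epsilon> n * \<bar>h\<bar>"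
    proof -
      have "norm ?b = (norm \<zeta>)\<^sup>2 / 2 * \<epsilon> n * \<bar>h\<bar>"
        using eps_pos[of n] by (simp add: norm_mult norm_divide norm_power)
      also have "\<dots> \<le> K\<^sup>2 / 2 * \<epsilon> n * \<bar>h\<bar>"
        using power_mono[OF zK, of 2] eps_pos[of n] by (intro mult_right_mono) auto
      finally show ?thesis .
    qed
    moreover have "norm ?c \<le> K\<^sup>2 / 2 * \<bar>(\<epsilon> n)\<^sup>2 * S n + \<sigma>\<bar>"
      using power_mono[OF zK, of 2] norm_of_real[of "(\<epsilon> n)\<^sup>2 * S n + \<sigma>", where 'a = complex]
      by (simp add: norm_mult norm_divide norm_power mult_right_mono)
    moreover have Lx: "norm (L x) \<le> 2 * K ^ 3 * (\<epsilon> n) ^ 3"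
    proof -
      have "norm (L x) \<le> 2 * norm x ^ 3"
        unfolding L_def by (rule norm_Ln_quadratic_approx) (use sm in \<open>simp add: x_def\<close>)
      also have "\<dots> \<le> 2 * (\<epsilon> n * K) ^ 3" using sm by (intro mult_left_mono power_mono) (auto simp: x_def)
      finally show ?thesis by (simp add: power_mult_distrib mult_ac)
    qed
    moreover have "norm ?d \<le> \<epsilon> n * (2 * K ^ 3 * (C * (1 / (1 - \<beta>) ^ 3 + 1)))"
    proof -
      have "norm ?d \<le> (\<Sum>m\<in>I n. 2 * K ^ 3 * (\<epsilon> n) ^ 3 * (1 / (1 - \<beta>) ^ 3 + 1))"
      proof (rule sum_norm_le)
        fix m assume m: "m \<in> I n"
        have "norm (L (x / (1 - b n m))) \<le> 2 * norm (x / (1 - b n m)) ^ 3"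
          unfolding L_def by (rule norm_Ln_quadratic_approx) (use sm m in \<open>simp add: x_def\<close>)
        also have "norm (x / (1 - b n m)) ^ 3 \<le> (\<epsilon> n * K / (1 - \<beta>)) ^ 3"
        proof -
          have "norm (1 - complex_of_real (b n m)) = 1 - b n m"
            using b_le[OF m] beta norm_of_real[of "1 - b n m", where 'a = complex] by simp
          then have "norm (x / (1 - b n m)) \<le> \<epsilon> n * K / (1 - \<beta>)"
            unfolding norm_divide using sm b_le[OF m] beta eps_pos[of n] K by (auto simp: x_def intro!: frac_le)
          then show ?thesis by (intro power_mono) auto
        qed
        finally have "norm (L (x / (1 - b n m))) \<le> 2 * (\<epsilon> n * K / (1 - \<beta>)) ^ 3" by simp
        then have "norm (L (x / (1 - b n m))) + norm (L x) \<le> 2 * (\<epsilon> n * K / (1 - \<beta>)) ^ 3 + 2 * K ^ 3 * (\<epsilon> n) ^ 3"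
          using Lx by linarith
        then show "norm (L (x / (1 - b n m)) - L x) \<le> 2 * K ^ 3 * (\<epsilon> n) ^ 3 * (1 / (1 - \<beta>) ^ 3 + 1)"
          using norm_triangle_ineq4[of "L (x / (1 - b n m))" "L x"]
          by (simp add: power_mult_distrib power_divide algebra_simps)
      qed
      also have "\<dots> = \<epsilon> n * (2 * K ^ 3 * (((\<epsilon> n)\<^sup>2 * real (card (I n))) * (1 / (1 - \<beta>) ^ 3 + 1)))"
        by (simp add: power3_eq_cube power2_eq_square)
      also have "\<dots> \<le> \<epsilon> n * (2 * K ^ 3 * (C * (1 / (1 - \<beta>) ^ 3 + 1)))"
        using card_le eps_pos[of n] K(1) beta by (intro mult_left_mono mult_right_mono) auto
      finally show ?thesis .
    qed
    moreover have "norm ?e \<le> \<epsilon> n * (2 * K ^ 3 * (C / (1 - \<beta>) + \<epsilon> n * \<bar>h\<bar>))"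
    proof -
      have "(\<epsilon> n)\<^sup>2 * \<bar>real_of_int (H n)\<bar> \<le> (\<epsilon> n)\<^sup>2 * (g n + \<bar>g n - H n\<bar>)"
        using g_bounds(1)[of n] by (intro mult_left_mono) auto
      also have "\<dots> = (\<epsilon> n)\<^sup>2 * g n + \<epsilon> n * \<bar>h\<bar>"
      proof -
        have "\<bar>h\<bar> = \<epsilon> n * \<bar>g n - H n\<bar>" using eps_pos[of n] by (simp add: h_def abs_mult)
        then show ?thesis by (simp add: power2_eq_square distrib_left mult.assoc)
      qed
      also have "\<dots> \<le> C / (1 - \<beta>) + \<epsilon> n * \<bar>h\<bar>" using g_bounds(2)[of n] by simp
      finally have 1: "(\<epsilon> n)\<^sup>2 * \<bar>real_of_int (H n)\<bar> \<le> C / (1 - \<beta>) + \<epsilon> n * \<bar>h\<bar>" .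
      have "norm ?e \<le> \<bar>real_of_int (H n)\<bar> * (2 * K ^ 3 * (\<epsilon> n) ^ 3)"
        unfolding norm_mult using Lx by (simp add: mult_left_mono)
      also have "\<dots> = \<epsilon> n * (2 * K ^ 3 * ((\<epsilon> n)\<^sup>2 * \<bar>real_of_int (H n)\<bar>))"
        by (simp add: power3_eq_cube power2_eq_square)
      also have "\<dots> \<le> \<epsilon> n * (2 * K ^ 3 * (C / (1 - \<beta>) + \<epsilon> n * \<bar>h\<bar>))"
        using 1 eps_pos[of n] K(1) by (intro mult_left_mono) auto
      finally show ?thesis .
    qed
    ultimately show "norm (E n \<zeta> - (\<sigma> / 2 * \<zeta>\<^sup>2 - y * \<zeta>)) \<le> D n"
      unfolding D_def h_def[symmetric] by linarith
  qed
  then have "uniform_limit (cball (0::complex) M) E (\<lambda>\<zeta>::complex. \<sigma> / 2 * \<zeta>\<^sup>2 - y * \<zeta>) sequentially"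
    unfolding uniform_limit_iff
  proof (intro allI impI)
    fix e :: real assume e: "0 < e"
    assume *: "\<forall>\<^sub>F n in sequentially. \<forall>\<zeta>\<in>cball (0::complex) M. norm (E n \<zeta> - (\<sigma> / 2 * \<zeta>\<^sup>2 - y * \<zeta>)) \<le> D n"
    have "\<forall>\<^sub>F n in sequentially. D n < e" using D e by (rule order_tendstoD(2))
    with * show "\<forall>\<^sub>F n in sequentially. \<forall>\<zeta>\<in>cball (0::complex) M. dist (E n \<zeta>) (\<sigma> / 2 * \<zeta>\<^sup>2 - y * \<zeta>) < e"
      by eventually_elim (auto simp: dist_norm intro: le_less_trans)
  qed
  ultimately show ?thesis by blast
qed

lemma uniform_limit_N_local:
  assumes H: "scaled_height H y"
  shows "uniform_limit (cball (0::complex) M) (N_local H) (\<lambda>\<zeta>::complex. exp (\<sigma> / 2 * \<zeta>\<^sup>2 - y * \<zeta>)) sequentially"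
proof -
  obtain E where E: "uniform_limit (cball (0::complex) M) E (\<lambda>\<zeta>::complex. \<sigma> / 2 * \<zeta>\<^sup>2 - y * \<zeta>) sequentially"
    "\<forall>\<^sub>F n in sequentially. \<forall>\<zeta>\<in>cball (0::complex) M. N_local H n \<zeta> = exp (E n \<zeta>)"
    using N_local_expansion[OF H] by blast
  define B where "B = \<bar>\<sigma>\<bar> / 2 * M\<^sup>2 + \<bar>y\<bar> * M"
  have B: "norm (\<sigma> / 2 * \<zeta>\<^sup>2 - y * \<zeta>) \<le> B" if "\<zeta> \<in> cball (0::complex) M" for \<zeta> :: complex
  proof -
    have z: "norm \<zeta> \<le> M" using that by simp
    have "norm (\<sigma> / 2 * \<zeta>\<^sup>2 - y * \<zeta>) \<le> \<bar>\<sigma>\<bar> / 2 * (norm \<zeta>)\<^sup>2 + \<bar>y\<bar> * norm \<zeta>"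
      using norm_triangle_ineq4[of "\<sigma> / 2 * \<zeta>\<^sup>2" "y * \<zeta>"] by (simp add: norm_mult norm_divide norm_power)
    also have "\<dots> \<le> B" unfolding B_def using z by (intro add_mono mult_left_mono power_mono) auto
    finally show ?thesis .
  qed
  show ?thesis
    unfolding uniform_limit_iff
  proof (intro allI impI)
    fix e :: real assume e: "0 < e"
    \<comment> \<open>\<open>exp (B + 1)\<close> is the Lipschitz constant of \<open>exp\<close> on
      a disk containing both exponents.\<close>
    define d where "d = min 1 (e / exp (B + 1))"
    have "d \<le> e / exp (B + 1)" by (simp add: d_def)
    then have "exp (B + 1) * d \<le> e" by (simp add: pos_le_divide_eq mult.commute)
    moreover have "0 < d" "d \<le> 1" using e by (simp_all add: d_def)
    ultimately have d: "0 < d" "d \<le> 1" "exp (B + 1) * d \<le> e" by auto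
    have "\<forall>\<^sub>F n in sequentially. \<forall>\<zeta>\<in>cball (0::complex) M. dist (E n \<zeta>) (\<sigma> / 2 * \<zeta>\<^sup>2 - y * \<zeta>) < d"
      by (rule E(1)[unfolded uniform_limit_iff, rule_format, OF d(1)])
    with E(2) show "\<forall>\<^sub>F n in sequentially. \<forall>\<zeta>\<in>cball (0::complex) M. dist (N_local H n \<zeta>) (exp (\<sigma> / 2 * \<zeta>\<^sup>2 - y * \<zeta>)) < e"
    proof (eventually_elim, intro ballI)
      fix n and \<zeta> :: complex
      assume n: "\<forall>\<zeta>\<in>cball (0::complex) M. N_local H n \<zeta> = exp (E n \<zeta>)"
        "\<forall>\<zeta>\<in>cball (0::complex) M. dist (E n \<zeta>) (\<sigma> / 2 * \<zeta>\<^sup>2 - y * \<zeta>) < d" and z: "\<zeta> \<in> cball (0::complex) M"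
      have lt: "norm (E n \<zeta> - (\<sigma> / 2 * \<zeta>\<^sup>2 - y * \<zeta>)) < d" using n z by (simp add: dist_norm)
      then have "norm (E n \<zeta>) \<le> B + 1"
        using norm_triangle_sub[of "E n \<zeta>" "\<sigma> / 2 * \<zeta>\<^sup>2 - y * \<zeta>"] B[OF z] d(2) by linarith
      then have "norm (exp (E n \<zeta>) - exp (\<sigma> / 2 * \<zeta>\<^sup>2 - y * \<zeta>)) \<le> exp (B + 1) * norm (E n \<zeta> - (\<sigma> / 2 * \<zeta>\<^sup>2 - y * \<zeta>))"
        using B[OF z] by (intro norm_exp_diff_le) auto
      also have "\<dots> < exp (B + 1) * d" using lt by simp
      finally show "dist (N_local H n \<zeta>) (exp (\<sigma> / 2 * \<zeta>\<^sup>2 - y * \<zeta>)) < e"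
        using n z d(3) by (simp add: dist_norm)
    qed
  qed
qed

end

section \<open>The residue term\<close>

lemma residue_exp_over_power:
  "residue (\<lambda>z. exp (of_real y * z) * z powi (- int n)) 0 =
     (if n = 0 then 0 else of_real y ^ (n - 1) / fact (n - 1))"
proof (cases n)
  case 0
  have "residue (\<lambda>z. exp (of_real y * z) * z powi (- int n)) 0 = 0"
    unfolding 0 by (rule residue_holo[of UNIV]) (auto intro!: holomorphic_intros)
  then show ?thesis using 0 by simp
next
  case (Suc k)
  have "(deriv ^^ j) (\<lambda>z. exp (of_real y * z)) = (\<lambda>z::complex. of_real y ^ j * exp (of_real y * z))" for j
  proof (induction j)
    case (Suc j)
    have "deriv (\<lambda>z::complex. of_real y ^ j * exp (of_real y * z)) z = of_real y ^ Suc j * exp (of_real y * z)" for z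
      by (rule DERIV_imp_deriv) (auto intro!: derivative_eq_intros)
    then show ?case using Suc by auto
  qed simp
  moreover have "residue (\<lambda>z. exp (of_real y * z) / (z - 0) ^ Suc k) 0 =
      (deriv ^^ k) (\<lambda>z. exp (of_real y * z)) 0 / fact k"
    by (rule residue_holomorphic_over_power[of UNIV]) (auto intro!: holomorphic_intros)
  moreover have "z powi (- int n) = inverse (z ^ Suc k)" for z :: complex
    unfolding Suc power_int_minus power_int_of_nat ..
  ultimately show ?thesis
    using Suc by (simp add: divide_inverse del: power_Suc)
qed

text \<open>The two outcomes serve the two directions in which the line \<open>Re z = -1\<close> is
  closed: to the right across the pole at 0, and to the left past no pole.\<close>

lemma rectangle_integral:
  fixes f :: "complex \<Rightarrow> complex" and a b d :: real
  assumes f: "f holomorphic_on - {0}" and ab: "a < b" "0 < d" "a \<noteq> 0" "b \<noteq> 0"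
  shows "contour_integral (linepath (Complex a (- d)) (Complex b (- d))) f +
    contour_integral (linepath (Complex b (- d)) (Complex b d)) f -
    contour_integral (linepath (Complex a d) (Complex b d)) f -
    contour_integral (linepath (Complex a (- d)) (Complex a d)) f =
    (if a < 0 \<and> 0 < b then 2 * pi * \<i> * residue f 0 else 0)"
proof -
  define r where "r = rectpath (Complex a (- d)) (Complex b d)"
  have nz: "0 \<notin> path_image r"
    using ab by (auto simp: r_def path_image_rectpath complex_eq_iff)
  have pi: "path_image r = closed_segment (Complex a (- d)) (Complex b (- d)) \<union>
      (closed_segment (Complex b (- d)) (Complex b d) \<union>
      (closed_segment (Complex b d) (Complex a d) \<union> closed_segment (Complex a d) (Complex a (- d))))"
    by (simp add: r_def rectpath_def Let_def path_image_join)
  have int: "f contour_integrable_on linepath p q" if "closed_segment p q \<subseteq> path_image r" for p q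
    using that nz f by (intro contour_integrable_continuous_linepath holomorphic_on_imp_continuous_on holomorphic_on_subset[OF f]) auto
  have i1: "f contour_integrable_on linepath (Complex a (- d)) (Complex b (- d))"
    and i2: "f contour_integrable_on linepath (Complex b (- d)) (Complex b d)"
    and i3: "f contour_integrable_on linepath (Complex b d) (Complex a d)"
    and i4: "f contour_integrable_on linepath (Complex a d) (Complex a (- d))"
    by (rule int, unfold pi, blast)+
  have "contour_integral r f =
      contour_integral (linepath (Complex a (- d)) (Complex b (- d))) f +
      (contour_integral (linepath (Complex b (- d)) (Complex b d)) f +
      (contour_integral (linepath (Complex b d) (Complex a d)) f +
      contour_integral (linepath (Complex a d) (Complex a (- d))) f))"
    unfolding r_def rectpath_def Let_def complex.sel
    by (subst contour_integral_join; (intro i1 i2 i3 i4 contour_integrable_joinI valid_path_join valid_path_linepath)?; simp?)+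
  moreover have "contour_integral (linepath (Complex b d) (Complex a d)) f = - contour_integral (linepath (Complex a d) (Complex b d)) f"
    "contour_integral (linepath (Complex a d) (Complex a (- d))) f = - contour_integral (linepath (Complex a (- d)) (Complex a d)) f"
    by (metis contour_integral_reversepath reversepath_linepath valid_path_linepath)+
  moreover have "contour_integral r f = 2 * pi * \<i> * (\<Sum>p\<in>{0}. winding_number r p * residue f p)"
    by (rule Residue_theorem[of UNIV]) (use f nz in \<open>auto simp: r_def Compl_eq_Diff_UNIV\<close>)
  moreover have "winding_number r 0 = (if a < 0 \<and> 0 < b then 1 else 0)"
  proof (cases "a < 0 \<and> 0 < b")
    case True
    then show ?thesis unfolding r_def using ab by (subst winding_number_rectpath) (auto simp: in_box_complex_iff)
  next
    case False
    then show ?thesis unfolding r_def using ab by (subst winding_number_rectpath_outside) (auto simp: in_cbox_complex_iff)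
  qed
  ultimately show ?thesis by (cases "a < 0 \<and> 0 < b") (auto simp: algebra_simps)
qed

lemma norm_exp_power_le:
  assumes "1 \<le> norm z" "y * Re z \<le> B" "1 \<le> k" "R \<le> norm z" "0 < R"
  shows "norm (exp (of_real y * z) * z powi (- int k)) \<le> exp B / R"
proof -
  have "norm (z powi (- int k)) = inverse (norm z ^ k)"
    unfolding power_int_minus power_int_of_nat by (simp add: norm_inverse norm_power)
  also have "\<dots> \<le> inverse (norm z ^ 1)"
    using assms by (intro le_imp_inverse_le power_increasing) auto
  also have "\<dots> \<le> inverse R" using assms by (intro le_imp_inverse_le) auto
  finally have "norm (z powi (- int k)) \<le> inverse R" .
  then have "norm (exp (of_real y * z)) * norm (z powi (- int k)) \<le> exp B * inverse R"
    using assms by (intro mult_mono) auto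
  then show ?thesis by (simp add: norm_mult divide_inverse)
qed

text \<open>The line is closed on the side where \<open>exp (y * z)\<close> decays: to the right,
  around the pole, for \<open>y < 0\<close>, and to the left for \<open>y > 0\<close>. For
  \<open>y = 0\<close> there is no decay, but \<open>k >= 2\<close> provides a primitive that
  vanishes at infinity.\<close>

lemma vertical_line_integral_limit:
  fixes y :: real
  assumes k: "1 \<le> k" and y: "y \<noteq> 0 \<or> 2 \<le> k"
  shows "((\<lambda>R::real. contour_integral (linepath (Complex (-1) R) (Complex (-1) (- R)))
      (\<lambda>z. exp (of_real y * z) * z powi (- int k))) \<longlongrightarrow>
    (if y < 0 then 2 * pi * \<i> * (of_real y ^ (k - 1) / fact (k - 1)) else 0)) at_top"
proof -
  define f where "f = (\<lambda>z::complex. exp (of_real y * z) * z powi (- int k))"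
  have hol: "f holomorphic_on - {0}" unfolding f_def by (intro holomorphic_intros) auto
  have int: "f contour_integrable_on linepath p q" if "0 \<notin> closed_segment p q" for p q
    using that by (intro contour_integrable_continuous_linepath holomorphic_on_imp_continuous_on holomorphic_on_subset[OF hol]) auto
  have rev: "contour_integral (linepath (Complex (-1) R) (Complex (-1) (- R))) f =
      - contour_integral (linepath (Complex (-1) (- R)) (Complex (-1) R)) f" for R
    by (metis contour_integral_reversepath reversepath_linepath valid_path_linepath)
  show ?thesis
  proof (cases "y = 0")
    case True
    then have k2: "2 \<le> k" using y by simp
    define F where "F = (\<lambda>z::complex. z powi (1 - int k) / (1 - of_nat k))"
    have F: "(F has_field_derivative f z) (at z within S)" if "z \<noteq> 0" for z S
    proof -
      have "(F has_field_derivative (of_int (1 - int k) * z powi (1 - int k - 1)) / (1 - of_nat k)) (at z within S)"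
        unfolding F_def using that by (auto intro!: derivative_eq_intros)
      moreover have "(1::complex) - of_nat k \<noteq> 0" using k2 of_nat_eq_1_iff[of k, where 'a = complex] by auto
      ultimately show ?thesis using True by (simp add: f_def)
    qed
    have F0: "((\<lambda>R. F (Complex (-1) (s * R))) \<longlongrightarrow> 0) at_top" if "s = 1 \<or> s = - 1" for s
    proof (rule Lim_null_comparison)
      show "\<forall>\<^sub>F R in at_top. norm (F (Complex (-1) (s * R))) \<le> 1 / R"
        using eventually_ge_at_top[of 1]
      proof eventually_elim
        case (elim R)
        have n: "R \<le> norm (Complex (-1) (s * R))"
          using that abs_Im_le_cmod[of "Complex (-1) (s * R)"] elim by auto
        have "norm (Complex (-1) (s * R) powi (1 - int k)) = inverse (norm (Complex (-1) (s * R)) ^ (k - 1))"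
          using k2 by (simp add: power_int_def norm_inverse norm_power nat_diff_distrib power_inverse)
        also have "\<dots> \<le> inverse (norm (Complex (-1) (s * R)) ^ 1)"
          using n elim k2 by (intro le_imp_inverse_le power_increasing) auto
        also have "\<dots> \<le> inverse R" using n elim by (intro le_imp_inverse_le) auto
        finally have 1: "norm (Complex (-1) (s * R) powi (1 - int k)) \<le> inverse R" .
        have "norm ((1::complex) - of_nat k) = real k - 1"
          using k2 norm_of_real[of "1 - real k", where 'a = complex] by simp
        then have "norm (F (Complex (-1) (s * R))) = norm (Complex (-1) (s * R) powi (1 - int k)) / (real k - 1)"
          by (simp add: F_def norm_divide)
        also have "\<dots> \<le> inverse R / 1" using 1 k2 elim by (intro frac_le) auto
        finally show ?case by (simp add: divide_inverse)
      qed
      show "((\<lambda>R::real. 1 / R) \<longlongrightarrow> 0) at_top" by real_asymp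
    qed
    have "((\<lambda>R. F (Complex (-1) (- 1 * R)) - F (Complex (-1) (1 * R))) \<longlongrightarrow> 0 - 0) at_top"
      by (intro tendsto_diff F0) auto
    moreover have "F (Complex (-1) (- 1 * R)) - F (Complex (-1) (1 * R)) =
        contour_integral (linepath (Complex (-1) R) (Complex (-1) (- R))) f" for R
    proof -
      have "z \<noteq> 0" if "z \<in> closed_segment (Complex (-1) R) (Complex (-1) (- R))" for z
        using that by (auto simp: closed_segment_def complex_eq_iff algebra_simps)
      then have "(f has_contour_integral (F (pathfinish (linepath (Complex (-1) R) (Complex (-1) (- R)))) -
          F (pathstart (linepath (Complex (-1) R) (Complex (-1) (- R)))))) (linepath (Complex (-1) R) (Complex (-1) (- R)))"
        by (intro contour_integral_primitive[where S = "closed_segment (Complex (-1) R) (Complex (-1) (- R))"] F) auto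
      then show ?thesis using contour_integral_unique by force
    qed
    ultimately show ?thesis using True by (simp add: f_def)
  next
    case False
    define c where "c = exp \<bar>y\<bar>"
    \<comment> \<open>Width \<open>sqrt R\<close> makes both errors vanish: the horizontal sides
      give \<open>O(sqrt R / R)\<close>, and the far side gives
      \<open>O(R * exp (- \<bar>y\<bar> * sqrt R))\<close>.\<close>
    define L where "L = (\<lambda>R::real. if y < 0 then sqrt R else - sqrt R)"
    define H where "H = (\<lambda>t R. contour_integral (linepath (Complex (-1) (t * R)) (Complex (L R) (t * R))) f)"
    define V where "V = (\<lambda>R. contour_integral (linepath (Complex (L R) (- R)) (Complex (L R) R)) f)"
    have bnd: "norm (f z) \<le> exp B / R" if "1 \<le> norm z" "y * Re z \<le> B" "R \<le> norm z" "0 < R" for z B R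
      unfolding f_def by (rule norm_exp_power_le[OF that(1,2) k that(3,4)])
    have H0: "(H t \<longlongrightarrow> 0) at_top" if t: "t = 1 \<or> t = - 1" for t
    proof (rule Lim_null_comparison)
      show "\<forall>\<^sub>F R in at_top. norm (H t R) \<le> c / R * (sqrt R + 1)"
        using eventually_ge_at_top[of 1]
      proof eventually_elim
        case (elim R)
        have z: "Im z = t * R \<and> y * Re z \<le> \<bar>y\<bar>" if zs: "z \<in> closed_segment (Complex (-1) (t * R)) (Complex (L R) (t * R))" for z
        proof -
          from zs obtain u where u: "0 \<le> u" "u \<le> 1" "z = (1 - u) *\<^sub>R Complex (-1) (t * R) + u *\<^sub>R Complex (L R) (t * R)"
            by (auto simp: closed_segment_def)
          have Re: "Re z = - (1 - u) + u * L R" and Im: "Im z = t * R" by (simp_all add: u(3) algebra_simps)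
          have "y * L R \<le> 0" using elim False by (auto simp: L_def mult_nonpos_nonneg)
          then have "u * (y * L R) \<le> 0" using u by (simp add: mult_nonneg_nonpos)
          moreover have "- (y * (1 - u)) \<le> \<bar>y\<bar> * 1"
            using u abs_ge_minus_self[of "y * (1 - u)"] mult_left_mono[of "1 - u" 1 "\<bar>y\<bar>"] by (simp add: abs_mult)
          moreover have "y * Re z = - (y * (1 - u)) + u * (y * L R)" unfolding Re by (simp add: algebra_simps)
          ultimately show ?thesis using Im by linarith
        qed
        have zn: "R \<le> norm z" if "z \<in> closed_segment (Complex (-1) (t * R)) (Complex (L R) (t * R))" for z
          using abs_Im_le_cmod[of z] z[OF that] t elim by auto
        have "norm (H t R) \<le> c / R * norm (Complex (L R) (t * R) - Complex (-1) (t * R))"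
          unfolding H_def c_def
        proof (rule contour_integral_bound_linepath)
          show "f contour_integrable_on linepath (Complex (-1) (t * R)) (Complex (L R) (t * R))"
            by (rule int) (use zn[of 0] elim in auto)
          show "norm (f z) \<le> exp \<bar>y\<bar> / R" if "z \<in> closed_segment (Complex (-1) (t * R)) (Complex (L R) (t * R))" for z
            using z[OF that] zn[OF that] elim by (intro bnd) auto
        qed (use elim in auto)
        also have "\<dots> \<le> c / R * (sqrt R + 1)"
        proof -
          have "Complex (L R) (t * R) - Complex (-1) (t * R) = of_real (L R + 1)" by (simp add: complex_eq_iff)
          then have "norm (Complex (L R) (t * R) - Complex (-1) (t * R)) = \<bar>L R + 1\<bar>" by (simp only: norm_of_real)
          also have "\<dots> \<le> sqrt R + 1" using elim by (auto simp: L_def)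
          finally show ?thesis using elim by (intro mult_left_mono) (auto simp: c_def)
        qed
        finally show ?case .
      qed
      show "((\<lambda>R. c / R * (sqrt R + 1)) \<longlongrightarrow> 0) at_top" by real_asymp
    qed
    have V0: "(V \<longlongrightarrow> 0) at_top"
    proof (rule Lim_null_comparison)
      show "\<forall>\<^sub>F R in at_top. norm (V R) \<le> exp (- \<bar>y\<bar> * sqrt R) / 1 * (2 * R)"
        using eventually_ge_at_top[of 1]
      proof eventually_elim
        case (elim R)
        have z: "Re z = L R" if zs: "z \<in> closed_segment (Complex (L R) (- R)) (Complex (L R) R)" for z
        proof -
          from zs obtain u where u: "z = (1 - u) *\<^sub>R Complex (L R) (- R) + u *\<^sub>R Complex (L R) R"
            by (auto simp: closed_segment_def)
          then show ?thesis by (simp add: u algebra_simps)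
        qed
        have zn: "1 \<le> norm z" if "z \<in> closed_segment (Complex (L R) (- R)) (Complex (L R) R)" for z
        proof -
          have "1 \<le> \<bar>L R\<bar>" using real_sqrt_ge_one[OF elim] by (simp add: L_def)
          then show ?thesis using abs_Re_le_cmod[of z] z[OF that] by linarith
        qed
        have "norm (V R) \<le> exp (- \<bar>y\<bar> * sqrt R) / 1 * norm (Complex (L R) R - Complex (L R) (- R))"
          unfolding V_def
        proof (rule contour_integral_bound_linepath)
          show "f contour_integrable_on linepath (Complex (L R) (- R)) (Complex (L R) R)"
            by (rule int) (use zn[of 0] in auto)
          show "norm (f z) \<le> exp (- \<bar>y\<bar> * sqrt R) / 1" if "z \<in> closed_segment (Complex (L R) (- R)) (Complex (L R) R)" for z
            using z[OF that] zn[OF that] False by (intro bnd) (auto simp: L_def)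
        qed (use elim in auto)
        also have "norm (Complex (L R) R - Complex (L R) (- R)) = 2 * R"
        proof -
          have "Complex (L R) R - Complex (L R) (- R) = \<i> * of_real (2 * R)" by (simp add: complex_eq_iff)
          then show ?thesis using elim by (simp only: norm_mult norm_of_real norm_ii)
        qed
        finally show ?case .
      qed
      have "0 < \<bar>y\<bar>" using False by simp
      then show "((\<lambda>R. exp (- \<bar>y\<bar> * sqrt R) / 1 * (2 * R)) \<longlongrightarrow> 0) at_top" by real_asymp
    qed
    have res: "residue f 0 = of_real y ^ (k - 1) / fact (k - 1)"
      unfolding f_def residue_exp_over_power using k by simp
    define l where "l = (if y < 0 then 2 * pi * \<i> * (of_real y ^ (k - 1) / fact (k - 1)) else 0)"
    have "\<forall>\<^sub>F R in at_top. l - H (- 1) R - V R + H 1 R =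
        contour_integral (linepath (Complex (-1) R) (Complex (-1) (- R))) f"
      using eventually_gt_at_top[of 1]
    proof eventually_elim
      case (elim R)
      then have s: "1 < sqrt R" by simp
      show ?case
      proof (cases "y < 0")
        case True
        then show ?thesis
          using rectangle_integral[OF hol, of "- 1" "L R" R] elim s
          unfolding rev H_def V_def l_def by (simp add: L_def res algebra_simps)
      next
        case f: False
        have "contour_integral (linepath (Complex p t) (Complex q t)) f = - contour_integral (linepath (Complex q t) (Complex p t)) f" for p q t
          by (metis contour_integral_reversepath reversepath_linepath valid_path_linepath)
        from this[of "L R" "- R" "- 1"] this[of "L R" "R" "- 1"] show ?thesis
          using rectangle_integral[OF hol, of "L R" "- 1" R] elim s f
          unfolding rev H_def V_def l_def by (simp add: L_def algebra_simps)
      qed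
    qed
    moreover have "((\<lambda>R. l - H (- 1) R - V R + H 1 R) \<longlongrightarrow> l - 0 - 0 + 0) at_top"
      by (intro tendsto_intros H0 V0) auto
    ultimately have "((\<lambda>R. contour_integral (linepath (Complex (-1) R) (Complex (-1) (- R))) f) \<longlongrightarrow> l) at_top"
      by (auto intro: Lim_transform_eventually)
    then show ?thesis by (simp add: f_def l_def)
  qed
qed

section \<open>Convergence of the double integral\<close>

text \<open>The angle is centred at 0 and rescaled by \<open>e\<close>, so that the interval
  \<open>[- pi / e, pi / e]\<close> exhausts the real line as \<open>e\<close> tends to 0. The
  indicator puts all integrals on the same measure space, as dominated convergence requires.\<close>

lemma circle_integral_as_line:
  assumes h: "continuous_on (sphere 0 \<rho>) h" and \<rho>: "0 < \<rho>" and e: "0 < e"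
  shows "circle_integral 0 \<rho> h =
    (\<integral>y. indicator {- (pi / e)..pi / e} y *\<^sub>R (h (\<rho> * cis (e * y)) * (\<i> * \<rho> * e * cis (e * y))) \<partial>lborel)"
proof -
  define G where "G = (\<lambda>\<theta>. h (\<rho> * cis \<theta>) * (\<i> * \<rho> * cis \<theta>))"
  have cont: "continuous_on S G" for S
    unfolding G_def
    by (intro continuous_intros continuous_on_compose2[OF h]) (use \<rho> in \<open>auto simp: norm_mult\<close>)
  have int: "G integrable_on {a..b}" for a b
    by (intro integrable_continuous_interval cont)
  have per: "G (x + 2 * pi) = G x" for x
    by (simp add: G_def flip: cis_mult)
  have "circle_integral 0 \<rho> h = integral {0..2 * pi} G"
  proof -
    have "((\<lambda>x. G (2 * pi * x + 0)) has_integral (integral {0..2 * pi} G /\<^sub>R (2 * pi))) {0..1}"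
      using has_integral_affinity'[OF integrable_integral[OF int[of 0 "2 * pi"], unfolded box_real(2)[symmetric]], of "2 * pi" 0]
      by simp
    then have "((\<lambda>x. (2 * pi) *\<^sub>R G (2 * pi * x)) has_integral ((2 * pi) *\<^sub>R (integral {0..2 * pi} G /\<^sub>R (2 * pi)))) {0..1}"
      by (intro has_integral_cmul) simp
    moreover have "(2 * pi) *\<^sub>R (integral {0..2 * pi} G /\<^sub>R (2 * pi)) = integral {0..2 * pi} G" by simp
    ultimately have "integral {0..1} (\<lambda>x. (2 * pi) *\<^sub>R G (2 * pi * x)) = integral {0..2 * pi} G"
      by (metis integral_unique)
    then show ?thesis
      unfolding circle_integral_param G_def by (simp add: scaleR_conv_of_real mult_ac)
  qed
  also have "\<dots> = integral {0..pi} G + integral {pi..2 * pi} G"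
    by (rule Henstock_Kurzweil_Integration.integral_combine[symmetric]) (use int in auto)
  also have "integral {pi..2 * pi} G = integral {- pi..0} G"
    using integral_shift_Icc_real[of "- pi" 0 G "2 * pi"] per by (simp add: o_def add.commute)
  also have "integral {0..pi} G + integral {- pi..0} G = integral {- pi..pi} G"
    by (subst add.commute, rule Henstock_Kurzweil_Integration.integral_combine) (use int in auto)
  finally have 1: "circle_integral 0 \<rho> h = integral {- pi..pi} G" .
  have "((\<lambda>x. G (e * x + 0)) has_integral (circle_integral 0 \<rho> h /\<^sub>R e)) {- (pi / e)..pi / e}"
    using has_integral_affinity'[OF integrable_integral[OF int[of "- pi" "pi"], unfolded box_real(2)[symmetric]] e, of 0] 1
    by (simp add: divide_inverse mult.commute)
  then have "((\<lambda>x. e *\<^sub>R G (e * x)) has_integral e *\<^sub>R (circle_integral 0 \<rho> h /\<^sub>R e)) {- (pi / e)..pi / e}"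
    by (intro has_integral_cmul) simp
  moreover have "e *\<^sub>R (circle_integral 0 \<rho> h /\<^sub>R e) = circle_integral 0 \<rho> h" using e by simp
  ultimately have "integral {- (pi / e)..pi / e} (\<lambda>x. e *\<^sub>R G (e * x)) = circle_integral 0 \<rho> h"
    by (metis integral_unique)
  then have "integral {- (pi / e)..pi / e} (\<lambda>x. h (\<rho> * cis (e * x)) * (\<i> * \<rho> * e * cis (e * x))) = circle_integral 0 \<rho> h"
    by (simp add: G_def scaleR_conv_of_real mult_ac)
  moreover have "set_integrable lborel {- (pi / e)..pi / e} (\<lambda>x. h (\<rho> * cis (e * x)) * (\<i> * \<rho> * e * cis (e * x)))"
    by (intro borel_integrable_atLeastAtMost' continuous_intros continuous_on_compose2[OF h]) (use \<rho> in \<open>auto simp: norm_mult\<close>)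
  ultimately show ?thesis
    using set_borel_integral_eq_integral(2) unfolding set_lebesgue_integral_def by metis
qed

lemma borel_measurable_circle_line:
  assumes h: "continuous_on (sphere 0 \<rho>) h" and \<rho>: "0 < \<rho>"
  shows "(\<lambda>y. indicator {- (pi / e)..pi / e} y *\<^sub>R (h (\<rho> * cis (e * y)) * (\<i> * \<rho> * e * cis (e * y)))) \<in> borel_measurable borel"
  by (intro borel_measurable_continuous_on_indicator continuous_intros continuous_on_compose2[OF h])
     (use \<rho> in \<open>auto simp: norm_mult\<close>)

text \<open>The polynomial factor comes from \<open>P_prod\<close> and the Gaussian from
  \<open>N_prod\<close>; the right-hand side is an integrable majorant.\<close>

lemma power_times_gaussian_bound:
  assumes c: "0 < (c::real)"
  shows "\<exists>B. \<forall>y. (5 + 2 * \<bar>y\<bar>) ^ m * exp (- (c * y\<^sup>2)) \<le> B * inverse (1 + y\<^sup>2)"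
proof (intro exI allI)
  fix y :: real
  let ?t = "5 + 2 * \<bar>y\<bar>"
  have "?t ^ m / fact m \<le> exp ?t"
  proof -
    have "(\<Sum>n\<in>{m}. ?t ^ n /\<^sub>R fact n) \<le> (\<Sum>n. ?t ^ n /\<^sub>R fact n)"
      by (rule sum_le_suminf[OF summable_exp_generic]) auto
    then show ?thesis by (simp add: exp_def divide_inverse mult.commute)
  qed
  then have 1: "?t ^ m \<le> fact m * exp ?t" by (simp add: field_simps)
  \<comment> \<open>Completing the square with \<open>3 * \<bar>y\<bar>\<close>: two of the three
    absorb the exponential of \<open>?t\<close>, and the third leaves
    \<open>exp (- \<bar>y\<bar>)\<close>, which beats \<open>1 + y^2\<close>.\<close>
  have "c * (\<bar>y\<bar> - 3 / (2 * c))\<^sup>2 \<ge> 0" using c by simp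
  moreover have "c * (\<bar>y\<bar> - 3 / (2 * c))\<^sup>2 = c * \<bar>y\<bar>\<^sup>2 - 3 * \<bar>y\<bar> + 9 / (4 * c)"
    unfolding power2_diff using c by (simp add: power2_eq_square field_simps)
  ultimately have 2: "3 * \<bar>y\<bar> - c * y\<^sup>2 \<le> 9 / (4 * c)" by simp
  have 3: "1 + y\<^sup>2 \<le> 2 * exp \<bar>y\<bar>"
    using exp_lower_Taylor_quadratic[of "\<bar>y\<bar>"] by simp
  have "?t ^ m * exp (- (c * y\<^sup>2)) \<le> fact m * exp ?t * exp (- (c * y\<^sup>2))"
    using 1 by (intro mult_right_mono) auto
  also have "\<dots> = fact m * exp (5 + (3 * \<bar>y\<bar> - c * y\<^sup>2) - \<bar>y\<bar>)"
    unfolding mult.assoc exp_add[symmetric] by (simp add: algebra_simps)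
  also have "\<dots> \<le> fact m * exp (5 + 9 / (4 * c) - \<bar>y\<bar>)" using 2 by simp
  also have "\<dots> = fact m * exp (5 + 9 / (4 * c)) * inverse (exp \<bar>y\<bar>)"
    by (simp only: exp_diff divide_inverse mult.assoc)
  also have "\<dots> \<le> fact m * exp (5 + 9 / (4 * c)) * (2 * inverse (1 + y\<^sup>2))"
  proof (rule mult_left_mono)
    have "inverse (2 * exp \<bar>y\<bar>) \<le> inverse (1 + y\<^sup>2)"
      using 3 by (intro le_imp_inverse_le) (auto simp: add_pos_nonneg)
    then show "inverse (exp \<bar>y\<bar>) \<le> 2 * inverse (1 + y\<^sup>2)" by simp
  qed simp
  finally show "?t ^ m * exp (- (c * y\<^sup>2)) \<le> (fact m * exp (5 + 9 / (4 * c)) * 2) * inverse (1 + y\<^sup>2)"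
    by simp
qed

lemma integrable_inverse_square: "integrable lborel (\<lambda>y::real. B * inverse (1 + y\<^sup>2))"
  using integrable_inverse_1_plus_square by (simp add: set_integrable_def einterval_eq_UNIV)

lemma uniform_limit_prod:
  fixes f :: "'i \<Rightarrow> 'a \<Rightarrow> 'b \<Rightarrow> complex"
  assumes "finite J" "\<And>j. j \<in> J \<Longrightarrow> uniform_limit S (f j) (l j) F" "\<And>j. j \<in> J \<Longrightarrow> bounded (l j ` S)"
  shows "uniform_limit S (\<lambda>n x. \<Prod>j\<in>J. f j n x) (\<lambda>x. \<Prod>j\<in>J. l j x) F \<and> bounded ((\<lambda>x. \<Prod>j\<in>J. l j x) ` S)"
  using assms
proof (induction J rule: finite_induct)
  case empty
  then show ?case by (auto intro: uniform_limit_const bounded_subset[of "{1}"])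
next
  case (insert j J)
  have "bounded ((\<lambda>x. l j x * (\<Prod>j\<in>J. l j x)) ` S)"
  proof -
    obtain a where a: "\<And>x. x \<in> S \<Longrightarrow> norm (l j x) \<le> a"
      using insert.prems(2)[of j] by (auto simp: bounded_iff)
    obtain c where c: "\<And>x. x \<in> S \<Longrightarrow> norm (\<Prod>j\<in>J. l j x) \<le> c"
      using insert.IH insert.prems unfolding bounded_iff by (metis image_eqI insert_iff)
    have "norm (l j x * (\<Prod>j\<in>J. l j x)) \<le> \<bar>a\<bar> * \<bar>c\<bar>" if "x \<in> S" for x
      unfolding norm_mult using a[OF that] c[OF that] by (intro mult_mono) auto
    then show ?thesis by (auto simp: bounded_iff)
  qed
  then show ?case
    using insert by (auto intro!: uniform_lim_mult)
qed

lemma circle_integral_cmult: "circle_integral z R (\<lambda>x. c * f x) = c * circle_integral z R f"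
proof -
  have "(\<lambda>t. c * f (z + R * cis (2 * pi * t)) * (2 * pi * \<i> * R * cis (2 * pi * t))) =
      (\<lambda>t. c * (f (z + R * cis (2 * pi * t)) * (2 * pi * \<i> * R * cis (2 * pi * t))))"
    by (simp add: mult.assoc)
  then show ?thesis unfolding circle_integral_param by (simp only: integral_mult_right)
qed

lemma norm_circle_integral_le:
  assumes "continuous_on (sphere z R) f" "0 < R" "\<And>x. x \<in> sphere z R \<Longrightarrow> norm (f x) \<le> B" "0 \<le> B"
  shows "norm (circle_integral z R f) \<le> B * (2 * pi * R)"
proof (rule has_contour_integral_bound_circlepath[OF has_contour_integral_integral])
  show "f contour_integrable_on circlepath z R"
    by (rule contour_integrable_continuous_circlepath) (use assms in simp)
qed (use assms in \<open>auto simp: dist_norm norm_minus_commute\<close>)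

lemma uniform_limit_of_tendsto:
  assumes "(a \<longlongrightarrow> l) F"
  shows "uniform_limit S (\<lambda>n x. a n) (\<lambda>x. l) F"
  unfolding uniform_limit_iff
proof (intro allI impI)
  fix e :: real assume "0 < e"
  from tendstoD[OF assms this] show "\<forall>\<^sub>F n in F. \<forall>x\<in>S. dist (a n) l < e"
    by eventually_elim auto
qed

lemma uniform_limit_bounded_eventually:
  fixes f :: "nat \<Rightarrow> 'a \<Rightarrow> complex"
  assumes "uniform_limit S f l F" "\<And>x. x \<in> S \<Longrightarrow> norm (l x) \<le> B"
  shows "\<forall>\<^sub>F n in F. \<forall>x\<in>S. norm (f n x) \<le> B + 1"
  using uniform_limitD[OF assms(1) zero_less_one]
proof (eventually_elim, intro ballI)
  fix n x assume "\<forall>x\<in>S. dist (f n x) (l x) < 1" "x \<in> S"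
  then show "norm (f n x) \<le> B + 1"
    using assms(2)[of x] norm_triangle_sub[of "f n x" "l x"] by (fastforce simp: dist_norm)
qed

text \<open>\<open>p n j\<close> is the inverse of the zero of the \<open>j\<close>-th factor. For
  \<open>j \<in> T\<close> it tends to 1 with error \<open>o(\<epsilon>)\<close>, so the
  displacement is invisible in the local variable; the other zeros tend to
  \<open>1 / \<kappa>\<close>. The condition \<open>\<beta> * \<kappa> < 1\<close> places this point
  beyond all the points \<open>b\<close>.\<close>

locale edge_data = edge_limit +
  fixes p :: "nat \<Rightarrow> nat \<Rightarrow> real" and T :: "nat set" and \<kappa> :: real
  assumes p_pos: "0 < p n j"
    and p_near: "j \<in> T \<Longrightarrow> (\<lambda>n. (p n j - 1) / \<epsilon> n) \<longlonglongrightarrow> 0"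
    and p_far: "j \<notin> T \<Longrightarrow> (\<lambda>n. p n j) \<longlonglongrightarrow> \<kappa>"
    and kappa: "0 < \<kappa>" "\<kappa> \<noteq> 1" "\<beta> * \<kappa> < 1"
begin

definition near_count :: "nat \<Rightarrow> nat" where
  "near_count s = card {j. j < s \<and> j \<in> T}"

text \<open>The scale of \<open>P_prod\<close> at \<open>1 + \<epsilon> * \<zeta>\<close>: a factor
  from \<open>T\<close> is asymptotically \<open>- \<epsilon> * \<zeta>\<close>, and any other one
  tends to \<open>1 - \<kappa>\<close>. These constants belong to one diagonal each and are
  therefore absorbed by conjugation.\<close>

definition nu :: "nat \<Rightarrow> nat \<Rightarrow> complex" where
  "nu s n = (\<Prod>j<s. if j \<in> T then - of_real (\<epsilon> n) else of_real (1 - \<kappa>))"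

definition P_local :: "nat \<Rightarrow> nat \<Rightarrow> complex \<Rightarrow> complex" where
  "P_local s n \<zeta> = P_prod (p n) s (1 + of_real (\<epsilon> n) * \<zeta>) / nu s n"

lemma nu_nonzero: "nu s n \<noteq> 0"
proof -
  have "complex_of_real (1 - \<kappa>) \<noteq> 0" using kappa by (metis eq_iff_diff_eq_0 of_real_eq_0_iff)
  then show ?thesis using eps_pos[of n] by (simp add: nu_def del: of_real_diff)
qed

lemma p_lim: "j \<in> T \<Longrightarrow> (\<lambda>n. p n j) \<longlonglongrightarrow> 1"
proof -
  assume j: "j \<in> T"
  have "(\<lambda>n. \<epsilon> n * ((p n j - 1) / \<epsilon> n) + 1) \<longlonglongrightarrow> 0 * 0 + 1"
    by (intro tendsto_intros eps_lim p_near[OF j])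
  moreover have "\<epsilon> n * ((p n j - 1) / \<epsilon> n) + 1 = p n j" for n using eps_pos[of n] by simp
  ultimately show ?thesis by simp
qed

lemma P_local_prod:
  "P_local s n \<zeta> = (\<Prod>j<s. if j \<in> T then of_real ((p n j - 1) / \<epsilon> n) + \<zeta> * of_real (p n j)
     else (1 - (1 + of_real (\<epsilon> n) * \<zeta>) * of_real (p n j)) / of_real (1 - \<kappa>))"
  unfolding P_local_def P_prod_def nu_def prod_dividef[symmetric]
proof (intro prod.cong refl)
  fix j
  have "complex_of_real (\<epsilon> n) \<noteq> 0" using eps_pos[of n] by simp
  then show "(1 - (1 + complex_of_real (\<epsilon> n) * \<zeta>) * complex_of_real (p n j)) / (if j \<in> T then - complex_of_real (\<epsilon> n) else complex_of_real (1 - \<kappa>)) =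
    (if j \<in> T then of_real ((p n j - 1) / \<epsilon> n) + \<zeta> * of_real (p n j)
     else (1 - (1 + of_real (\<epsilon> n) * \<zeta>) * of_real (p n j)) / of_real (1 - \<kappa>))"
    by (simp add: field_simps)
qed

text \<open>After division by its scale a factor from \<open>T\<close> is
  \<open>(p - 1) / \<epsilon> + \<zeta> * p\<close>, which tends to \<open>\<zeta>\<close>; the
  others tend to 1.\<close>

lemma uniform_limit_P_local:
  "uniform_limit (cball 0 M) (P_local s) (\<lambda>\<zeta>. \<zeta> ^ near_count s) sequentially"
proof -
  define f where "f = (\<lambda>j n (\<zeta>::complex). if j \<in> T then of_real ((p n j - 1) / \<epsilon> n) + \<zeta> * of_real (p n j)
     else (1 - (1 + of_real (\<epsilon> n) * \<zeta>) * of_real (p n j)) / of_real (1 - \<kappa>))"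
  define l where "l = (\<lambda>j (\<zeta>::complex). if j \<in> T then \<zeta> else 1)"
  have "uniform_limit (cball 0 M) (\<lambda>n \<zeta>. \<Prod>j<s. f j n \<zeta>) (\<lambda>\<zeta>. \<Prod>j<s. l j \<zeta>) sequentially"
  proof (rule uniform_limit_prod[where f = f and l = l, THEN conjunct1])
    fix j
    have bz: "bounded ((\<lambda>\<zeta>. \<zeta>) ` cball (0::complex) M)" by simp
    have bc: "bounded ((\<lambda>x. c) ` cball (0::complex) M)" for c :: complex
      by (rule bounded_subset[of "{c}"]) auto
    show "bounded (l j ` cball (0::complex) M)" using bz bc[of 1] by (cases "j \<in> T") (simp_all add: l_def[abs_def])
    show "uniform_limit (cball 0 M) (f j) (l j) sequentially"
    proof (cases "j \<in> T")
      case True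
      have "uniform_limit (cball 0 M) (\<lambda>n \<zeta>::complex. of_real ((p n j - 1) / \<epsilon> n) + \<zeta> * of_real (p n j)) (\<lambda>\<zeta>. of_real 0 + \<zeta> * of_real 1) sequentially"
        by (intro uniform_limit_add uniform_lim_mult uniform_limit_of_tendsto tendsto_of_real p_near p_lim True bz bc uniform_limit_of_tendsto)
           (auto simp: uniform_limit_iff)
      then show ?thesis using True by (simp add: f_def[abs_def] l_def[abs_def])
    next
      case False
      have "(\<lambda>n. (1 - complex_of_real (p n j)) / of_real (1 - \<kappa>)) \<longlonglongrightarrow> (1 - of_real \<kappa>) / of_real (1 - \<kappa>)"
        using kappa(2) by (intro tendsto_intros p_far False) (auto simp del: of_real_diff)
      then have 1: "(\<lambda>n. (1 - complex_of_real (p n j)) / of_real (1 - \<kappa>)) \<longlonglongrightarrow> 1"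
      proof -
        have "complex_of_real (1 - \<kappa>) \<noteq> 0" using kappa(2) by (metis eq_iff_diff_eq_0 of_real_eq_0_iff)
        moreover have "1 - complex_of_real \<kappa> = of_real (1 - \<kappa>)" by simp
        ultimately show ?thesis
          using \<open>(\<lambda>n. (1 - complex_of_real (p n j)) / of_real (1 - \<kappa>)) \<longlonglongrightarrow> (1 - of_real \<kappa>) / of_real (1 - \<kappa>)\<close>
          by (metis divide_self)
      qed
      have "(\<lambda>n. - (complex_of_real (\<epsilon> n) * of_real (p n j) / of_real (1 - \<kappa>))) \<longlonglongrightarrow> - (of_real 0 * of_real \<kappa> / of_real (1 - \<kappa>))"
        using kappa(2) by (intro tendsto_intros p_far eps_lim False) (auto simp del: of_real_diff)
      then have 2: "(\<lambda>n. - (complex_of_real (\<epsilon> n) * of_real (p n j) / of_real (1 - \<kappa>))) \<longlonglongrightarrow> 0" by simp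
      have "uniform_limit (cball 0 M) (\<lambda>n \<zeta>. (1 - complex_of_real (p n j)) / of_real (1 - \<kappa>) + \<zeta> * (- (complex_of_real (\<epsilon> n) * of_real (p n j) / of_real (1 - \<kappa>))))
          (\<lambda>\<zeta>. 1 + \<zeta> * 0) sequentially"
        by (intro uniform_limit_add uniform_lim_mult uniform_limit_of_tendsto 1 2 bz bc) (auto simp: uniform_limit_iff)
      moreover have "(1 - (1 + e * x) * a) / c = (1 - a) / c + x * (- (e * a / c))" for e x a c :: complex
        by (simp add: divide_inverse algebra_simps)
      then have "f j = (\<lambda>n \<zeta>. (1 - complex_of_real (p n j)) / of_real (1 - \<kappa>) + \<zeta> * (- (complex_of_real (\<epsilon> n) * of_real (p n j) / of_real (1 - \<kappa>))))"
        using False by (intro ext) (simp only: f_def if_False)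
      ultimately show ?thesis using False by (simp add: l_def[abs_def])
    qed
  qed simp
  moreover have "(\<Prod>j<s. l j \<zeta>) = \<zeta> ^ near_count s" for \<zeta> :: complex
    by (simp add: l_def prod.If_cases near_count_def Int_def)
  ultimately show ?thesis by (simp add: P_local_prod[abs_def] f_def)
qed

lemma uniform_limit_quotient:
  assumes "scaled_height H y"
  shows "uniform_limit (sphere 0 1) (\<lambda>n \<zeta>. N_local H n \<zeta> / P_local s n \<zeta>)
    (\<lambda>\<zeta>. exp (of_real (\<sigma> / 2) * \<zeta>\<^sup>2 - of_real y * \<zeta>) / \<zeta> ^ near_count s) sequentially"
proof (rule uniform_lim_divide[where b = 1])
  have "compact ((\<lambda>\<zeta>. exp (of_real (\<sigma> / 2) * \<zeta>\<^sup>2 - of_real y * \<zeta>)) ` sphere (0::complex) 1)"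
    by (intro compact_continuous_image continuous_intros) auto
  then show "bounded ((\<lambda>\<zeta>. exp (of_real (\<sigma> / 2) * \<zeta>\<^sup>2 - of_real y * \<zeta>)) ` sphere (0::complex) 1)"
    by (rule compact_imp_bounded)
  show "uniform_limit (sphere 0 1) (N_local H) (\<lambda>\<zeta>. exp (of_real (\<sigma> / 2) * \<zeta>\<^sup>2 - of_real y * \<zeta>)) sequentially"
    using uniform_limit_on_subset[OF uniform_limit_N_local[OF assms, of 1]] by (simp add: subset_iff)
  show "uniform_limit (sphere 0 1) (P_local s) (\<lambda>\<zeta>. \<zeta> ^ near_count s) sequentially"
    using uniform_limit_on_subset[OF uniform_limit_P_local[where M = 1]] by (simp add: subset_iff)
qed (auto simp: norm_power)

text \<open>The local coordinate of the point with angle \<open>\<epsilon> * y\<close> on the circle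
  of radius \<open>1 - 2 * \<epsilon>\<close>. It tends to \<open>-2 + \<i> * y\<close>; the radius
  is chosen to produce the line \<open>Re \<omega> = -2\<close> of the limiting kernel.\<close>

definition omega :: "nat \<Rightarrow> real \<Rightarrow> complex" where
  "omega n y = (of_real (1 - 2 * \<epsilon> n) * cis (\<epsilon> n * y) - 1) / of_real (\<epsilon> n)"

lemma one_plus_omega: "1 + of_real (\<epsilon> n) * omega n y = of_real (1 - 2 * \<epsilon> n) * cis (\<epsilon> n * y)"
  using eps_pos[of n] by (simp add: omega_def)

lemma omega_lim: "(\<lambda>n. omega n y) \<longlonglongrightarrow> Complex (- 2) y"
proof -
  have "((\<lambda>t. exp (\<i> * of_real y * t)) has_field_derivative \<i> * of_real y) (at 0)"
    by (auto intro!: derivative_eq_intros)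
  then have "((\<lambda>t. (exp (\<i> * of_real y * t) - 1) / t) \<longlongrightarrow> \<i> * of_real y) (at 0)"
    by (simp add: has_field_derivative_iff)
  moreover have "filterlim (\<lambda>n. complex_of_real (\<epsilon> n)) (at 0) sequentially"
    using eps_pos tendsto_of_real[OF eps_lim, where 'a = complex]
    by (auto simp: filterlim_at less_imp_neq[OF eps_pos, symmetric])
  ultimately have 1: "(\<lambda>n. (exp (\<i> * of_real y * of_real (\<epsilon> n)) - 1) / of_real (\<epsilon> n)) \<longlonglongrightarrow> \<i> * of_real y"
    by (rule filterlim_compose)
  have "(\<lambda>n. cis (\<epsilon> n * y)) \<longlonglongrightarrow> cis (0 * y)"
    unfolding cis_conv_exp by (intro tendsto_intros eps_lim)
  then have "(\<lambda>n. (exp (\<i> * of_real y * of_real (\<epsilon> n)) - 1) / of_real (\<epsilon> n) - 2 * cis (\<epsilon> n * y)) \<longlonglongrightarrow> \<i> * of_real y - 2 * cis (0 * y)"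
    by (intro tendsto_diff tendsto_mult tendsto_const 1)
  moreover have "(exp (\<i> * of_real y * of_real (\<epsilon> n)) - 1) / of_real (\<epsilon> n) - 2 * cis (\<epsilon> n * y) = omega n y" for n
    using eps_pos[of n] by (simp add: omega_def cis_conv_exp field_simps)
  moreover have "\<i> * of_real y - 2 * cis (0 * y) = Complex (- 2) y" by (simp add: complex_eq_iff)
  ultimately show ?thesis by simp
qed

lemma norm_omega_le: "norm (omega n y) \<le> 2 + \<bar>y\<bar>"
proof -
  have "norm (cis (\<epsilon> n * y) - 1) = 2 * \<bar>sin (\<epsilon> n * y / 2)\<bar>"
    using dist_exp_i_1[of "\<epsilon> n * y"] by (simp add: cis_conv_exp)
  also have "\<dots> \<le> \<epsilon> n * \<bar>y\<bar>"
    using abs_sin_x_le_abs_x[of "\<epsilon> n * y / 2"] eps_pos[of n] by (simp add: abs_mult)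
  finally have 1: "norm (cis (\<epsilon> n * y) - 1) \<le> \<epsilon> n * \<bar>y\<bar>" .
  have eq: "of_real (1 - 2 * \<epsilon> n) * cis (\<epsilon> n * y) - 1 = (cis (\<epsilon> n * y) - 1) - of_real (2 * \<epsilon> n) * cis (\<epsilon> n * y)"
    by (simp add: algebra_simps)
  have "norm (of_real (2 * \<epsilon> n) * cis (\<epsilon> n * y)) = 2 * \<epsilon> n"
    using eps_pos[of n] by (simp add: norm_mult)
  then have "norm (of_real (1 - 2 * \<epsilon> n) * cis (\<epsilon> n * y) - 1) \<le> \<epsilon> n * \<bar>y\<bar> + 2 * \<epsilon> n"
    unfolding eq using norm_triangle_ineq4[of "cis (\<epsilon> n * y) - 1" "of_real (2 * \<epsilon> n) * cis (\<epsilon> n * y)"] 1 by linarith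
  also have "\<dots> = \<epsilon> n * (2 + \<bar>y\<bar>)" by (simp add: algebra_simps)
  finally show ?thesis
    using eps_pos[of n] by (simp add: omega_def norm_divide divide_le_eq mult.commute)
qed

lemma eventually_small: "0 < c \<Longrightarrow> \<forall>\<^sub>F n in sequentially. \<epsilon> n < c"
  by (rule order_tendstoD(2)[OF eps_lim])

lemma N_local_omega_lim:
  assumes "scaled_height H y'"
  shows "(\<lambda>n. N_local H n (omega n y)) \<longlonglongrightarrow> exp (of_real (\<sigma> / 2) * (Complex (- 2) y)\<^sup>2 - of_real y' * Complex (- 2) y)"
proof -
  have "isCont (\<lambda>\<zeta>. exp (of_real (\<sigma> / 2) * \<zeta>\<^sup>2 - of_real y' * \<zeta>)) (Complex (- 2) y)"
    by (intro continuous_intros)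
  then show ?thesis
    using tendsto_uniform_limit_compose[OF uniform_limit_N_local[OF assms, of "2 + \<bar>y\<bar>"] _ omega_lim[of y]]
    by (simp add: norm_omega_le)
qed

lemma P_local_omega_lim: "(\<lambda>n. P_local s n (omega n y)) \<longlonglongrightarrow> Complex (- 2) y ^ near_count s"
proof -
  have "isCont (\<lambda>\<zeta>. \<zeta> ^ near_count s) (Complex (- 2) y)"
    by (intro continuous_intros)
  then show ?thesis
    using tendsto_uniform_limit_compose[OF uniform_limit_P_local[where M = "2 + \<bar>y\<bar>"] _ omega_lim[of y]]
    by (simp add: norm_omega_le)
qed

text \<open>The power of the variable has constant modulus on the circle, so relative to
  \<open>y = 0\<close> the size is that of \<open>N_prod\<close> alone, which has a Gaussian bound.
  At \<open>y = 0\<close> the value converges to a nonzero limit.\<close>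

lemma N_local_omega_bound:
  assumes "scaled_height H y'"
  shows "\<exists>B c. 0 < c \<and> 0 < B \<and> (\<forall>\<^sub>F n in sequentially. \<forall>y. \<bar>y\<bar> \<le> pi / \<epsilon> n \<longrightarrow>
    norm (inverse (N_local H n (omega n y))) \<le> B * exp (- (c * y\<^sup>2)))"
proof -
  obtain c where c: "0 < c" "\<forall>\<^sub>F n in sequentially. c \<le> (\<epsilon> n)\<^sup>2 * (\<Sum>m\<in>I n. b n m)"
    using sum_b_lower by blast
  define l where "l = exp (of_real (\<sigma> / 2) * (Complex (- 2) 0)\<^sup>2 - of_real y' * Complex (- 2) 0)"
  have "(\<lambda>n. inverse (N_local H n (omega n 0))) \<longlonglongrightarrow> inverse l"
    unfolding l_def by (intro tendsto_inverse N_local_omega_lim assms) simp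
  then have ev: "\<forall>\<^sub>F n in sequentially. norm (inverse (N_local H n (omega n 0))) < norm (inverse l) + 1"
    by (intro order_tendstoD(2)[OF tendsto_norm]) auto
  have ev2: "\<forall>\<^sub>F n in sequentially. \<epsilon> n < (1 - \<beta>) / 2"
    by (rule eventually_small) (use beta in simp)
  have "\<forall>\<^sub>F n in sequentially. \<forall>y. \<bar>y\<bar> \<le> pi / \<epsilon> n \<longrightarrow>
    norm (inverse (N_local H n (omega n y))) \<le> (norm (inverse l) + 1) * exp (- (c / 40 * y\<^sup>2))"
    using c(2) ev ev2
  proof eventually_elim
    case (elim n)
    have e: "\<epsilon> n < (1 - \<beta>) / 2" by (rule elim(3))
    define \<rho> where "\<rho> = 1 - 2 * \<epsilon> n"
    have \<rho>: "\<beta> < \<rho>" "\<rho> \<le> 1" "0 < \<rho>" using e eps_pos[of n] beta by (simp_all add: \<rho>_def)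
    show ?case
    proof (intro allI impI)
      fix y assume y: "\<bar>y\<bar> \<le> pi / \<epsilon> n"
      define N where "N = N_prod (I n) (b n)"
      have "1 + of_real (\<epsilon> n) * omega n 0 = of_real \<rho>" using one_plus_omega[of n 0] by (simp add: \<rho>_def)
      have nz: "N (of_real \<rho> * cis t) \<noteq> 0" for t
        unfolding N_def
      proof (rule N_prod_nonzero_norm[OF finite_I])
        show "\<bar>b n m\<bar> < norm (of_real \<rho> * cis t)" if "m \<in> I n" for m
          using b_nonneg[OF that] b_le[OF that] \<rho> by (simp add: norm_mult)
      qed (use \<rho> in \<open>simp add: norm_mult\<close>)
      have N1: "N 1 \<noteq> 0"
        unfolding N_def
      proof (rule N_prod_nonzero_norm[OF finite_I])
        show "\<bar>b n m\<bar> < norm (1::complex)" if "m \<in> I n" for m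
          using b_nonneg[OF that] b_le[OF that] beta by simp
      qed simp
      define W where "W = of_real \<rho> * cis (\<epsilon> n * y)"
      have w0: "N_local H n (omega n 0) = N (of_real \<rho>) / N 1 * of_real \<rho> powi (- H n)"
        unfolding N_local_def one_plus_omega N_def[symmetric] \<rho>_def[symmetric] by simp
      have w: "N_local H n (omega n y) = N W / N 1 * W powi (- H n)"
        unfolding N_local_def one_plus_omega N_def[symmetric] \<rho>_def[symmetric] W_def by simp
      have nW: "norm (W powi (- H n)) = norm ((of_real \<rho> :: complex) powi (- H n))"
        using \<rho> by (simp add: W_def norm_power_int norm_mult)
      have W0: "W \<noteq> 0" "complex_of_real \<rho> \<noteq> 0" using \<rho> by (simp_all add: W_def)
      have NW: "N W \<noteq> 0" "N (of_real \<rho>) \<noteq> 0" using nz[of "\<epsilon> n * y"] nz[of 0] by (simp_all add: W_def)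
      have "norm (inverse (N_local H n (omega n y))) = norm (inverse (N_local H n (omega n 0))) * norm (N (of_real \<rho>) / N W)"
        unfolding w w0 norm_mult norm_divide norm_inverse nW using NW N1 W0 by (simp add: field_simps)
      also have "\<dots> \<le> (norm (inverse l) + 1) * exp (- (c / 40 * y\<^sup>2))"
      proof (rule mult_mono)
        have "norm (N (of_real \<rho>) / N W) \<le> exp (- ((\<epsilon> n * y)\<^sup>2 / 40 * (\<Sum>m\<in>I n. b n m)))"
          unfolding N_def W_def
        proof (rule N_prod_circle_bound)
          show "b n m < \<rho>" if "m \<in> I n" for m using b_le[OF that] \<rho> by simp
          show "\<bar>\<epsilon> n * y\<bar> \<le> pi" using y eps_pos[of n] by (simp add: abs_mult field_simps)
        qed (use finite_I b_nonneg \<rho> in auto)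
        also have "\<dots> \<le> exp (- (c / 40 * y\<^sup>2))"
        proof -
          have "c * (y\<^sup>2 / 40) \<le> (\<epsilon> n)\<^sup>2 * (\<Sum>m\<in>I n. b n m) * (y\<^sup>2 / 40)" using elim(1) by (intro mult_right_mono) auto
          then show ?thesis by (simp add: power_mult_distrib mult_ac)
        qed
        finally show "norm (N (of_real \<rho>) / N W) \<le> exp (- (c / 40 * y\<^sup>2))" .
      qed (use elim(2) in auto)
      finally show "norm (inverse (N_local H n (omega n y))) \<le> (norm (inverse l) + 1) * exp (- (c / 40 * y\<^sup>2))" .
    qed
  qed
  then show ?thesis
    using c(1) by (intro exI[of _ "norm (inverse l) + 1"] exI[of _ "c / 40"]) (auto intro: add_nonneg_pos)
qed

text \<open>A factor from \<open>T\<close> is eventually at most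
  \<open>1 + 2 * (2 + \<bar>y\<bar>)\<close>, whence \<open>5 + 2 * \<bar>y\<bar>\<close>; the other
  factors are bounded because the circle stays inside the unit disk.\<close>

lemma P_local_omega_bound:
  "\<exists>B. 0 < B \<and> (\<forall>\<^sub>F n in sequentially. \<forall>y. norm (P_local s n (omega n y)) \<le> B * (5 + 2 * \<bar>y\<bar>) ^ s)"
proof -
  define B where "B = 1 + (2 + \<kappa>) / \<bar>1 - \<kappa>\<bar>"
  have B1: "1 \<le> B" using kappa by (simp add: B_def)
  have "\<forall>\<^sub>F n in sequentially. if j \<in> T then \<bar>(p n j - 1) / \<epsilon> n\<bar> < 1 \<and> p n j < 2 else p n j < \<kappa> + 1" for j
  proof (cases "j \<in> T")
    case True
    have "\<forall>\<^sub>F n in sequentially. \<bar>(p n j - 1) / \<epsilon> n\<bar> < 1"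
      using tendsto_rabs_zero[OF p_near[OF True]] by (rule order_tendstoD(2)) simp
    moreover have "\<forall>\<^sub>F n in sequentially. p n j < 2"
      using p_lim[OF True] by (rule order_tendstoD(2)) simp
    ultimately show ?thesis by eventually_elim (use True in auto)
  next
    case False
    have "\<forall>\<^sub>F n in sequentially. p n j < \<kappa> + 1"
      using p_far[OF False] by (rule order_tendstoD(2)) simp
    then show ?thesis by eventually_elim (use False in auto)
  qed
  then have "\<forall>\<^sub>F n in sequentially. \<forall>j\<in>{..<s}. if j \<in> T then \<bar>(p n j - 1) / \<epsilon> n\<bar> < 1 \<and> p n j < 2 else p n j < \<kappa> + 1"
    by (intro eventually_ball_finite) auto
  then have "\<forall>\<^sub>F n in sequentially. \<forall>y. norm (P_local s n (omega n y)) \<le> B ^ s * (5 + 2 * \<bar>y\<bar>) ^ s"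
    using eventually_small[OF half_gt_zero[OF zero_less_one]]
  proof (eventually_elim, intro allI)
    fix n and y :: real
    assume el: "\<forall>j\<in>{..<s}. if j \<in> T then \<bar>(p n j - 1) / \<epsilon> n\<bar> < 1 \<and> p n j < 2 else p n j < \<kappa> + 1" and e: "\<epsilon> n < 1 / 2"
    have "norm (P_local s n (omega n y)) \<le> (\<Prod>j<s. B * (5 + 2 * \<bar>y\<bar>))"
      unfolding P_local_prod prod_norm[symmetric]
    proof (rule prod_mono, intro conjI)
      fix j assume "j \<in> {..<s}"
      then have j: "if j \<in> T then \<bar>(p n j - 1) / \<epsilon> n\<bar> < 1 \<and> p n j < 2 else p n j < \<kappa> + 1" using el by blast
      show "norm (if j \<in> T then of_real ((p n j - 1) / \<epsilon> n) + omega n y * of_real (p n j)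
         else (1 - (1 + of_real (\<epsilon> n) * omega n y) * of_real (p n j)) / of_real (1 - \<kappa>)) \<le> B * (5 + 2 * \<bar>y\<bar>)"
      proof (cases "j \<in> T")
        case True
        have "norm (of_real ((p n j - 1) / \<epsilon> n) + omega n y * of_real (p n j)) \<le> \<bar>(p n j - 1) / \<epsilon> n\<bar> + norm (omega n y) * p n j"
          using norm_triangle_ineq[of "of_real ((p n j - 1) / \<epsilon> n)" "omega n y * of_real (p n j)"] p_pos[of n j]
          by (simp add: norm_mult del: of_real_divide of_real_diff)
        also have "norm (omega n y) * p n j \<le> (2 + \<bar>y\<bar>) * 2"
          using norm_omega_le[of n y] j True p_pos[of n j] by (intro mult_mono) auto
        also have "\<bar>(p n j - 1) / \<epsilon> n\<bar> + (2 + \<bar>y\<bar>) * 2 \<le> 1 * (5 + 2 * \<bar>y\<bar>)" using j True by simp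
        also have "\<dots> \<le> B * (5 + 2 * \<bar>y\<bar>)" using B1 by (intro mult_right_mono) auto
        finally show ?thesis using True by simp
      next
        case False
        have "norm (1 - (1 + of_real (\<epsilon> n) * omega n y) * of_real (p n j)) \<le> 1 + (1 - 2 * \<epsilon> n) * p n j"
          unfolding one_plus_omega
          using norm_triangle_ineq4[of 1 "of_real (1 - 2 * \<epsilon> n) * cis (\<epsilon> n * y) * of_real (p n j)"] p_pos[of n j] e
          by (simp add: norm_mult del: of_real_diff)
        also have "\<dots> \<le> 1 + 1 * (\<kappa> + 1)"
          using j False p_pos[of n j] e eps_pos[of n] by (intro add_left_mono mult_mono) auto
        finally have "norm ((1 - (1 + of_real (\<epsilon> n) * omega n y) * of_real (p n j)) / of_real (1 - \<kappa>)) \<le> (2 + \<kappa>) / \<bar>1 - \<kappa>\<bar>"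
          unfolding norm_divide norm_of_real by (intro divide_right_mono) auto
        also have "\<dots> \<le> B * 1" by (simp add: B_def)
        also have "\<dots> \<le> B * (5 + 2 * \<bar>y\<bar>)" using B1 by (intro mult_left_mono) auto
        finally show ?thesis using False by simp
      qed
    qed simp
    then show "norm (P_local s n (omega n y)) \<le> B ^ s * (5 + 2 * \<bar>y\<bar>) ^ s" by (simp add: power_mult_distrib)
  qed
  then show ?thesis using B1 by (intro exI[of _ "B ^ s"]) auto
qed

end

section \<open>Dominated convergence of the integral around the critical point\<close>

context edge_data
begin

lemma N_one_nonzero: "N_prod (I n) (b n) 1 \<noteq> 0"
proof (rule N_prod_nonzero_norm[OF finite_I])
  show "\<bar>b n m\<bar> < norm (1::complex)" if "m \<in> I n" for m
    using b_nonneg[OF that] b_le[OF that] beta by simp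
qed simp

text \<open>The factors depending on \<open>\<omega>\<close> alone are collected in front, so that
  the integral over \<open>\<zeta>\<close> can be taken first; the value of \<open>N_prod\<close> at
  1 cancels between the two variables.\<close>

lemma edge_integrand_local:
  fixes \<zeta> \<omega> :: complex
  assumes "1 + of_real (\<epsilon> n) * \<omega> \<noteq> 0"
  shows "edge_integrand (I n) (b n) (p n) s1 s2 (H1 n) (H2 n) (1 + of_real (\<epsilon> n) * \<zeta>) (1 + of_real (\<epsilon> n) * \<omega>) =
    (P_local s2 n \<omega> / N_local H2 n \<omega> * (nu s2 n / nu s1 n) * (1 / of_real (\<epsilon> n)) * (1 / (1 + of_real (\<epsilon> n) * \<omega>))) *
    (N_local H1 n \<zeta> / P_local s1 n \<zeta> * (1 / (\<zeta> - \<omega>)))"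
proof -
  have main: "A / B * (P2 / P1) * (1 / (z - w)) * X * w powi (h - 1) =
      P2 / v2 / (B / N1 * w powi (- h)) * (v2 / v1) * (1 / e) * (1 / w) * (A / N1 * X / (P1 / v1) * (1 / D))"
    if "v1 \<noteq> 0" "v2 \<noteq> 0" "N1 \<noteq> 0" "e \<noteq> 0" "w \<noteq> 0" "z - w = e * D"
    for A B P1 P2 D X v1 v2 z w e N1 :: complex and h
  proof -
    have pw: "w powi (h - 1) = inverse (w powi (- h)) * inverse w"
      using that by (simp add: power_int_diff power_int_minus divide_inverse)
    \<comment> \<open>Each cancelling pair is kept as a product \<open>inverse v * v\<close>, so
      that both sides agree up to the order of the factors.\<close>
    have "P2 / v2 / (B / N1 * w powi (- h)) * (v2 / v1) * (1 / e) * (1 / w) * (A / N1 * X / (P1 / v1) * (1 / D)) =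
        A / B * (P2 / P1) * (1 / (e * D)) * X * (inverse (w powi (- h)) * inverse w) * (inverse v2 * v2) * (inverse v1 * v1) * (inverse N1 * N1)"
      by (simp only: divide_inverse inverse_mult_distrib inverse_inverse_eq mult_1_left mult_ac)
    then show ?thesis using that pw by simp
  qed
  show ?thesis
    unfolding edge_integrand_def N_local_def P_local_def
    by (rule main[OF nu_nonzero nu_nonzero N_one_nonzero _ assms]) (use eps_pos[of n] in \<open>simp_all add: algebra_simps\<close>)
qed

text \<open>\<open>\<epsilon> < 1 / 4\<close> keeps \<open>w\<close> away from 0,
  \<open>\<epsilon> < (1 - \<beta>) / 2\<close> keeps the points \<open>b\<close> inside the circle
  of \<open>w\<close>, and the last condition keeps the circle of radius \<open>\<epsilon>\<close>
  about 1 off the zeros of \<open>P_prod\<close>.\<close>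

definition good :: "nat \<Rightarrow> nat \<Rightarrow> bool" where
  "good s n \<longleftrightarrow> \<epsilon> n < 1 / 4 \<and> \<epsilon> n < (1 - \<beta>) / 2 \<and> (\<forall>\<zeta>\<in>sphere 0 1. P_local s n \<zeta> \<noteq> 0)"

lemma eventually_good: "\<forall>\<^sub>F n in sequentially. good s n"
proof -
  have "uniform_limit (sphere 0 1) (P_local s) (\<lambda>\<zeta>. \<zeta> ^ near_count s) sequentially"
    using uniform_limit_on_subset[OF uniform_limit_P_local[where M = 1]] by (simp add: subset_iff)
  from uniform_limitD[OF this zero_less_one]
  have "\<forall>\<^sub>F n in sequentially. \<forall>\<zeta>\<in>sphere 0 1. P_local s n \<zeta> \<noteq> 0"
    by eventually_elim (force simp: dist_norm norm_power)
  moreover have "\<forall>\<^sub>F n in sequentially. \<epsilon> n < 1 / 4" by (rule eventually_small) simp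
  moreover have "\<forall>\<^sub>F n in sequentially. \<epsilon> n < (1 - \<beta>) / 2" by (rule eventually_small) (use beta in simp)
  ultimately show ?thesis unfolding good_def by eventually_elim simp
qed

lemma good_circles:
  assumes "good s n" "dist 1 z = \<epsilon> n" "norm w = 1 - 2 * \<epsilon> n"
  shows "z \<noteq> 0" "P_prod (p n) s z \<noteq> 0" "w \<noteq> 0" "\<epsilon> n \<le> norm (z - w)" "m \<in> I n \<Longrightarrow> \<bar>b n m\<bar> < norm w"
proof -
  have e: "\<epsilon> n < 1 / 4" "\<epsilon> n < (1 - \<beta>) / 2" using assms(1) by (auto simp: good_def)
  have nz: "1 - \<epsilon> n \<le> norm z" using norm_triangle_ineq2[of 1 "1 - z"] assms(2) by (simp add: dist_norm)
  then show "z \<noteq> 0" using e by auto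
  show "w \<noteq> 0" using assms(3) e by auto
  show "\<epsilon> n \<le> norm (z - w)" using norm_triangle_ineq2[of z w] nz assms(3) by linarith
  show "\<bar>b n m\<bar> < norm w" if "m \<in> I n" using b_nonneg[OF that] b_le[OF that] assms(3) e by simp
  define \<zeta> where "\<zeta> = (z - 1) / of_real (\<epsilon> n)"
  have "norm \<zeta> = 1" using assms(2) eps_pos[of n] by (simp add: \<zeta>_def norm_divide dist_norm norm_minus_commute)
  then have "P_local s n \<zeta> \<noteq> 0" using assms(1) by (simp add: good_def)
  moreover have "1 + of_real (\<epsilon> n) * \<zeta> = z" using eps_pos[of n] by (simp add: \<zeta>_def)
  ultimately show "P_prod (p n) s z \<noteq> 0" by (auto simp: P_local_def)
qed

lemma good_integrand_continuous:
  assumes "good s1 n"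
  shows "continuous_on (sphere 1 (\<epsilon> n) \<times> sphere 0 (1 - 2 * \<epsilon> n)) (\<lambda>(z, w). edge_integrand (I n) (b n) (p n) s1 s2 h1 h2 z w)"
proof (rule continuous_on_edge_integrand[OF finite_I p_pos])
  fix z w :: complex assume zw: "z \<in> sphere 1 (\<epsilon> n)" "w \<in> sphere 0 (1 - 2 * \<epsilon> n)"
  then have zw': "dist 1 z = \<epsilon> n" "norm w = 1 - 2 * \<epsilon> n" by auto
  note g = good_circles[OF assms zw']
  have "w \<noteq> of_real (b n m)" if "m \<in> I n" for m using g(5)[OF that] by auto
  moreover have "z \<notin> P_zeros (p n) s1"
  proof
    assume "z \<in> P_zeros (p n) s1"
    then obtain j where j: "j < s1" "z = of_real (1 / p n j)" by (auto simp: P_zeros_def)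
    then have "1 - z * of_real (p n j) = 0" using p_pos[of n j] by simp
    then have "P_prod (p n) s1 z = 0" unfolding P_prod_def using j(1) by (intro prod_zero) auto
    then show False using g(2) by simp
  qed
  moreover have "w \<noteq> z" using g(4) eps_pos[of n] by auto
  ultimately show "z \<noteq> 0 \<and> z \<notin> P_zeros (p n) s1 \<and> w \<noteq> 0 \<and> w \<noteq> z \<and> (\<forall>m\<in>I n. w \<noteq> complex_of_real (b n m))"
    using g by auto
qed

definition inner_integral :: "(nat \<Rightarrow> int) \<Rightarrow> nat \<Rightarrow> nat \<Rightarrow> complex \<Rightarrow> complex" where
  "inner_integral H s n \<omega> = circle_integral 0 1 (\<lambda>\<zeta>. N_local H n \<zeta> / P_local s n \<zeta> * (1 / (\<zeta> - \<omega>)))"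

lemma good_omega:
  assumes "good s n"
  shows "norm (1 + of_real (\<epsilon> n) * omega n y) = 1 - 2 * \<epsilon> n" "1 + of_real (\<epsilon> n) * omega n y \<noteq> 0"
    "norm \<zeta> = 1 \<Longrightarrow> 1 \<le> norm (\<zeta> - omega n y)"
proof -
  have e: "\<epsilon> n < 1 / 4" using assms by (auto simp: good_def)
  show 1: "norm (1 + of_real (\<epsilon> n) * omega n y) = 1 - 2 * \<epsilon> n"
    unfolding one_plus_omega using e by (simp add: norm_mult del: of_real_diff)
  then show "1 + of_real (\<epsilon> n) * omega n y \<noteq> 0" using e by auto
  assume "norm \<zeta> = 1"
  then have "dist 1 (1 + of_real (\<epsilon> n) * \<zeta>) = \<epsilon> n" using eps_pos[of n] by (simp add: dist_norm norm_mult)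
  from good_circles(4)[OF assms this 1] have "\<epsilon> n \<le> norm (of_real (\<epsilon> n) * (\<zeta> - omega n y))"
    by (simp add: algebra_simps)
  then have "\<epsilon> n * 1 \<le> \<epsilon> n * norm (\<zeta> - omega n y)" using eps_pos[of n] by (simp add: norm_mult)
  then show "1 \<le> norm (\<zeta> - omega n y)" using eps_pos[of n] by (simp only: mult_le_cancel_left_pos)
qed

lemma continuous_on_local_quotient:
  assumes "good s n"
  shows "continuous_on (sphere 0 1) (\<lambda>\<zeta>. N_local H n \<zeta> / P_local s n \<zeta>)"
proof -
  have "1 + complex_of_real (\<epsilon> n) * \<zeta> \<noteq> 0" if "norm \<zeta> = 1" for \<zeta>
  proof -
    have "norm (complex_of_real (\<epsilon> n) * \<zeta>) < 1" using assms that eps_pos[of n] by (simp add: good_def norm_mult)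
    moreover have "complex_of_real (\<epsilon> n) * \<zeta> = - 1" if "1 + complex_of_real (\<epsilon> n) * \<zeta> = 0"
      using that by (simp add: add_eq_0_iff)
    ultimately show ?thesis by fastforce
  qed
  then have nz: "1 + complex_of_real (\<epsilon> n) * \<zeta> \<noteq> 0" if "\<zeta> \<in> sphere 0 1" for \<zeta> using that by simp
  have aff: "continuous_on (sphere 0 1) (\<lambda>\<zeta>. 1 + complex_of_real (\<epsilon> n) * \<zeta>)" by (intro continuous_intros)
  have P: "P_local s n \<zeta> \<noteq> 0" if "\<zeta> \<in> sphere 0 1" for \<zeta> using assms that by (simp add: good_def)
  have "continuous_on (sphere 0 1) (N_local H n)"
    unfolding N_local_def
    by (intro continuous_on_mult continuous_on_divide continuous_on_const continuous_on_power_int continuous_on_N_prod aff)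
       (use nz N_one_nonzero in auto)
  moreover have "continuous_on (sphere 0 1) (P_local s n)"
    unfolding P_local_def by (intro continuous_on_divide continuous_on_const continuous_on_P_prod aff) (use nu_nonzero in auto)
  ultimately show ?thesis using P by (intro continuous_on_divide) auto
qed

text \<open>A bound uniform in \<open>y\<close> exists since the circle of radius
  \<open>1 - 2 * \<epsilon>\<close> about 0 and the circle of radius \<open>\<epsilon>\<close> about
  1 are at distance at least \<open>\<epsilon>\<close>, so \<open>1 / (\<zeta> - \<omega>)\<close>
  has norm at most 1 everywhere.\<close>

lemma inner_integral_bound:
  assumes "scaled_height H y'"
  shows "\<exists>B. 0 \<le> B \<and> (\<forall>\<^sub>F n in sequentially. \<forall>y. norm (inner_integral H s n (omega n y)) \<le> B)"
proof -
  have "compact ((\<lambda>\<zeta>. exp (of_real (\<sigma> / 2) * \<zeta>\<^sup>2 - of_real y' * \<zeta>) / \<zeta> ^ near_count s) ` sphere (0::complex) 1)"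
    by (intro compact_continuous_image continuous_intros) auto
  from compact_imp_bounded[OF this] obtain L
    where L: "\<And>x. x \<in> (\<lambda>\<zeta>. exp (of_real (\<sigma> / 2) * \<zeta>\<^sup>2 - of_real y' * \<zeta>) / \<zeta> ^ near_count s) ` sphere (0::complex) 1 \<Longrightarrow> norm x \<le> L"
    unfolding bounded_iff by blast
  have ev: "\<forall>\<^sub>F n in sequentially. \<forall>\<zeta>\<in>sphere 0 1. norm (N_local H n \<zeta> / P_local s n \<zeta>) \<le> L + 1"
    by (rule uniform_limit_bounded_eventually[OF uniform_limit_quotient[OF assms] L[OF imageI]])
  have "\<forall>\<^sub>F n in sequentially. \<forall>y. norm (inner_integral H s n (omega n y)) \<le> \<bar>L + 1\<bar> * (2 * pi * 1)"
    using ev eventually_good[of s]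
  proof (eventually_elim, intro allI)
    fix n and y :: real
    assume n: "\<forall>\<zeta>\<in>sphere 0 1. norm (N_local H n \<zeta> / P_local s n \<zeta>) \<le> L + 1" and g: "good s n"
    have nz: "\<zeta> - omega n y \<noteq> 0" if "norm \<zeta> = 1" for \<zeta> using good_omega(3)[OF g that, of y] by auto
    show "norm (inner_integral H s n (omega n y)) \<le> \<bar>L + 1\<bar> * (2 * pi * 1)"
      unfolding inner_integral_def
    proof (rule norm_circle_integral_le)
      show "continuous_on (sphere 0 1) (\<lambda>\<zeta>. N_local H n \<zeta> / P_local s n \<zeta> * (1 / (\<zeta> - omega n y)))"
        by (intro continuous_intros continuous_on_local_quotient g) (use nz in auto)
      fix \<zeta> :: complex assume z: "\<zeta> \<in> sphere 0 1"
      then have "1 \<le> norm (\<zeta> - omega n y)" using good_omega(3)[OF g, of \<zeta> y] by simp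
      then have "norm (1 / (\<zeta> - omega n y)) \<le> 1"
        by (simp add: norm_divide divide_le_eq_1)
      moreover have "norm (N_local H n \<zeta> / P_local s n \<zeta>) \<le> \<bar>L + 1\<bar>" using n z by fastforce
      ultimately have "norm (N_local H n \<zeta> / P_local s n \<zeta>) * norm (1 / (\<zeta> - omega n y)) \<le> \<bar>L + 1\<bar> * 1"
        by (intro mult_mono) auto
      then show "norm (N_local H n \<zeta> / P_local s n \<zeta> * (1 / (\<zeta> - omega n y))) \<le> \<bar>L + 1\<bar>" by (simp only: norm_mult mult_1_right)
    qed simp_all
  qed
  then show ?thesis by (intro exI[of _ "\<bar>L + 1\<bar> * (2 * pi * 1)"]) auto
qed

lemma inner_integral_limit:
  assumes "scaled_height H y'"
  shows "(\<lambda>n. inner_integral H s n (omega n y)) \<longlonglongrightarrow>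
    circle_integral 0 1 (\<lambda>\<zeta>. exp (of_real (\<sigma> / 2) * \<zeta>\<^sup>2 - of_real y' * \<zeta>) / \<zeta> ^ near_count s * (1 / (\<zeta> - Complex (- 2) y)))"
  unfolding inner_integral_def
proof (rule contour_integral_uniform_limit_circlepath(2))
  let ?w = "Complex (- 2) y"
  have low: "1 \<le> norm (\<zeta> - ?w)" if "\<zeta> \<in> sphere 0 1" for \<zeta>
  proof -
    have "2 \<le> norm ?w" using abs_Re_le_cmod[of ?w] by simp
    moreover have "norm ?w \<le> norm \<zeta> + norm (\<zeta> - ?w)" using norm_triangle_ineq4[of \<zeta> "\<zeta> - ?w"] by simp
    ultimately show ?thesis using that by simp
  qed
  show "\<forall>\<^sub>F n in sequentially. (\<lambda>\<zeta>. N_local H n \<zeta> / P_local s n \<zeta> * (1 / (\<zeta> - omega n y))) contour_integrable_on circlepath 0 1"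
    using eventually_good[of s]
  proof eventually_elim
    fix n assume g: "good s n"
    have nz: "\<zeta> - omega n y \<noteq> 0" if "norm \<zeta> = 1" for \<zeta> using good_omega(3)[OF g that, of y] by auto
    show "(\<lambda>\<zeta>. N_local H n \<zeta> / P_local s n \<zeta> * (1 / (\<zeta> - omega n y))) contour_integrable_on circlepath 0 1"
    proof (rule contour_integrable_continuous_circlepath)
      have "continuous_on (sphere 0 1) (\<lambda>\<zeta>. N_local H n \<zeta> / P_local s n \<zeta> * (1 / (\<zeta> - omega n y)))"
        by (intro continuous_intros continuous_on_local_quotient g) (use nz in auto)
      then show "continuous_on (path_image (circlepath 0 1)) (\<lambda>\<zeta>. N_local H n \<zeta> / P_local s n \<zeta> * (1 / (\<zeta> - omega n y)))"
        by simp
    qed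
  qed
  show "uniform_limit (sphere 0 1) (\<lambda>n \<zeta>. N_local H n \<zeta> / P_local s n \<zeta> * (1 / (\<zeta> - omega n y)))
     (\<lambda>\<zeta>. exp (of_real (\<sigma> / 2) * \<zeta>\<^sup>2 - of_real y' * \<zeta>) / \<zeta> ^ near_count s * (1 / (\<zeta> - ?w))) sequentially"
  proof (rule uniform_lim_mult[OF uniform_limit_quotient[OF assms]])
    show "uniform_limit (sphere 0 1) (\<lambda>n \<zeta>. 1 / (\<zeta> - omega n y)) (\<lambda>\<zeta>. 1 / (\<zeta> - ?w)) sequentially"
    proof (rule uniform_lim_divide[where b = 1])
      have "uniform_limit (sphere 0 1) (\<lambda>n \<zeta>::complex. \<zeta> + - omega n y) (\<lambda>\<zeta>. \<zeta> + - ?w) sequentially"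
        by (intro uniform_limit_add uniform_limit_of_tendsto tendsto_minus omega_lim) (auto simp: uniform_limit_iff)
      then show "uniform_limit (sphere 0 1) (\<lambda>n \<zeta>. \<zeta> - omega n y) (\<lambda>\<zeta>. \<zeta> - ?w) sequentially" by simp
      show "bounded ((\<lambda>\<zeta>::complex. 1::complex) ` sphere 0 1)" by (rule bounded_subset[of "{1}"]) auto
    qed (use low in \<open>auto intro: uniform_limit_const\<close>)
    have "compact ((\<lambda>\<zeta>. exp (of_real (\<sigma> / 2) * \<zeta>\<^sup>2 - of_real y' * \<zeta>) / \<zeta> ^ near_count s) ` sphere (0::complex) 1)"
      by (intro compact_continuous_image continuous_intros) auto
    then show "bounded ((\<lambda>\<zeta>. exp (of_real (\<sigma> / 2) * \<zeta>\<^sup>2 - of_real y' * \<zeta>) / \<zeta> ^ near_count s) ` sphere (0::complex) 1)"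
      by (rule compact_imp_bounded)
    show "bounded ((\<lambda>\<zeta>. 1 / (\<zeta> - ?w)) ` sphere 0 1)"
      unfolding bounded_iff
    proof (intro exI[of _ 1] ballI)
      fix x assume "x \<in> (\<lambda>\<zeta>. 1 / (\<zeta> - ?w)) ` sphere 0 1"
      then obtain \<zeta> where "\<zeta> \<in> sphere 0 1" "x = 1 / (\<zeta> - ?w)" by blast
      then show "norm x \<le> 1" using low[of \<zeta>] by (simp add: norm_divide divide_le_eq_1)
    qed
  qed
qed simp_all

text \<open>Counting powers of \<open>\<epsilon>\<close>: \<open>dz\<close> and \<open>dw\<close>
  give one each and \<open>1 / (z - w)\<close> gives an inverse, so one is left, which the prefactor
  \<open>1 / \<epsilon>\<close> cancels; the factors \<open>nu\<close> cancel the scales of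
  \<open>P_prod\<close>. What remains converges pointwise in \<open>y\<close> and has a polynomial
  times Gaussian majorant.\<close>

lemma double_integral_limit:
  assumes H1: "scaled_height H1 y1" and H2: "scaled_height H2 y2"
  shows "(\<lambda>n. 1 / of_real (\<epsilon> n) * (nu s1 n / nu s2 n) *
      circle_integral 0 (1 - 2 * \<epsilon> n) (\<lambda>w. circle_integral 1 (\<epsilon> n)
        (\<lambda>z. edge_integrand (I n) (b n) (p n) s1 s2 (H1 n) (H2 n) z w))) \<longlonglongrightarrow>
    (\<integral>y. \<i> * circle_integral 0 1 (\<lambda>\<zeta>. turning_integrand \<sigma> (near_count s1) (near_count s2) y1 y2 \<zeta> (Complex (- 2) y)) \<partial>lborel)"
    (is "?X \<longlonglongrightarrow> _")
proof -
  define h where "h = (\<lambda>n w. circle_integral 1 (\<epsilon> n) (\<lambda>z. edge_integrand (I n) (b n) (p n) s1 s2 (H1 n) (H2 n) z w))"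
  define c where "c = (\<lambda>n. 1 / of_real (\<epsilon> n) * (nu s1 n / nu s2 n))"
  define \<rho> where "\<rho> = (\<lambda>n. 1 - 2 * \<epsilon> n)"
  define s where "s = (\<lambda>n y. c n * (indicator {- (pi / \<epsilon> n)..pi / \<epsilon> n} y *\<^sub>R (h n (\<rho> n * cis (\<epsilon> n * y)) * (\<i> * \<rho> n * \<epsilon> n * cis (\<epsilon> n * y)))))"
  define l where "l = (\<lambda>y. \<i> * circle_integral 0 1 (\<lambda>\<zeta>. turning_integrand \<sigma> (near_count s1) (near_count s2) y1 y2 \<zeta> (Complex (- 2) y)))"
  have hcont: "continuous_on (sphere 0 (\<rho> n)) (h n)" if g: "good s1 n" for n
    using continuous_on_circle_integral_param[OF continuous_on_swap_args[OF good_integrand_continuous[OF g]]] eps_pos[of n]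
    by (simp add: h_def \<rho>_def)
  have rpos: "0 < \<rho> n" if "good s1 n" for n using that by (simp add: good_def \<rho>_def)
  have X: "?X n = (\<integral>y. s n y \<partial>lborel)" if g: "good s1 n" for n
  proof -
    have "circle_integral 0 (\<rho> n) (h n) = (\<integral>y. indicator {- (pi / \<epsilon> n)..pi / \<epsilon> n} y *\<^sub>R (h n (\<rho> n * cis (\<epsilon> n * y)) * (\<i> * \<rho> n * \<epsilon> n * cis (\<epsilon> n * y))) \<partial>lborel)"
      by (rule circle_integral_as_line[OF hcont[OF g] rpos[OF g] eps_pos])
    then show ?thesis
      unfolding s_def by (simp only: integral_mult_right_zero) (simp only: c_def h_def \<rho>_def)
  qed
  have meas: "s n \<in> borel_measurable lborel" if g: "good s1 n" for n
    unfolding s_def using borel_measurable_circle_line[OF hcont[OF g] rpos[OF g], of "\<epsilon> n"] by measurable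
  have s_eq: "s n y = \<i> * (P_local s2 n (omega n y) * inverse (N_local H2 n (omega n y))) * inner_integral H1 s1 n (omega n y)"
    if g: "good s1 n" and y: "\<bar>y\<bar> \<le> pi / \<epsilon> n" for n y
  proof -
    define w where "w = 1 + of_real (\<epsilon> n) * omega n y"
    have w: "w = \<rho> n * cis (\<epsilon> n * y)" by (simp only: w_def one_plus_omega \<rho>_def)
    have w0: "w \<noteq> 0" using good_omega(2)[OF g] by (simp add: w_def)
    have e0: "complex_of_real (\<epsilon> n) \<noteq> 0" using eps_pos[of n] by simp
    have "h n w = circle_integral 0 1 (\<lambda>\<zeta>. \<epsilon> n * edge_integrand (I n) (b n) (p n) s1 s2 (H1 n) (H2 n) (1 + of_real (\<epsilon> n) * \<zeta>) w)"
      unfolding h_def by (rule circle_integral_affine)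
    also have "\<dots> = circle_integral 0 1 (\<lambda>\<zeta>. (P_local s2 n (omega n y) / N_local H2 n (omega n y) * (nu s2 n / nu s1 n) * (1 / w)) *
        (N_local H1 n \<zeta> / P_local s1 n \<zeta> * (1 / (\<zeta> - omega n y))))"
    proof -
      have "complex_of_real (\<epsilon> n) * (a * b * (1 / complex_of_real (\<epsilon> n)) * c * Q) = a * b * c * Q" for a b c Q using e0 by simp
      then show ?thesis unfolding w_def edge_integrand_local[OF good_omega(2)[OF g]] by (simp only:)
    qed
    also have "\<dots> = (P_local s2 n (omega n y) / N_local H2 n (omega n y) * (nu s2 n / nu s1 n) * (1 / w)) * inner_integral H1 s1 n (omega n y)"
      unfolding inner_integral_def by (rule circle_integral_cmult)
    finally have hw: "h n w = (P_local s2 n (omega n y) / N_local H2 n (omega n y) * (nu s2 n / nu s1 n) * (1 / w)) * inner_integral H1 s1 n (omega n y)" .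
    have "s n y = c n * (h n w * (\<i> * \<epsilon> n * w))"
      using y by (simp add: s_def w indicator_def abs_le_iff mult_ac)
    then show ?thesis
      unfolding hw c_def using w0 e0 nu_nonzero[of s1 n] nu_nonzero[of s2 n] by (simp add: field_simps)
  qed
  have s_zero: "s n y = 0" if "\<not> \<bar>y\<bar> \<le> pi / \<epsilon> n" for n y
    using that by (simp add: s_def indicator_def abs_le_iff) linarith
  have lim: "(\<lambda>n. s n y) \<longlonglongrightarrow> l y" for y
  proof -
    have "(\<lambda>n. \<i> * (P_local s2 n (omega n y) * inverse (N_local H2 n (omega n y))) * inner_integral H1 s1 n (omega n y)) \<longlonglongrightarrow>
      \<i> * (Complex (- 2) y ^ near_count s2 * inverse (exp (of_real (\<sigma> / 2) * (Complex (- 2) y)\<^sup>2 - of_real y2 * Complex (- 2) y))) *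
      circle_integral 0 1 (\<lambda>\<zeta>. exp (of_real (\<sigma> / 2) * \<zeta>\<^sup>2 - of_real y1 * \<zeta>) / \<zeta> ^ near_count s1 * (1 / (\<zeta> - Complex (- 2) y)))"
      by (intro tendsto_intros P_local_omega_lim N_local_omega_lim H2 inner_integral_limit H1) simp
    also have "\<i> * (Complex (- 2) y ^ near_count s2 * inverse (exp (of_real (\<sigma> / 2) * (Complex (- 2) y)\<^sup>2 - of_real y2 * Complex (- 2) y))) *
      circle_integral 0 1 (\<lambda>\<zeta>. exp (of_real (\<sigma> / 2) * \<zeta>\<^sup>2 - of_real y1 * \<zeta>) / \<zeta> ^ near_count s1 * (1 / (\<zeta> - Complex (- 2) y))) = l y"
    proof -
      have "turning_integrand \<sigma> (near_count s1) (near_count s2) y1 y2 \<zeta> \<omega> =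
         (\<omega> ^ near_count s2 * inverse (exp (of_real (\<sigma> / 2) * \<omega>\<^sup>2 - of_real y2 * \<omega>))) *
         (exp (of_real (\<sigma> / 2) * \<zeta>\<^sup>2 - of_real y1 * \<zeta>) / \<zeta> ^ near_count s1 * (1 / (\<zeta> - \<omega>)))" for \<zeta> \<omega>
        unfolding turning_integrand_def right_diff_distrib exp_diff
        by (simp only: divide_inverse inverse_mult_distrib inverse_inverse_eq mult_1_left mult_ac)
      then show ?thesis unfolding l_def by (simp only: circle_integral_cmult mult.assoc)
    qed
    finally have "(\<lambda>n. \<i> * (P_local s2 n (omega n y) * inverse (N_local H2 n (omega n y))) * inner_integral H1 s1 n (omega n y)) \<longlonglongrightarrow> l y" .
    moreover have "\<forall>\<^sub>F n in sequentially. \<i> * (P_local s2 n (omega n y) * inverse (N_local H2 n (omega n y))) * inner_integral H1 s1 n (omega n y) = s n y"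
    proof -
      have "\<forall>\<^sub>F n in sequentially. \<epsilon> n < pi / (\<bar>y\<bar> + 1)" by (rule eventually_small) simp
      with eventually_good[of s1] show ?thesis
      proof eventually_elim
        fix n assume g: "good s1 n" and "\<epsilon> n < pi / (\<bar>y\<bar> + 1)"
        then have "\<epsilon> n * (\<bar>y\<bar> + 1) < pi" by (simp add: pos_less_divide_eq)
        then have "\<epsilon> n * \<bar>y\<bar> \<le> pi" using eps_pos[of n] by (simp add: distrib_left)
        then have "\<bar>y\<bar> \<le> pi / \<epsilon> n" using eps_pos[of n] by (simp add: pos_le_divide_eq mult.commute)
        from s_eq[OF g this] show "\<i> * (P_local s2 n (omega n y) * inverse (N_local H2 n (omega n y))) * inner_integral H1 s1 n (omega n y) = s n y" by simp
      qed
    qed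
    ultimately show ?thesis by (rule Lim_transform_eventually)
  qed
  obtain B2 c2 where B2: "0 < c2" "0 < B2" "\<forall>\<^sub>F n in sequentially. \<forall>y. \<bar>y\<bar> \<le> pi / \<epsilon> n \<longrightarrow>
    norm (inverse (N_local H2 n (omega n y))) \<le> B2 * exp (- (c2 * y\<^sup>2))"
    using N_local_omega_bound[OF H2] by blast
  obtain B3 where B3: "0 < B3" "\<forall>\<^sub>F n in sequentially. \<forall>y. norm (P_local s2 n (omega n y)) \<le> B3 * (5 + 2 * \<bar>y\<bar>) ^ s2"
    using P_local_omega_bound by blast
  obtain B1 where B1: "0 \<le> B1" "\<forall>\<^sub>F n in sequentially. \<forall>y. norm (inner_integral H1 s1 n (omega n y)) \<le> B1"
    using inner_integral_bound[OF H1] by blast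
  obtain B4 where B4: "\<And>y. (5 + 2 * \<bar>y\<bar>) ^ s2 * exp (- (c2 * y\<^sup>2)) \<le> B4 * inverse (1 + y\<^sup>2)"
    using power_times_gaussian_bound[OF B2(1)] by blast
  define bd where "bd = (\<lambda>y::real. (B3 * B2 * B1 * B4) * inverse (1 + y\<^sup>2))"
  have B4nn: "0 \<le> B4 * inverse (1 + y\<^sup>2)" for y :: real
    by (rule order_trans[OF _ B4]) simp
  have "\<forall>\<^sub>F n in sequentially. good s1 n \<and> (\<forall>y. norm (s n y) \<le> bd y)"
    using B2(3) B3(2) B1(2) eventually_good[of s1]
  proof (eventually_elim, intro conjI allI)
    fix n y
    assume n: "\<forall>y. \<bar>y\<bar> \<le> pi / \<epsilon> n \<longrightarrow> norm (inverse (N_local H2 n (omega n y))) \<le> B2 * exp (- (c2 * y\<^sup>2))"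
      "\<forall>y. norm (P_local s2 n (omega n y)) \<le> B3 * (5 + 2 * \<bar>y\<bar>) ^ s2"
      "\<forall>y. norm (inner_integral H1 s1 n (omega n y)) \<le> B1" and g: "good s1 n"
    show "norm (s n y) \<le> bd y"
    proof (cases "\<bar>y\<bar> \<le> pi / \<epsilon> n")
      case True
      have "norm (s n y) = norm (P_local s2 n (omega n y)) * norm (inverse (N_local H2 n (omega n y))) * norm (inner_integral H1 s1 n (omega n y))"
        unfolding s_eq[OF g True] by (simp add: norm_mult)
      also have "\<dots> \<le> (B3 * (5 + 2 * \<bar>y\<bar>) ^ s2) * (B2 * exp (- (c2 * y\<^sup>2))) * B1"
        using n True B1 B2 B3 by (intro mult_mono) (auto intro!: mult_nonneg_nonneg)
      also have "\<dots> = (B3 * B2 * B1) * ((5 + 2 * \<bar>y\<bar>) ^ s2 * exp (- (c2 * y\<^sup>2)))" by (simp only: mult_ac)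
      also have "\<dots> \<le> (B3 * B2 * B1) * (B4 * inverse (1 + y\<^sup>2))"
        using B1 B2 B3 by (intro mult_left_mono B4) auto
      finally show ?thesis by (simp only: bd_def mult.assoc)
    next
      case False
      have "0 \<le> (B3 * B2 * B1) * (B4 * inverse (1 + y\<^sup>2))" using B1(1) B2(1,2) B3(1) by (intro mult_nonneg_nonneg[OF _ B4nn]) auto
      then show ?thesis using s_zero[OF False] by (simp only: bd_def mult.assoc norm_zero)
    qed
  qed
  \<comment> \<open>The majorant holds only for large \<open>n\<close>, while dominated convergence
    wants it for every \<open>n\<close>; the sequence is therefore shifted by
    \<open>n0\<close>.\<close>
  then obtain n0 where n0: "\<And>n. n0 \<le> n \<Longrightarrow> good s1 n \<and> (\<forall>y. norm (s n y) \<le> bd y)"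
    unfolding eventually_sequentially by blast
  have lim': "(\<lambda>n. s (n + n0) y) \<longlonglongrightarrow> l y" for y
    using LIMSEQ_ignore_initial_segment[OF lim] .
  have m': "s (n + n0) \<in> borel_measurable lborel" for n using n0[of "n + n0"] by (intro meas) simp
  have "(\<lambda>n. \<integral>y. s (n + n0) y \<partial>lborel) \<longlonglongrightarrow> (\<integral>y. l y \<partial>lborel)"
  proof (rule integral_dominated_convergence[where w = bd])
    show "l \<in> borel_measurable lborel"
      by (rule borel_measurable_LIMSEQ_metric[OF m' lim'])
    show "integrable lborel bd" unfolding bd_def by (rule integrable_inverse_square)
    show "AE y in lborel. norm (s (n + n0) y) \<le> bd y" for n using n0[of "n + n0"] by simp
  qed (use m' lim' in auto)
  then have "(\<lambda>n. \<integral>y. s n y \<partial>lborel) \<longlonglongrightarrow> (\<integral>y. l y \<partial>lborel)" by (rule LIMSEQ_offset)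
  moreover have "\<forall>\<^sub>F n in sequentially. (\<integral>y. s n y \<partial>lborel) = ?X n"
    using eventually_good[of s1] by eventually_elim (rule X[symmetric])
  ultimately show ?thesis unfolding l_def by (rule Lim_transform_eventually)
qed

end

section \<open>The circle around the other zeros\<close>

lemma tendsto_exp_neg_over_square:
  fixes \<epsilon> :: "nat \<Rightarrow> real"
  assumes "\<And>n. 0 < \<epsilon> n" "\<epsilon> \<longlonglongrightarrow> 0" "0 < c"
  shows "(\<lambda>n. (1 / \<epsilon> n) ^ k * exp (- (c / (\<epsilon> n)\<^sup>2) + d / \<epsilon> n)) \<longlonglongrightarrow> 0"
proof -
  have lim: "filterlim \<epsilon> (at_right 0) sequentially"
    using assms(1,2) by (auto simp: filterlim_at less_imp_neq[OF assms(1), symmetric] intro!: always_eventually)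
  have "((\<lambda>x::real. (1 / x) ^ k * exp (- (c / x\<^sup>2) + d / x)) \<longlongrightarrow> 0) (at_right 0)"
    using assms(3) by real_asymp
  from filterlim_compose[OF this lim] show ?thesis .
qed

lemma tendsto_exp_neg_over:
  fixes \<epsilon> :: "nat \<Rightarrow> real"
  assumes "\<And>n. 0 < \<epsilon> n" "\<epsilon> \<longlonglongrightarrow> 0" "0 < c"
  shows "(\<lambda>n. (1 / \<epsilon> n) ^ k * exp (- (c / \<epsilon> n))) \<longlonglongrightarrow> 0"
proof -
  have lim: "filterlim \<epsilon> (at_right 0) sequentially"
    using assms(1,2) by (auto simp: filterlim_at less_imp_neq[OF assms(1), symmetric] intro!: always_eventually)
  have "((\<lambda>x::real. (1 / x) ^ k * exp (- (c / x))) \<longlongrightarrow> 0) (at_right 0)"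
    using assms(3) by real_asymp
  from filterlim_compose[OF this lim] show ?thesis .
qed

context edge_data
begin

definition q :: real where "q = 1 / \<kappa>"

text \<open>The last inequality is \<open>ln x < x - 1\<close> at
  \<open>x = 1 / q \<noteq> 1\<close>. Times \<open>g\<close>, it bounds from below the exponent by
  which \<open>N_prod * z powi (- g)\<close> is smaller at \<open>q\<close> than at 1.\<close>

lemma q: "0 < q" "q \<noteq> 1" "\<beta> < q" "0 < ln q - 1 + 1 / q"
proof -
  show q0: "0 < q" "q \<noteq> 1" "\<beta> < q" using kappa by (auto simp: q_def field_simps)
  have "ln (1 / q) < 1 / q - 1"
    using ln_le_minus_one[of "1 / q"] ln_eq_minus_one[of "1 / q"] q0 by (auto simp: less_le)
  then show "0 < ln q - 1 + 1 / q" using q0 by (simp add: ln_div)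
qed

text \<open>The radius of the circle about \<open>q\<close>. As \<open>d\<close> tends to 0, the
  left-hand side of the last condition tends to \<open>- (ln q - 1 + 1 / q)\<close>, so half of the
  exponential rate survives on the whole circle; the other conditions keep the circle away from 0,
  from 1 and from the points \<open>b\<close>.\<close>

definition delta :: real where
  "delta = (SOME d. 0 < d \<and> d < q \<and> d < \<bar>q - 1\<bar> / 2 \<and> \<beta> < q - d \<and>
     1 - 1 / q + d / (q * (q - d)) - ln (q - d) < - (ln q - 1 + 1 / q) / 2)"

lemma delta: "0 < delta" "delta < q" "delta < \<bar>q - 1\<bar> / 2" "\<beta> < q - delta"
  "1 - 1 / q + delta / (q * (q - delta)) - ln (q - delta) < - (ln q - 1 + 1 / q) / 2"
proof -
  have "((\<lambda>d. 1 - 1 / q + d / (q * (q - d)) - ln (q - d)) \<longlongrightarrow> 1 - 1 / q + 0 / (q * (q - 0)) - ln (q - 0)) (at_right 0)"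
    using q by (intro tendsto_intros) auto
  then have e1: "\<forall>\<^sub>F d in at_right 0. 1 - 1 / q + d / (q * (q - d)) - ln (q - d) < - (ln q - 1 + 1 / q) / 2"
    using q by (intro order_tendstoD(2)) auto
  have less: "\<forall>\<^sub>F d in at_right 0. d < c" if "0 < c" for c :: real
    using that by (rule order_tendstoD(2)[OF tendsto_ident_at])
  have e2: "\<forall>\<^sub>F d in at_right 0. \<beta> < q - d"
    using less[of "q - \<beta>"] q by (simp add: algebra_simps)
  have e3: "\<forall>\<^sub>F d in at_right (0::real). 0 < d" by (rule eventually_at_right_less)
  have "\<forall>\<^sub>F d in at_right 0. 0 < d \<and> d < q \<and> d < \<bar>q - 1\<bar> / 2 \<and> \<beta> < q - d \<and>
     1 - 1 / q + d / (q * (q - d)) - ln (q - d) < - (ln q - 1 + 1 / q) / 2"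
    by (intro eventually_conj e1 e2 e3 less) (use q in auto)
  then have "\<exists>d. 0 < d \<and> d < q \<and> d < \<bar>q - 1\<bar> / 2 \<and> \<beta> < q - d \<and>
     1 - 1 / q + d / (q * (q - d)) - ln (q - d) < - (ln q - 1 + 1 / q) / 2"
    by (rule eventually_happens'[OF trivial_limit_at_right_real])
  from someI_ex[OF this, folded delta_def]
  show "0 < delta" "delta < q" "delta < \<bar>q - 1\<bar> / 2" "\<beta> < q - delta"
    "1 - 1 / q + delta / (q * (q - delta)) - ln (q - delta) < - (ln q - 1 + 1 / q) / 2"
    by auto
qed

lemma p_inverse_near: "j \<in> T \<Longrightarrow> \<forall>\<^sub>F n in sequentially. \<bar>1 / p n j - 1\<bar> < \<epsilon> n"
proof -
  assume j: "j \<in> T"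
  have "(\<lambda>n. \<bar>(p n j - 1) / \<epsilon> n * (1 / p n j)\<bar>) \<longlonglongrightarrow> \<bar>0 * (1 / 1)\<bar>"
    by (intro tendsto_intros p_near p_lim j) auto
  then have "\<forall>\<^sub>F n in sequentially. \<bar>(p n j - 1) / \<epsilon> n * (1 / p n j)\<bar> < 1"
    by (intro order_tendstoD(2)) auto
  then show ?thesis
  proof eventually_elim
    fix n assume "\<bar>(p n j - 1) / \<epsilon> n * (1 / p n j)\<bar> < 1"
    moreover have "(p n j - 1) / \<epsilon> n * (1 / p n j) = - ((1 / p n j - 1) / \<epsilon> n)"
      using p_pos[of n j] eps_pos[of n] by (simp add: field_simps)
    ultimately have "\<bar>(1 / p n j - 1) / \<epsilon> n\<bar> < 1" by (simp only: abs_minus_cancel)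
    then have "\<bar>1 / p n j - 1\<bar> / \<epsilon> n < 1" using eps_pos[of n] by (simp only: abs_divide abs_of_pos)
    then show "\<bar>1 / p n j - 1\<bar> < \<epsilon> n" using eps_pos[of n] by (simp add: divide_less_eq)
  qed
qed

lemma p_inverse_far: "j \<notin> T \<Longrightarrow> \<forall>\<^sub>F n in sequentially. \<bar>1 / p n j - q\<bar> < delta / 2"
proof -
  assume j: "j \<notin> T"
  have "(\<lambda>n. \<bar>1 / p n j - q\<bar>) \<longlonglongrightarrow> \<bar>1 / \<kappa> - q\<bar>"
    using kappa by (intro tendsto_intros p_far j) auto
  then show ?thesis using delta(1) by (intro order_tendstoD(2)) (auto simp: q_def)
qed

text \<open>The zeros near \<open>q\<close> are confined to half the radius \<open>delta\<close>, so
  the circle keeps distance \<open>delta / 2\<close> from them. The condition with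
  \<open>4 * \<epsilon> n\<close> separates this circle both from the zeros near 1 and from the
  circle of \<open>w\<close>.\<close>

definition separated_poles :: "nat \<Rightarrow> nat \<Rightarrow> bool" where
  "separated_poles s n \<longleftrightarrow> good s n \<and> 4 * \<epsilon> n < \<bar>q - 1\<bar> / 2 - delta \<and> 3 * \<epsilon> n < 1 - \<beta> \<and>
     (\<forall>j\<in>{..<s}. if j \<in> T then \<bar>1 / p n j - 1\<bar> < \<epsilon> n else \<bar>1 / p n j - q\<bar> < delta / 2)"

lemma separated_polesD:
  "separated_poles s n \<Longrightarrow> j < s \<Longrightarrow> if j \<in> T then \<bar>1 / p n j - 1\<bar> < \<epsilon> n else \<bar>1 / p n j - q\<bar> < delta / 2"
  unfolding separated_poles_def by blast

lemma eventually_separated_poles: "\<forall>\<^sub>F n in sequentially. separated_poles s n"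
proof -
  have "\<forall>\<^sub>F n in sequentially. if j \<in> T then \<bar>1 / p n j - 1\<bar> < \<epsilon> n else \<bar>1 / p n j - q\<bar> < delta / 2" for j
    using p_inverse_near[of j] p_inverse_far[of j] by (cases "j \<in> T") auto
  then have "\<forall>\<^sub>F n in sequentially. \<forall>j\<in>{..<s}. if j \<in> T then \<bar>1 / p n j - 1\<bar> < \<epsilon> n else \<bar>1 / p n j - q\<bar> < delta / 2"
    by (intro eventually_ball_finite) auto
  moreover have "\<forall>\<^sub>F n in sequentially. \<epsilon> n < (\<bar>q - 1\<bar> / 2 - delta) / 4"
    using delta(3) by (intro eventually_small) auto
  moreover have "\<forall>\<^sub>F n in sequentially. \<epsilon> n < (1 - \<beta>) / 3"
    using beta by (intro eventually_small) auto
  ultimately show ?thesis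
    using eventually_good[of s] unfolding separated_poles_def by eventually_elim simp
qed

definition far_factor :: real where
  "far_factor = min (\<kappa> / 2) (1 / 2) * (delta / 2)"

lemma far_factor_pos: "0 < far_factor"
  using kappa delta by (simp add: far_factor_def)

text \<open>The norm of each factor is \<open>p n j\<close> times the distance of \<open>z\<close>
  from the zero \<open>1 / p n j\<close>; the first is at least
  \<open>min (\<kappa> / 2) (1 / 2)\<close> and the second at least
  \<open>delta / 2\<close>.\<close>

lemma P_prod_far_lower_bound:
  assumes sep: "separated_poles s n" and z: "dist (of_real q) z = delta"
  shows "far_factor ^ s \<le> norm (P_prod (p n) s z)"
proof -
  have "far_factor \<le> norm (1 - z * of_real (p n j))" if j: "j < s" for j
  proof -
    have eq: "1 - z * of_real (p n j) = - (of_real (p n j) * (z - of_real (1 / p n j)))"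
      using p_pos[of n j] by (simp add: field_simps)
    have n: "norm (1 - z * of_real (p n j)) = p n j * dist z (of_real (1 / p n j))"
      unfolding eq norm_minus_cancel norm_mult using p_pos[of n j] by (simp add: dist_norm)
    have e4: "\<epsilon> n < 1 / 4" using sep by (simp add: separated_poles_def good_def)
    have "min (\<kappa> / 2) (1 / 2) \<le> p n j \<and> delta / 2 \<le> dist z (of_real (1 / p n j))"
    proof (cases "j \<in> T")
      case True
      then have d: "\<bar>1 / p n j - 1\<bar> < \<epsilon> n" using separated_polesD[OF sep j] by simp
      then have "1 / p n j \<le> 2" using e4 by linarith
      then have "1 / 2 \<le> p n j" using p_pos[of n j] by (simp add: field_simps)
      moreover have "dist (of_real q) (of_real (1 / p n j) :: complex) = \<bar>q - 1 / p n j\<bar>"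
        by (simp only: dist_of_real dist_real_def)
      moreover have "\<bar>q - 1\<bar> - \<epsilon> n \<le> \<bar>q - 1 / p n j\<bar>" using d by linarith
      moreover have "dist (of_real q) (of_real (1 / p n j) :: complex) \<le> dist (of_real q) z + dist z (of_real (1 / p n j))"
        by (rule dist_triangle)
      moreover have "4 * \<epsilon> n < \<bar>q - 1\<bar> / 2 - delta" using sep by (simp add: separated_poles_def)
      moreover have "delta / 2 \<le> D"
        if "D0 = a" "Q - e \<le> a" "D0 \<le> delta + D" "4 * e < Q / 2 - delta" "0 < e" for D0 a Q e D
        using that delta(1) by linarith
      ultimately show ?thesis using z eps_pos[of n] by (metis min.coboundedI2)
    next
      case False
      then have d: "\<bar>1 / p n j - q\<bar> < delta / 2" using separated_polesD[OF sep j] by simp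
      then have "1 / p n j \<le> 2 * q" using delta by linarith
      then have "\<kappa> / 2 \<le> p n j" using p_pos[of n j] kappa by (simp add: q_def field_simps)
      moreover have "dist (of_real q) (of_real (1 / p n j) :: complex) = \<bar>q - 1 / p n j\<bar>"
        by (simp only: dist_of_real dist_real_def)
      moreover have "dist (of_real q) z \<le> dist (of_real q) (of_real (1 / p n j) :: complex) + dist z (of_real (1 / p n j))"
        using dist_triangle[of "of_real q" z "of_real (1 / p n j)"] by (simp only: dist_commute)
      ultimately have "min (\<kappa> / 2) (1 / 2) \<le> p n j" "delta / 2 \<le> dist z (of_real (1 / p n j))"
        using z d by linarith+
      then show ?thesis ..
    qed
    then show ?thesis unfolding n far_factor_def using kappa delta by (intro mult_mono) auto
  qed
  then have "(\<Prod>j<s. far_factor) \<le> (\<Prod>j<s. norm (1 - z * of_real (p n j)))"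
    using far_factor_pos by (intro prod_mono) auto
  then show ?thesis by (simp add: P_prod_def prod_norm)
qed

text \<open>\<open>g\<close> is at least of order \<open>1 / \<epsilon>^2\<close> by the lower bound
  for the sum of the \<open>b\<close>, whereas \<open>g - H\<close> is only of order
  \<open>1 / \<epsilon>\<close>; hence \<open>H\<close> is eventually positive.\<close>

lemma height_facts:
  assumes "scaled_height H y"
  shows "\<exists>c>0. \<forall>\<^sub>F n in sequentially. c \<le> (\<epsilon> n)\<^sup>2 * g n \<and> \<bar>\<epsilon> n * (g n - H n)\<bar> \<le> \<bar>y\<bar> + 1 \<and> 1 \<le> H n"
proof -
  obtain c where c: "0 < c" "\<forall>\<^sub>F n in sequentially. c \<le> (\<epsilon> n)\<^sup>2 * (\<Sum>m\<in>I n. b n m)"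
    using sum_b_lower by blast
  have "(\<lambda>n. \<bar>\<epsilon> n * (g n - H n)\<bar>) \<longlonglongrightarrow> \<bar>- y\<bar>"
    using assms unfolding scaled_height_def by (rule tendsto_rabs)
  then have "\<forall>\<^sub>F n in sequentially. \<bar>\<epsilon> n * (g n - H n)\<bar> < \<bar>y\<bar> + 1" by (intro order_tendstoD(2)) auto
  moreover have "\<forall>\<^sub>F n in sequentially. \<epsilon> n < c / (2 * (\<bar>y\<bar> + 1))" using c by (intro eventually_small) auto
  moreover have "\<forall>\<^sub>F n in sequentially. \<epsilon> n < c / 2" using c by (intro eventually_small) auto
  moreover have "\<forall>\<^sub>F n in sequentially. \<epsilon> n < 1" by (intro eventually_small) auto
  ultimately have "\<forall>\<^sub>F n in sequentially. c \<le> (\<epsilon> n)\<^sup>2 * g n \<and> \<bar>\<epsilon> n * (g n - H n)\<bar> \<le> \<bar>y\<bar> + 1 \<and> 1 \<le> H n"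
    using c(2)
  proof eventually_elim
    case (elim n)
    have "(\<epsilon> n)\<^sup>2 * (\<Sum>m\<in>I n. b n m) \<le> (\<epsilon> n)\<^sup>2 * g n" by (intro mult_left_mono sum_b_le_g) auto
    then have 1: "c \<le> (\<epsilon> n)\<^sup>2 * g n" using elim by linarith
    have "\<epsilon> n * (\<epsilon> n * (g n - H n)) \<le> \<epsilon> n * (\<bar>y\<bar> + 1)" using elim eps_pos[of n] by (intro mult_left_mono) auto
    moreover have "\<epsilon> n * (2 * (\<bar>y\<bar> + 1)) < c" using elim by (simp add: pos_less_divide_eq)
    moreover have "\<epsilon> n * (\<epsilon> n * (g n - H n)) = (\<epsilon> n)\<^sup>2 * g n - (\<epsilon> n)\<^sup>2 * H n" by (simp add: power2_eq_square algebra_simps)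
    ultimately have "c / 2 < (\<epsilon> n)\<^sup>2 * H n" using 1 by argo
    moreover have "(\<epsilon> n)\<^sup>2 \<le> \<epsilon> n" using elim eps_pos[of n] by (simp add: power2_eq_square mult_le_one)
    ultimately have "0 < (\<epsilon> n)\<^sup>2 * H n" using c by linarith
    then have "0 < H n" by (simp add: zero_less_mult_iff)
    then show ?case using 1 elim by simp
  qed
  then show ?thesis using c by blast
qed

lemma nu_bound: "\<epsilon> n < 1 \<Longrightarrow> norm (nu s n) \<le> (1 + \<bar>1 - \<kappa>\<bar>) ^ s"
proof -
  assume "\<epsilon> n < 1"
  then have "norm (nu s n) \<le> (\<Prod>j<s. 1 + \<bar>1 - \<kappa>\<bar>)"
    unfolding nu_def prod_norm[symmetric] using eps_pos[of n]
    by (intro prod_mono) (auto simp del: of_real_diff)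
  then show ?thesis by simp
qed

text \<open>Writing \<open>H = g - (g - H)\<close> in the bound for the power lets its main part
  combine with the bound for \<open>N_prod\<close>. What is left is a negative multiple of
  \<open>g\<close>, of order \<open>1 / \<epsilon>^2\<close>, and an error of order
  \<open>1 / \<epsilon>\<close>.\<close>

lemma N_far_bound:
  assumes z: "dist (of_real q) z = delta" and H: "0 \<le> H n"
  shows "norm (N_prod (I n) (b n) z / N_prod (I n) (b n) 1 * z powi (- H n)) \<le>
    exp (g n * (- (ln q - 1 + 1 / q) / 2) + (g n - H n) * ln (q - delta))"
proof -
  have nz: "q - delta \<le> norm z"
    using norm_triangle_ineq2[of "of_real q" "of_real q - z"] z q by (simp add: dist_norm)
  then have z0: "z \<noteq> 0" using delta by auto
  have "norm (1 / z - 1 / of_real q) = delta / (norm z * q)"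
  proof -
    have "1 / z - 1 / of_real q = (of_real q - z) / (z * of_real q)" using z0 q by (simp add: field_simps)
    then show ?thesis using z q by (simp add: norm_divide norm_mult dist_norm)
  qed
  also have "\<dots> \<le> delta / (q * (q - delta))"
    unfolding mult.commute[of "norm z"] using nz q delta by (intro divide_left_mono mult_left_mono mult_pos_pos) auto
  finally have "norm (N_prod (I n) (b n) z / N_prod (I n) (b n) 1) \<le> exp (g n * (1 - 1 / q + delta / (q * (q - delta))))"
    unfolding g_def
  proof (intro N_prod_far_bound[OF finite_I _ _ _ q(1) z0])
    show "b n m < 1" "b n m < q" "0 \<le> b n m" if "m \<in> I n" for m
      using b_nonneg[OF that] b_le[OF that] beta q by auto
  qed
  moreover have "norm (z powi (- H n)) \<le> exp (- H n * ln (q - delta))"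
  proof -
    have "norm (z powi (- H n)) = inverse (norm z ^ nat (H n))"
      using H by (simp add: power_int_minus norm_inverse norm_power power_int_def power_inverse)
    also have "\<dots> \<le> inverse ((q - delta) ^ nat (H n))"
      using nz delta by (intro le_imp_inverse_le power_mono) auto
    also have "(q - delta) ^ nat (H n) = exp (H n * ln (q - delta))"
    proof -
      have "real (nat (H n)) = H n" using H by simp
      then show ?thesis using delta exp_of_nat_mult[of "nat (H n)" "ln (q - delta)"] by simp
    qed
    finally show ?thesis by (simp add: exp_minus)
  qed
  ultimately have "norm (N_prod (I n) (b n) z / N_prod (I n) (b n) 1 * z powi (- H n)) \<le>
      exp (g n * (1 - 1 / q + delta / (q * (q - delta)))) * exp (- H n * ln (q - delta))"
    unfolding norm_mult by (intro mult_mono) auto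
  also have "\<dots> = exp (g n * (1 - 1 / q + delta / (q * (q - delta)) - ln (q - delta)) + (g n - H n) * ln (q - delta))"
    by (simp add: algebra_simps flip: exp_add)
  also have "\<dots> \<le> exp (g n * (- (ln q - 1 + 1 / q) / 2) + (g n - H n) * ln (q - delta))"
    using delta(5) g_bounds(1)[of n] by (intro exp_mono add_right_mono mult_left_mono) auto
  finally show ?thesis .
qed

lemma far_integrand_continuous:
  fixes z w :: complex
  assumes sep: "separated_poles s1 n"
  shows "continuous_on (sphere (of_real q) delta \<times> sphere 0 (1 - 2 * \<epsilon> n)) (\<lambda>(z, w). edge_integrand (I n) (b n) (p n) s1 s2 h1 h2 z w)"
    and "dist (of_real q) z = delta \<Longrightarrow> norm w = 1 - 2 * \<epsilon> n \<Longrightarrow> delta \<le> norm (z - w)"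
proof -
  have g: "good s1 n" using sep by (simp add: separated_poles_def)
  show dz: "delta \<le> norm (z - w)" if "dist (of_real q) z = delta" "norm w = 1 - 2 * \<epsilon> n" for z w :: complex
  proof -
    have "\<bar>q - norm w\<bar> \<le> dist (of_real q) w"
      using norm_triangle_ineq3[of "of_real q" w] q by (simp add: dist_norm)
    moreover have "dist (of_real q) w \<le> dist (of_real q) z + dist z w" by (rule dist_triangle)
    moreover have "4 * \<epsilon> n < \<bar>q - 1\<bar> / 2 - delta" using sep by (simp add: separated_poles_def)
    moreover have "\<bar>q - 1\<bar> - 2 * \<epsilon> n \<le> \<bar>q - norm w\<bar>" using eps_pos[of n] unfolding that(2) by linarith
    moreover have "delta \<le> D"
      if "a \<le> D0" "D0 \<le> delta + D" "4 * e < Q / 2 - delta" "Q - 2 * e \<le> a" "0 < e" for D0 a Q e D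
      using that delta(1) by linarith
    ultimately show ?thesis using that(1) eps_pos[of n] by (metis dist_norm)
  qed
  show "continuous_on (sphere (of_real q) delta \<times> sphere 0 (1 - 2 * \<epsilon> n)) (\<lambda>(z, w). edge_integrand (I n) (b n) (p n) s1 s2 h1 h2 z w)"
  proof (rule continuous_on_edge_integrand[OF finite_I p_pos])
    fix z w :: complex assume "z \<in> sphere (of_real q) delta" "w \<in> sphere 0 (1 - 2 * \<epsilon> n)"
    then have zw: "dist (of_real q) z = delta" "norm w = 1 - 2 * \<epsilon> n" by auto
    \<comment> \<open>A sample point on the circle about 1, through which the facts on
      \<open>w\<close> in \<open>good_circles\<close> become available.\<close>
    have "dist (1::complex) (of_real (1 + \<epsilon> n)) = \<epsilon> n" using eps_pos[of n] by (simp add: dist_norm)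
    note gc = good_circles[OF g this zw(2)]
    have "w \<noteq> of_real (b n m)" if "m \<in> I n" for m using gc(5)[OF that] by auto
    moreover have "z \<notin> P_zeros (p n) s1"
    proof
      assume "z \<in> P_zeros (p n) s1"
      then obtain j where j: "j < s1" "z = of_real (1 / p n j)" by (auto simp: P_zeros_def)
      then have "1 - z * of_real (p n j) = 0" using p_pos[of n j] by simp
      then have "P_prod (p n) s1 z = 0" unfolding P_prod_def using j(1) by (intro prod_zero) auto
      then show False using P_prod_far_lower_bound[OF sep zw(1)] far_factor_pos
        by (metis linorder_not_le norm_zero zero_less_power)
    qed
    moreover have "w \<noteq> z" using dz[OF zw] delta by auto
    moreover have "z \<noteq> 0" using zw(1) delta q by auto
    ultimately show "z \<noteq> 0 \<and> z \<notin> P_zeros (p n) s1 \<and> w \<noteq> 0 \<and> w \<noteq> z \<and> (\<forall>m\<in>I n. w \<noteq> complex_of_real (b n m))"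
      using gc(3) by auto
  qed
qed

text \<open>On the circle about \<open>q\<close> the exponent is a negative multiple of
  \<open>1 / \<epsilon>^2\<close>, up to an error of order \<open>1 / \<epsilon>\<close>; the
  exponential beats the powers of \<open>1 / \<epsilon>\<close> coming from \<open>P_prod\<close>
  and from the normalization.\<close>

lemma far_integral_limit:
  assumes H1: "scaled_height H1 y1" and H2: "scaled_height H2 y2"
  shows "(\<lambda>n. 1 / of_real (\<epsilon> n) * (nu s1 n / nu s2 n) *
      circle_integral 0 (1 - 2 * \<epsilon> n) (\<lambda>w. circle_integral (of_real q) delta
        (\<lambda>z. edge_integrand (I n) (b n) (p n) s1 s2 (H1 n) (H2 n) z w))) \<longlonglongrightarrow> 0"
proof -
  obtain c where c: "0 < c" "\<forall>\<^sub>F n in sequentially. c \<le> (\<epsilon> n)\<^sup>2 * g n \<and> \<bar>\<epsilon> n * (g n - H1 n)\<bar> \<le> \<bar>y1\<bar> + 1 \<and> 1 \<le> H1 n"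
    using height_facts[OF H1] by blast
  obtain B2 c2 where B2: "0 < c2" "0 < B2" "\<forall>\<^sub>F n in sequentially. \<forall>y. \<bar>y\<bar> \<le> pi / \<epsilon> n \<longrightarrow>
    norm (inverse (N_local H2 n (omega n y))) \<le> B2 * exp (- (c2 * y\<^sup>2))"
    using N_local_omega_bound[OF H2] by blast
  obtain B3 where B3: "0 < B3" "\<forall>\<^sub>F n in sequentially. \<forall>y. norm (P_local s2 n (omega n y)) \<le> B3 * (5 + 2 * \<bar>y\<bar>) ^ s2"
    using P_local_omega_bound by blast
  define r where "r = (ln q - 1 + 1 / q) / 2"
  have r: "0 < r" using q by (simp add: r_def field_simps)
  define E where "E = (\<lambda>n. exp (- (r * c / (\<epsilon> n)\<^sup>2) + (\<bar>y1\<bar> + 1) * \<bar>ln (q - delta)\<bar> / \<epsilon> n))"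
  define K where "K = (1 + \<bar>1 - \<kappa>\<bar>) ^ s1 * (B2 * B3 * 13 ^ s2 * inverse (far_factor ^ s1) * inverse delta * 2 * (2 * pi * delta) * (2 * pi))"
  have bound: "\<forall>\<^sub>F n in sequentially. norm (1 / of_real (\<epsilon> n) * (nu s1 n / nu s2 n) *
      circle_integral 0 (1 - 2 * \<epsilon> n) (\<lambda>w. circle_integral (of_real q) delta
        (\<lambda>z. edge_integrand (I n) (b n) (p n) s1 s2 (H1 n) (H2 n) z w))) \<le> K * ((1 / \<epsilon> n) ^ (s2 + 1) * E n)"
    using c(2) B2(3) B3(2) eventually_separated_poles[of s1]
  proof eventually_elim
    case (elim n)
    note sep = elim(4)
    have e4: "\<epsilon> n < 1 / 4" using sep by (simp add: separated_poles_def good_def)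
    define f where "f = edge_integrand (I n) (b n) (p n) s1 s2 (H1 n) (H2 n)"
    define N1 where "N1 = N_prod (I n) (b n) 1"
    \<comment> \<open>\<open>norm (nu s2 n)\<close> may tend to 0; it stays in the bound so that the
      denominator of the prefactor cancels it.\<close>
    define Q where "Q = norm (nu s2 n) * (B2 * B3 * 13 ^ s2 * inverse (far_factor ^ s1) * inverse delta * 2) * ((1 / \<epsilon> n) ^ s2 * E n)"
    have Q0: "0 \<le> Q"
      unfolding Q_def E_def using B2 B3 far_factor_pos delta eps_pos[of n]
      by (intro mult_nonneg_nonneg) (auto intro: less_imp_le)
    have fb: "norm (f z w) \<le> Q" if z: "dist (of_real q) z = delta" and w: "norm w = 1 - 2 * \<epsilon> n" for z w :: complex
    proof -
      \<comment> \<open>Any \<open>w\<close> on the circle is reached by taking for \<open>y\<close>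
        its argument over \<open>\<epsilon>\<close>, so the bounds along the line apply.\<close>
      define y where "y = Arg w / \<epsilon> n"
      have w0: "w \<noteq> 0" using w e4 by auto
      have y: "\<bar>y\<bar> \<le> pi / \<epsilon> n"
        using Arg_bounded[of w] eps_pos[of n] by (simp add: y_def abs_divide divide_right_mono abs_le_iff)
      have wy: "1 + of_real (\<epsilon> n) * omega n y = w"
        using Arg_eq[OF w0] w eps_pos[of n] unfolding one_plus_omega by (simp add: y_def cis_conv_exp)
      have 1: "norm (N_prod (I n) (b n) z / N1 * z powi (- H1 n)) \<le> E n"
      proof -
        have "norm (N_prod (I n) (b n) z / N1 * z powi (- H1 n)) \<le> exp (g n * (- (ln q - 1 + 1 / q) / 2) + (g n - H1 n) * ln (q - delta))"
          unfolding N1_def using elim(1) by (intro N_far_bound z) auto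
        also have "\<dots> \<le> E n"
        proof -
          have "c / (\<epsilon> n)\<^sup>2 \<le> g n" using elim(1) eps_pos[of n] by (simp add: pos_divide_le_eq mult.commute)
          then have "r * (c / (\<epsilon> n)\<^sup>2) \<le> r * g n" using r by (intro mult_left_mono) auto
          moreover have "(g n - H1 n) * ln (q - delta) \<le> (\<bar>y1\<bar> + 1) / \<epsilon> n * \<bar>ln (q - delta)\<bar>"
          proof -
            have "\<bar>g n - H1 n\<bar> \<le> (\<bar>y1\<bar> + 1) / \<epsilon> n"
              using elim(1) eps_pos[of n] by (simp add: abs_mult pos_le_divide_eq mult.commute)
            then have "\<bar>g n - H1 n\<bar> * \<bar>ln (q - delta)\<bar> \<le> (\<bar>y1\<bar> + 1) / \<epsilon> n * \<bar>ln (q - delta)\<bar>" by (intro mult_right_mono) auto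
            moreover have "(g n - H1 n) * ln (q - delta) \<le> \<bar>g n - H1 n\<bar> * \<bar>ln (q - delta)\<bar>"
              unfolding abs_mult[symmetric] by (rule abs_ge_self)
            ultimately show ?thesis by (rule order_trans[rotated])
          qed
          moreover have "g n * (- (ln q - 1 + 1 / q) / 2) = - (r * g n)" by (simp add: r_def field_simps)
          moreover have "r * c / (\<epsilon> n)\<^sup>2 = r * (c / (\<epsilon> n)\<^sup>2)" by simp
          moreover have "(\<bar>y1\<bar> + 1) * \<bar>ln (q - delta)\<bar> / \<epsilon> n = (\<bar>y1\<bar> + 1) / \<epsilon> n * \<bar>ln (q - delta)\<bar>" by simp
          ultimately show ?thesis unfolding E_def exp_le_cancel_iff by linarith
        qed
        finally show ?thesis .
      qed
      have 2: "norm (inverse (N_local H2 n (omega n y))) \<le> B2"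
      proof -
        have "norm (inverse (N_local H2 n (omega n y))) \<le> B2 * exp (- (c2 * y\<^sup>2))" using elim(2) y by blast
        also have "\<dots> \<le> B2 * 1" using B2 by (intro mult_left_mono) auto
        finally show ?thesis by simp
      qed
      \<comment> \<open>The 13 is \<open>5 + 2 * 4\<close>: here
        \<open>\<bar>y\<bar> <= pi / \<epsilon> <= 4 / \<epsilon>\<close> and
        \<open>5 <= 5 / \<epsilon>\<close>.\<close>
      have 3: "norm (P_local s2 n (omega n y)) \<le> B3 * (13 / \<epsilon> n) ^ s2"
      proof -
        have "\<bar>y\<bar> \<le> 4 / \<epsilon> n"
          using y pi_less_4 eps_pos[of n] by (meson divide_right_mono less_imp_le order_trans)
        moreover have "5 \<le> 5 / \<epsilon> n" using e4 eps_pos[of n] by (simp add: pos_le_divide_eq)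
        ultimately have "5 + 2 * \<bar>y\<bar> \<le> 13 / \<epsilon> n" by (simp add: add_divide_distrib[symmetric])
        then have "B3 * (5 + 2 * \<bar>y\<bar>) ^ s2 \<le> B3 * (13 / \<epsilon> n) ^ s2" using B3 by (intro mult_left_mono power_mono) auto
        then show ?thesis using elim(3) by (meson order_trans)
      qed
      have 4: "norm (inverse (P_prod (p n) s1 z)) \<le> inverse (far_factor ^ s1)"
        unfolding norm_inverse using P_prod_far_lower_bound[OF sep z] far_factor_pos
        by (intro le_imp_inverse_le) auto
      have 5: "norm (inverse (z - w)) \<le> inverse delta"
        unfolding norm_inverse using far_integrand_continuous(2)[OF sep z w] delta by (intro le_imp_inverse_le) auto
      have 6: "norm (inverse w) \<le> 2"
      proof -
        have "inverse (norm w) \<le> inverse (1 / 2)" using w e4 by (intro le_imp_inverse_le) auto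
        then show ?thesis by (simp add: norm_inverse)
      qed
      have "f z w = (nu s2 n * (inverse (N_local H2 n (omega n y)) * P_local s2 n (omega n y) * inverse (P_prod (p n) s1 z) * inverse (z - w) * inverse w)) *
          (N_prod (I n) (b n) z / N1 * z powi (- H1 n))"
      proof -
        have pw: "w powi (H2 n - 1) = inverse (w powi (- H2 n)) * inverse w"
          using w0 by (simp add: power_int_diff power_int_minus divide_inverse)
        have gen: "v * (inverse (B / N * Y) * (P2 / v) * inverse P1 * inverse D * i) * (A / N * X) =
            A / B * (P2 / P1) * (1 / D) * X * (inverse Y * i)" if "v \<noteq> 0" "N \<noteq> 0" for v B N Y P1 P2 D A X i :: complex
        proof -
          have "v * (inverse (B / N * Y) * (P2 / v) * inverse P1 * inverse D * i) * (A / N * X) =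
            A / B * (P2 / P1) * (1 / D) * X * (inverse Y * i) * (inverse v * v) * (inverse N * N)"
            by (simp only: divide_inverse inverse_mult_distrib inverse_inverse_eq mult_1_left mult_ac)
          then show ?thesis using that by simp
        qed
        show ?thesis
          unfolding f_def edge_integrand_def N_local_def P_local_def wy pw N1_def
          by (rule gen[OF nu_nonzero N_one_nonzero, symmetric])
      qed
      then have "norm (f z w) = (norm (nu s2 n) * (norm (inverse (N_local H2 n (omega n y))) * norm (P_local s2 n (omega n y)) *
          norm (inverse (P_prod (p n) s1 z)) * norm (inverse (z - w)) * norm (inverse w))) *
          norm (N_prod (I n) (b n) z / N1 * z powi (- H1 n))"
        by (simp only: norm_mult)
      also have "\<dots> \<le> (norm (nu s2 n) * (B2 * (B3 * (13 / \<epsilon> n) ^ s2) * inverse (far_factor ^ s1) * inverse delta * 2)) * E n"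
        using 1 2 3 4 5 6 B2 B3 far_factor_pos delta eps_pos[of n]
        by (intro mult_mono mult_nonneg_nonneg norm_ge_zero order_refl) (auto intro: less_imp_le)
      also have "\<dots> = Q" unfolding Q_def by (simp add: power_divide divide_inverse power_mult_distrib power_inverse mult_ac)
      finally show ?thesis .
    qed
    have "norm (circle_integral 0 (1 - 2 * \<epsilon> n) (\<lambda>w. circle_integral (of_real q) delta (\<lambda>z. f z w))) \<le>
        (Q * (2 * pi * delta)) * (2 * pi * (1 - 2 * \<epsilon> n))"
    proof (rule norm_circle_integral_le)
      note cont = far_integrand_continuous(1)[OF sep, where ?s2.0 = s2 and ?h1.0 = "H1 n" and ?h2.0 = "H2 n", folded f_def]
      show "continuous_on (sphere 0 (1 - 2 * \<epsilon> n)) (\<lambda>w. circle_integral (of_real q) delta (\<lambda>z. f z w))"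
        using continuous_on_circle_integral_param[OF continuous_on_swap_args[OF cont]] delta by simp
      fix w :: complex assume "w \<in> sphere 0 (1 - 2 * \<epsilon> n)"
      then have w: "norm w = 1 - 2 * \<epsilon> n" by simp
      show "norm (circle_integral (of_real q) delta (\<lambda>z. f z w)) \<le> Q * (2 * pi * delta)"
      proof (rule norm_circle_integral_le)
        have "continuous_on (sphere (of_real q) delta) (\<lambda>z. (\<lambda>(z, w). f z w) (z, w))"
          by (rule continuous_on_compose2[OF cont]) (use w in \<open>auto intro!: continuous_intros\<close>)
        then show "continuous_on (sphere (of_real q) delta) (\<lambda>z. f z w)" by simp
      qed (use fb[OF _ w] Q0 delta in auto)
    qed (use e4 Q0 delta in auto)
    also have "\<dots> \<le> (Q * (2 * pi * delta)) * (2 * pi * 1)"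
      using Q0 delta eps_pos[of n] by (intro mult_left_mono) auto
    finally have int: "norm (circle_integral 0 (1 - 2 * \<epsilon> n) (\<lambda>w. circle_integral (of_real q) delta (\<lambda>z. f z w))) \<le>
        (Q * (2 * pi * delta)) * (2 * pi)" by simp
    have "norm (1 / of_real (\<epsilon> n) * (nu s1 n / nu s2 n) *
      circle_integral 0 (1 - 2 * \<epsilon> n) (\<lambda>w. circle_integral (of_real q) delta (\<lambda>z. f z w))) \<le>
      (1 / \<epsilon> n * ((1 + \<bar>1 - \<kappa>\<bar>) ^ s1 / norm (nu s2 n))) * ((Q * (2 * pi * delta)) * (2 * pi))"
      unfolding norm_mult norm_divide using int nu_bound[of n s1] e4 eps_pos[of n]
      by (intro mult_mono divide_right_mono mult_nonneg_nonneg divide_nonneg_nonneg) auto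
    also have "\<dots> = K * ((1 / \<epsilon> n) ^ (s2 + 1) * E n)"
    proof -
      have "norm (nu s2 n) \<noteq> 0" using nu_nonzero by simp
      then show ?thesis by (simp add: K_def Q_def field_simps)
    qed
    finally show ?case unfolding f_def .
  qed
  have "(\<lambda>n. K * ((1 / \<epsilon> n) ^ (s2 + 1) * E n)) \<longlonglongrightarrow> K * 0"
  proof (intro tendsto_mult tendsto_const)
    show "(\<lambda>n. (1 / \<epsilon> n) ^ (s2 + 1) * E n) \<longlonglongrightarrow> 0"
      unfolding E_def by (rule tendsto_exp_neg_over_square[OF eps_pos eps_lim]) (use r c in simp)
  qed
  then have "(\<lambda>n. K * ((1 / \<epsilon> n) ^ (s2 + 1) * E n)) \<longlonglongrightarrow> 0" by simp
  with bound show ?thesis by (rule Lim_null_comparison)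
qed

end

section \<open>The diagonal term\<close>

lemma uniform_limit_contour_residue:
  "circle_integral 0 1 (\<lambda>\<zeta>. exp (of_real y * \<zeta>) * \<zeta> powi (- int k)) =
    2 * pi * \<i> * (if k = 0 then 0 else of_real y ^ (k - 1) / fact (k - 1))"
proof -
  have "circle_integral 0 1 (\<lambda>\<zeta>. exp (of_real y * \<zeta>) * \<zeta> powi (- int k)) =
    2 * pi * \<i> * (\<Sum>p | p \<in> {0} \<and> dist 0 p < 1. residue (\<lambda>\<zeta>. exp (of_real y * \<zeta>) * \<zeta> powi (- int k)) p)"
    by (rule circle_integral_residues) (auto intro!: holomorphic_intros)
  moreover have "{p. p \<in> {0::complex} \<and> dist 0 p < 1} = {0}" by auto
  ultimately show ?thesis by (simp only: residue_exp_over_power sum.insert finite.emptyI empty_iff sum.empty not_False_eq_True add_0_right)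
qed

text \<open>Only for \<open>y2 < y1\<close> is the line closed around the pole, so the principal
  value is a one-sided power function. The excluded case, equal heights with powers differing by 1,
  is the jump of that function.\<close>

lemma residue_term_value:
  assumes "n2 < n1" "y1 \<noteq> y2 \<or> n2 + 2 \<le> n1"
  shows "residue_term n1 n2 y1 y2 =
    (if y2 < y1 then of_real (y2 - y1) ^ (n1 - n2 - 1) / fact (n1 - n2 - 1) else 0)"
proof -
  have e: "- int n1 + int n2 = - int (n1 - n2)" using assms(1) by simp
  have "((\<lambda>R::real. contour_integral (linepath (Complex (-1) R) (Complex (-1) (- R)))
      (\<lambda>\<zeta>. exp (of_real (y2 - y1) * \<zeta>) * \<zeta> powi (- int n1 + int n2))) \<longlongrightarrow>
    (if y2 - y1 < 0 then 2 * pi * \<i> * (of_real (y2 - y1) ^ (n1 - n2 - 1) / fact (n1 - n2 - 1)) else 0)) at_top"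
    unfolding e by (rule vertical_line_integral_limit) (use assms in auto)
  from tendsto_Lim[OF trivial_limit_at_top_linorder this] show ?thesis
    unfolding residue_term_def by simp
qed

context edge_data
begin

lemma norm_nu: "norm (nu s n) = \<epsilon> n ^ near_count s * \<bar>1 - \<kappa>\<bar> ^ card {j. j < s \<and> j \<notin> T}"
proof -
  have "norm (nu s n) = (\<Prod>j<s. if j \<in> T then \<epsilon> n else \<bar>1 - \<kappa>\<bar>)"
    unfolding nu_def prod_norm[symmetric] using eps_pos[of n]
    by (intro prod.cong) (auto simp del: of_real_diff)
  also have "\<dots> = \<epsilon> n ^ near_count s * \<bar>1 - \<kappa>\<bar> ^ card {j. j < s \<and> j \<notin> T}"
    by (simp add: prod.If_cases near_count_def Int_def)
  finally show ?thesis .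
qed

lemma near_count_mono: "s \<le> s' \<Longrightarrow> near_count s \<le> near_count s'"
  unfolding near_count_def by (intro card_mono) auto

lemma norm_nu_quotient:
  assumes "s2 \<le> s1"
  shows "norm (nu s1 n / nu s2 n) = \<epsilon> n ^ (near_count s1 - near_count s2) *
    (\<bar>1 - \<kappa>\<bar> ^ card {j. j < s1 \<and> j \<notin> T} / \<bar>1 - \<kappa>\<bar> ^ card {j. j < s2 \<and> j \<notin> T})"
  using near_count_mono[OF assms] eps_pos[of n] by (simp add: norm_divide norm_nu power_diff)

text \<open>The diagonal integrand is a quotient of two terms \<open>N_local / P_local\<close> with
  the same \<open>N_prod\<close>, so it inherits their uniform limits. The Gaussians cancel, and the
  integral of \<open>exp ((y2 - y1) * \<zeta>) / \<zeta> ^ k\<close> over the unit circle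
  remains.\<close>

lemma diagonal_near_limit:
  assumes H1: "scaled_height H1 y1" and H2: "scaled_height H2 y2" and s: "s2 \<le> s1"
  defines "k \<equiv> near_count s1 - near_count s2"
  shows "(\<lambda>n. 1 / of_real (\<epsilon> n) * (nu s1 n / nu s2 n) *
      circle_integral 1 (\<epsilon> n) (diagonal_integrand (p n) s1 s2 (H1 n) (H2 n))) \<longlonglongrightarrow>
    2 * pi * \<i> * (if k = 0 then 0 else of_real (y2 - y1) ^ (k - 1) / fact (k - 1))"
proof -
  define G where "G = (\<lambda>n \<zeta>. (N_local H1 n \<zeta> / P_local s1 n \<zeta>) / (N_local H2 n \<zeta> / P_local s2 n \<zeta>) * inverse (1 + \<zeta> * of_real (\<epsilon> n)))"
  define l where "l = (\<lambda>H y s (\<zeta>::complex). exp (of_real (\<sigma> / 2) * \<zeta>\<^sup>2 - of_real y * \<zeta>) / \<zeta> ^ near_count s)"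
  have gd: "\<forall>\<^sub>F n in sequentially. good s1 n \<and> good s2 n \<and> 3 * \<epsilon> n < 1 - \<beta>"
    using eventually_good[of s1] eventually_good[of s2] eventually_separated_poles[of s1]
    by eventually_elim (simp add: separated_poles_def)
  have bl: "bounded ((\<lambda>\<zeta>. exp (of_real (\<sigma> / 2) * \<zeta>\<^sup>2 - of_real y * \<zeta>) / \<zeta> ^ k) ` sphere (0::complex) 1)" for y k
    by (intro compact_imp_bounded compact_continuous_image continuous_intros) auto
  \<comment> \<open>A lower bound on the unit circle for the limit of the denominator, as required
    for a uniform limit of quotients.\<close>
  define B where "B = exp (- (\<bar>\<sigma>\<bar> / 2 + \<bar>y2\<bar>))"
  have low: "B \<le> norm (exp (of_real (\<sigma> / 2) * \<zeta>\<^sup>2 - of_real y2 * \<zeta>) / \<zeta> ^ near_count s2)" if "\<zeta> \<in> sphere 0 1" for \<zeta> :: complex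
  proof -
    have "norm (of_real (\<sigma> / 2) * \<zeta>\<^sup>2 - of_real y2 * \<zeta>) \<le> \<bar>\<sigma>\<bar> / 2 + \<bar>y2\<bar>"
      using norm_triangle_ineq4[of "of_real (\<sigma> / 2) * \<zeta>\<^sup>2" "of_real y2 * \<zeta>"] that by (simp add: norm_mult norm_power norm_divide)
    then have "- (\<bar>\<sigma>\<bar> / 2 + \<bar>y2\<bar>) \<le> Re (of_real (\<sigma> / 2) * \<zeta>\<^sup>2 - of_real y2 * \<zeta>)"
      using abs_Re_le_cmod[of "of_real (\<sigma> / 2) * \<zeta>\<^sup>2 - of_real y2 * \<zeta>"] by linarith
    then show ?thesis unfolding B_def norm_divide norm_exp_eq_Re using that by (simp add: norm_power)
  qed
  have ul0: "uniform_limit (sphere 0 1) G (\<lambda>\<zeta>. (exp (of_real (\<sigma> / 2) * \<zeta>\<^sup>2 - of_real y1 * \<zeta>) / \<zeta> ^ near_count s1) /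
      (exp (of_real (\<sigma> / 2) * \<zeta>\<^sup>2 - of_real y2 * \<zeta>) / \<zeta> ^ near_count s2) * inverse (1 + \<zeta> * 0)) sequentially"
    unfolding G_def
  proof (rule uniform_lim_mult)
    show "uniform_limit (sphere 0 1) (\<lambda>n \<zeta>. N_local H1 n \<zeta> / P_local s1 n \<zeta> / (N_local H2 n \<zeta> / P_local s2 n \<zeta>))
      (\<lambda>\<zeta>. (exp (of_real (\<sigma> / 2) * \<zeta>\<^sup>2 - of_real y1 * \<zeta>) / \<zeta> ^ near_count s1) /
      (exp (of_real (\<sigma> / 2) * \<zeta>\<^sup>2 - of_real y2 * \<zeta>) / \<zeta> ^ near_count s2)) sequentially"
      by (rule uniform_lim_divide[OF uniform_limit_quotient[OF H1] uniform_limit_quotient[OF H2] bl low]) (simp_all add: B_def)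
    show "bounded ((\<lambda>\<zeta>. exp (of_real (\<sigma> / 2) * \<zeta>\<^sup>2 - of_real y1 * \<zeta>) / \<zeta> ^ near_count s1 /
      (exp (of_real (\<sigma> / 2) * \<zeta>\<^sup>2 - of_real y2 * \<zeta>) / \<zeta> ^ near_count s2)) ` sphere (0::complex) 1)"
      by (intro compact_imp_bounded compact_continuous_image continuous_intros) auto
    have "uniform_limit (sphere 0 1) (\<lambda>n \<zeta>::complex. 1 + \<zeta> * of_real (\<epsilon> n)) (\<lambda>\<zeta>. 1 + \<zeta> * of_real 0) sequentially"
    proof (intro uniform_limit_add uniform_limit_const uniform_lim_mult uniform_limit_of_tendsto tendsto_of_real eps_lim)
      show "bounded ((\<lambda>x::complex. complex_of_real 0) ` sphere 0 1)" by (rule bounded_subset[of "{0}"]) auto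
    qed (auto simp: uniform_limit_iff)
    from uniform_lim_inverse[OF this, of 1]
    show "uniform_limit (sphere 0 1) (\<lambda>n \<zeta>::complex. inverse (1 + \<zeta> * of_real (\<epsilon> n))) (\<lambda>\<zeta>. inverse (1 + \<zeta> * 0)) sequentially"
      by (simp add: o_def)
    show "bounded ((\<lambda>\<zeta>::complex. inverse (1 + \<zeta> * 0)) ` sphere (0::complex) 1)" by (rule bounded_subset[of "{1}"]) auto
  qed
  have "(exp (of_real (\<sigma> / 2) * \<zeta>\<^sup>2 - of_real y1 * \<zeta>) / \<zeta> ^ near_count s1) /
      (exp (of_real (\<sigma> / 2) * \<zeta>\<^sup>2 - of_real y2 * \<zeta>) / \<zeta> ^ near_count s2) * inverse (1 + \<zeta> * 0) =
      exp (of_real (y2 - y1) * \<zeta>) * \<zeta> powi (- int k)" if "\<zeta> \<in> sphere 0 1" for \<zeta> :: complex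
  proof -
    have z: "\<zeta> \<noteq> 0" using that by auto
    have z1: "\<zeta> ^ near_count s1 = \<zeta> ^ near_count s2 * \<zeta> ^ k"
      using near_count_mono[OF s] by (simp add: k_def flip: power_add)
    have z2: "\<zeta> powi (- int k) = inverse (\<zeta> ^ k)" by (simp add: power_int_minus)
    have z3: "exp (of_real (\<sigma> / 2) * \<zeta>\<^sup>2 - of_real y1 * \<zeta>) = exp (of_real (y2 - y1) * \<zeta>) * exp (of_real (\<sigma> / 2) * \<zeta>\<^sup>2 - of_real y2 * \<zeta>)"
      unfolding exp_add[symmetric] by (rule arg_cong[of _ _ exp]) (simp add: algebra_simps)
    have gen: "E * E2 / (Zb * Zk) / (E2 / Zb) = E * inverse Zk" if "E2 \<noteq> 0" "Zb \<noteq> 0" for E E2 Zb Zk :: complex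
      using that by (cases "Zk = 0") (simp_all add: field_simps)
    show ?thesis
      unfolding z1 z2 z3 mult_zero_right add_0_right inverse_1 mult_1_right by (rule gen) (use z in simp_all)
  qed
  note eq = this
  have ul: "uniform_limit (sphere 0 1) G (\<lambda>\<zeta>. exp (of_real (y2 - y1) * \<zeta>) * \<zeta> powi (- int k)) sequentially"
  proof (rule uniform_limitI)
    fix e :: real assume "0 < e"
    from uniform_limitD[OF ul0 this]
    show "\<forall>\<^sub>F n in sequentially. \<forall>\<zeta>\<in>sphere 0 1. dist (G n \<zeta>) (exp (of_real (y2 - y1) * \<zeta>) * \<zeta> powi (- int k)) < e"
    proof (eventually_elim, intro ballI)
      fix n and \<zeta> :: complex
      assume "\<forall>x\<in>sphere 0 1. dist (G n x) (exp (of_real (\<sigma> / 2) * x\<^sup>2 - of_real y1 * x) / x ^ near_count s1 /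
         (exp (of_real (\<sigma> / 2) * x\<^sup>2 - of_real y2 * x) / x ^ near_count s2) * inverse (1 + x * 0)) < e"
        and z: "\<zeta> \<in> sphere 0 1"
      from this(1)[rule_format, OF z] show "dist (G n \<zeta>) (exp (of_real (y2 - y1) * \<zeta>) * \<zeta> powi (- int k)) < e"
        unfolding eq[OF z] .
    qed
  qed
  have cont: "\<forall>\<^sub>F n in sequentially. G n contour_integrable_on circlepath 0 1 \<and>
     1 / of_real (\<epsilon> n) * (nu s1 n / nu s2 n) * circle_integral 1 (\<epsilon> n) (diagonal_integrand (p n) s1 s2 (H1 n) (H2 n)) = circle_integral 0 1 (G n)"
    using gd
  proof eventually_elim
    case (elim n)
    then have g1: "good s1 n" and g2: "good s2 n" and e: "3 * \<epsilon> n < 1 - \<beta>" by auto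
    have nz: "1 + of_real (\<epsilon> n) * \<zeta> \<noteq> 0 \<and> N_prod (I n) (b n) (1 + of_real (\<epsilon> n) * \<zeta>) \<noteq> 0" if "norm \<zeta> = 1" for \<zeta> :: complex
    proof -
      have n: "1 - \<epsilon> n \<le> norm (1 + of_real (\<epsilon> n) * \<zeta>)"
        using norm_triangle_ineq4[of "1 + of_real (\<epsilon> n) * \<zeta>" "of_real (\<epsilon> n) * \<zeta>"] that eps_pos[of n] by (simp add: norm_mult)
      have pos: "0 < norm (1 + of_real (\<epsilon> n) * \<zeta>)" "\<beta> < norm (1 + of_real (\<epsilon> n) * \<zeta>)" using n e eps_pos[of n] beta by linarith+
      have "N_prod (I n) (b n) (1 + of_real (\<epsilon> n) * \<zeta>) \<noteq> 0"
        by (rule N_prod_nonzero_norm[OF finite_I pos(1)]) (use b_nonneg b_le pos(2) in fastforce)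
      then show ?thesis using pos by auto
    qed
    have NL: "N_local H2 n \<zeta> \<noteq> 0" if "norm \<zeta> = 1" for \<zeta>
      using nz[OF that] N_one_nonzero by (simp add: N_local_def)
    have PL: "P_local s1 n \<zeta> \<noteq> 0" "P_local s2 n \<zeta> \<noteq> 0" if "norm \<zeta> = 1" for \<zeta>
      using g1 g2 that by (auto simp: good_def)
    have "continuous_on (sphere 0 1) (G n)"
      unfolding G_def using NL PL nz
      by (intro continuous_intros continuous_on_local_quotient g1 g2) (auto simp: mult.commute)
    then have "G n contour_integrable_on circlepath 0 1"
      by (intro contour_integrable_continuous_circlepath) simp
    moreover have "1 / of_real (\<epsilon> n) * (nu s1 n / nu s2 n) * circle_integral 1 (\<epsilon> n) (diagonal_integrand (p n) s1 s2 (H1 n) (H2 n)) = circle_integral 0 1 (G n)"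
      unfolding circle_integral_affine[of 1 "\<epsilon> n"] circle_integral_cmult[symmetric]
    proof (rule contour_integral_cong[OF refl])
      fix \<zeta> assume "\<zeta> \<in> path_image (circlepath 0 1)"
      then have z: "norm \<zeta> = 1" by simp
      define x where "x = 1 + of_real (\<epsilon> n) * \<zeta>"
      have x: "x \<noteq> 0" "N_prod (I n) (b n) x \<noteq> 0" using nz[OF z] by (simp_all add: x_def)
      have pw: "x powi (H2 n - H1 n - 1) = x powi (- H1 n) / x powi (- H2 n) * inverse x"
        using x by (simp add: power_int_diff power_int_minus divide_inverse mult_ac)
      have G: "G n \<zeta> = (N_prod (I n) (b n) x / N_prod (I n) (b n) 1 * x powi (- H1 n) / (P_prod (p n) s1 x / nu s1 n)) /
          (N_prod (I n) (b n) x / N_prod (I n) (b n) 1 * x powi (- H2 n) / (P_prod (p n) s2 x / nu s2 n)) * inverse x"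
        by (simp add: G_def N_local_def P_local_def x_def mult.commute)
      have gen: "(N / N1 * X1 / (P1 / v1)) / (N / N1 * X2 / (P2 / v2)) * i = 1 / e * (v1 / v2) * (e * (P2 / P1 * (X1 / X2 * i)))"
        if "N \<noteq> 0" "N1 \<noteq> 0" "e \<noteq> 0" for N N1 X1 P1 v1 X2 P2 v2 i e :: complex
      proof -
        have "(N / N1 * X1 / (P1 / v1)) / (N / N1 * X2 / (P2 / v2)) * i * (inverse e * e) =
          1 / e * (v1 / v2) * (e * (P2 / P1 * (X1 / X2 * i))) * (inverse N * N) * (inverse N1 * N1)"
          by (simp only: divide_inverse inverse_mult_distrib inverse_inverse_eq mult_1_left mult_ac)
        then show ?thesis using that by simp
      qed
      show "1 / of_real (\<epsilon> n) * (nu s1 n / nu s2 n) * (of_real (\<epsilon> n) * diagonal_integrand (p n) s1 s2 (H1 n) (H2 n) (1 + of_real (\<epsilon> n) * \<zeta>)) = G n \<zeta>"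
        unfolding G diagonal_integrand_def x_def[symmetric] pw
        by (rule gen[OF x(2) N_one_nonzero, symmetric]) (use eps_pos[of n] in simp)
    qed
    ultimately show ?case by blast
  qed
  have "(\<lambda>n. circle_integral 0 1 (G n)) \<longlonglongrightarrow> circle_integral 0 1 (\<lambda>\<zeta>. exp (of_real (y2 - y1) * \<zeta>) * \<zeta> powi (- int k))"
    by (rule contour_integral_uniform_limit_circlepath(2)[OF _ ul]) (use cont in \<open>auto elim: eventually_mono\<close>)
  moreover have "\<forall>\<^sub>F n in sequentially. circle_integral 0 1 (G n) =
     1 / of_real (\<epsilon> n) * (nu s1 n / nu s2 n) * circle_integral 1 (\<epsilon> n) (diagonal_integrand (p n) s1 s2 (H1 n) (H2 n))"
    using cont by eventually_elim simp
  ultimately show ?thesis unfolding uniform_limit_contour_residue by (rule Lim_transform_eventually)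
qed

lemma P_quotient_tendsto_zero:
  fixes r :: "nat \<Rightarrow> real"
  assumes "s2 < s1" "\<And>j. 0 < r j"
  shows "((\<lambda>z. P_prod r s2 z / P_prod r s1 z) \<longlongrightarrow> 0) at_infinity"
proof -
  have inv: "((\<lambda>z. inverse z) \<longlongrightarrow> (0::complex)) at_infinity"
    by (rule tendsto_inverse_0)
  have one: "((\<lambda>z. inverse (1 - z * complex_of_real (r j))) \<longlongrightarrow> 0) at_infinity" for j
  proof -
    have "((\<lambda>z. inverse z * inverse (inverse z - of_real (r j))) \<longlongrightarrow> 0 * inverse (0 - complex_of_real (r j))) at_infinity"
      using assms(2)[of j] by (intro tendsto_intros inv) auto
    moreover have "\<forall>\<^sub>F z in at_infinity. inverse z * inverse (inverse z - complex_of_real (r j)) =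
        inverse (1 - z * of_real (r j))"
      using eventually_not_equal_at_infinity[of "0::complex"]
    proof eventually_elim
      fix z :: complex assume "z \<noteq> 0"
      then have "1 - z * of_real (r j) = z * (inverse z - of_real (r j))"
        by (simp add: right_diff_distrib)
      then show "inverse z * inverse (inverse z - of_real (r j)) = inverse (1 - z * of_real (r j))"
        by simp
    qed
    ultimately show ?thesis by (auto intro: Lim_transform_eventually)
  qed
  have "((\<lambda>z. \<Prod>j\<in>{s2..<s1}. inverse (1 - z * complex_of_real (r j))) \<longlongrightarrow> (\<Prod>j\<in>{s2..<s1}. 0)) at_infinity"
    by (intro tendsto_prod one)
  then have lim: "((\<lambda>z. \<Prod>j\<in>{s2..<s1}. inverse (1 - z * complex_of_real (r j))) \<longlongrightarrow> 0) at_infinity"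
    using assms(1) by (simp add: zero_power)
  have "\<forall>\<^sub>F z in at_infinity. \<forall>x\<in>P_zeros r s2. z \<noteq> x"
    by (intro eventually_ball_finite finite_P_zeros ballI eventually_not_equal_at_infinity)
  then have "\<forall>\<^sub>F z in at_infinity. (\<Prod>j\<in>{s2..<s1}. inverse (1 - z * complex_of_real (r j))) = P_prod r s2 z / P_prod r s1 z"
  proof eventually_elim
    fix z assume "\<forall>x\<in>P_zeros r s2. z \<noteq> x"
    then have "P_prod r s2 z \<noteq> 0" using assms(2) by (intro P_prod_nonzero) auto
    moreover have "P_prod r s1 z = P_prod r s2 z * (\<Prod>j\<in>{s2..<s1}. 1 - z * of_real (r j))"
      using assms(1) unfolding P_prod_def
      by (subst prod.union_disjoint[symmetric]) (auto intro!: prod.cong)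
    ultimately show "(\<Prod>j\<in>{s2..<s1}. inverse (1 - z * complex_of_real (r j))) = P_prod r s2 z / P_prod r s1 z"
      by (simp add: prod_inversef[symmetric, unfolded o_def] divide_inverse)
  qed
  with lim show ?thesis by (rule Lim_transform_eventually)
qed

text \<open>For \<open>h2 > h1\<close> there is no pole at 0, so the circle is contracted and meets
  only zeros near \<open>q < 1\<close>. For \<open>h2 <= h1\<close> the integrand decays at
  infinity, so the circle is blown up and meets the zeros near 1 and those near
  \<open>q > 1\<close>.\<close>

lemma diagonal_circle_cases:
  fixes h1 h2 :: int
  assumes sep: "separated_poles s1 n" and s: "s2 < s1"
  defines "f \<equiv> diagonal_integrand (p n) s1 s2 h1 h2"
  shows "1 \<le> h2 - h1 \<Longrightarrow> circle_integral 0 (1 - 2 * \<epsilon> n) f = (if q < 1 then circle_integral (of_real q) delta f else 0)"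
    and "h2 - h1 \<le> 0 \<Longrightarrow> circle_integral 0 (1 - 2 * \<epsilon> n) f =
      - circle_integral 1 (\<epsilon> n) f - (if 1 < q then circle_integral (of_real q) delta f else 0)"
proof -
  define Z where "Z = P_zeros (p n) s1"
  define \<rho> where "\<rho> = 1 - 2 * \<epsilon> n"
  have e4: "\<epsilon> n < 1 / 4" "4 * \<epsilon> n < \<bar>q - 1\<bar> / 2 - delta" using sep by (simp_all add: separated_poles_def good_def)
  \<comment> \<open>A zero near 1 lies outside the circle of radius \<open>\<rho>\<close>; one near
    \<open>q\<close> lies inside or outside according as \<open>q\<close> is below or above
    1.\<close>
  have zer: "\<rho> < norm x \<and> dist 1 x < \<epsilon> n \<and> delta < dist (of_real q) x \<or>
      \<epsilon> n < dist 1 x \<and> dist (of_real q) x < delta \<and> (if q < 1 then norm x < \<rho> else \<rho> < norm x)" if x: "x \<in> Z" for x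
  proof -
    from x obtain j where j: "j < s1" "x = of_real (1 / p n j)" by (auto simp: P_zeros_def Z_def)
    have d: "dist 1 x = \<bar>1 / p n j - 1\<bar>" "dist (of_real q) x = \<bar>1 / p n j - q\<bar>" "norm x = 1 / p n j"
      using p_pos[of n j] dist_of_real[of 1 "1 / p n j", where 'a = complex]
        dist_of_real[of q "1 / p n j", where 'a = complex]
      unfolding j(2) by (simp_all add: dist_real_def abs_minus_commute norm_divide)
    show ?thesis
    proof (cases "j \<in> T")
      case True
      then have "\<bar>1 / p n j - 1\<bar> < \<epsilon> n" using separated_polesD[OF sep j(1)] by simp
      then have n: "\<rho> < norm x" "dist 1 x < \<epsilon> n"
        using eps_pos[of n] unfolding d \<rho>_def by linarith+
      have "delta < X" if "Q \<le> B + X" "B < e" "4 * e < Q / 2 - delta" "0 < e" for Q X B e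
        using that delta(1) by linarith
      from this[of "\<bar>q - 1\<bar>" "dist 1 x" "dist (of_real q) x" "\<epsilon> n"] n(2) e4(2) eps_pos[of n]
      have "delta < dist (of_real q) x" unfolding d by linarith
      then show ?thesis using n by blast
    next
      case False
      then have a: "\<bar>1 / p n j - q\<bar> < delta / 2" using separated_polesD[OF sep j(1)] by simp
      then have "dist (of_real q) x < delta"
        using delta(1) unfolding d by linarith
      moreover have "e < X" if "Q \<le> B + X" "B < delta / 2" "4 * e < Q / 2 - delta" "0 < e" for Q X B e
        using that delta(1) by linarith
      from this[of "\<bar>q - 1\<bar>" "dist (of_real q) x" "dist 1 x" "\<epsilon> n"] a e4(2) eps_pos[of n]
      have "\<epsilon> n < dist 1 x" unfolding d by linarith
      moreover have "if q < 1 then norm x < \<rho> else \<rho> < norm x"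
      proof (cases "q < 1")
        case True
        then have "\<bar>q - 1\<bar> = 1 - q" by simp
        then have "norm x < \<rho>" using a e4(2) eps_pos[of n] delta(1) unfolding d \<rho>_def by argo
        then show ?thesis using True by simp
      next
        case False
        then have "\<bar>q - 1\<bar> = q - 1" by simp
        then have "\<rho> < norm x" using a e4(2) eps_pos[of n] delta(1) unfolding d \<rho>_def by argo
        then show ?thesis using False by simp
      qed
      ultimately show ?thesis by blast
    qed
  qed
  define R1 where "R1 = (\<Sum>x | x \<in> Z \<and> dist 1 x < \<epsilon> n. residue f x)"
  define R2 where "R2 = (\<Sum>x | x \<in> Z \<and> dist (of_real q) x < delta. residue f x)"
  have finZ: "finite Z" by (simp add: Z_def)
  have Pz: "P_prod (p n) s1 z \<noteq> 0" if "z \<notin> Z" for z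
    using that unfolding Z_def by (intro P_prod_nonzero p_pos)
  have rpos: "0 < \<rho>" "0 < \<epsilon> n" "\<epsilon> n < 1" using e4 eps_pos[of n] by (simp_all add: \<rho>_def)
  have Zq: "{x. x \<in> Z \<and> dist 0 x < \<rho>} = (if q < 1 then {x. x \<in> Z \<and> dist (of_real q) x < delta} else {})"
    using zer by (auto split: if_splits; fastforce)
  have dq0: "dist (of_real q) (0::complex) = q" using q by simp
  show "circle_integral 0 (1 - 2 * \<epsilon> n) f = (if q < 1 then circle_integral (of_real q) delta f else 0)" if A: "1 \<le> h2 - h1"
  proof -
    have hol: "f holomorphic_on - Z"
      unfolding f_def diagonal_integrand_def
      by (intro holomorphic_intros holomorphic_P_prod) (use A Pz in auto)
    have "circle_integral 0 \<rho> f = 2 * pi * \<i> * (\<Sum>x | x \<in> Z \<and> dist 0 x < \<rho>. residue f x)"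
      by (rule circle_integral_residues[OF finZ hol rpos(1)]) (use zer in \<open>force split: if_splits\<close>)
    moreover have "circle_integral (of_real q) delta f = 2 * pi * \<i> * R2"
      unfolding R2_def by (rule circle_integral_residues[OF finZ hol delta(1)]) (use zer in force)
    ultimately show ?thesis
      unfolding \<rho>_def[symmetric] by (cases "q < 1") (simp_all only: Zq R2_def if_True if_False sum.empty mult_zero_right)
  qed
  show "circle_integral 0 (1 - 2 * \<epsilon> n) f = - circle_integral 1 (\<epsilon> n) f - (if 1 < q then circle_integral (of_real q) delta f else 0)"
    if A: "h2 - h1 \<le> 0"
  proof -
    define Z0 where "Z0 = insert 0 Z"
    have fin: "finite Z0" using finZ by (simp add: Z0_def)
    have zZ: "0 \<notin> Z" using zer[of 0] rpos delta dq0 by auto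
    have hol: "f holomorphic_on - Z0"
      unfolding f_def diagonal_integrand_def
      by (intro holomorphic_intros holomorphic_P_prod) (use Pz in \<open>auto simp: Z0_def\<close>)
    have decay: "((\<lambda>z. z * f z) \<longlongrightarrow> 0) at_infinity"
    proof -
      have "((\<lambda>z. (P_prod (p n) s2 z / P_prod (p n) s1 z) * inverse z ^ nat (h1 - h2)) \<longlongrightarrow> 0 * 0 ^ nat (h1 - h2)) at_infinity"
        by (intro tendsto_mult tendsto_power P_quotient_tendsto_zero s p_pos tendsto_inverse_0)
      moreover have "\<forall>\<^sub>F z in at_infinity. (P_prod (p n) s2 z / P_prod (p n) s1 z) * inverse z ^ nat (h1 - h2) = z * f z"
        using eventually_not_equal_at_infinity[of "0::complex"]
      proof eventually_elim
        fix z :: complex assume z: "z \<noteq> 0"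
        have "z powi (h2 - h1 - 1) = z powi (h2 - h1) * inverse z" using z by (simp add: power_int_diff divide_inverse)
        moreover have "z powi (h2 - h1) = inverse z ^ nat (h1 - h2)" using A by (auto simp: power_int_def)
        ultimately show "(P_prod (p n) s2 z / P_prod (p n) s1 z) * inverse z ^ nat (h1 - h2) = z * f z"
          using z by (simp add: f_def diagonal_integrand_def)
      qed
      ultimately show ?thesis by (auto intro: Lim_transform_eventually)
    qed
    have "circle_integral 0 \<rho> f = 2 * pi * \<i> * (\<Sum>x | x \<in> Z0 \<and> dist 0 x < \<rho>. residue f x)"
      by (rule circle_integral_residues[OF fin hol rpos(1)]) (use zer rpos in \<open>force simp: Z0_def split: if_splits\<close>)
    also have "{x. x \<in> Z0 \<and> dist 0 x < \<rho>} = insert 0 {x. x \<in> Z \<and> dist 0 x < \<rho>}"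
      using rpos by (auto simp: Z0_def)
    also have "(\<Sum>x\<in>insert 0 {x. x \<in> Z \<and> dist 0 x < \<rho>}. residue f x) = residue f 0 + (if q < 1 then R2 else 0)"
      using finZ zZ Zq by (simp add: R2_def)
    finally have I0: "circle_integral 0 \<rho> f = 2 * pi * \<i> * (residue f 0 + (if q < 1 then R2 else 0))" .
    have "circle_integral 1 (\<epsilon> n) f = 2 * pi * \<i> * (\<Sum>x | x \<in> Z0 \<and> dist 1 x < \<epsilon> n. residue f x)"
      by (rule circle_integral_residues[OF fin hol rpos(2)]) (use zer rpos in \<open>force simp: Z0_def\<close>)
    also have "{x. x \<in> Z0 \<and> dist 1 x < \<epsilon> n} = {x. x \<in> Z \<and> dist 1 x < \<epsilon> n}" using rpos by (auto simp: Z0_def)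
    finally have I1: "circle_integral 1 (\<epsilon> n) f = 2 * pi * \<i> * R1" by (simp add: R1_def)
    have "circle_integral (of_real q) delta f = 2 * pi * \<i> * (\<Sum>x | x \<in> Z0 \<and> dist (of_real q) x < delta. residue f x)"
      by (rule circle_integral_residues[OF fin hol delta(1)]) (use zer delta dq0 in \<open>force simp: Z0_def\<close>)
    also have "{x. x \<in> Z0 \<and> dist (of_real q) x < delta} = {x. x \<in> Z \<and> dist (of_real q) x < delta}"
      using delta dq0 by (auto simp: Z0_def)
    finally have Iq: "circle_integral (of_real q) delta f = 2 * pi * \<i> * R2" by (simp add: R2_def)
    have "(\<Sum>x\<in>Z0. residue f x) = 0" by (rule sum_residues_zero[OF fin hol decay])
    moreover have "(\<Sum>x\<in>Z0. residue f x) = residue f 0 + (R1 + R2)"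
    proof -
      have "Z = {x. x \<in> Z \<and> dist 1 x < \<epsilon> n} \<union> {x. x \<in> Z \<and> dist (of_real q) x < delta}" using zer by blast
      then have "(\<Sum>x\<in>Z. residue f x) = (\<Sum>x\<in>{x. x \<in> Z \<and> dist 1 x < \<epsilon> n} \<union> {x. x \<in> Z \<and> dist (of_real q) x < delta}. residue f x)"
        by (rule arg_cong)
      also have "\<dots> = R1 + R2"
        unfolding R1_def R2_def
      proof (rule sum.union_disjoint)
        have "\<not> (dist 1 x < \<epsilon> n \<and> dist (of_real q) x < delta)" if "x \<in> Z" for x using zer[OF that] by linarith
        then show "{x. x \<in> Z \<and> dist 1 x < \<epsilon> n} \<inter> {x. x \<in> Z \<and> dist (of_real q) x < delta} = {}" by blast
      qed (use finZ in auto)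
      finally show ?thesis using finZ zZ by (simp add: Z0_def)
    qed
    \<comment> \<open>The residue at 0 is traded for those at the zeros, since all residues add up
      to zero.\<close>
    ultimately have r0: "residue f 0 = - R1 - R2" by (simp add: algebra_simps eq_neg_iff_add_eq_0)
    show ?thesis
      unfolding \<rho>_def[symmetric] I0 I1 Iq r0 using q(2) by (cases "q < 1") (auto simp: algebra_simps)
  qed
qed

text \<open>In both configurations that occur, \<open>norm z\<close> to the power
  \<open>H2 - H1\<close> is exponentially small in \<open>\<bar>H2 - H1\<bar>\<close> on the circle
  about \<open>q\<close>: either the exponent is positive and the circle lies inside the unit disk,
  or the exponent is not positive and the circle lies outside.\<close>

lemma diagonal_far_bound:
  assumes s: "s2 \<le> s1" and lim: "(\<lambda>n. \<epsilon> n * A n) \<longlonglongrightarrow> y"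
    and ne: "y \<noteq> 0 \<or> near_count s2 + 2 \<le> near_count s1"
    and A: "\<And>n. real_of_int (H2 n - H1 n) = A n"
  shows "\<exists>B. B \<longlonglongrightarrow> 0 \<and> (\<forall>\<^sub>F n in sequentially.
     (if 1 \<le> H2 n - H1 n then q < 1 else 1 < q) \<longrightarrow>
     norm (1 / of_real (\<epsilon> n) * (nu s1 n / nu s2 n) *
       circle_integral (of_real q) delta (diagonal_integrand (p n) s1 s2 (H1 n) (H2 n))) \<le> B n)"
proof -
  define k where "k = near_count s1 - near_count s2"
  define c where "c = \<bar>1 - \<kappa>\<bar> ^ card {j. j < s1 \<and> j \<notin> T} / \<bar>1 - \<kappa>\<bar> ^ card {j. j < s2 \<and> j \<notin> T}"
  \<comment> \<open>The decay rate per unit of the exponent, taken at the point of the circle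
    closest to the unit circle. The factor \<open>exp L\<close> in \<open>K\<close> accounts for the
    shift in \<open>H2 - H1 - 1\<close>.\<close>
  define L where "L = (if q < 1 then - ln (q + delta) else ln (q - delta))"
  have L: "0 < L" using delta q unfolding L_def by auto
  define D where "D = (1 + (q + delta) * (2 + 2 * \<kappa>)) ^ s2"
  define K where "K = c * (D * inverse (far_factor ^ s1) * exp L * (2 * pi * delta))"
  define B where "B = (\<lambda>n. K * ((1 / \<epsilon> n) * \<epsilon> n ^ k * exp (- (L * \<bar>A n\<bar>))))"
  have c0: "0 \<le> c" by (simp add: c_def)
  have D0: "0 \<le> D" unfolding D_def using q delta kappa by (intro zero_le_power) simp
  have bound: "\<forall>\<^sub>F n in sequentially. (if 1 \<le> H2 n - H1 n then q < 1 else 1 < q) \<longrightarrow>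
     norm (1 / of_real (\<epsilon> n) * (nu s1 n / nu s2 n) *
       circle_integral (of_real q) delta (diagonal_integrand (p n) s1 s2 (H1 n) (H2 n))) \<le> B n"
    using eventually_separated_poles[of s1]
  proof (eventually_elim, intro impI)
    fix n assume sep: "separated_poles s1 n" and side: "if 1 \<le> H2 n - H1 n then q < 1 else 1 < q"
    define M where "M = D * inverse (far_factor ^ s1) * exp (L - L * \<bar>A n\<bar>)"
    have M0: "0 \<le> M" unfolding M_def using D0 far_factor_pos by (intro mult_nonneg_nonneg) auto
    have fb: "norm (diagonal_integrand (p n) s1 s2 (H1 n) (H2 n) z) \<le> M" if z: "dist (of_real q) z = delta" for z
    proof -
      have nz: "q - delta \<le> norm z" "norm z \<le> q + delta"
        using norm_triangle_ineq2[of "of_real q" "of_real q - z"] norm_triangle_ineq4[of "of_real q" "of_real q - z"] z q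
        by (simp_all add: dist_norm)
      have "norm (P_prod (p n) s2 z) \<le> D"
      proof -
        have "norm (P_prod (p n) s2 z) \<le> (\<Prod>j<s2. 1 + (q + delta) * (2 + 2 * \<kappa>))"
          unfolding P_prod_def prod_norm[symmetric]
        proof (intro prod_mono conjI norm_ge_zero)
          fix j assume "j \<in> {..<s2}"
          then have j: "j < s1" using s by simp
          have pj: "p n j \<le> 2 + 2 * \<kappa>"
          proof (cases "j \<in> T")
            case True
            have "\<bar>1 / p n j - 1\<bar> < \<epsilon> n" using separated_polesD[OF sep j] True by simp
            then have "1 / 2 \<le> 1 / p n j" using sep by (simp add: separated_poles_def good_def) linarith
            then show ?thesis using p_pos[of n j] kappa by (simp add: field_simps)
          next
            case False
            have "\<bar>1 / p n j - q\<bar> < delta / 2" using separated_polesD[OF sep j] False by simp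
            then have "q / 2 \<le> 1 / p n j" using delta by linarith
            then have "p n j \<le> 2 * \<kappa>" using p_pos[of n j] kappa by (simp add: q_def field_simps)
            then show ?thesis by simp
          qed
          have "norm (1 - z * of_real (p n j)) \<le> 1 + norm z * p n j"
            using norm_triangle_ineq4[of 1 "z * of_real (p n j)"] p_pos[of n j] by (simp add: norm_mult)
          also have "norm z * p n j \<le> (q + delta) * (2 + 2 * \<kappa>)"
            using nz pj p_pos[of n j] delta q by (intro mult_mono) (auto intro: less_imp_le)
          finally show "norm (1 - z * of_real (p n j)) \<le> 1 + (q + delta) * (2 + 2 * \<kappa>)" by simp
        qed
        then show ?thesis by (simp add: D_def)
      qed
      moreover have "norm (inverse (P_prod (p n) s1 z)) \<le> inverse (far_factor ^ s1)"
        unfolding norm_inverse using P_prod_far_lower_bound[OF sep z] far_factor_pos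
        by (intro le_imp_inverse_le) auto
      moreover have "norm (z powi (H2 n - H1 n - 1)) \<le> exp (L - L * \<bar>A n\<bar>)"
      proof (cases "1 \<le> H2 n - H1 n")
        case True
        then have q1: "q < 1" using side by simp
        define a where "a = nat (H2 n - H1 n - 1)"
        have a: "real a = A n - 1" "\<bar>A n\<bar> = A n" using True A[of n] by (simp_all add: a_def)
        have "norm (z powi (H2 n - H1 n - 1)) = norm z ^ a"
          using True by (simp add: power_int_def a_def norm_power)
        also have "\<dots> \<le> (q + delta) ^ a" using nz by (intro power_mono) auto
        also have "\<dots> = exp (real a * ln (q + delta))"
          using q delta exp_of_nat_mult[of a "ln (q + delta)"] by simp
        also have "real a * ln (q + delta) = L - L * \<bar>A n\<bar>" using q1 unfolding a by (simp add: L_def algebra_simps)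
        finally show ?thesis .
      next
        case False
        then have q1: "1 < q" using side by simp
        define a where "a = nat (1 - (H2 n - H1 n))"
        have a: "real a = 1 - A n" "\<bar>A n\<bar> = - A n" using False A[of n] by (simp_all add: a_def)
        have "norm (z powi (H2 n - H1 n - 1)) = inverse (norm z ^ a)"
          using False by (simp add: power_int_def a_def norm_power norm_inverse power_inverse algebra_simps)
        also have "\<dots> \<le> inverse ((q - delta) ^ a)" using nz delta by (intro le_imp_inverse_le power_mono) auto
        also have "\<dots> = exp (- (real a * ln (q - delta)))"
          using q delta exp_of_nat_mult[of a "ln (q - delta)"] by (simp add: exp_minus)
        also have "\<dots> \<le> exp (L - L * \<bar>A n\<bar>)"
        proof -
          have "- (real a * ln (q - delta)) = - L - L * \<bar>A n\<bar>" using q1 unfolding a by (simp add: L_def algebra_simps)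
          then show ?thesis using L by simp
        qed
        finally show ?thesis .
      qed
      ultimately have "norm (P_prod (p n) s2 z) * norm (inverse (P_prod (p n) s1 z)) * norm (z powi (H2 n - H1 n - 1)) \<le> M"
        unfolding M_def using D0 far_factor_pos by (intro mult_mono mult_nonneg_nonneg norm_ge_zero) auto
      then show ?thesis by (simp only: diagonal_integrand_def divide_inverse norm_mult)
    qed
    have "norm (circle_integral (of_real q) delta (diagonal_integrand (p n) s1 s2 (H1 n) (H2 n))) \<le> M * (2 * pi * delta)"
    proof (rule norm_circle_integral_le)
      have "P_prod (p n) s1 z \<noteq> 0" if "dist (of_real q) z = delta" for z :: complex
        using P_prod_far_lower_bound[OF sep that] far_factor_pos by (metis linorder_not_le norm_zero zero_less_power)
      moreover have "z \<noteq> 0" if "dist (of_real q) z = delta" for z :: complex using that delta q by auto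
      ultimately show "continuous_on (sphere (of_real q) delta) (diagonal_integrand (p n) s1 s2 (H1 n) (H2 n))"
        unfolding diagonal_integrand_def by (intro continuous_intros continuous_on_P_prod) auto
    qed (use fb M0 delta in auto)
    then have "norm (1 / of_real (\<epsilon> n) * (nu s1 n / nu s2 n) *
       circle_integral (of_real q) delta (diagonal_integrand (p n) s1 s2 (H1 n) (H2 n))) \<le>
       (1 / \<epsilon> n) * (\<epsilon> n ^ k * c) * (M * (2 * pi * delta))"
      unfolding norm_mult[of "1 / of_real (\<epsilon> n) * (nu s1 n / nu s2 n)"] norm_mult[of "1 / of_real (\<epsilon> n)"]
        norm_nu_quotient[OF s] k_def[symmetric] c_def[symmetric] using eps_pos[of n] c0
      by (simp add: norm_divide mult_left_mono divide_right_mono)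
    also have "\<dots> = B n" by (simp add: B_def K_def M_def exp_diff exp_minus divide_inverse mult_ac)
    finally show "norm (1 / of_real (\<epsilon> n) * (nu s1 n / nu s2 n) *
       circle_integral (of_real q) delta (diagonal_integrand (p n) s1 s2 (H1 n) (H2 n))) \<le> B n" .
  qed
  \<comment> \<open>If \<open>k >= 2\<close>, the power \<open>\<epsilon> ^ (k - 1)\<close>
    suffices. Otherwise \<open>y \<noteq> 0\<close>, so \<open>\<bar>A n\<bar>\<close> grows like
    \<open>1 / \<epsilon>\<close> and the exponential beats \<open>1 / \<epsilon>\<close>.\<close>
  have "(\<lambda>n. (1 / \<epsilon> n) * \<epsilon> n ^ k * exp (- (L * \<bar>A n\<bar>))) \<longlonglongrightarrow> 0"
  proof (cases "2 \<le> k")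
    case True
    have "(\<lambda>n. \<epsilon> n ^ (k - 1)) \<longlonglongrightarrow> 0 ^ (k - 1)" by (intro tendsto_intros eps_lim)
    then have l: "(\<lambda>n. \<epsilon> n ^ (k - 1)) \<longlonglongrightarrow> 0" using True by (simp add: zero_power)
    have "norm ((1 / \<epsilon> n) * \<epsilon> n ^ k * exp (- (L * \<bar>A n\<bar>))) \<le> \<epsilon> n ^ (k - 1)" for n
    proof -
      have "(1 / \<epsilon> n) * \<epsilon> n ^ k = \<epsilon> n ^ (k - 1)" using True eps_pos[of n] by (simp add: power_diff)
      moreover have "\<epsilon> n ^ (k - 1) * exp (- (L * \<bar>A n\<bar>)) \<le> \<epsilon> n ^ (k - 1) * 1"
        using L eps_pos[of n] by (intro mult_left_mono) auto
      ultimately show ?thesis using eps_pos[of n] by (simp add: abs_mult)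
    qed
    then show ?thesis by (intro Lim_null_comparison[OF _ l] always_eventually) auto
  next
    case False
    then have y: "y \<noteq> 0" using ne by (auto simp: k_def)
    have "(\<lambda>n. \<bar>\<epsilon> n * A n\<bar>) \<longlonglongrightarrow> \<bar>y\<bar>" by (rule tendsto_rabs[OF lim])
    then have ev: "\<forall>\<^sub>F n in sequentially. \<bar>y\<bar> / 2 < \<bar>\<epsilon> n * A n\<bar>" using y by (intro order_tendstoD(1)) auto
    have l: "(\<lambda>n. (1 / \<epsilon> n) ^ 1 * exp (- (L * (\<bar>y\<bar> / 2) / \<epsilon> n))) \<longlonglongrightarrow> 0"
      by (rule tendsto_exp_neg_over[OF eps_pos eps_lim]) (use L y in simp)
    have e1: "\<forall>\<^sub>F n in sequentially. \<epsilon> n < 1" by (rule eventually_small) simp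
    show ?thesis
    proof (rule Lim_null_comparison[OF _ l])
      show "\<forall>\<^sub>F n in sequentially. norm ((1 / \<epsilon> n) * \<epsilon> n ^ k * exp (- (L * \<bar>A n\<bar>))) \<le> (1 / \<epsilon> n) ^ 1 * exp (- (L * (\<bar>y\<bar> / 2) / \<epsilon> n))"
        using ev e1
      proof eventually_elim
        case (elim n)
        have "\<bar>y\<bar> / 2 / \<epsilon> n \<le> \<bar>A n\<bar>" using less_imp_le[OF elim(1)] eps_pos[of n] by (simp add: abs_mult pos_divide_le_eq mult_ac)
        then have "L * (\<bar>y\<bar> / 2 / \<epsilon> n) \<le> L * \<bar>A n\<bar>" using L by (intro mult_left_mono) auto
        then have a1: "exp (- (L * \<bar>A n\<bar>)) \<le> exp (- (L * (\<bar>y\<bar> / 2) / \<epsilon> n))" by simp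
        have "\<epsilon> n ^ k \<le> 1" using elim eps_pos[of n] by (intro power_le_one) auto
        then have a2: "(1 / \<epsilon> n) * \<epsilon> n ^ k \<le> (1 / \<epsilon> n) * 1" using eps_pos[of n] by (intro mult_left_mono) auto
        have "(1 / \<epsilon> n) * \<epsilon> n ^ k * exp (- (L * \<bar>A n\<bar>)) \<le> (1 / \<epsilon> n) * 1 * exp (- (L * (\<bar>y\<bar> / 2) / \<epsilon> n))"
          by (rule mult_mono[OF a2 a1]) (use eps_pos[of n] in simp_all)
        moreover have "0 \<le> (1 / \<epsilon> n) * \<epsilon> n ^ k * exp (- (L * \<bar>A n\<bar>))" using eps_pos[of n] by simp
        ultimately show ?case by (simp only: real_norm_def abs_of_nonneg power_one_right mult_1_right)
      qed
    qed
  qed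
  then have "B \<longlonglongrightarrow> K * 0" unfolding B_def by (intro tendsto_mult tendsto_const)
  with bound show ?thesis by (intro exI[of _ B]) simp
qed

lemma scaled_height_diff:
  assumes "scaled_height H1 y1" "scaled_height H2 y2"
  shows "(\<lambda>n. \<epsilon> n * real_of_int (H2 n - H1 n)) \<longlonglongrightarrow> y2 - y1"
proof -
  have "(\<lambda>n. \<epsilon> n * (g n - H1 n) - \<epsilon> n * (g n - H2 n)) \<longlonglongrightarrow> - y1 - - y2"
    using assms unfolding scaled_height_def by (intro tendsto_diff)
  moreover have "\<epsilon> n * (g n - H1 n) - \<epsilon> n * (g n - H2 n) = \<epsilon> n * real_of_int (H2 n - H1 n)" for n
    by (simp add: algebra_simps)
  ultimately show ?thesis by simp
qed

text \<open>For \<open>y1 \<noteq> y2\<close> the sign of \<open>H2 - H1\<close> is eventually that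
  of \<open>y2 - y1\<close>, so the two cases of the circle integral become the one-sided residue
  term. For \<open>y1 = y2\<close> the sign may vary with \<open>n\<close>, but then
  \<open>near_count s1\<close> exceeds \<open>near_count s2\<close> by at least 2 and the
  contribution near 1 tends to 0 by itself.\<close>

lemma diagonal_limit:
  assumes H1: "scaled_height H1 y1" and H2: "scaled_height H2 y2" and s: "s2 < s1"
    and ne: "y1 \<noteq> y2 \<or> near_count s2 + 2 \<le> near_count s1"
  shows "(\<lambda>n. 1 / of_real (\<epsilon> n) * (nu s1 n / nu s2 n) *
      circle_integral 0 (1 - 2 * \<epsilon> n) (diagonal_integrand (p n) s1 s2 (H1 n) (H2 n))) \<longlonglongrightarrow>
    - (2 * pi * \<i>) * (if near_count s2 < near_count s1 then residue_term (near_count s1) (near_count s2) y1 y2 else 0)"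
    (is "?X \<longlonglongrightarrow> - (2 * pi * \<i>) * ?t")
proof -
  define k where "k = near_count s1 - near_count s2"
  define v where "v = (if k = 0 then 0 else complex_of_real (y2 - y1) ^ (k - 1) / fact (k - 1))"
  define C where "C = (\<lambda>n. 1 / of_real (\<epsilon> n) * (nu s1 n / nu s2 n))"
  define m where "m = (\<lambda>n. C n * circle_integral 1 (\<epsilon> n) (diagonal_integrand (p n) s1 s2 (H1 n) (H2 n)))"
  define u where "u = (\<lambda>n. if 1 \<le> H2 n - H1 n then 0 else - m n)"
  have ml: "m \<longlonglongrightarrow> 2 * pi * \<i> * v"
    using diagonal_near_limit[OF H1 H2 less_imp_le[OF s]] unfolding m_def C_def v_def k_def .
  have dl: "(\<lambda>n. \<epsilon> n * real_of_int (H2 n - H1 n)) \<longlonglongrightarrow> y2 - y1" by (rule scaled_height_diff[OF H1 H2])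
  have ne': "y2 - y1 \<noteq> 0 \<or> near_count s2 + 2 \<le> near_count s1" using ne by auto
  obtain B where B: "B \<longlonglongrightarrow> 0" "\<forall>\<^sub>F n in sequentially.
     (if 1 \<le> H2 n - H1 n then q < 1 else 1 < q) \<longrightarrow>
     norm (C n * circle_integral (of_real q) delta (diagonal_integrand (p n) s1 s2 (H1 n) (H2 n))) \<le> B n"
    using diagonal_far_bound[OF less_imp_le[OF s] dl ne' refl] unfolding C_def by blast
  have "\<forall>\<^sub>F n in sequentially. norm (?X n - u n) \<le> \<bar>B n\<bar>"
    using B(2) eventually_separated_poles[of s1]
  proof eventually_elim
    fix n assume b: "(if 1 \<le> H2 n - H1 n then q < 1 else 1 < q) \<longrightarrow>
     norm (C n * circle_integral (of_real q) delta (diagonal_integrand (p n) s1 s2 (H1 n) (H2 n))) \<le> B n"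
      and sep: "separated_poles s1 n"
    show "norm (?X n - u n) \<le> \<bar>B n\<bar>"
    proof (cases "1 \<le> H2 n - H1 n")
      case True
      show ?thesis
        using b True diagonal_circle_cases(1)[OF sep s True] by (auto simp: u_def C_def)
    next
      case False
      then have le: "H2 n - H1 n \<le> 0" by simp
      have "?X n - u n = - (if 1 < q then C n * circle_integral (of_real q) delta (diagonal_integrand (p n) s1 s2 (H1 n) (H2 n)) else 0)"
        unfolding diagonal_circle_cases(2)[OF sep s le] using False by (simp add: u_def m_def C_def algebra_simps)
      then show ?thesis using b False by auto
    qed
  qed
  then have 1: "(\<lambda>n. ?X n - u n) \<longlonglongrightarrow> 0"
    by (rule Lim_null_comparison) (use tendsto_rabs_zero[OF B(1)] in simp)
  have t: "?t = (if y2 < y1 then v else 0)"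
  proof (cases "near_count s2 < near_count s1")
    case True
    then show ?thesis using residue_term_value[OF True ne] by (simp add: v_def k_def)
  next
    case False
    then show ?thesis by (simp add: v_def k_def)
  qed
  have 2: "u \<longlonglongrightarrow> - (2 * pi * \<i>) * ?t"
  proof -
    consider "y2 < y1" | "y1 < y2" | "y1 = y2" by linarith
    then show ?thesis
    proof cases
      case 1
      then have "\<forall>\<^sub>F n in sequentially. \<epsilon> n * real_of_int (H2 n - H1 n) < 0"
        by (intro order_tendstoD(2)[OF dl]) auto
      then have "\<forall>\<^sub>F n in sequentially. - m n = u n"
      proof eventually_elim
        case (elim n)
        then have "real_of_int (H2 n - H1 n) < 0" using eps_pos[of n] by (simp add: mult_less_0_iff)
        then show ?case by (simp add: u_def)
      qed
      with tendsto_minus[OF ml] have "u \<longlonglongrightarrow> - (2 * pi * \<i> * v)" by (rule Lim_transform_eventually)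
      then show ?thesis using 1 t by simp
    next
      case 2
      then have "\<forall>\<^sub>F n in sequentially. 0 < \<epsilon> n * real_of_int (H2 n - H1 n)"
        by (intro order_tendstoD(1)[OF dl]) auto
      then have "\<forall>\<^sub>F n in sequentially. 0 = u n"
      proof eventually_elim
        case (elim n)
        then have "0 < real_of_int (H2 n - H1 n)" using eps_pos[of n] by (simp add: zero_less_mult_iff)
        then show ?case by (simp add: u_def)
      qed
      with tendsto_const[of 0] have "u \<longlonglongrightarrow> 0" by (rule Lim_transform_eventually)
      then show ?thesis using 2 t by simp
    next
      case 3
      then have "2 \<le> k" using ne by (simp add: k_def)
      then have "v = 0" using 3 by (simp add: v_def)
      then have "m \<longlonglongrightarrow> 0" using ml by simp
      then have "(\<lambda>n. norm (m n)) \<longlonglongrightarrow> 0" by (rule tendsto_norm_zero)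
      then have "u \<longlonglongrightarrow> 0"
        by (rule Lim_null_comparison[rotated]) (auto simp: u_def intro!: always_eventually)
      then show ?thesis using 3 t by simp
    qed
  qed
  from tendsto_add[OF 1 2] show ?thesis by simp
qed

text \<open>The three parts of the decomposition have been treated separately; what remains is that
  the circles used there fit it for large \<open>n\<close>, and that the signs agree with the
  orientations in \<open>turning_kernel\<close>.\<close>

theorem edge_integral_limit:
  assumes H1: "scaled_height H1 y1" and H2: "scaled_height H2 y2"
    and ne: "s1 \<le> s2 \<or> y1 \<noteq> y2 \<or> near_count s2 + 2 \<le> near_count s1"
    and R: "\<forall>\<^sub>F n in sequentially. 0 < Rz n \<and> 0 < Rw n \<and> (\<forall>j<s1. Rz n < 1 / p n j) \<and> (\<forall>m\<in>I n. b n m < Rw n) \<and>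
      (if s2 < s1 then Rz n < Rw n else Rw n < Rz n)"
  shows "(\<lambda>n. 1 / of_real (\<epsilon> n) * (nu s1 n / nu s2 n) * (1 / (2 * of_real pi * \<i>)\<^sup>2 *
      circle_integral 0 (Rz n) (\<lambda>z. circle_integral 0 (Rw n) (edge_integrand (I n) (b n) (p n) s1 s2 (H1 n) (H2 n) z)))) \<longlonglongrightarrow>
    turning_kernel \<sigma> (near_count s1) (near_count s2) y1 y2"
proof -
  define C where "C = (\<lambda>n. 1 / of_real (\<epsilon> n) * (nu s1 n / nu s2 n))"
  define f where "f = (\<lambda>n. edge_integrand (I n) (b n) (p n) s1 s2 (H1 n) (H2 n))"
  define X1 where "X1 = (\<lambda>n. circle_integral 0 (1 - 2 * \<epsilon> n) (\<lambda>w. circle_integral 1 (\<epsilon> n) (\<lambda>z. f n z w)))"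
  define X2 where "X2 = (\<lambda>n. circle_integral 0 (1 - 2 * \<epsilon> n) (\<lambda>w. circle_integral (of_real q) delta (\<lambda>z. f n z w)))"
  define X3 where "X3 = (\<lambda>n. circle_integral 0 (1 - 2 * \<epsilon> n) (diagonal_integrand (p n) s1 s2 (H1 n) (H2 n)))"
  define t where "t = (if near_count s2 < near_count s1 then residue_term (near_count s1) (near_count s2) y1 y2 else 0)"
  define l where "l = (\<integral>y. \<i> * circle_integral 0 1 (\<lambda>\<zeta>. turning_integrand \<sigma> (near_count s1) (near_count s2) y1 y2 \<zeta> (Complex (- 2) y)) \<partial>lborel)"
  define i2 where "i2 = 1 / (2 * of_real pi * \<i>)\<^sup>2"
  have l1: "(\<lambda>n. C n * X1 n) \<longlonglongrightarrow> l"
    using double_integral_limit[OF H1 H2] by (simp add: C_def X1_def l_def f_def)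
  have l2: "(\<lambda>n. C n * X2 n) \<longlonglongrightarrow> 0"
    using far_integral_limit[OF H1 H2] by (simp add: C_def X2_def f_def)
  have l3: "(\<lambda>n. if s2 < s1 then 2 * pi * \<i> * (C n * X3 n) else 0) \<longlonglongrightarrow> 2 * pi * \<i> * (- (2 * pi * \<i>) * t)"
  proof (cases "s2 < s1")
    case True
    have "(\<lambda>n. C n * X3 n) \<longlonglongrightarrow> - (2 * pi * \<i>) * t"
      unfolding C_def X3_def t_def by (rule diagonal_limit[OF H1 H2 True]) (use ne True in auto)
    then show ?thesis by (simp only: True if_True) (rule tendsto_mult[OF tendsto_const])
  next
    case False
    then have "t = 0" using near_count_mono[of s1 s2] by (simp add: t_def)
    then show ?thesis using False by simp
  qed
  obtain c where "0 < c" and hf: "\<forall>\<^sub>F n in sequentially. c \<le> (\<epsilon> n)\<^sup>2 * g n \<and> \<bar>\<epsilon> n * (g n - H1 n)\<bar> \<le> \<bar>y1\<bar> + 1 \<and> 1 \<le> H1 n"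
    using height_facts[OF H1] by blast
  have ev: "\<forall>\<^sub>F n in sequentially. i2 * (- (C n * X1 n) - C n * X2 n - (if s2 < s1 then 2 * pi * \<i> * (C n * X3 n) else 0)) =
      C n * (i2 * circle_integral 0 (Rz n) (\<lambda>z. circle_integral 0 (Rw n) (f n z)))"
    using R hf eventually_separated_poles[of s1]
  proof eventually_elim
    fix n
    assume r: "0 < Rz n \<and> 0 < Rw n \<and> (\<forall>j<s1. Rz n < 1 / p n j) \<and> (\<forall>m\<in>I n. b n m < Rw n) \<and>
      (if s2 < s1 then Rz n < Rw n else Rw n < Rz n)"
      and h: "c \<le> (\<epsilon> n)\<^sup>2 * g n \<and> \<bar>\<epsilon> n * (g n - H1 n)\<bar> \<le> \<bar>y1\<bar> + 1 \<and> 1 \<le> H1 n" and sep: "separated_poles s1 n"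
    have e: "\<epsilon> n < 1 / 4" "4 * \<epsilon> n < \<bar>q - 1\<bar> / 2 - delta" "3 * \<epsilon> n < 1 - \<beta>" using sep by (simp_all add: separated_poles_def good_def)
    have pj: "\<beta> < 1 / p n j \<and> (\<bar>1 / p n j - 1\<bar> < \<epsilon> n \<or> \<bar>1 / p n j - q\<bar> < delta)" if "j < s1" for j
    proof (cases "j \<in> T")
      case True
      then have a: "\<bar>1 / p n j - 1\<bar> < \<epsilon> n" using separated_polesD[OF sep that] by simp
      then have "\<beta> < 1 / p n j" using e(3) eps_pos[of n] by linarith
      then show ?thesis using a by blast
    next
      case False
      then have a: "\<bar>1 / p n j - q\<bar> < delta / 2" using separated_polesD[OF sep that] by simp
      then have "\<beta> < 1 / p n j" "\<bar>1 / p n j - q\<bar> < delta" using delta(1,4) by linarith+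
      then show ?thesis by blast
    qed
    have "circle_integral 0 (Rz n) (\<lambda>z. circle_integral 0 (Rw n) (f n z)) = - X1 n - X2 n - (if s2 < s1 then 2 * pi * \<i> * X3 n else 0)"
      unfolding X1_def X2_def X3_def f_def
    proof (rule edge_integral_decomposition[OF finite_I])
      show "\<bar>b n m\<bar> < Rw n" if "m \<in> I n" for m using r that b_nonneg[OF that] by simp
      show "\<bar>b n m\<bar> < 1 - 2 * \<epsilon> n" if "m \<in> I n" for m using b_nonneg[OF that] b_le[OF that] e eps_pos[of n] by simp
      show "\<bar>b n m\<bar> < 1 / p n j" if "m \<in> I n" "j < s1" for m j using b_nonneg[OF that(1)] b_le[OF that(1)] pj[OF that(2)] by simp
      have "\<bar>q - 1\<bar> - 2 * \<epsilon> n \<le> \<bar>q - (1 - 2 * \<epsilon> n)\<bar>" using eps_pos[of n] by linarith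
      then show "delta < \<bar>q - (1 - 2 * \<epsilon> n)\<bar>" using e(2) eps_pos[of n] delta(1) by argo
      show "\<epsilon> n + delta < \<bar>q - 1\<bar>" using e(2) eps_pos[of n] delta(1) by argo
      show "\<bar>1 / p n j - 1\<bar> < \<epsilon> n \<or> \<bar>1 / p n j - q\<bar> < delta" if "j < s1" for j using pj[OF that] by blast
    qed (use r h e eps_pos[of n] delta p_pos in auto)
    note J = this
    show "i2 * (- (C n * X1 n) - C n * X2 n - (if s2 < s1 then 2 * pi * \<i> * (C n * X3 n) else 0)) =
      C n * (i2 * circle_integral 0 (Rz n) (\<lambda>z. circle_integral 0 (Rw n) (f n z)))"
      unfolding J by (simp add: algebra_simps)
  qed
  have lim: "(\<lambda>n. i2 * (- (C n * X1 n) - C n * X2 n - (if s2 < s1 then 2 * pi * \<i> * (C n * X3 n) else 0))) \<longlonglongrightarrow>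
      i2 * (- l - 0 - 2 * pi * \<i> * (- (2 * pi * \<i>) * t))"
    by (intro tendsto_mult tendsto_diff tendsto_minus tendsto_const l1 l2 l3)
  \<comment> \<open>The minus sign in front of \<open>l\<close> turns the unit circle clockwise; the
    two factors \<open>2 * pi * \<i>\<close> of the diagonal part cancel against
    \<open>i2\<close>.\<close>
  have tk: "i2 * (- l - 0 - 2 * pi * \<i> * (- (2 * pi * \<i>) * t)) = turning_kernel \<sigma> (near_count s1) (near_count s2) y1 y2"
  proof -
    have "(\<integral>y. \<i> * contour_integral (reversepath (circlepath 0 1))
          (\<lambda>\<zeta>. turning_integrand \<sigma> (near_count s1) (near_count s2) y1 y2 \<zeta> (Complex (-2) y)) \<partial>lborel) = - l"
      unfolding l_def by (subst contour_integral_reversepath) simp_all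
    moreover have "i2 * (2 * pi * \<i> * (2 * pi * \<i> * t)) = t" by (simp add: i2_def power2_eq_square field_simps)
    ultimately show ?thesis by (simp add: turning_kernel_def i2_def[symmetric] t_def right_diff_distrib)
  qed
  from Lim_transform_eventually[OF lim[unfolded tk] ev] show ?thesis unfolding C_def f_def i2_def .
qed

end

section \<open>Riemann sums\<close>

text \<open>For increasing \<open>f\<close> each term lies between the increment of the primitive
  over the step to its left and that over the step to its right. The step is \<open>2 * r\<close>
  because half-integers of one class are two apart.\<close>

lemma riemann_sum_bounds:
  fixes f G :: "real \<Rightarrow> real"
  assumes deriv: "\<And>x. x \<in> {lo..hi} \<Longrightarrow> (G has_real_derivative f x) (at x)"
    and mono: "\<And>x y. lo \<le> x \<Longrightarrow> x \<le> y \<Longrightarrow> y \<le> hi \<Longrightarrow> f x \<le> f y"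
    and r: "0 < r" and a: "lo \<le> a - 2 * r" "a + 2 * r * real N \<le> hi"
  shows "(\<Sum>j<N. 2 * r * f (a + 2 * r * real j)) \<le> G (a + 2 * r * real N) - G a"
    and "G (a - 2 * r + 2 * r * real N) - G (a - 2 * r) \<le> (\<Sum>j<N. 2 * r * f (a + 2 * r * real j))"
proof -
  have step: "(y - x) * f x \<le> G y - G x \<and> G y - G x \<le> (y - x) * f y" if xy: "lo \<le> x" "x < y" "y \<le> hi" for x y
  proof -
    obtain z where z: "x < z" "z < y" "G y - G x = (y - x) * f z"
      using MVT2[OF xy(2), of G f] deriv xy by auto
    then show ?thesis using xy mono[of x z] mono[of z y] by (auto intro!: mult_left_mono)
  qed
  have in1: "2 * r * f (a + 2 * r * real j) \<le> G (a + 2 * r * real (Suc j)) - G (a + 2 * r * real j)"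
    and in2: "G (a - 2 * r + 2 * r * real (Suc j)) - G (a - 2 * r + 2 * r * real j) \<le> 2 * r * f (a + 2 * r * real j)"
    if j: "j < N" for j
  proof -
    have jj: "2 * r * real (Suc j) \<le> 2 * r * real N" using j r by (intro mult_left_mono) auto
    have j0: "0 \<le> 2 * r * real j" using r by simp
    have e: "2 * r * real (Suc j) = 2 * r * real j + 2 * r" by (simp add: algebra_simps)
    have "a + 2 * r * real (Suc j) - (a + 2 * r * real j) = 2 * r" unfolding e by simp
    moreover have "lo \<le> a + 2 * r * real j" "a + 2 * r * real j < a + 2 * r * real (Suc j)" "a + 2 * r * real (Suc j) \<le> hi"
      using a r jj j0 unfolding e by linarith+
    ultimately show "2 * r * f (a + 2 * r * real j) \<le> G (a + 2 * r * real (Suc j)) - G (a + 2 * r * real j)"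
      using step by metis
    have b: "a - 2 * r + 2 * r * real (Suc j) = a + 2 * r * real j" unfolding e by simp
    have "lo \<le> a - 2 * r + 2 * r * real j" "a - 2 * r + 2 * r * real j < a + 2 * r * real j" "a + 2 * r * real j \<le> hi"
      using a r jj j0 unfolding e by linarith+
    moreover have "a + 2 * r * real j - (a - 2 * r + 2 * r * real j) = 2 * r" by simp
    ultimately show "G (a - 2 * r + 2 * r * real (Suc j)) - G (a - 2 * r + 2 * r * real j) \<le> 2 * r * f (a + 2 * r * real j)"
      unfolding b using step by metis
  qed
  have "(\<Sum>j<N. 2 * r * f (a + 2 * r * real j)) \<le> (\<Sum>j<N. G (a + 2 * r * real (Suc j)) - G (a + 2 * r * real j))"
    by (intro sum_mono in1) simp
  also have "\<dots> = G (a + 2 * r * real N) - G a"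
    using sum_lessThan_telescope[of "\<lambda>j. G (a + 2 * r * real j)" N] by simp
  finally show "(\<Sum>j<N. 2 * r * f (a + 2 * r * real j)) \<le> G (a + 2 * r * real N) - G a" .
  have "G (a - 2 * r + 2 * r * real N) - G (a - 2 * r) = (\<Sum>j<N. G (a - 2 * r + 2 * r * real (Suc j)) - G (a - 2 * r + 2 * r * real j))"
    using sum_lessThan_telescope[of "\<lambda>j. G (a - 2 * r + 2 * r * real j)" N] by simp
  also have "\<dots> \<le> (\<Sum>j<N. 2 * r * f (a + 2 * r * real j))"
    by (intro sum_mono in2) simp
  finally show "G (a - 2 * r + 2 * r * real N) - G (a - 2 * r) \<le> (\<Sum>j<N. 2 * r * f (a + 2 * r * real j))" .
qed

text \<open>Differentiability makes \<open>G (x n) - G X\<close> asymptotically proportional to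
  \<open>x n - X\<close>, so errors \<open>o(sqrt r)\<close> in the argument stay
  \<open>o(sqrt r)\<close>.\<close>

lemma scaled_difference_limit:
  fixes G :: "real \<Rightarrow> real" and x r :: "nat \<Rightarrow> real"
  assumes G: "(G has_real_derivative d) (at X)"
    and r: "\<And>n. 0 < r n" "r \<longlonglongrightarrow> 0" and x: "(\<lambda>n. (x n - X) / sqrt (r n)) \<longlonglongrightarrow> 0"
  shows "(\<lambda>n. (G (x n) - G X) / sqrt (r n)) \<longlonglongrightarrow> 0" "x \<longlonglongrightarrow> X"
proof -
  have s: "(\<lambda>n. sqrt (r n)) \<longlonglongrightarrow> 0" using tendsto_real_sqrt[OF r(2)] by simp
  have "(\<lambda>n. (x n - X) / sqrt (r n) * sqrt (r n) + X) \<longlonglongrightarrow> 0 * 0 + X"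
    by (intro tendsto_intros x s)
  moreover have "(x n - X) / sqrt (r n) * sqrt (r n) + X = x n" for n using r(1)[of n] by simp
  ultimately show xl: "x \<longlonglongrightarrow> X" by simp
  \<comment> \<open>The difference quotient with its continuous value at \<open>X\<close>, since
    \<open>x n = X\<close> is possible.\<close>
  define q where "q = (\<lambda>y. if y = X then d else (G y - G X) / (y - X))"
  have "isCont q X"
    unfolding isCont_def q_def using G unfolding has_field_derivative_iff
    by (auto intro: Lim_transform_eventually simp: eventually_at_filter)
  then have "(\<lambda>n. q (x n)) \<longlonglongrightarrow> q X" using xl by (rule isCont_tendsto_compose)
  then have "(\<lambda>n. q (x n) * ((x n - X) / sqrt (r n))) \<longlonglongrightarrow> q X * 0" by (intro tendsto_mult x)
  moreover have "(\<lambda>n. q (x n) * ((x n - X) / sqrt (r n))) = (\<lambda>n. (G (x n) - G X) / sqrt (r n))"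
    by (rule ext) (simp add: q_def)
  ultimately show "(\<lambda>n. (G (x n) - G X) / sqrt (r n)) \<longlonglongrightarrow> 0" by (simp only: mult_zero_right)
qed

text \<open>The two-sided bounds differ by one step at each end, an error \<open>O(r)\<close>, and
  the end points are known up to \<open>o(sqrt r)\<close>. This precision is demanded by the linear
  term of the exponent, where the error is divided by \<open>sqrt r\<close>.\<close>

lemma riemann_sum_limit:
  fixes f G :: "real \<Rightarrow> real" and r a :: "nat \<Rightarrow> real" and N :: "nat \<Rightarrow> nat"
  assumes deriv: "\<And>x. x \<in> {lo..hi} \<Longrightarrow> (G has_real_derivative f x) (at x)"
    and mono: "\<And>x y. lo \<le> x \<Longrightarrow> x \<le> y \<Longrightarrow> y \<le> hi \<Longrightarrow> f x \<le> f y"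
    and r: "\<And>n. 0 < r n" "r \<longlonglongrightarrow> 0"
    and AB: "lo < A" "A < hi" "lo < B" "B < hi"
    and a: "(\<lambda>n. (a n - A) / sqrt (r n)) \<longlonglongrightarrow> 0"
    and b: "(\<lambda>n. (a n + 2 * r n * real (N n) - B) / sqrt (r n)) \<longlonglongrightarrow> 0"
  shows "(\<lambda>n. ((\<Sum>j<N n. 2 * r n * f (a n + 2 * r n * real j)) - (G B - G A)) / sqrt (r n)) \<longlonglongrightarrow> 0"
proof -
  have s: "(\<lambda>n. sqrt (r n)) \<longlonglongrightarrow> 0" using tendsto_real_sqrt[OF r(2)] by simp
  have sr: "2 * r n / sqrt (r n) = 2 * sqrt (r n)" for n
    using real_div_sqrt[of "r n"] r(1)[of n] by (simp add: less_imp_le flip: times_divide_eq_right)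
  have shift: "(\<lambda>n. (x n - 2 * r n - X) / sqrt (r n)) \<longlonglongrightarrow> 0" if "(\<lambda>n. (x n - X) / sqrt (r n)) \<longlonglongrightarrow> 0" for x X
  proof -
    have "(\<lambda>n. (x n - X) / sqrt (r n) - 2 * sqrt (r n)) \<longlonglongrightarrow> 0 - 2 * 0"
      by (intro tendsto_intros that s)
    moreover have "(x n - X) / sqrt (r n) - 2 * sqrt (r n) = (x n - 2 * r n - X) / sqrt (r n)" for n
      unfolding sr[symmetric] by (simp add: diff_divide_distrib)
    ultimately show ?thesis by simp
  qed
  have dA: "(G has_real_derivative f A) (at A)" and dB: "(G has_real_derivative f B) (at B)"
    using deriv AB by auto
  define x where "x = (\<lambda>n. a n + 2 * r n * real (N n))"
  have b': "(\<lambda>n. (x n - B) / sqrt (r n)) \<longlonglongrightarrow> 0" using b by (simp add: x_def)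
  have a2: "(\<lambda>n. (a n - 2 * r n - A) / sqrt (r n)) \<longlonglongrightarrow> 0" by (rule shift[OF a])
  have b2: "(\<lambda>n. (x n - 2 * r n - B) / sqrt (r n)) \<longlonglongrightarrow> 0" by (rule shift[OF b'])
  note A1 = scaled_difference_limit[OF dA r a] and A2 = scaled_difference_limit[OF dA r a2]
    and B1 = scaled_difference_limit[OF dB r b'] and B2 = scaled_difference_limit[OF dB r b2]
  have up: "(\<lambda>n. (G (x n) - G B) / sqrt (r n) - (G (a n) - G A) / sqrt (r n)) \<longlonglongrightarrow> 0 - 0"
    by (intro tendsto_diff A1(1) B1(1))
  have low: "(\<lambda>n. (G (x n - 2 * r n) - G B) / sqrt (r n) - (G (a n - 2 * r n) - G A) / sqrt (r n)) \<longlonglongrightarrow> 0 - 0"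
    by (intro tendsto_diff A2(1) B2(1))
  have ev: "\<forall>\<^sub>F n in sequentially. lo < a n - 2 * r n \<and> x n < hi"
    using order_tendstoD(1)[OF A2(2) AB(1)] order_tendstoD(2)[OF B1(2) AB(4)] by eventually_elim simp
  show ?thesis
  proof (rule tendsto_sandwich[OF _ _ low[simplified] up[simplified]])
    show "\<forall>\<^sub>F n in sequentially. (G (x n - 2 * r n) - G B) / sqrt (r n) - (G (a n - 2 * r n) - G A) / sqrt (r n) \<le>
        ((\<Sum>j<N n. 2 * r n * f (a n + 2 * r n * real j)) - (G B - G A)) / sqrt (r n)"
      using ev
    proof eventually_elim
      case (elim n)
      have "G (a n - 2 * r n + 2 * r n * real (N n)) - G (a n - 2 * r n) \<le> (\<Sum>j<N n. 2 * r n * f (a n + 2 * r n * real j))"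
        by (rule riemann_sum_bounds(2)[OF deriv mono r(1)]) (use elim in \<open>auto simp: x_def\<close>)
      moreover have "a n - 2 * r n + 2 * r n * real (N n) = x n - 2 * r n" by (simp add: x_def)
      ultimately show ?case
        using r(1)[of n] by (simp add: diff_divide_distrib[symmetric] divide_right_mono)
    qed
    show "\<forall>\<^sub>F n in sequentially. ((\<Sum>j<N n. 2 * r n * f (a n + 2 * r n * real j)) - (G B - G A)) / sqrt (r n) \<le>
        (G (x n) - G B) / sqrt (r n) - (G (a n) - G A) / sqrt (r n)"
      using ev
    proof eventually_elim
      case (elim n)
      have "(\<Sum>j<N n. 2 * r n * f (a n + 2 * r n * real j)) \<le> G (a n + 2 * r n * real (N n)) - G (a n)"
        by (rule riemann_sum_bounds(1)[OF deriv mono r(1)]) (use elim in \<open>auto simp: x_def\<close>)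
      then show ?case
        using r(1)[of n] by (simp add: x_def diff_divide_distrib[symmetric] divide_right_mono)
    qed
  qed
qed

section \<open>Poles and zeros of the two-periodic model after rescaling\<close>

definition wall_set :: "nat \<Rightarrow> nat \<Rightarrow> int set" where
  "wall_set l k = {m. - int l \<le> m \<and> m < int k \<and> odd m} \<union> {m. - int l \<le> m \<and> m < - int k \<and> even m}"

text \<open>\<open>wall_set c k\<close> is the part of \<open>D_minus\<close> before a diagonal near
  the right edge. It consists of two arithmetic progressions with step 2, one for each value of the
  weights; as \<open>l\<close> is odd, the odd one starts at \<open>- l\<close> and the even one at
  \<open>1 - l\<close>.\<close>

lemma sum_wall_set:
  fixes F :: "int \<Rightarrow> real"
  assumes "odd l" "even k" "k < l"
  shows "(\<Sum>m\<in>wall_set l k. F m) = (\<Sum>j<(l + k + 1) div 2. F (2 * int j - int l)) +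
    (\<Sum>j<(l - k - 1) div 2. F (2 * int j + 1 - int l))"
    and "card (wall_set l k) \<le> l + k" "finite (wall_set l k)"
proof -
  let ?O = "{m. - int l \<le> m \<and> m < int k \<and> odd m}" and ?E = "{m. - int l \<le> m \<and> m < - int k \<and> even m}"
  have fin: "finite ?O" "finite ?E"
    by (rule finite_subset[of _ "{- int l..int k}"]; force)+
  then show f: "finite (wall_set l k)" by (simp add: wall_set_def)
  have "wall_set l k \<subseteq> {- int l..<int k}" by (auto simp: wall_set_def)
  from card_mono[OF _ this] show "card (wall_set l k) \<le> l + k" by simp
  obtain a where a: "l = 2 * a + 1" using assms(1) by (rule oddE)
  obtain b where b: "k = 2 * b" using assms(2) by (rule evenE)
  have ab: "b \<le> a" using assms(3) a b by simp
  have O: "(\<Sum>m\<in>?O. F m) = (\<Sum>j<(l + k + 1) div 2. F (2 * int j - int l))"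
  proof (rule sum.reindex_bij_witness[where i = "\<lambda>j. 2 * int j - int l" and j = "\<lambda>m. nat ((m + int l) div 2)"])
    fix m assume "m \<in> ?O"
    then obtain x where x: "m = 2 * x + 1" "- int l \<le> m" "m < int k" by (auto elim: oddE)
    have e: "m + int l = 2 * (x + int a + 1)" and x0: "0 \<le> x + int a + 1" "x + 1 \<le> int b" using x unfolding a b by auto
    have d: "(m + int l) div 2 = x + int a + 1" unfolding e by simp
    show "2 * int (nat ((m + int l) div 2)) - int l = m" "nat ((m + int l) div 2) \<in> {..<(l + k + 1) div 2}"
      "F (2 * int (nat ((m + int l) div 2)) - int l) = F m"
      unfolding d using x0 x a b by (auto simp: add.commute)
  next
    fix j assume "j \<in> {..<(l + k + 1) div 2}"
    then have "j < a + b + 1" using a b by simp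
    then show "nat ((2 * int j - int l + int l) div 2) = j" "2 * int j - int l \<in> ?O"
      using a b by auto
  qed
  have E: "(\<Sum>m\<in>?E. F m) = (\<Sum>j<(l - k - 1) div 2. F (2 * int j + 1 - int l))"
  proof (rule sum.reindex_bij_witness[where i = "\<lambda>j. 2 * int j + 1 - int l" and j = "\<lambda>m. nat ((m - 1 + int l) div 2)"])
    fix m assume "m \<in> ?E"
    then obtain x where x: "m = 2 * x" "- int l \<le> m" "m < - int k" by (auto elim: evenE)
    have e: "m - 1 + int l = 2 * (x + int a)" and x0: "0 \<le> x + int a" "x < - int b" using x unfolding a b by auto
    have d: "(m - 1 + int l) div 2 = x + int a" unfolding e by simp
    show "2 * int (nat ((m - 1 + int l) div 2)) + 1 - int l = m" "nat ((m - 1 + int l) div 2) \<in> {..<(l - k - 1) div 2}"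
      "F (2 * int (nat ((m - 1 + int l) div 2)) + 1 - int l) = F m"
      unfolding d using x0 x a b by (auto simp: add.commute)
  next
    fix j assume "j \<in> {..<(l - k - 1) div 2}"
    then have "j < a - b" using a b by simp
    then show "nat ((2 * int j + 1 - int l - 1 + int l) div 2) = j" "2 * int j + 1 - int l \<in> ?E"
      using a b by auto
  qed
  have "?O \<inter> ?E = {}" by auto
  then show "(\<Sum>m\<in>wall_set l k. F m) = (\<Sum>j<(l + k + 1) div 2. F (2 * int j - int l)) +
    (\<Sum>j<(l - k - 1) div 2. F (2 * int j + 1 - int l))"
    unfolding wall_set_def using fin O E by (simp add: sum.union_disjoint)
qed

text \<open>The numbers \<open>x_minus m\<close> and \<open>x_plus m\<close> after rescaling \<open>z\<close> by the critical point \<open>exp v * sqrt \<alpha> / A\<close>,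
  where \<open>A\<close> is \<open>\<alpha>\<close> at the top and \<open>1\<close> at the bottom; \<open>j\<close> counts half-integers from the edge. At \<open>tau = - v\<close> the
  inversion exchanges the roles of \<open>x_minus\<close> and \<open>x_plus\<close> and leads to the same numbers.\<close>

definition wall_pole :: "real \<Rightarrow> real \<Rightarrow> real \<Rightarrow> real \<Rightarrow> int \<Rightarrow> real" where
  "wall_pole A \<alpha> v r m = (if odd m then A / \<alpha> else A) * exp (r * (of_int m + 1 / 2) - v)"

definition edge_zero :: "real \<Rightarrow> real \<Rightarrow> real \<Rightarrow> real \<Rightarrow> nat \<Rightarrow> nat \<Rightarrow> real" where
  "edge_zero A \<alpha> v r D j = (if even (D + j) then \<alpha> / A else 1 / A) * exp (v - r * (real D - real j - 1 / 2))"

text \<open>Up to sign the limit of the curvature sums: \<open>1 / (1 - t)\<close> is a primitive of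
  \<open>t / (1 - t)^2\<close> for the measure \<open>dt / t\<close>, evaluated at the ends of the
  two progressions of poles.\<close>

definition critical_curvature :: "real \<Rightarrow> real \<Rightarrow> real \<Rightarrow> real \<Rightarrow> real" where
  "critical_curvature u v A \<alpha> = 1 / 2 * (1 / (1 - A * exp (- 2 * v)) - 1 / (1 - A * exp (- u - v)) +
     1 / (1 - A / \<alpha> * exp (- 2 * v)) - 1 / (1 - A / \<alpha> * exp (u - v)))"

text \<open>The substitution \<open>t = q * exp x\<close> turns a sum over equally spaced exponents
  into a Riemann sum for \<open>dt / t\<close>. The margin between \<open>hi\<close> and the end
  points \<open>A\<close>, \<open>B\<close> keeps all arguments below 1 although the end points are
  perturbed.\<close>

lemma exp_riemann_limit:
  fixes r a :: "nat \<Rightarrow> real" and N :: "nat \<Rightarrow> nat" and \<phi> \<Gamma> :: "real \<Rightarrow> real"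
  assumes \<Gamma>: "\<And>t. 0 < t \<Longrightarrow> t < 1 \<Longrightarrow> (\<Gamma> has_real_derivative \<phi> t / t) (at t)"
    and mono: "\<And>s t. 0 < s \<Longrightarrow> s \<le> t \<Longrightarrow> t < 1 \<Longrightarrow> \<phi> s \<le> \<phi> t"
    and r: "\<And>n. 0 < r n" "r \<longlonglongrightarrow> 0"
    and q: "0 < q" "q * exp hi < 1" and AB: "A < hi" "B < hi"
    and a: "(\<lambda>n. (a n - A) / sqrt (r n)) \<longlonglongrightarrow> 0"
    and b: "(\<lambda>n. (a n + 2 * r n * real (N n) - B) / sqrt (r n)) \<longlonglongrightarrow> 0"
  shows "(\<lambda>n. (r n * (\<Sum>j<N n. \<phi> (q * exp (a n + 2 * r n * real j))) -
    1 / 2 * (\<Gamma> (q * exp B) - \<Gamma> (q * exp A))) / sqrt (r n)) \<longlonglongrightarrow> 0"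
proof -
  define lo where "lo = min A B - 1"
  have small: "0 < q * exp x \<and> q * exp x < 1" if "x \<le> hi" for x
    using q that by (auto intro: le_less_trans[OF mult_left_mono[of "exp x" "exp hi" q]])
  have "(\<lambda>n. ((\<Sum>j<N n. 2 * r n * \<phi> (q * exp (a n + 2 * r n * real j))) - (\<Gamma> (q * exp B) - \<Gamma> (q * exp A))) / sqrt (r n)) \<longlonglongrightarrow> 0"
  proof (rule riemann_sum_limit[where f = "\<lambda>x. \<phi> (q * exp x)" and G = "\<lambda>x. \<Gamma> (q * exp x)" and lo = lo and hi = hi])
    fix x assume "x \<in> {lo..hi}"
    then have x: "0 < q * exp x" "q * exp x < 1" using small by auto
    have "((\<lambda>x. \<Gamma> (q * exp x)) has_real_derivative (\<phi> (q * exp x) / (q * exp x)) * (q * exp x)) (at x)"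
      by (rule DERIV_chain2[where f = \<Gamma> and g = "\<lambda>x. q * exp x", OF \<Gamma>[OF x]]) (auto intro!: derivative_eq_intros)
    then show "((\<lambda>x. \<Gamma> (q * exp x)) has_real_derivative \<phi> (q * exp x)) (at x)"
      using q by simp
  next
    fix x y assume "x \<le> y" "y \<le> hi"
    then show "\<phi> (q * exp x) \<le> \<phi> (q * exp y)"
      using small[of x] small[of y] q by (intro mono) auto
  qed (use r AB a b in \<open>auto simp: lo_def\<close>)
  from tendsto_mult_left[OF this, of "1 / 2"]
  have "(\<lambda>n. 1 / 2 * (((\<Sum>j<N n. 2 * r n * \<phi> (q * exp (a n + 2 * r n * real j))) - (\<Gamma> (q * exp B) - \<Gamma> (q * exp A))) / sqrt (r n))) \<longlonglongrightarrow> 0"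
    by simp
  moreover have "1 / 2 * (((\<Sum>j<N n. 2 * r n * \<phi> (q * exp (a n + 2 * r n * real j))) - (\<Gamma> (q * exp B) - \<Gamma> (q * exp A))) / sqrt (r n)) =
     (r n * (\<Sum>j<N n. \<phi> (q * exp (a n + 2 * r n * real j))) -
    1 / 2 * (\<Gamma> (q * exp B) - \<Gamma> (q * exp A))) / sqrt (r n)" for n
  proof -
    have "(\<Sum>j<N n. 2 * r n * \<phi> (q * exp (a n + 2 * r n * real j))) = 2 * (r n * (\<Sum>j<N n. \<phi> (q * exp (a n + 2 * r n * real j))))"
      by (simp add: sum_distrib_left mult.assoc)
    then show ?thesis by (simp only: ring_distribs) (simp add: diff_divide_distrib)
  qed
  ultimately show ?thesis by (simp only:)
qed

text \<open>\<open>D\<close> is the distance of the edge under consideration and \<open>l\<close>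
  that of the opposite one, so \<open>(l, D)\<close> is \<open>(c, d)\<close> at
  \<open>tau = v\<close> and \<open>(d, c)\<close> at \<open>tau = - v\<close>. The inequalities are
  imposed for all \<open>n\<close>, which is arranged later by passing to a tail of the
  sequence.\<close>

locale edge_model =
  fixes r :: "nat \<Rightarrow> real" and k l D :: "nat \<Rightarrow> nat" and u v \<alpha> :: real and e :: nat and odd_edge :: bool
  assumes r_pos: "0 < r n" and r_lim: "r \<longlonglongrightarrow> 0"
    and k_lim: "(\<lambda>n. (r n * real (k n) - u) / sqrt (r n)) \<longlonglongrightarrow> 0"
    and l_lim: "(\<lambda>n. (r n * real (l n) - v) / sqrt (r n)) \<longlonglongrightarrow> 0"
    and D_lim: "(\<lambda>n. (r n * real (D n) - v) / sqrt (r n)) \<longlonglongrightarrow> 0"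
    and even_k: "even (k n)" and odd_l: "odd (l n)" and parity_D: "odd (D n) \<longleftrightarrow> odd_edge"
    and k_close: "\<bar>r n * real (k n) - u\<bar> \<le> (v - u) / 2"
    and size_le: "r n * real (l n + k n) \<le> u + v + 2" and k_less: "k n < l n"
    and uv: "0 < u" "u < v" and alpha: "1 < \<alpha>" "exp (- 2 * u) * \<alpha> < 1" and e: "e = 1 \<or> e = 2"
begin

definition A :: real where "A = (if e = 1 then \<alpha> else 1)"

lemma A: "1 \<le> A" "A \<le> \<alpha>" "0 < A" and alpha_pos: "0 < \<alpha>"
  using alpha by (auto simp: A_def)

lemma sqrt_r: "(\<lambda>n. sqrt (r n)) \<longlonglongrightarrow> 0"
  using tendsto_real_sqrt[OF r_lim] by simp

lemma shift_lim:
  assumes "(\<lambda>n. (x n - X) / sqrt (r n)) \<longlonglongrightarrow> 0"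
  shows "(\<lambda>n. (x n + c * r n - X) / sqrt (r n)) \<longlonglongrightarrow> 0"
proof -
  have "(\<lambda>n. (x n - X) / sqrt (r n) + c * sqrt (r n)) \<longlonglongrightarrow> 0 + c * 0"
    by (intro tendsto_intros assms sqrt_r)
  moreover have "(x n - X) / sqrt (r n) + c * sqrt (r n) = (x n + c * r n - X) / sqrt (r n)" for n
  proof -
    have "c * sqrt (r n) = c * r n / sqrt (r n)"
      using real_div_sqrt[of "r n"] r_pos[of n] by (simp add: less_imp_le flip: times_divide_eq_right)
    then show ?thesis by (simp add: add_divide_distrib diff_divide_distrib)
  qed
  ultimately show ?thesis by (simp only: mult_zero_right add_0_left)
qed

lemma neg_lim:
  assumes "(\<lambda>n. (x n - X) / sqrt (r n)) \<longlonglongrightarrow> 0"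
  shows "(\<lambda>n. (- x n - - X) / sqrt (r n)) \<longlonglongrightarrow> 0"
proof -
  have "(- x n - - X) / sqrt (r n) = - ((x n - X) / sqrt (r n))" for n by (simp add: minus_divide_left)
  then show ?thesis using tendsto_minus[OF assms] by simp
qed

text \<open>These are bounds for the two classes of poles; \<open>exp (- ((v - u) / 2))\<close>
  leaves half of the gap between \<open>u\<close> and \<open>v\<close> for the deviation of
  \<open>r * k\<close> from \<open>u\<close>. The assumption
  \<open>exp (- 2 * u) * \<alpha> < 1\<close> makes the even class, which has the larger prefactor,
  no worse than the odd one.\<close>

lemma edge_factors_less: "A / \<alpha> * exp (- ((v - u) / 2)) < 1" "A * exp (- 2 * u - (v - u) / 2) \<le> A / \<alpha> * exp (- ((v - u) / 2))"
proof -
  have "A / \<alpha> * exp (- ((v - u) / 2)) \<le> 1 * exp (- ((v - u) / 2))"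
    using A alpha_pos by (intro mult_right_mono) auto
  also have "\<dots> < 1" using uv by simp
  finally show "A / \<alpha> * exp (- ((v - u) / 2)) < 1" .
  have "exp (- 2 * u) \<le> 1 / \<alpha>" using alpha(2) alpha_pos by (simp add: field_simps)
  then have "A * exp (- 2 * u) * exp (- ((v - u) / 2)) \<le> A * (1 / \<alpha>) * exp (- ((v - u) / 2))"
    using A by (intro mult_left_mono mult_right_mono) auto
  moreover have "A * exp (- 2 * u - (v - u) / 2) = A * exp (- 2 * u) * exp (- ((v - u) / 2))"
    by (simp only: mult.assoc exp_add[symmetric]) simp
  ultimately show "A * exp (- 2 * u - (v - u) / 2) \<le> A / \<alpha> * exp (- ((v - u) / 2))"
    by (simp only:) simp
qed

text \<open>In the scaled variable the odd progression runs from \<open>- v\<close> to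
  \<open>u\<close> and the even one from \<open>- v\<close> to \<open>- u\<close>; each is a Riemann
  sum of its own.\<close>

lemma wall_sum_limit:
  fixes \<phi> \<Gamma> :: "real \<Rightarrow> real"
  assumes \<Gamma>: "\<And>t. 0 < t \<Longrightarrow> t < 1 \<Longrightarrow> (\<Gamma> has_real_derivative \<phi> t / t) (at t)"
    and mono: "\<And>s t. 0 < s \<Longrightarrow> s \<le> t \<Longrightarrow> t < 1 \<Longrightarrow> \<phi> s \<le> \<phi> t"
  shows "(\<lambda>n. (r n * (\<Sum>m\<in>wall_set (l n) (k n). \<phi> (wall_pole A \<alpha> v (r n) m)) -
    1 / 2 * (\<Gamma> (A / \<alpha> * exp (u - v)) - \<Gamma> (A / \<alpha> * exp (- 2 * v)) + \<Gamma> (A * exp (- u - v)) - \<Gamma> (A * exp (- 2 * v)))) / sqrt (r n)) \<longlonglongrightarrow> 0"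
proof -
  define S1 where "S1 = (\<lambda>n. \<Sum>j<(l n + k n + 1) div 2. \<phi> (A / \<alpha> * exp (- v) * exp (- (r n * real (l n)) + 1 / 2 * r n + 2 * r n * real j)))"
  define S2 where "S2 = (\<lambda>n. \<Sum>j<(l n - k n - 1) div 2. \<phi> (A * exp (- v) * exp (- (r n * real (l n)) + 3 / 2 * r n + 2 * r n * real j)))"
  \<comment> \<open>Up to a multiple of \<open>r\<close>, which is below the precision
    \<open>sqrt r\<close>, the progression ends at \<open>r * k\<close>.\<close>
  have e1: "- (r n * real (l n)) + 1 / 2 * r n + 2 * r n * real ((l n + k n + 1) div 2) = r n * real (k n) + 3 / 2 * r n" for n
  proof -
    have "2 * real ((l n + k n + 1) div 2) = real (l n) + real (k n) + 1"
      using even_k[of n] odd_l[of n] by (auto elim!: evenE oddE)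
    moreover have "2 * r n * real ((l n + k n + 1) div 2) = r n * (2 * real ((l n + k n + 1) div 2))" by simp
    ultimately show ?thesis by (simp only:) (simp add: algebra_simps)
  qed
  have e2: "- (r n * real (l n)) + 3 / 2 * r n + 2 * r n * real ((l n - k n - 1) div 2) = - (r n * real (k n)) + 1 / 2 * r n" for n
  proof -
    have "even (l n - k n - 1)" using even_k[of n] odd_l[of n] k_less[of n] by auto
    then have "2 * ((l n - k n - 1) div 2) = l n - k n - 1" by simp
    then have "2 * real ((l n - k n - 1) div 2) = real (l n - k n - 1)" by (metis of_nat_mult of_nat_numeral)
    also have "\<dots> = real (l n) - real (k n) - 1" using k_less[of n] by (simp add: of_nat_diff)
    finally have "2 * real ((l n - k n - 1) div 2) = real (l n) - real (k n) - 1" .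
    moreover have "2 * r n * real ((l n - k n - 1) div 2) = r n * (2 * real ((l n - k n - 1) div 2))" by simp
    ultimately show ?thesis by (simp only:) (simp add: algebra_simps)
  qed
  have 1: "(\<lambda>n. (r n * S1 n - 1 / 2 * (\<Gamma> (A / \<alpha> * exp (- v) * exp u) - \<Gamma> (A / \<alpha> * exp (- v) * exp (- v)))) / sqrt (r n)) \<longlonglongrightarrow> 0"
    unfolding S1_def
  proof (rule exp_riemann_limit[where hi = "(u + v) / 2", OF \<Gamma> mono r_pos r_lim])
    have "- v + (u + v) / 2 = - ((v - u) / 2)" by (simp add: field_simps)
    then have "A / \<alpha> * exp (- v) * exp ((u + v) / 2) = A / \<alpha> * exp (- ((v - u) / 2))"
      by (simp only: mult.assoc exp_add[symmetric])
    then show "A / \<alpha> * exp (- v) * exp ((u + v) / 2) < 1" using edge_factors_less(1) by (simp only:)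
    show "(\<lambda>n. (- (r n * real (l n)) + 1 / 2 * r n - - v) / sqrt (r n)) \<longlonglongrightarrow> 0"
      by (rule shift_lim[OF neg_lim[OF l_lim]])
    show "(\<lambda>n. (- (r n * real (l n)) + 1 / 2 * r n + 2 * r n * real ((l n + k n + 1) div 2) - u) / sqrt (r n)) \<longlonglongrightarrow> 0"
      unfolding e1 by (rule shift_lim[OF k_lim])
  qed (use A alpha_pos uv in auto)
  have 2: "(\<lambda>n. (r n * S2 n - 1 / 2 * (\<Gamma> (A * exp (- v) * exp (- u)) - \<Gamma> (A * exp (- v) * exp (- v)))) / sqrt (r n)) \<longlonglongrightarrow> 0"
    unfolding S2_def
  proof (rule exp_riemann_limit[where hi = "- u + (v - u) / 2", OF \<Gamma> mono r_pos r_lim])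
    have "- v + (- u + (v - u) / 2) = - 2 * u - (v - u) / 2" by (simp add: field_simps)
    then have "A * exp (- v) * exp (- u + (v - u) / 2) = A * exp (- 2 * u - (v - u) / 2)"
      by (simp only: mult.assoc exp_add[symmetric])
    then show "A * exp (- v) * exp (- u + (v - u) / 2) < 1" using edge_factors_less by (metis le_less_trans)
    show "- v < - u + (v - u) / 2" using uv by argo
    show "(\<lambda>n. (- (r n * real (l n)) + 3 / 2 * r n - - v) / sqrt (r n)) \<longlonglongrightarrow> 0"
      by (rule shift_lim[OF neg_lim[OF l_lim]])
    show "(\<lambda>n. (- (r n * real (l n)) + 3 / 2 * r n + 2 * r n * real ((l n - k n - 1) div 2) - - u) / sqrt (r n)) \<longlonglongrightarrow> 0"
      unfolding e2 by (rule shift_lim[OF neg_lim[OF k_lim]])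
  qed (use A alpha_pos uv in auto)
  have s: "(\<Sum>m\<in>wall_set (l n) (k n). \<phi> (wall_pole A \<alpha> v (r n) m)) = S1 n + S2 n" for n
  proof -
    have "wall_pole A \<alpha> v (r n) (2 * int j - int (l n)) = A / \<alpha> * exp (- v) * exp (- (r n * real (l n)) + 1 / 2 * r n + 2 * r n * real j)" for j
      using odd_l[of n] by (simp add: wall_pole_def mult.assoc exp_add[symmetric] algebra_simps)
    moreover have "wall_pole A \<alpha> v (r n) (2 * int j + 1 - int (l n)) = A * exp (- v) * exp (- (r n * real (l n)) + 3 / 2 * r n + 2 * r n * real j)" for j
      using odd_l[of n] by (simp add: wall_pole_def mult.assoc exp_add[symmetric] algebra_simps)
    ultimately show ?thesis
      unfolding sum_wall_set(1)[OF odd_l even_k k_less] S1_def S2_def by (simp only:)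
  qed
  have ex: "A / \<alpha> * exp (- v) * exp u = A / \<alpha> * exp (u - v)" "A / \<alpha> * exp (- v) * exp (- v) = A / \<alpha> * exp (- 2 * v)"
    "A * exp (- v) * exp (- u) = A * exp (- u - v)" "A * exp (- v) * exp (- v) = A * exp (- 2 * v)"
    by (simp_all add: mult.assoc exp_add[symmetric] algebra_simps)
  from tendsto_add[OF 1 2]
  show ?thesis unfolding s ex
    by (simp only: add_divide_distrib[symmetric] add_0_left) (simp add: algebra_simps)
qed

lemma arguments_less: "A * exp (- 2 * v) < 1" "A * exp (- u - v) < 1" "A / \<alpha> * exp (- 2 * v) < 1" "A / \<alpha> * exp (u - v) < 1"
  "A * exp (- 2 * v) < A * exp (- u - v)" "A / \<alpha> * exp (- 2 * v) < A / \<alpha> * exp (u - v)"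
proof -
  show *: "A * exp (- 2 * v) < A * exp (- u - v)" "A / \<alpha> * exp (- 2 * v) < A / \<alpha> * exp (u - v)"
    using A alpha_pos uv by (auto intro!: mult_strict_left_mono divide_strict_right_mono)
  have "- u - v \<le> - 2 * u - (v - u) / 2" "u - v \<le> - ((v - u) / 2)" using uv by (simp_all add: field_simps)
  then have "A * exp (- u - v) \<le> A * exp (- 2 * u - (v - u) / 2)" "A / \<alpha> * exp (u - v) \<le> A / \<alpha> * exp (- ((v - u) / 2))"
    using A alpha_pos by (auto intro!: mult_left_mono divide_right_mono)
  then show "A * exp (- u - v) < 1" using edge_factors_less by linarith
  then show "A * exp (- 2 * v) < 1" using * by linarith
  show "A / \<alpha> * exp (u - v) < 1"
    using edge_factors_less \<open>A / \<alpha> * exp (u - v) \<le> A / \<alpha> * exp (- ((v - u) / 2))\<close> by linarith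
  then show "A / \<alpha> * exp (- 2 * v) < 1" using * by linarith
qed

text \<open>\<open>1 / (1 - x)\<close> increases for \<open>x < 1\<close>, and
  \<open>- 2 * v\<close> is smaller than both \<open>- u - v\<close> and
  \<open>u - v\<close>.\<close>

lemma curvature_neg: "critical_curvature u v A \<alpha> < 0"
proof -
  have "1 / (1 - A * exp (- 2 * v)) < 1 / (1 - A * exp (- u - v))"
    using arguments_less by (intro divide_strict_left_mono) auto
  moreover have "1 / (1 - A / \<alpha> * exp (- 2 * v)) < 1 / (1 - A / \<alpha> * exp (u - v))"
    using arguments_less by (intro divide_strict_left_mono mult_pos_pos) auto
  moreover have "1 / 2 * (w - x + y - z) < 0" if "w < x" "y < z" for w x y z :: real using that by simp
  ultimately show ?thesis unfolding critical_curvature_def by blast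
qed

lemma wall_pole_le:
  assumes "m \<in> wall_set (l n) (k n)"
  shows "wall_pole A \<alpha> v (r n) m \<le> A / \<alpha> * exp (- ((v - u) / 2))"
proof (cases "odd m")
  case True
  then have "m \<le> int (k n) - 1" using assms by (auto simp: wall_set_def)
  then have "real_of_int m \<le> real (k n) - 1" by linarith
  then have "r n * (of_int m + 1 / 2) \<le> r n * real (k n)" using r_pos[of n] by (intro mult_left_mono) auto
  then have "r n * (of_int m + 1 / 2) - v \<le> - ((v - u) / 2)" using abs_le_D1[OF k_close[of n]] by argo
  then show ?thesis
    using True A alpha_pos unfolding wall_pole_def by (auto intro!: mult_left_mono divide_right_mono)
next
  case False
  then have "m < - int (k n)" using assms by (auto simp: wall_set_def)
  then have "real_of_int m + 1 \<le> - real (k n)" by linarith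
  then have "r n * (of_int m + 1 / 2) \<le> r n * - real (k n)" using r_pos[of n] by (intro mult_left_mono) auto
  then have "r n * (of_int m + 1 / 2) - v \<le> - 2 * u - (v - u) / 2" using abs_le_D2[OF k_close[of n]] by argo
  then have "wall_pole A \<alpha> v (r n) m \<le> A * exp (- 2 * u - (v - u) / 2)"
    using False A unfolding wall_pole_def by (auto intro!: mult_left_mono)
  then show ?thesis using edge_factors_less(2) by linarith
qed

text \<open>The \<open>j\<close>-th factor from the edge has index \<open>D - 1 - j\<close>, whose
  parity selects the prefactor \<open>\<alpha> / A\<close> or \<open>1 / A\<close>. The first equals
  1 for \<open>e = 1\<close>, the second for \<open>e = 2\<close>, and in both cases the prefactor
  of the other class is \<open>\<alpha> / A^2\<close>.\<close>

definition near_set :: "nat set" where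
  "near_set = {j. (odd_edge \<noteq> even j) = (e = 1)}"

lemma even_D_add: "even (D n + j) \<longleftrightarrow> odd_edge \<noteq> even j"
  using parity_D[of n] by auto

lemma edge_exponent_lim: "(\<lambda>n. (v - r n * (real (D n) - real j - 1 / 2) - 0) / sqrt (r n)) \<longlonglongrightarrow> 0"
proof -
  have "(\<lambda>n. (- (r n * real (D n)) + (real j + 1 / 2) * r n - - v) / sqrt (r n)) \<longlonglongrightarrow> 0"
    by (rule shift_lim[OF neg_lim[OF D_lim]])
  moreover have "- (r n * real (D n)) + (real j + 1 / 2) * r n - - v = v - r n * (real (D n) - real j - 1 / 2) - 0" for n
    by (simp add: algebra_simps)
  ultimately show ?thesis by (simp only:)
qed

lemma edge_zero_near:
  assumes "j \<in> near_set"
  shows "edge_zero A \<alpha> v (r n) (D n) j = exp (v - r n * (real (D n) - real j - 1 / 2))"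
  unfolding edge_zero_def even_D_add A_def using assms[unfolded near_set_def] e alpha_pos by auto

lemma edge_zero_far:
  assumes "j \<notin> near_set"
  shows "edge_zero A \<alpha> v (r n) (D n) j = \<alpha> / A\<^sup>2 * exp (v - r n * (real (D n) - real j - 1 / 2))"
  unfolding edge_zero_def even_D_add A_def using assms[unfolded near_set_def] e alpha_pos by (auto simp: power2_eq_square)

text \<open>With \<open>\<kappa> = \<alpha> / A^2\<close>, the zeros of the other class tend to
  \<open>\<alpha>\<close> at the top and to \<open>1 / \<alpha>\<close> at the bottom, which is why
  both sides of 1 had to be treated.\<close>

sublocale edge_data "\<lambda>n. sqrt (r n)" "\<lambda>n. wall_set (l n) (k n)" "\<lambda>n. wall_pole A \<alpha> v (r n)"
  "A / \<alpha> * exp (- ((v - u) / 2))" "critical_curvature u v A \<alpha>" "u + v + 2"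
  "\<lambda>n. edge_zero A \<alpha> v (r n) (D n)" near_set "\<alpha> / A\<^sup>2"
proof unfold_locales
  fix n
  show "0 < sqrt (r n)" using r_pos[of n] by simp
  show "finite (wall_set (l n) (k n))" by (rule sum_wall_set(3)[OF odd_l even_k k_less])
  have "(sqrt (r n))\<^sup>2 * real (card (wall_set (l n) (k n))) \<le> r n * real (l n + k n)"
    using sum_wall_set(2)[OF odd_l even_k k_less, of n] r_pos[of n] by (simp add: mult_left_mono)
  then show "(sqrt (r n))\<^sup>2 * real (card (wall_set (l n) (k n))) \<le> u + v + 2" using size_le[of n] by linarith
  fix m show "0 \<le> wall_pole A \<alpha> v (r n) m" using A alpha_pos by (simp add: wall_pole_def)
  assume "m \<in> wall_set (l n) (k n)"
  then show "wall_pole A \<alpha> v (r n) m \<le> A / \<alpha> * exp (- ((v - u) / 2))" by (rule wall_pole_le)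
next
  \<comment> \<open>The curvature sum is the case \<open>\<phi> t = t / (1 - t)^2\<close>,
    \<open>\<Gamma> t = 1 / (1 - t)\<close> of the limit of sums over the poles.\<close>
  define L where "L = 1 / 2 * (1 / (1 - A / \<alpha> * exp (u - v)) - 1 / (1 - A / \<alpha> * exp (- 2 * v)) + 1 / (1 - A * exp (- u - v)) - 1 / (1 - A * exp (- 2 * v)))"
  have "(\<lambda>n. (r n * (\<Sum>m\<in>wall_set (l n) (k n). wall_pole A \<alpha> v (r n) m / (1 - wall_pole A \<alpha> v (r n) m)\<^sup>2) - L) / sqrt (r n)) \<longlonglongrightarrow> 0"
    unfolding L_def
  proof (rule wall_sum_limit)
    fix t :: real assume "0 < t" "t < 1"
    then show "((\<lambda>t. 1 / (1 - t)) has_real_derivative t / (1 - t)\<^sup>2 / t) (at t)"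
      by (auto intro!: derivative_eq_intros simp: power2_eq_square)
  next
    fix s t :: real assume "0 < s" "s \<le> t" "t < 1"
    then show "s / (1 - s)\<^sup>2 \<le> t / (1 - t)\<^sup>2" by (intro frac_le power_mono) auto
  qed
  from tendsto_add[OF tendsto_mult[OF this sqrt_r] tendsto_const[of L]]
  have "(\<lambda>n. (r n * (\<Sum>m\<in>wall_set (l n) (k n). wall_pole A \<alpha> v (r n) m / (1 - wall_pole A \<alpha> v (r n) m)\<^sup>2) - L) / sqrt (r n) * sqrt (r n) + L) \<longlonglongrightarrow> L" by simp
  moreover have "x / sqrt (r n) * sqrt (r n) = x" for x n using r_pos[of n] by simp
  moreover have "L = - critical_curvature u v A \<alpha>"
  proof -
    have "1 / 2 * (w - x + y - z) = - (1 / 2 * (z - y + x - w))" for w x y z :: real by (simp add: algebra_simps)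
    then show ?thesis unfolding L_def critical_curvature_def .
  qed
  moreover have "(sqrt (r n))\<^sup>2 = r n" for n using r_pos[of n] by simp
  ultimately show "(\<lambda>n. (sqrt (r n))\<^sup>2 * (\<Sum>m\<in>wall_set (l n) (k n). wall_pole A \<alpha> v (r n) m / (1 - wall_pole A \<alpha> v (r n) m)\<^sup>2)) \<longlonglongrightarrow> - critical_curvature u v A \<alpha>"
    by simp
next
  fix n j show "0 < edge_zero A \<alpha> v (r n) (D n) j" using A alpha_pos by (simp add: edge_zero_def)
next
  fix j assume j: "j \<in> near_set"
  show "(\<lambda>n. (edge_zero A \<alpha> v (r n) (D n) j - 1) / sqrt (r n)) \<longlonglongrightarrow> 0"
    unfolding edge_zero_near[OF j]
    using scaled_difference_limit(1)[OF DERIV_exp[of 0] r_pos r_lim edge_exponent_lim[of j]] by simp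
next
  fix j assume j: "j \<notin> near_set"
  have "(\<lambda>n. \<alpha> / A\<^sup>2 * exp (v - r n * (real (D n) - real j - 1 / 2))) \<longlonglongrightarrow> \<alpha> / A\<^sup>2 * exp 0"
    by (intro tendsto_intros scaled_difference_limit(2)[OF DERIV_exp[of 0] r_pos r_lim edge_exponent_lim[of j]])
  then show "(\<lambda>n. edge_zero A \<alpha> v (r n) (D n) j) \<longlonglongrightarrow> \<alpha> / A\<^sup>2" unfolding edge_zero_far[OF j] by simp
next
  show "(\<lambda>n. sqrt (r n)) \<longlonglongrightarrow> 0" by (rule sqrt_r)
  show "0 < A / \<alpha> * exp (- ((v - u) / 2))" "A / \<alpha> * exp (- ((v - u) / 2)) < 1"
    using A alpha_pos edge_factors_less by auto
  show "critical_curvature u v A \<alpha> < 0" by (rule curvature_neg)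
  show "0 < \<alpha> / A\<^sup>2" using A alpha_pos by simp
  show "\<alpha> / A\<^sup>2 \<noteq> 1" using alpha by (auto simp: A_def power2_eq_square)
  have "A / \<alpha> * exp (- ((v - u) / 2)) * (\<alpha> / A\<^sup>2) = 1 / A * exp (- ((v - u) / 2))"
    using A alpha_pos by (simp add: power2_eq_square field_simps)
  also have "\<dots> \<le> 1 * exp (- ((v - u) / 2))" using A by (intro mult_right_mono) auto
  also have "\<dots> < 1" using uv by simp
  finally show "A / \<alpha> * exp (- ((v - u) / 2)) * (\<alpha> / A\<^sup>2) < 1" .
qed

text \<open>The two classes of factors alternate, so the count grows at every second step; the
  offset in \<open>edge_power\<close> records which class comes first.\<close>

lemma near_count_eq: "near_count s = edge_power odd_edge e s"
proof (induction s)
  case 0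
  then show ?case using e by (auto simp: near_count_def edge_power_def)
next
  case (Suc s)
  have "{j. j < Suc s \<and> j \<in> near_set} = {j. j < s \<and> j \<in> near_set} \<union> (if s \<in> near_set then {s} else {})"
    by (auto simp: less_Suc_eq)
  then have "near_count (Suc s) = near_count s + (if s \<in> near_set then 1 else 0)"
    unfolding near_count_def by simp
  also have "\<dots> = edge_power odd_edge e s + (if s \<in> near_set then 1 else 0)" by (simp only: Suc.IH)
  also have "\<dots> = edge_power odd_edge e (Suc s)"
    unfolding edge_power_def near_set_def using e by (cases "even s"; cases odd_edge) (auto elim!: evenE oddE)
  finally show ?case .
qed

text \<open>Dividing each factor by \<open>exp v\<close> or by \<open>\<alpha> * exp v\<close>
  produces the poles at the ends of the progressions. The identity is the critical point equation,
  its right-hand side being the limit of \<open>r * g\<close>.\<close>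

lemma turning_height_eq:
  assumes chi: "e = 1 \<and> chi = chi_top u v \<alpha> \<or> e = 2 \<and> chi = chi_bottom u v \<alpha>"
  shows "chi + v / 2 = 1 / 2 * (ln (1 - A * exp (- 2 * v)) - ln (1 - A * exp (- u - v)) +
    ln (1 - A / \<alpha> * exp (- 2 * v)) - ln (1 - A / \<alpha> * exp (u - v)))"
proof -
  have "chi = - v / 2 - 1 / 2 * ln ((1 - A * exp (- u - v)) * (1 - A / \<alpha> * exp (u - v)) / ((1 - A * exp (- 2 * v)) * (1 - A / \<alpha> * exp (- 2 * v))))"
  proof -
    define E where "E = exp v"
    have E: "0 < E" by (simp add: E_def)
    have ex: "exp (- u) = E * exp (- u - v)" "exp u = E * exp (u - v)" "exp (- v) = E * exp (- 2 * v)"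
      by (simp_all add: E_def exp_add[symmetric])
    have "(E - E * x * A') * (E - E * y) / ((E - E * z * A') * (E - E * z)) = (1 - A' * x) * (1 - y) / ((1 - A' * z) * (1 - z))" for x y z A'
    proof -
      have "(E - E * x * A') * (E - E * y) / ((E - E * z * A') * (E - E * z)) = (E * E) * ((1 - A' * x) * (1 - y)) / ((E * E) * ((1 - A' * z) * (1 - z)))"
        by (simp add: algebra_simps)
      then show ?thesis using E by simp
    qed
    moreover have "(E - E * x) * (\<alpha> * E - E * y) / ((E - E * z) * (\<alpha> * E - E * z)) = (1 - 1 * x) * (1 - 1 / \<alpha> * y) / ((1 - 1 * z) * (1 - 1 / \<alpha> * z))" for x y z
    proof -
      have "(E - E * x) * (\<alpha> * E - E * y) = (\<alpha> * E * E) * ((1 - 1 * x) * (1 - 1 / \<alpha> * y))" for x y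
        using alpha_pos by (simp add: field_simps)
      then have "(E - E * x) * (\<alpha> * E - E * y) / ((E - E * z) * (\<alpha> * E - E * z)) = (\<alpha> * E * E) * ((1 - 1 * x) * (1 - 1 / \<alpha> * y)) / ((\<alpha> * E * E) * ((1 - 1 * z) * (1 - 1 / \<alpha> * z)))"
        by (simp only:)
      then show ?thesis using E alpha_pos by simp
    qed
    ultimately show ?thesis
      using chi alpha_pos unfolding chi_top_def chi_bottom_def E_def[symmetric] ex by (auto simp: A_def)
  qed
  moreover have "ln (w * x / (y * z)) = ln w + ln x - ln y - ln z" if "0 < w" "0 < x" "0 < y" "0 < z" for w x y z :: real
    using that by (simp add: ln_mult ln_div)
  moreover have "1 / 2 * (y - w + z - x) = - v / 2 - 1 / 2 * (w + x - y - z) + v / 2" for w x y z :: real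
    by (simp add: field_simps)
  ultimately show ?thesis
    using arguments_less by simp
qed

text \<open>In \<open>r * (g - H)\<close> the limits \<open>chi + v / 2\<close> cancel. The errors
  of the Riemann sum, of the floor of \<open>chi / r\<close>, of \<open>r * D\<close>, and the shift
  by \<open>s\<close> are all \<open>o(sqrt r)\<close>, so after division by \<open>sqrt r\<close>
  only the local height survives.\<close>

lemma scaled_heightI:
  fixes H :: "nat \<Rightarrow> int" and h :: "nat \<Rightarrow> real"
  assumes H: "\<forall>\<^sub>F n in sequentially. real_of_int (H n) = h n + (real (D n) - real s) / 2 + 1 / 2"
    and h: "(\<lambda>n. sqrt (r n) * (h n - real_of_int \<lfloor>chi / r n\<rfloor>)) \<longlonglongrightarrow> y"
    and chi: "e = 1 \<and> chi = chi_top u v \<alpha> \<or> e = 2 \<and> chi = chi_bottom u v \<alpha>"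
  shows "scaled_height H y"
proof -
  define L where "L = 1 / 2 * (- ln (1 - A / \<alpha> * exp (u - v)) - - ln (1 - A / \<alpha> * exp (- 2 * v)) + - ln (1 - A * exp (- u - v)) - - ln (1 - A * exp (- 2 * v)))"
  have "(\<lambda>n. (r n * (\<Sum>m\<in>wall_set (l n) (k n). wall_pole A \<alpha> v (r n) m / (1 - wall_pole A \<alpha> v (r n) m)) - L) / sqrt (r n)) \<longlonglongrightarrow> 0"
    unfolding L_def
  proof (rule wall_sum_limit)
    fix t :: real assume "0 < t" "t < 1"
    then show "((\<lambda>t. - ln (1 - t)) has_real_derivative t / (1 - t) / t) (at t)"
      by (auto intro!: derivative_eq_intros)
  next
    fix s t :: real assume "0 < s" "s \<le> t" "t < 1"
    then show "s / (1 - s) \<le> t / (1 - t)" by (intro frac_le) auto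
  qed
  then have g: "(\<lambda>n. (r n * g n - L) / sqrt (r n)) \<longlonglongrightarrow> 0" unfolding g_def .
  have L: "L = chi + v / 2" unfolding turning_height_eq[OF chi] L_def by simp
  have f: "(\<lambda>n. (chi - r n * real_of_int \<lfloor>chi / r n\<rfloor>) / sqrt (r n)) \<longlonglongrightarrow> 0"
  proof (rule tendsto_sandwich[OF _ _ tendsto_const sqrt_r])
    have "0 \<le> chi - r n * real_of_int \<lfloor>chi / r n\<rfloor> \<and> chi - r n * real_of_int \<lfloor>chi / r n\<rfloor> \<le> r n" for n
      using floor_divide_lower[OF r_pos[of n], of chi] floor_divide_upper[OF r_pos[of n], of chi]
      by (simp add: algebra_simps)
    then have "0 \<le> (chi - r n * real_of_int \<lfloor>chi / r n\<rfloor>) / sqrt (r n) \<and> (chi - r n * real_of_int \<lfloor>chi / r n\<rfloor>) / sqrt (r n) \<le> r n / sqrt (r n)" for n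
      using r_pos[of n] by (simp add: divide_right_mono)
    then show "\<forall>\<^sub>F n in sequentially. 0 \<le> (chi - r n * real_of_int \<lfloor>chi / r n\<rfloor>) / sqrt (r n)"
      "\<forall>\<^sub>F n in sequentially. (chi - r n * real_of_int \<lfloor>chi / r n\<rfloor>) / sqrt (r n) \<le> sqrt (r n)"
      using r_pos by (auto simp: real_div_sqrt less_imp_le)
  qed
  have "(\<lambda>n. (r n * g n - L) / sqrt (r n) + (chi - r n * real_of_int \<lfloor>chi / r n\<rfloor>) / sqrt (r n) - 1 / 2 * ((r n * real (D n) - v) / sqrt (r n))
     + (real s - 1) / 2 * sqrt (r n) - sqrt (r n) * (h n - real_of_int \<lfloor>chi / r n\<rfloor>)) \<longlonglongrightarrow> 0 + 0 - 1 / 2 * 0 + (real s - 1) / 2 * 0 - y"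
    by (intro tendsto_intros g f D_lim sqrt_r h)
  then have "(\<lambda>n. (r n * g n - L) / sqrt (r n) + (chi - r n * real_of_int \<lfloor>chi / r n\<rfloor>) / sqrt (r n) - 1 / 2 * ((r n * real (D n) - v) / sqrt (r n))
     + (real s - 1) / 2 * sqrt (r n) - sqrt (r n) * (h n - real_of_int \<lfloor>chi / r n\<rfloor>)) \<longlonglongrightarrow> - y" by simp
  then show ?thesis unfolding scaled_height_def
  proof (rule Lim_transform_eventually)
    show "\<forall>\<^sub>F n in sequentially. (r n * g n - L) / sqrt (r n) + (chi - r n * real_of_int \<lfloor>chi / r n\<rfloor>) / sqrt (r n) - 1 / 2 * ((r n * real (D n) - v) / sqrt (r n))
     + (real s - 1) / 2 * sqrt (r n) - sqrt (r n) * (h n - real_of_int \<lfloor>chi / r n\<rfloor>) = sqrt (r n) * (g n - H n)"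
      using H
    proof eventually_elim
      case (elim n)
      define q where "q = sqrt (r n)"
      have q: "0 < q" "r n = q * q" using r_pos[of n] by (simp_all add: q_def)
      show ?case unfolding q_def[symmetric] unfolding q(2) L elim using q(1) by (simp add: field_simps)
    qed
  qed
qed

end

section \<open>The second derivative of \<open>S\<close> at the turning point\<close>

text \<open>The integrand depends on \<open>M - ln z\<close> only, so its derivative in
  \<open>z\<close> is \<open>- 1 / z\<close> times its derivative in \<open>M\<close>, and the
  differentiated integral reduces to boundary values.\<close>

lemma log_integral_derivative:
  fixes a z :: real
  assumes "lo \<le> hi" "0 < a" "exp hi * a < z"
  shows "((\<lambda>z. integral {lo..hi} (\<lambda>M. ln (1 - exp M * a / z))) has_real_derivative
    1 / z * (ln (1 - exp lo * a / z) - ln (1 - exp hi * a / z))) (at z)"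
proof -
  define U where "U = {exp hi * a<..}"
  have U: "0 < x" "exp t * a < x" if "x \<in> U" "t \<le> hi" for x t
  proof -
    have "exp t * a \<le> exp hi * a" using that assms by (intro mult_right_mono) auto
    then show "exp t * a < x" using that by (simp add: U_def)
    moreover have "0 < exp t * a" using assms by simp
    ultimately show "0 < x" by linarith
  qed
  have "((\<lambda>x. integral (cbox lo hi) (\<lambda>t. ln (1 - exp t * a / x))) has_field_derivative
      integral (cbox lo hi) (\<lambda>t. exp t * a / (z * (z - exp t * a)))) (at z within U)"
  proof (rule leibniz_rule_field_derivative[where fx = "\<lambda>x t. exp t * a / (x * (x - exp t * a))"])
    fix x t assume x: "x \<in> U" and t: "t \<in> cbox lo hi"
    have p: "0 < x" "exp t * a < x" using U[OF x] t by auto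
    then have q: "0 < 1 - exp t * a / x" by simp
    have "((\<lambda>x. ln (1 - exp t * a / x)) has_field_derivative 1 / (1 - exp t * a / x) * (exp t * a / (x * x))) (at x within U)"
      using p q by (auto intro!: derivative_eq_intros simp: power2_eq_square)
    moreover have "1 / (1 - exp t * a / x) * (exp t * a / (x * x)) = exp t * a / (x * (x - exp t * a))"
      using p q by (simp add: field_simps)
    ultimately show "((\<lambda>x. ln (1 - exp t * a / x)) has_field_derivative exp t * a / (x * (x - exp t * a))) (at x within U)"
      by (simp only:)
  next
    fix x assume x: "x \<in> U"
    have "continuous_on (cbox lo hi) (\<lambda>t. ln (1 - exp t * a / x))"
      using U[OF x] by (auto intro!: continuous_intros simp: field_simps) (metis less_irrefl)+
    then show "(\<lambda>t. ln (1 - exp t * a / x)) integrable_on cbox lo hi" by (rule integrable_continuous)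
  next
    show "continuous_on (U \<times> cbox lo hi) (\<lambda>(x, t). exp t * a / (x * (x - exp t * a)))"
      unfolding case_prod_unfold using U by (force intro!: continuous_intros)
  qed (use assms in \<open>auto simp: U_def\<close>)
  then have 1: "((\<lambda>x. integral {lo..hi} (\<lambda>t. ln (1 - exp t * a / x))) has_field_derivative
      integral {lo..hi} (\<lambda>t. exp t * a / (z * (z - exp t * a)))) (at z)"
    using assms by (simp add: U_def at_within_open[of z "{exp hi * a<..}"])
  have z: "z \<in> U" using assms by (simp add: U_def)
  have "((\<lambda>t. exp t * a / (z * (z - exp t * a))) has_integral (- (1 / z) * ln (1 - exp hi * a / z) - - (1 / z) * ln (1 - exp lo * a / z))) {lo..hi}"
  proof (rule fundamental_theorem_of_calculus[OF assms(1)])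
    fix t assume t: "t \<in> {lo..hi}"
    have p: "0 < z" "exp t * a < z" using U[OF z] t by auto
    then have q: "0 < 1 - exp t * a / z" by simp
    have "((\<lambda>t. - (1 / z) * ln (1 - exp t * a / z)) has_real_derivative - (1 / z) * (1 / (1 - exp t * a / z) * - (exp t * a / z))) (at t within {lo..hi})"
      using p q by (auto intro!: derivative_eq_intros)
    moreover have "- (1 / z) * (1 / (1 - exp t * a / z) * - (exp t * a / z)) = exp t * a / (z * (z - exp t * a))"
      using p q by (simp add: field_simps)
    ultimately show "((\<lambda>t. - (1 / z) * ln (1 - exp t * a / z)) has_vector_derivative exp t * a / (z * (z - exp t * a))) (at t within {lo..hi})"
      by (simp only: has_real_derivative_iff_has_vector_derivative)
  qed
  then have "integral {lo..hi} (\<lambda>t. exp t * a / (z * (z - exp t * a))) = 1 / z * (ln (1 - exp lo * a / z) - ln (1 - exp hi * a / z))"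
    by (simp add: integral_unique algebra_simps diff_divide_distrib)
  with 1 show ?thesis by (simp only:)
qed

text \<open>The derivative of \<open>B / x\<close> is \<open>B' / x - B / x^2\<close>, whose last
  term vanishes at a critical point; there \<open>z^2\<close> times the second derivative is the
  second derivative in the variable \<open>ln z\<close>.\<close>

lemma second_log_derivative:
  fixes F B :: "real \<Rightarrow> real"
  assumes S: "open S" "z \<in> S" "0 \<notin> S"
    and F: "\<And>x. x \<in> S \<Longrightarrow> (F has_real_derivative B x / x) (at x)"
    and B: "B z = 0" "(B has_real_derivative B') (at z)"
  shows "z\<^sup>2 * (deriv ^^ 2) F z = z * B'"
proof -
  have z: "z \<noteq> 0" using S by auto
  have "\<forall>\<^sub>F x in nhds z. deriv F x = B x / x"
    using eventually_nhds_in_open[OF S(1,2)] by eventually_elim (rule DERIV_imp_deriv[OF F])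
  then have "deriv (deriv F) z = deriv (\<lambda>x. B x / x) z" by (rule deriv_cong_ev) simp
  also have "\<dots> = B' / z"
    by (rule DERIV_imp_deriv) (use z B in \<open>auto intro!: derivative_eq_intros simp: power2_eq_square\<close>)
  finally show ?thesis using z by (simp add: numeral_2_eq_2 power2_eq_square)
qed

lemma S_fun_right:
  assumes "0 < u" "u < v"
  shows "S_fun u v \<alpha> v chi z = 1 / 2 * integral {- v..- u} (\<lambda>M. ln (1 - exp M * sqrt \<alpha> / z) + ln (1 - exp M / sqrt \<alpha> / z))
    + 1 / 2 * integral {- u..u} (\<lambda>M. ln (1 - exp M / sqrt \<alpha> / z)) - (chi + v / 2) * ln z"
proof -
  have "limit_wall u v = - v" using assms by (simp add: limit_wall_def field_simps)
  then show ?thesis using assms by (simp add: S_fun_def min_def max_def)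
qed

text \<open>At \<open>- v\<close> only the integrals with \<open>exp (- M) * z\<close> survive. The
  substitution \<open>M \<mapsto> - M\<close> turns them into those at \<open>v\<close> with
  \<open>1 / z\<close>, and \<open>ln (1 / z) = - ln z\<close> with the evenness of
  \<open>limit_wall\<close> matches the last term.\<close>

lemma S_fun_reflect:
  assumes "0 < u" "u < v" "0 < z"
  shows "S_fun u v \<alpha> (- v) chi z = - S_fun u v \<alpha> v chi (1 / z)"
proof -
  have 1: "integral {u..v} (\<lambda>M. ln (1 - exp (- M) / sqrt \<alpha> * z) + ln (1 - exp (- M) * sqrt \<alpha> * z)) =
    integral {- v..- u} (\<lambda>M. ln (1 - exp M / sqrt \<alpha> * z) + ln (1 - exp M * sqrt \<alpha> * z))"
    using Henstock_Kurzweil_Integration.integral_reflect_real[of "- u" "- v" "\<lambda>M. ln (1 - exp M / sqrt \<alpha> * z) + ln (1 - exp M * sqrt \<alpha> * z)"] by simp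
  have 2: "integral {- u..u} (\<lambda>M. ln (1 - exp (- M) / sqrt \<alpha> * z)) = integral {- u..u} (\<lambda>M. ln (1 - exp M / sqrt \<alpha> * z))"
    using Henstock_Kurzweil_Integration.integral_reflect_real[of u "- u" "\<lambda>M. ln (1 - exp M / sqrt \<alpha> * z)"] by simp
  have "S_fun u v \<alpha> (- v) chi z = - (1 / 2) * integral {u..v} (\<lambda>M. ln (1 - exp (- M) / sqrt \<alpha> * z) + ln (1 - exp (- M) * sqrt \<alpha> * z))
    - 1 / 2 * integral {- u..u} (\<lambda>M. ln (1 - exp (- M) / sqrt \<alpha> * z)) - (chi + v / 2) * ln z"
  proof -
    have "limit_wall u (- v) = - v" using assms by (simp add: limit_wall_def field_simps)
    then show ?thesis using assms by (simp add: S_fun_def min_def max_def)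
  qed
  then show ?thesis
    unfolding S_fun_right[OF assms(1,2)] 1 2 using assms(3) by (simp add: ln_div add.commute)
qed

text \<open>This is \<open>z\<close> times the derivative of \<open>S_fun\<close> at
  \<open>tau = v\<close>. The boundary values at \<open>- u\<close> of the two integrals with
  \<open>1 / sqrt \<alpha>\<close> cancel, which leaves four logarithms.\<close>

definition S_log_derivative :: "real \<Rightarrow> real \<Rightarrow> real \<Rightarrow> real \<Rightarrow> real \<Rightarrow> real" where
  "S_log_derivative u v \<alpha> chi z = 1 / 2 * (ln (1 - exp (- v) * sqrt \<alpha> / z) - ln (1 - exp (- u) * sqrt \<alpha> / z) +
     ln (1 - exp (- v) * (1 / sqrt \<alpha>) / z) - ln (1 - exp u * (1 / sqrt \<alpha>) / z)) - (chi + v / 2)"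

lemma S_fun_right_derivative:
  assumes uv: "0 < u" "u < v" and \<alpha>: "0 < \<alpha>" and z: "exp (- u) * sqrt \<alpha> < z" "exp u * (1 / sqrt \<alpha>) < z"
  shows "(S_fun u v \<alpha> v chi has_real_derivative S_log_derivative u v \<alpha> chi z / z) (at z)"
proof -
  define J :: "real \<Rightarrow> real \<Rightarrow> real \<Rightarrow> real \<Rightarrow> real"
    where "J = (\<lambda>lo hi a z. integral {lo..hi} (\<lambda>M. ln (1 - exp M * a / z)))"
  define U where "U = {max (exp (- u) * sqrt \<alpha>) (exp u * (1 / sqrt \<alpha>))<..}"
  have z0: "0 < z" using z(2) \<alpha> by (meson exp_gt_zero less_trans mult_pos_pos real_sqrt_gt_zero zero_less_divide_1_iff)
  have less: "exp M * a / x < 1" if "x \<in> U" "0 < a" "exp hi * a < x" "M \<le> hi" for x a hi M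
  proof -
    have "exp M * a \<le> exp hi * a" using that by (intro mult_right_mono) auto
    then have "exp M * a < x" using that by linarith
    moreover have "0 < exp M * a" using that by simp
    ultimately show ?thesis by (simp add: field_simps)
  qed
  have int: "(\<lambda>M. ln (1 - exp M * a / x)) integrable_on {lo..hi}" if "x \<in> U" "0 < a" "exp hi * a < x" for x lo hi a
  proof (rule integrable_continuous_real)
    have x0: "0 < x" using mult_pos_pos[OF exp_gt_zero[of hi] \<open>0 < a\<close>] that(3) by linarith
    have "1 - exp M * a / x \<noteq> 0" if "M \<in> {lo..hi}" for M
      using less[OF \<open>x \<in> U\<close> \<open>0 < a\<close> \<open>exp hi * a < x\<close>, of M] that by auto
    then show "continuous_on {lo..hi} (\<lambda>M. ln (1 - exp M * a / x))"
      using less[OF that, of hi] x0 by (intro continuous_intros) auto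
  qed
  have S: "S_fun u v \<alpha> v chi x = 1 / 2 * (J (- v) (- u) (sqrt \<alpha>) x + J (- v) (- u) (1 / sqrt \<alpha>) x) + 1 / 2 * J (- u) u (1 / sqrt \<alpha>) x - (chi + v / 2) * ln x"
    if x: "x \<in> U" for x
  proof -
    have "exp (- u) * (1 / sqrt \<alpha>) \<le> exp u * (1 / sqrt \<alpha>)" using uv \<alpha> by (intro mult_right_mono) auto
    then have "exp (- u) * (1 / sqrt \<alpha>) < x" using x by (simp add: U_def)
    then have "integral {- v..- u} (\<lambda>M. ln (1 - exp M * sqrt \<alpha> / x) + ln (1 - exp M * (1 / sqrt \<alpha>) / x)) =
       J (- v) (- u) (sqrt \<alpha>) x + J (- v) (- u) (1 / sqrt \<alpha>) x"
      unfolding J_def using x \<alpha> by (intro integral_add int) (auto simp: U_def)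
    then show ?thesis unfolding S_fun_right[OF uv] J_def by simp
  qed
  have "exp (- u) * (1 / sqrt \<alpha>) \<le> exp u * (1 / sqrt \<alpha>)" using uv \<alpha> by (intro mult_right_mono) auto
  then have z3: "exp (- u) * (1 / sqrt \<alpha>) < z" using z by linarith
  have D: "((\<lambda>x. 1 / 2 * (J (- v) (- u) (sqrt \<alpha>) x + J (- v) (- u) (1 / sqrt \<alpha>) x) + 1 / 2 * J (- u) u (1 / sqrt \<alpha>) x - (chi + v / 2) * ln x)
     has_real_derivative 1 / 2 * (1 / z * (ln (1 - exp (- v) * sqrt \<alpha> / z) - ln (1 - exp (- u) * sqrt \<alpha> / z)) +
       1 / z * (ln (1 - exp (- v) * (1 / sqrt \<alpha>) / z) - ln (1 - exp (- u) * (1 / sqrt \<alpha>) / z))) +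
       1 / 2 * (1 / z * (ln (1 - exp (- u) * (1 / sqrt \<alpha>) / z) - ln (1 - exp u * (1 / sqrt \<alpha>) / z))) - (chi + v / 2) * (1 / z)) (at z)"
    unfolding J_def
    by (intro DERIV_diff DERIV_add DERIV_cmult log_integral_derivative DERIV_ln_divide) (use uv \<alpha> z z3 z0 in auto)
  have e: "1 / 2 * (1 / z * (a - b) + 1 / z * (c - d)) + 1 / 2 * (1 / z * (d - f)) - k * (1 / z) = (1 / 2 * (a - b + c - f) - k) / z" for a b c d f k :: real
    using z0 by (simp add: field_simps)
  show ?thesis
  proof (rule has_field_derivative_transform_within_open[OF D[unfolded e, folded S_log_derivative_def]])
    show "open U" "z \<in> U" using z by (auto simp: U_def)
  qed (simp add: S)
qed

lemma S_log_derivative_derivative: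
  assumes z: "0 < z" "exp (- u) * sqrt \<alpha> < z" "exp u * (1 / sqrt \<alpha>) < z" and uv: "0 < u" "u < v" and \<alpha>: "0 < \<alpha>"
  shows "(S_log_derivative u v \<alpha> chi has_real_derivative 1 / z * (1 / 2 * (1 / (1 - exp (- v) * sqrt \<alpha> / z) - 1 / (1 - exp (- u) * sqrt \<alpha> / z) +
     1 / (1 - exp (- v) * (1 / sqrt \<alpha>) / z) - 1 / (1 - exp u * (1 / sqrt \<alpha>) / z)))) (at z)"
proof -
  have d: "((\<lambda>z. ln (1 - x / z)) has_real_derivative 1 / z * (1 / (1 - x / z)) - 1 / z) (at z)" if x: "x < z" for x
  proof -
    have q: "0 < 1 - x / z" using x z by simp
    have "((\<lambda>z. ln (1 - x / z)) has_real_derivative 1 / (1 - x / z) * (x / (z * z))) (at z)"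
      using z q by (auto intro!: derivative_eq_intros simp: power2_eq_square)
    moreover have "1 / (1 - x / z) * (x / (z * z)) = 1 / z * (1 / (1 - x / z)) - 1 / z"
      using z q x by (simp add: field_simps)
    ultimately show ?thesis by (simp only:)
  qed
  have "exp (- v) * sqrt \<alpha> \<le> exp (- u) * sqrt \<alpha>" "exp (- v) * (1 / sqrt \<alpha>) \<le> exp u * (1 / sqrt \<alpha>)"
    using uv \<alpha> by (auto intro!: mult_right_mono divide_right_mono)
  then have x: "exp (- v) * sqrt \<alpha> < z" "exp (- v) * (1 / sqrt \<alpha>) < z" using z by linarith+
  have D: "(S_log_derivative u v \<alpha> chi has_real_derivative 1 / 2 * ((1 / z * (1 / (1 - exp (- v) * sqrt \<alpha> / z)) - 1 / z) - (1 / z * (1 / (1 - exp (- u) * sqrt \<alpha> / z)) - 1 / z) +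
     (1 / z * (1 / (1 - exp (- v) * (1 / sqrt \<alpha>) / z)) - 1 / z) - (1 / z * (1 / (1 - exp u * (1 / sqrt \<alpha>) / z)) - 1 / z)) - 0) (at z)"
    unfolding S_log_derivative_def[abs_def]
    by (intro DERIV_diff DERIV_add DERIV_cmult d DERIV_const x z)
  have e: "1 / 2 * ((1 / z * a - 1 / z) - (1 / z * b - 1 / z) + (1 / z * c - 1 / z) - (1 / z * d - 1 / z)) - 0 = 1 / z * (1 / 2 * (a - b + c - d))" for a b c d
    using z by (simp add: field_simps)
  from D show ?thesis unfolding e .
qed

section \<open>Identification of the curvature with the second derivative of S\<close>

context edge_model
begin

text \<open>At the turning value of \<open>z\<close> the four arguments in
  \<open>S_log_derivative\<close> become those of \<open>critical_curvature\<close>, so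
  \<open>turning_height_eq\<close> says that the point is critical, and differentiating once more
  gives the curvature. The edge at \<open>- v\<close> follows from the reflection of S.\<close>

lemma S_second_eq:
  assumes chi: "e = 1 \<and> chi = chi_top u v \<alpha> \<or> e = 2 \<and> chi = chi_bottom u v \<alpha>"
  shows "S_second u v \<alpha> v chi e = critical_curvature u v A \<alpha>"
    and "S_second u v \<alpha> (- v) chi e = - critical_curvature u v A \<alpha>"
proof -
  define z where "z = exp v * sqrt \<alpha> / A"
  define B where "B = S_log_derivative u v \<alpha> chi"
  define U where "U = {max (exp (- u) * sqrt \<alpha>) (exp u * (1 / sqrt \<alpha>))<..}"
  have q: "0 < sqrt \<alpha>" "sqrt \<alpha> * sqrt \<alpha> = \<alpha>" using alpha_pos by simp_all
  have z0: "0 < z" using A q by (simp add: z_def)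
  have ex: "exp (- v) * sqrt \<alpha> / z = A * exp (- 2 * v)" "exp (- u) * sqrt \<alpha> / z = A * exp (- u - v)"
    "exp (- v) * (1 / sqrt \<alpha>) / z = A / \<alpha> * exp (- 2 * v)" "exp u * (1 / sqrt \<alpha>) / z = A / \<alpha> * exp (u - v)"
  proof -
    have 1: "exp x * sqrt \<alpha> / z = A * exp (x - v)" for x
      using q A by (simp add: z_def exp_diff)
    have 2: "exp x * (1 / sqrt \<alpha>) / z = A / \<alpha> * exp (x - v)" for x
    proof -
      have "sqrt \<alpha> * (exp v * sqrt \<alpha>) = \<alpha> * exp v" using q(2) by (metis mult.assoc mult.commute)
      then show ?thesis using q A by (simp add: z_def exp_diff mult.commute)
    qed
    show "exp (- v) * sqrt \<alpha> / z = A * exp (- 2 * v)" "exp (- u) * sqrt \<alpha> / z = A * exp (- u - v)"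
      "exp (- v) * (1 / sqrt \<alpha>) / z = A / \<alpha> * exp (- 2 * v)" "exp u * (1 / sqrt \<alpha>) / z = A / \<alpha> * exp (u - v)"
      unfolding 1 2 by simp_all
  qed
  have zU: "exp (- u) * sqrt \<alpha> < z" "exp u * (1 / sqrt \<alpha>) < z"
  proof -
    have "exp (- u) * sqrt \<alpha> / z < 1" "exp u * (1 / sqrt \<alpha>) / z < 1" unfolding ex by (rule arguments_less)+
    then show "exp (- u) * sqrt \<alpha> < z" "exp u * (1 / sqrt \<alpha>) < z" using z0 by (simp_all only: divide_less_eq_1_pos)
  qed
  have B0: "B z = 0"
    unfolding B_def S_log_derivative_def ex turning_height_eq[OF chi] by simp
  have B': "(B has_real_derivative 1 / z * critical_curvature u v A \<alpha>) (at z)"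
    using S_log_derivative_derivative[OF z0 zU uv alpha_pos, of chi]
    unfolding ex critical_curvature_def[symmetric] B_def[symmetric] .
  have U0: "0 < x" if "x \<in> U" for x
  proof -
    have "0 < exp (- u) * sqrt \<alpha>" using q by simp
    then show ?thesis using that by (simp add: U_def)
  qed
  have turn: "z_turning v \<alpha> v e = z" "z_turning v \<alpha> (- v) e = 1 / z"
  proof -
    have "\<alpha> / sqrt \<alpha> = sqrt \<alpha>" using alpha_pos by (simp add: real_div_sqrt)
    then have "exp v * (if e = 1 then 1 / sqrt \<alpha> else sqrt \<alpha>) = z"
      using q by (simp add: z_def A_def field_simps)
    then show "z_turning v \<alpha> v e = z" "z_turning v \<alpha> (- v) e = 1 / z"
      using uv by (simp_all add: z_turning_def Let_def)
  qed
  have F: "(S_fun u v \<alpha> v chi has_real_derivative B x / x) (at x)" if "x \<in> U" for x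
    unfolding B_def by (rule S_fun_right_derivative[OF uv alpha_pos]) (use that in \<open>auto simp: U_def\<close>)
  have "z\<^sup>2 * (deriv ^^ 2) (S_fun u v \<alpha> v chi) z = z * (1 / z * critical_curvature u v A \<alpha>)"
  proof (rule second_log_derivative[where S = U])
    show "open U" "z \<in> U" "0 \<notin> U" using zU U0[of 0] by (auto simp: U_def)
    show "B z = 0" by (rule B0)
    show "(B has_real_derivative 1 / z * critical_curvature u v A \<alpha>) (at z)" by (rule B')
  qed (rule F)
  then show "S_second u v \<alpha> v chi e = critical_curvature u v A \<alpha>"
    using z0 unfolding S_second_def turn by simp
  \<comment> \<open>The outer factor \<open>1 / z\<close>, the derivative of \<open>B\<close> and
    the derivative \<open>- z^2\<close> of the inversion multiply to
    \<open>- critical_curvature\<close>.\<close>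
  have "(1 / z)\<^sup>2 * (deriv ^^ 2) (S_fun u v \<alpha> (- v) chi) (1 / z) = 1 / z * ((1 / z * critical_curvature u v A \<alpha>) * - z\<^sup>2)"
  proof (rule second_log_derivative[where S = "{x. 0 < x \<and> 1 / x \<in> U}" and B = "\<lambda>x. B (1 / x)"])
    have "{x. 0 < x \<and> 1 / x \<in> U} = {0<..<1 / max (exp (- u) * sqrt \<alpha>) (exp u * (1 / sqrt \<alpha>))}"
    proof -
      have m: "0 < max (exp (- u) * sqrt \<alpha>) (exp u * (1 / sqrt \<alpha>))" using q by (simp add: less_max_iff_disj)
      have "m < 1 / x \<longleftrightarrow> x < 1 / m" if "0 < m" "0 < x" for m x :: real using that by (simp add: field_simps)
      then show ?thesis using m by (auto simp only: U_def greaterThan_iff greaterThanLessThan_iff mem_Collect_eq)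
    qed
    then show "open {x. 0 < x \<and> 1 / x \<in> U}" by simp
    show "1 / z \<in> {x. 0 < x \<and> 1 / x \<in> U}" using z0 zU by (simp add: U_def)
    show "B (1 / (1 / z)) = 0" using B0 by simp
    have "((\<lambda>x. 1 / x) has_real_derivative - z\<^sup>2) (at (1 / z))"
      using z0 by (auto intro!: derivative_eq_intros simp: power2_eq_square)
    then show "((\<lambda>x. B (1 / x)) has_real_derivative 1 / z * critical_curvature u v A \<alpha> * - z\<^sup>2) (at (1 / z))"
      by (rule DERIV_chain2[where f = B and g = "\<lambda>x. 1 / x", rotated]) (use B' in simp)
  next
    fix x assume "x \<in> {x. 0 < x \<and> 1 / x \<in> U}"
    then have x: "0 < x" "1 / x \<in> U" by auto
    have d: "((\<lambda>x. 1 / x) has_real_derivative - (1 / (x * x))) (at x)"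
      using x by (auto intro!: derivative_eq_intros simp: power2_eq_square)
    have "((\<lambda>x. - S_fun u v \<alpha> v chi (1 / x)) has_real_derivative - (B (1 / x) / (1 / x) * - (1 / (x * x)))) (at x)"
      by (intro DERIV_minus DERIV_chain2[where f = "S_fun u v \<alpha> v chi" and g = "\<lambda>x. 1 / x", OF F[OF x(2)] d])
    moreover have "- (B (1 / x) / (1 / x) * - (1 / (x * x))) = B (1 / x) / x" using x by simp
    ultimately have "((\<lambda>x. - S_fun u v \<alpha> v chi (1 / x)) has_real_derivative B (1 / x) / x) (at x)" by (simp only:)
    then show "(S_fun u v \<alpha> (- v) chi has_real_derivative B (1 / x) / x) (at x)"
      by (rule has_field_derivative_transform_within_open[where S = "{0<..}"])
        (use x uv in \<open>auto simp: S_fun_reflect\<close>)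
  qed auto
  then show "S_second u v \<alpha> (- v) chi e = - critical_curvature u v A \<alpha>"
    using z0 unfolding S_second_def turn by (simp add: power2_eq_square)
qed

end

section \<open>The kernel of the two-periodic model\<close>

text \<open>Cells of the staircase satisfy \<open>i + j <= k + 1\<close>, and on the diagonal
  \<open>t\<close> one has \<open>i + j = 2 * min i j + \<bar>t\<bar>\<close>; so there are
  \<open>(k + 1 - \<bar>t\<bar>) div 2\<close> of them as long as this is positive.\<close>

lemma back_wall_staircase:
  assumes "even k"
  shows "back_wall (staircase k) t = (if \<bar>t\<bar> < int k then (if even t then - int k else - int k - 1) else - \<bar>t\<bar>)"
proof -
  define N where "N = nat ((int k + 1 - \<bar>t\<bar>) div 2)"
  have "{(i, j). 1 \<le> i \<and> 1 \<le> j \<and> j \<le> staircase k i \<and> int j - int i = t} = (\<lambda>i. (i + 1 + nat (- t), i + 1 + nat t)) ` {..<N}"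
    (is "?L = ?R")
  proof (intro equalityI subsetI)
    fix x assume "x \<in> ?L"
    then obtain i j where x: "x = (i, j)" "1 \<le> i" "1 \<le> j" "j \<le> k + 1 - i" "int j - int i = t"
      by (auto simp: staircase_def)
    have "min i j - 1 < N"
    proof -
      have "2 * int (min i j) + \<bar>t\<bar> = int i + int j" using x(5) by (simp add: min_def)
      then show ?thesis unfolding N_def using x by linarith
    qed
    moreover have "x = (min i j - 1 + 1 + nat (- t), min i j - 1 + 1 + nat t)"
      using x by (auto simp: min_def)
    ultimately show "x \<in> ?R" by blast
  next
    fix x assume "x \<in> ?R"
    then obtain i where i: "i < N" "x = (i + 1 + nat (- t), i + 1 + nat t)" by blast
    have "2 * int i + 2 + \<bar>t\<bar> \<le> int k + 1" using i(1) unfolding N_def by linarith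
    then show "x \<in> ?L" unfolding i(2) staircase_def by auto
  qed
  moreover have "card ((\<lambda>i. (i + 1 + nat (- t), i + 1 + nat t)) ` {..<N}) = N"
    by (subst card_image) (auto intro: inj_onI)
  ultimately have "back_wall (staircase k) t = - \<bar>t\<bar> - 2 * int N" by (simp add: back_wall_def)
  moreover have "2 * int N = (if \<bar>t\<bar> < int k then (if even t then int k - \<bar>t\<bar> else int k + 1 - \<bar>t\<bar>) else 0)"
  proof (cases "\<bar>t\<bar> < int k")
    case True
    then have N: "int N = (int k + 1 - \<bar>t\<bar>) div 2" by (simp add: N_def)
    show ?thesis
    proof (cases "even t")
      case True
      then have "even (int k - \<bar>t\<bar>)" using assms by simp
      then obtain x where "int k - \<bar>t\<bar> = 2 * x" by (rule evenE)
      then show ?thesis using N True \<open>\<bar>t\<bar> < int k\<close> by (simp add: algebra_simps)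
    next
      case False
      then have "even (int k + 1 - \<bar>t\<bar>)" using assms by simp
      then show ?thesis using N False \<open>\<bar>t\<bar> < int k\<close> by simp
    qed
  next
    case False
    then have "(int k + 1 - \<bar>t\<bar>) div 2 \<le> 0" by linarith
    then show ?thesis using False by (simp add: N_def)
  qed
  ultimately show ?thesis by simp
qed

lemma wall_step:
  assumes "even k"
  shows "back_wall (staircase k) (m + 1) - back_wall (staircase k) m =
    (if m < - int k \<or> m < int k \<and> odd m then 1 else - 1)"
  unfolding back_wall_staircase[OF assms] using assms by (auto simp: abs_if) presburger+

lemma D_minus_staircase: "even k \<Longrightarrow> D_minus (staircase k) c d =
    {m. - int c \<le> m \<and> m < int d \<and> (m < - int k \<or> m < int k \<and> odd m)}"
  by (auto simp: D_minus_def wall_step)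

lemma D_plus_staircase: "even k \<Longrightarrow> D_plus (staircase k) c d =
    {m. - int c \<le> m \<and> m < int d \<and> (int k \<le> m \<or> - int k \<le> m \<and> even m)}"
  by (auto simp: D_plus_def wall_step not_less split: if_splits)

text \<open>For even \<open>c\<close> the first weight \<open>q_t\<close> is that of the other parity; its effect on all \<open>x_plus m\<close> is a common
  factor, absorbed by rescaling \<open>z\<close>.\<close>

definition parity_factor :: "real \<Rightarrow> nat \<Rightarrow> real" where
  "parity_factor \<alpha> c = (if odd c then 1 else \<alpha>)"

text \<open>Each step multiplies by \<open>exp (- r)\<close> and by \<open>\<alpha>\<close> or its
  inverse, so \<open>sqrt \<alpha>\<close> and \<open>1 / sqrt \<alpha>\<close> alternate. The value
  at \<open>m = - c\<close> has the prefactor \<open>sqrt \<alpha>\<close>, which for even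
  \<open>c\<close> is rewritten as \<open>\<alpha> * (1 / sqrt \<alpha>)\<close>.\<close>

lemma x_plus_two_periodic:
  assumes "0 < \<alpha>" "- int c \<le> m"
  shows "x_plus c (two_periodic \<alpha> r) (sqrt \<alpha> * exp (- r * (1 / 2 - real c))) m =
    parity_factor \<alpha> c * (if odd m then sqrt \<alpha> else 1 / sqrt \<alpha>) * exp (- r * (of_int m + 1 / 2))"
  using assms(2)
proof (induction m rule: int_ge_induct)
  case base
  have "\<alpha> / sqrt \<alpha> = sqrt \<alpha>" using assms(1) by (simp add: real_div_sqrt)
  then show ?case by (simp add: x_plus_def parity_factor_def algebra_simps)
next
  case (step m)
  have "{- int c + 1..m + 1} = insert (m + 1) {- int c + 1..m}" using step.hyps by auto
  then have "x_plus c (two_periodic \<alpha> r) (sqrt \<alpha> * exp (- r * (1 / 2 - real c))) (m + 1) =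
      x_plus c (two_periodic \<alpha> r) (sqrt \<alpha> * exp (- r * (1 / 2 - real c))) m * two_periodic \<alpha> r (m + 1)"
    by (simp add: x_plus_def)
  also have "\<dots> = parity_factor \<alpha> c * (if odd m then sqrt \<alpha> else 1 / sqrt \<alpha>) * exp (- r * (of_int m + 1 / 2)) * two_periodic \<alpha> r (m + 1)"
    by (simp only: step.IH)
  also have "\<dots> = parity_factor \<alpha> c * (if odd (m + 1) then sqrt \<alpha> else 1 / sqrt \<alpha>) * (exp (- r * (of_int m + 1 / 2)) * exp (- r))"
  proof -
    have "(if odd m then s else 1 / s) * two_periodic (s * s) r (m + 1) = (if odd (m + 1) then s else 1 / s) * exp (- r)"
      if "0 < s" for s
      using that by (simp add: two_periodic_def field_simps)
    from this[of "sqrt \<alpha>"] have q: "(if odd m then sqrt \<alpha> else 1 / sqrt \<alpha>) * two_periodic \<alpha> r (m + 1) =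
        (if odd (m + 1) then sqrt \<alpha> else 1 / sqrt \<alpha>) * exp (- r)"
      using assms(1) by (simp del: even_add)
    have *: "x * y * z * w = x * z * (y * w)" for x y z w :: real by (simp only: mult_ac)
    show ?thesis unfolding *[of "parity_factor \<alpha> c"] q by (simp only: mult_ac)
  qed
  also have "exp (- r * (of_int m + 1 / 2)) * exp (- r) = exp (- r * (of_int (m + 1) + 1 / 2))"
    by (simp add: exp_add[symmetric] algebra_simps)
  finally show ?case .
qed

lemma P_prod_inverse: "P_prod p s (1 / z) = (\<Prod>j<s. 1 - of_real (p j) / z)"
  by (simp add: P_prod_def)

text \<open>To the right of the last corner the wall only descends, so every index from
  \<open>t\<close> to the edge is in \<open>D_plus\<close>, and the part of \<open>D_minus\<close>
  before \<open>t\<close> does not depend on \<open>t\<close>.\<close>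

lemma Phi_right:
  assumes "even k" "k \<le> d" "int k \<le> t" "t = int d - int s" "s \<le> d + c"
  shows "Phi (staircase k) c d q a z t = N_prod (wall_set c k) (x_minus c q a) z /
    P_prod (\<lambda>j. x_plus c q a (int d - 1 - int j)) s z"
proof -
  have 1: "{m \<in> D_minus (staircase k) c d. m < t} = wall_set c k"
    using assms unfolding D_minus_staircase[OF assms(1)] wall_set_def by auto
  have 2: "{m \<in> D_plus (staircase k) c d. t \<le> m} = (\<lambda>j. int d - 1 - int j) ` {..<s}" (is "?L = ?R")
  proof (intro equalityI subsetI)
    fix m assume "m \<in> ?L"
    then have "t \<le> m" "m < int d" unfolding D_plus_staircase[OF assms(1)] by auto
    then have "nat (int d - 1 - m) < s" "m = int d - 1 - int (nat (int d - 1 - m))" using assms by auto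
    then show "m \<in> ?R" by blast
  next
    fix m assume "m \<in> ?R"
    then show "m \<in> ?L" using assms unfolding D_plus_staircase[OF assms(1)] by auto
  qed
  have "inj_on (\<lambda>j. int d - 1 - int j) {..<s}" by (auto intro: inj_onI)
  then show ?thesis
    unfolding Phi_def 1 2 N_prod_def P_prod_def by (simp add: prod.reindex divide_inverse mult.commute)
qed

text \<open>The reflection of half-integers reads \<open>m \<mapsto> - m - 1\<close> in the integer
  encoding; it exchanges the roles of \<open>D_plus\<close> and \<open>D_minus\<close>.\<close>

lemma Phi_left:
  assumes "even k" "k \<le> c" "t \<le> - int k" "t = - int c + int s" "s \<le> d + c"
  shows "Phi (staircase k) c d q a z t = P_prod (\<lambda>j. x_minus c q a (- int c + int j)) s (1 / z) /
    N_prod (wall_set d k) (\<lambda>m. x_plus c q a (- m - 1)) (1 / z)"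
proof -
  have 1: "{m \<in> D_plus (staircase k) c d. t \<le> m} = (\<lambda>m. - m - 1) ` wall_set d k" (is "?L = ?R")
  proof (intro equalityI subsetI)
    fix m assume "m \<in> ?L"
    then have "- m - 1 \<in> wall_set d k" unfolding D_plus_staircase[OF assms(1)] wall_set_def by auto
    moreover have "m = - (- m - 1) - 1" by simp
    ultimately show "m \<in> ?R" by blast
  next
    fix m assume "m \<in> ?R"
    then show "m \<in> ?L" using assms unfolding D_plus_staircase[OF assms(1)] wall_set_def by auto
  qed
  have 2: "{m \<in> D_minus (staircase k) c d. m < t} = (\<lambda>j. - int c + int j) ` {..<s}" (is "?L = ?R")
  proof (intro equalityI subsetI)
    fix m assume "m \<in> ?L"
    then have "m < t" "- int c \<le> m" unfolding D_minus_staircase[OF assms(1)] by auto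
    then have "nat (m + int c) < s" "m = - int c + int (nat (m + int c))" using assms by auto
    then show "m \<in> ?R" by blast
  next
    fix m assume "m \<in> ?R"
    then show "m \<in> ?L" using assms unfolding D_minus_staircase[OF assms(1)] by auto
  qed
  have "inj_on (\<lambda>j. - int c + int j) {..<s}" "inj_on (\<lambda>m::int. - m - 1) (wall_set d k)" by (auto intro: inj_onI)
  then show ?thesis
    unfolding Phi_def 1 2 N_prod_def P_prod_inverse by (simp add: prod.reindex divide_inverse mult.commute)
qed

section \<open>Rescaling, inversion and radii of the edge integral\<close>

definition edge_integral ::
    "int set \<Rightarrow> (int \<Rightarrow> real) \<Rightarrow> (nat \<Rightarrow> real) \<Rightarrow> nat \<Rightarrow> nat \<Rightarrow> int \<Rightarrow> int \<Rightarrow> real \<Rightarrow> real \<Rightarrow> complex" where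
  "edge_integral I b p s1 s2 H1 H2 Rz Rw = 1 / (2 * of_real pi * \<i>)\<^sup>2 *
     circle_integral 0 Rz (\<lambda>z. circle_integral 0 Rw (edge_integrand I b p s1 s2 H1 H2 z))"

text \<open>At the right edge \<open>s2 < s1\<close> means \<open>t1 < t2\<close>. After inversion
  the same condition, with the two arguments exchanged, describes the left edge.\<close>

definition edge_radii ::
    "int set \<Rightarrow> (int \<Rightarrow> real) \<Rightarrow> (nat \<Rightarrow> real) \<Rightarrow> nat \<Rightarrow> nat \<Rightarrow> real \<Rightarrow> real \<Rightarrow> bool" where
  "edge_radii I b p s1 s2 Rz Rw \<longleftrightarrow> 0 < Rz \<and> 0 < Rw \<and> (\<forall>j<s1. Rz < 1 / p j) \<and> (\<forall>m\<in>I. b m < Rw) \<and>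
     (if s2 < s1 then Rz < Rw else Rw < Rz)"

lemma edge_radii_cong:
  assumes "\<And>m. m \<in> I \<Longrightarrow> b m = b' m" "\<And>j. j < s1 \<Longrightarrow> p j = p' j"
  shows "edge_radii I b p s1 s2 = edge_radii I b' p' s1 s2"
  using assms by (auto simp: edge_radii_def fun_eq_iff)

lemma edge_integral_cong:
  assumes "\<And>m. m \<in> I \<Longrightarrow> b m = b' m" "\<And>j. j < s1 \<or> j < s2 \<Longrightarrow> p j = p' j"
  shows "edge_integral I b p s1 s2 = edge_integral I b' p' s1 s2"
proof -
  have "N_prod I b = N_prod I b'" "P_prod p s1 = P_prod p' s1" "P_prod p s2 = P_prod p' s2"
    using assms by (auto simp: N_prod_def P_prod_def fun_eq_iff intro!: prod.cong)
  then have "edge_integrand I b p s1 s2 = edge_integrand I b' p' s1 s2" by (simp add: fun_eq_iff edge_integrand_def)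
  then show ?thesis by (intro ext) (simp only: edge_integral_def)
qed

lemma edge_radii_scale:
  assumes "0 < l"
  shows "edge_radii I (\<lambda>m. b m * l) (\<lambda>j. p j / l) s1 s2 Rz Rw = edge_radii I b p s1 s2 (Rz / l) (Rw / l)"
  using assms by (auto simp: edge_radii_def field_simps)

text \<open>Counting powers of \<open>l\<close>: \<open>dz\<close>, \<open>dw\<close> and
  \<open>1 / (z - w)\<close> leave one factor, and the two powers give
  \<open>l powi (H2 - H1 - 1)\<close>. The total splits into one factor for each argument and so is
  a conjugation.\<close>

lemma edge_integral_scale:
  fixes l :: real
  assumes l: "0 < l" and R: "0 < Rz" "0 < Rw"
  shows "edge_integral I (\<lambda>m. b m * l) (\<lambda>j. p j / l) s1 s2 H1 H2 Rz Rw =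
    of_real (l powi (H2 - H1)) * edge_integral I b p s1 s2 H1 H2 (Rz / l) (Rw / l)"
proof -
  have e: "of_real l * (of_real l * edge_integrand I (\<lambda>m. b m * l) (\<lambda>j. p j / l) s1 s2 H1 H2 (of_real l * z) (of_real l * w)) =
     of_real (l powi (H2 - H1)) * edge_integrand I b p s1 s2 H1 H2 z w" for z w :: complex
  proof -
    have N: "N_prod I (\<lambda>m. b m * l) (of_real l * x) = N_prod I b x" for x
      using l by (simp add: N_prod_def)
    have P: "P_prod (\<lambda>j. p j / l) s (of_real l * x) = P_prod p s x" for s x
      using l by (simp add: P_prod_def)
    have d: "1 / (of_real l * z - of_real l * w) = 1 / of_real l * (1 / (z - w))"
      by (simp add: right_diff_distrib[symmetric])
    have p: "(of_real l * x) powi i = of_real l powi i * x powi i" for x :: complex and i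
      by (rule power_int_mult_distrib)
    have "of_real l * (of_real l * (1 / of_real l * (of_real l powi (- H1) * of_real l powi (H2 - 1)))) = (of_real (l powi (H2 - H1)) :: complex)"
    proof -
      have "complex_of_real l \<noteq> 0" using l by simp
      then have "of_real l powi (- H1) * of_real l powi (H2 - 1) = (of_real l powi (H2 - H1) / of_real l :: complex)"
        by (simp add: power_int_diff power_int_minus field_simps)
      then show ?thesis using l by simp
    qed
    moreover have "L * (L * (A * B * (K * D) * (x * x') * (y * y'))) = L * (L * (K * (x * y))) * (A * B * D * x' * y')" for L A B K D x x' y y' :: complex
      by (simp only: mult_ac)
    ultimately show ?thesis unfolding edge_integrand_def N P d p by (simp only:)
  qed
  have "circle_integral 0 Rz (\<lambda>z. circle_integral 0 Rw (edge_integrand I (\<lambda>m. b m * l) (\<lambda>j. p j / l) s1 s2 H1 H2 z)) =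
     circle_integral 0 (Rz / l) (\<lambda>z. of_real l * circle_integral 0 Rw (edge_integrand I (\<lambda>m. b m * l) (\<lambda>j. p j / l) s1 s2 H1 H2 (of_real l * z)))"
    using circle_integral_scale[where l = l and z = 0 and R = "Rz / l" and f = "\<lambda>z. circle_integral 0 Rw (edge_integrand I (\<lambda>m. b m * l) (\<lambda>j. p j / l) s1 s2 H1 H2 z)"] l by simp
  also have "\<dots> = circle_integral 0 (Rz / l) (\<lambda>z. of_real l * circle_integral 0 (Rw / l) (\<lambda>w. of_real l * edge_integrand I (\<lambda>m. b m * l) (\<lambda>j. p j / l) s1 s2 H1 H2 (of_real l * z) (of_real l * w)))"
  proof -
    have "circle_integral 0 Rw f = circle_integral 0 (Rw / l) (\<lambda>w. of_real l * f (of_real l * w))" for f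
      using circle_integral_scale[where l = l and z = 0 and R = "Rw / l" and f = f] l by simp
    then show ?thesis by (simp only:)
  qed
  also have "\<dots> = of_real (l powi (H2 - H1)) * circle_integral 0 (Rz / l) (\<lambda>z. circle_integral 0 (Rw / l) (edge_integrand I b p s1 s2 H1 H2 z))"
    unfolding circle_integral_cmult[symmetric] e by (simp only: circle_integral_cmult)
  finally show ?thesis unfolding edge_integral_def by (simp only: mult_ac)
qed

lemma complex_powr_integer:
  fixes z :: complex
  assumes "z \<noteq> 0" "x = real_of_int n"
  shows "z powr of_real x = z powi n"
  using assms complex_powr_of_int[of z n] by simp

text \<open>Integrality of \<open>H1\<close> and \<open>H2\<close> turns \<open>powr\<close> into
  \<open>powi\<close>, so no branch of the logarithm enters.\<close>

lemma kernel_right: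
  assumes k: "even k" "k \<le> d" "int k \<le> t1" "int k \<le> t2" and t: "t1 = int d - int s1" "t2 = int d - int s2"
    and H: "real_of_int H1 = h1 - of_int (back_wall (staircase k) t1) / 2 + 1 / 2"
      "real_of_int H2 = h2 - of_int (back_wall (staircase k) t2) / 2 + 1 / 2"
    and R: "0 < Rz" "0 < Rw"
  shows "kernel_at_radii (staircase k) c d q a (t1, h1) (t2, h2) (Rz, Rw) =
    edge_integral (wall_set c k) (x_minus c q a) (\<lambda>j. x_plus c q a (int d - 1 - int j)) s1 s2 H1 H2 Rz Rw"
  unfolding kernel_at_radii_def edge_integral_def prod.case
proof (intro arg_cong2[of _ _ _ _ "(*)"] refl contour_integral_eq)
  fix z w :: complex
  assume "z \<in> path_image (circlepath 0 Rz)" "w \<in> path_image (circlepath 0 Rw)"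
  then have zw: "z \<noteq> 0" "w \<noteq> 0" using R by auto
  have s: "s1 \<le> d + c" "s2 \<le> d + c" using k t by linarith+
  have z: "z powr of_real (- h1 + real_of_int (back_wall (staircase k) t1) / 2 + 1 / 2) = z powi (- H1) * z"
  proof -
    have "z powr of_real (- h1 + real_of_int (back_wall (staircase k) t1) / 2 + 1 / 2) = z powi (- H1 + 1)"
      by (rule complex_powr_integer[OF zw(1)]) (simp add: H)
    also have "\<dots> = z powi (- H1) * z" using power_int_add[OF disjI1[OF zw(1)], of "- H1" 1] by (simp only: power_int_1_right)
    finally show ?thesis .
  qed
  have w: "w powr of_real (h2 - real_of_int (back_wall (staircase k) t2) / 2 + 1 / 2) = w powi (H2 - 1) * w"
  proof -
    have "w powr of_real (h2 - real_of_int (back_wall (staircase k) t2) / 2 + 1 / 2) = w powi H2"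
      by (rule complex_powr_integer[OF zw(2)]) (simp add: H)
    then show ?thesis using zw by (simp add: power_int_diff)
  qed
  show "Phi (staircase k) c d q a z t1 / Phi (staircase k) c d q a w t2 * (1 / (z - w)) *
      z powr of_real (- h1 + real_of_int (back_wall (staircase k) t1) / 2 + 1 / 2) *
      w powr of_real (h2 - real_of_int (back_wall (staircase k) t2) / 2 + 1 / 2) * (1 / (z * w)) =
    edge_integrand (wall_set c k) (x_minus c q a) (\<lambda>j. x_plus c q a (int d - 1 - int j)) s1 s2 H1 H2 z w"
    unfolding z w Phi_right[OF k(1,2,3) t(1) s(1)] Phi_right[OF k(1,2,4) t(2) s(2)] edge_integrand_def
    using zw by (simp add: divide_simps)
qed

text \<open>Under \<open>z = 1 / W\<close>, \<open>w = 1 / Z\<close> the factor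
  \<open>1 / (z - w)\<close> becomes \<open>Z * W / (Z - W)\<close>. Together with
  \<open>1 / (z * w) = Z * W\<close> it cancels the factor \<open>1 / (Z^2 * W^2)\<close> of the
  inversion, and an edge integral with the two arguments exchanged remains.\<close>

lemma kernel_left:
  assumes k: "even k" "k \<le> c" "t1 \<le> - int k" "t2 \<le> - int k" and t: "t1 = - int c + int s1" "t2 = - int c + int s2"
    and H: "real_of_int H1 = h1 - of_int (back_wall (staircase k) t1) / 2 + 1 / 2"
      "real_of_int H2 = h2 - of_int (back_wall (staircase k) t2) / 2 + 1 / 2"
    and pos: "\<And>j. j < s2 \<Longrightarrow> 0 < x_minus c q a (- int c + int j)" "\<And>m. m \<in> wall_set d k \<Longrightarrow> 0 < x_plus c q a (- m - 1)"
    and R: "edge_radii (wall_set d k) (\<lambda>m. x_plus c q a (- m - 1)) (\<lambda>j. x_minus c q a (- int c + int j)) s2 s1 (1 / Rw) (1 / Rz)"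
    and fin: "finite (wall_set d k)"
  shows "kernel_at_radii (staircase k) c d q a (t1, h1) (t2, h2) (Rz, Rw) =
    edge_integral (wall_set d k) (\<lambda>m. x_plus c q a (- m - 1)) (\<lambda>j. x_minus c q a (- int c + int j)) s2 s1 H2 H1 (1 / Rw) (1 / Rz)"
proof -
  define E where "E = edge_integrand (wall_set d k) (\<lambda>m. x_plus c q a (- m - 1)) (\<lambda>j. x_minus c q a (- int c + int j)) s2 s1 H2 H1"
  define F where "F = (\<lambda>z w. Phi (staircase k) c d q a z t1 / Phi (staircase k) c d q a w t2 * (1 / (z - w)) *
      z powr of_real (- h1 + real_of_int (back_wall (staircase k) t1) / 2 + 1 / 2) *
      w powr of_real (h2 - real_of_int (back_wall (staircase k) t2) / 2 + 1 / 2) * (1 / (z * w)))"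
  have R0: "0 < Rz" "0 < Rw" using R by (auto simp: edge_radii_def)
  have s: "s1 \<le> d + c" "s2 \<le> d + c" using k t by linarith+
  have ne: "Z \<noteq> W" if "Z \<in> sphere 0 (1 / Rw)" "W \<in> sphere 0 (1 / Rz)" for Z W :: complex
    using that R by (auto simp: edge_radii_def split: if_splits)
  have e: "F (1 / W) (1 / Z) / Z\<^sup>2 / W\<^sup>2 = E Z W" if ZW: "Z \<in> sphere 0 (1 / Rw)" "W \<in> sphere 0 (1 / Rz)" for Z W
  proof -
    have zw: "Z \<noteq> 0" "W \<noteq> 0" using that R0 by auto
    have w: "(1 / W) powr of_real (- h1 + real_of_int (back_wall (staircase k) t1) / 2 + 1 / 2) = W powi (H1 - 1)"
    proof -
      have "(1 / W) powr of_real (- h1 + real_of_int (back_wall (staircase k) t1) / 2 + 1 / 2) = (1 / W) powi (- (H1 - 1))"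
        using zw by (intro complex_powr_integer) (simp_all add: H)
      also have "\<dots> = W powi (H1 - 1)"
        unfolding inverse_eq_divide[symmetric] by (simp only: power_int_minus power_int_inverse inverse_inverse_eq)
      finally show ?thesis .
    qed
    have z: "(1 / Z) powr of_real (h2 - real_of_int (back_wall (staircase k) t2) / 2 + 1 / 2) = Z powi (- H2)"
    proof -
      have "(1 / Z) powr of_real (h2 - real_of_int (back_wall (staircase k) t2) / 2 + 1 / 2) = (1 / Z) powi H2"
        using zw by (intro complex_powr_integer) (simp_all add: H)
      also have "\<dots> = Z powi (- H2)"
        unfolding inverse_eq_divide[symmetric] by (simp only: power_int_minus power_int_inverse)
      finally show ?thesis .
    qed
    have d: "1 / (1 / W - 1 / Z) = Z * W * (1 / (Z - W))"
      using zw ne[OF ZW] by (simp add: field_simps)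
    have i: "1 / (1 / x) = x" for x :: complex by simp
    show ?thesis
      unfolding F_def E_def w z d Phi_left[OF k(1,2,3) t(1) s(1)] Phi_left[OF k(1,2,4) t(2) s(2)] edge_integrand_def i
      using zw by (simp add: power2_eq_square mult_ac)
  qed
  have "circle_integral 0 Rz (\<lambda>z. circle_integral 0 Rw (F z)) =
      circle_integral 0 (1 / Rz) (\<lambda>W. circle_integral 0 Rw (F (1 / W)) / W\<^sup>2)"
    by (rule circle_integral_inverse[OF R0(1)])
  also have "\<dots> = circle_integral 0 (1 / Rz) (\<lambda>W. circle_integral 0 (1 / Rw) (\<lambda>Z. F (1 / W) (1 / Z) / Z\<^sup>2) / W\<^sup>2)"
    unfolding circle_integral_inverse[OF R0(2)] ..
  also have "\<dots> = circle_integral 0 (1 / Rz) (\<lambda>W. circle_integral 0 (1 / Rw) (\<lambda>Z. E Z W))"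
  proof (rule contour_integral_eq)
    fix W assume "W \<in> path_image (circlepath 0 (1 / Rz))"
    then have W: "W \<in> sphere 0 (1 / Rz)" using R0 by simp
    have "circle_integral 0 (1 / Rw) (\<lambda>Z. F (1 / W) (1 / Z) / Z\<^sup>2) / W\<^sup>2 = 1 / W\<^sup>2 * circle_integral 0 (1 / Rw) (\<lambda>Z. F (1 / W) (1 / Z) / Z\<^sup>2)"
      by simp
    also have "\<dots> = circle_integral 0 (1 / Rw) (\<lambda>Z. 1 / W\<^sup>2 * (F (1 / W) (1 / Z) / Z\<^sup>2))"
      by (rule circle_integral_cmult[symmetric])
    also have "\<dots> = circle_integral 0 (1 / Rw) (\<lambda>Z. E Z W)"
      by (rule contour_integral_eq) (use e[OF _ W] R0 in \<open>simp add: mult.commute[of "W\<^sup>2"]\<close>)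
    finally show "circle_integral 0 (1 / Rw) (\<lambda>Z. F (1 / W) (1 / Z) / Z\<^sup>2) / W\<^sup>2 = circle_integral 0 (1 / Rw) (\<lambda>Z. E Z W)" .
  qed
  also have "\<dots> = circle_integral 0 (1 / Rw) (\<lambda>Z. circle_integral 0 (1 / Rz) (E Z))"
  proof (rule circle_integral_swap[symmetric])
    show "continuous_on (sphere 0 (1 / Rw) \<times> sphere 0 (1 / Rz)) (\<lambda>(x, y). E x y)"
      unfolding E_def
    proof (rule continuous_on_edge_integrand[OF fin pos(1)])
      fix Z W :: complex assume ZW: "Z \<in> sphere 0 (1 / Rw)" "W \<in> sphere 0 (1 / Rz)"
      have "Z \<notin> P_zeros (\<lambda>j. x_minus c q a (- int c + int j)) s2"
      proof
        assume "Z \<in> P_zeros (\<lambda>j. x_minus c q a (- int c + int j)) s2"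
        then obtain j where "j < s2" "Z = of_real (1 / x_minus c q a (- int c + int j))" unfolding P_zeros_def by blast
        then have "norm Z = 1 / x_minus c q a (- int c + int j)" using pos(1)[of j] by (simp only: norm_of_real) simp
        then show False using R \<open>j < s2\<close> ZW(1) by (auto simp: edge_radii_def)
      qed
      moreover have "W \<noteq> of_real (x_plus c q a (- m - 1))" if m: "m \<in> wall_set d k" for m
      proof
        assume "W = of_real (x_plus c q a (- m - 1))"
        then have "norm W = x_plus c q a (- m - 1)" using pos(2)[OF m] by simp
        then show False using R m ZW(2) by (auto simp: edge_radii_def)
      qed
      ultimately show "Z \<noteq> 0 \<and> Z \<notin> P_zeros (\<lambda>j. x_minus c q a (- int c + int j)) s2 \<and> W \<noteq> 0 \<and> W \<noteq> Z \<and>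
          (\<forall>m\<in>wall_set d k. W \<noteq> of_real (x_plus c q a (- m - 1)))"
        using ne[OF ZW] ZW R0 by auto
    qed
  qed (use R0 in auto)
  finally show ?thesis
    unfolding kernel_at_radii_def edge_integral_def prod.case F_def E_def by (simp only:)
qed

lemma x_minus_two_periodic:
  assumes "0 < \<alpha>" "- int c \<le> m"
  shows "x_minus c (two_periodic \<alpha> r) (sqrt \<alpha> * exp (- r * (1 / 2 - real c))) m =
    1 / parity_factor \<alpha> c * (if odd m then 1 / sqrt \<alpha> else sqrt \<alpha>) * exp (r * (of_int m + 1 / 2))"
proof -
  have "exp (r * (of_int m + 1 / 2)) = 1 / exp (- r * (of_int m + 1 / 2))" by (simp add: exp_minus inverse_eq_divide)
  then show ?thesis unfolding x_minus_def x_plus_two_periodic[OF assms] by simp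
qed

text \<open>\<open>l\<close> is the turning value of \<open>z\<close>, and dividing by it moves the
  critical point to 1; the parity factor is 1 as \<open>c\<close> is odd.\<close>

lemma weights_right:
  assumes pos: "0 < \<alpha>" "0 < A" and "odd c" "l = exp v * sqrt \<alpha> / A"
  shows "m \<in> wall_set c k \<Longrightarrow> x_minus c (two_periodic \<alpha> r) (sqrt \<alpha> * exp (- r * (1 / 2 - real c))) m = wall_pole A \<alpha> v r m * l"
    and "j < d \<Longrightarrow> x_plus c (two_periodic \<alpha> r) (sqrt \<alpha> * exp (- r * (1 / 2 - real c))) (int d - 1 - int j) = edge_zero A \<alpha> v r d j / l"
proof -
  define s where "s = sqrt \<alpha>"
  have s: "0 < s" "\<alpha> = s * s" using pos by (simp_all add: s_def)
  assume "m \<in> wall_set c k"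
  then have ge: "- int c \<le> m" by (auto simp: wall_set_def)
  have "exp (r * (of_int m + 1 / 2) - v) = exp (r * (of_int m + 1 / 2)) / exp v" by (rule exp_diff)
  then show "x_minus c (two_periodic \<alpha> r) (sqrt \<alpha> * exp (- r * (1 / 2 - real c))) m = wall_pole A \<alpha> v r m * l"
    unfolding x_minus_two_periodic[OF pos(1) ge] wall_pole_def assms(4)
    unfolding s_def[symmetric]
    using s(1) pos(2) assms(3) by (simp add: s(2) parity_factor_def)
next
  define s where "s = sqrt \<alpha>"
  have s: "0 < s" "\<alpha> = s * s" using pos by (simp_all add: s_def)
  assume j: "j < d"
  then have ge: "- int c \<le> int d - 1 - int j" by linarith
  have "exp (v - r * (real d - real j - 1 / 2)) = exp v * exp (- r * (of_int (int d - 1 - int j) + 1 / 2))"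
    by (simp add: exp_add[symmetric] algebra_simps)
  then show "x_plus c (two_periodic \<alpha> r) (sqrt \<alpha> * exp (- r * (1 / 2 - real c))) (int d - 1 - int j) = edge_zero A \<alpha> v r d j / l"
    unfolding x_plus_two_periodic[OF pos(1) ge] edge_zero_def assms(4)
    unfolding s_def[symmetric]
    using s(1) pos(2) assms(3) by (simp add: s(2) parity_factor_def)
qed

lemma weights_left:
  assumes pos: "0 < \<alpha>" "0 < A" and "k < c" "l = parity_factor \<alpha> c * (exp v * sqrt \<alpha> / A)"
  shows "m \<in> wall_set d k \<Longrightarrow> x_plus c (two_periodic \<alpha> r) (sqrt \<alpha> * exp (- r * (1 / 2 - real c))) (- m - 1) = wall_pole A \<alpha> v r m * l"
    and "x_minus c (two_periodic \<alpha> r) (sqrt \<alpha> * exp (- r * (1 / 2 - real c))) (- int c + int j) = edge_zero A \<alpha> v r c j / l"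
proof -
  define s where "s = sqrt \<alpha>"
  have s: "0 < s" "\<alpha> = s * s" using pos by (simp_all add: s_def)
  define t where "t = parity_factor \<alpha> c"
  assume "m \<in> wall_set d k"
  then have ge: "- int c \<le> - m - 1" using assms(3) by (auto simp: wall_set_def)
  have "- r * (of_int (- m - 1) + 1 / 2) = r * (of_int m + 1 / 2)" by (simp add: algebra_simps)
  moreover have "exp (r * (of_int m + 1 / 2) - v) = exp (r * (of_int m + 1 / 2)) / exp v" by (rule exp_diff)
  ultimately show "x_plus c (two_periodic \<alpha> r) (sqrt \<alpha> * exp (- r * (1 / 2 - real c))) (- m - 1) = wall_pole A \<alpha> v r m * l"
    unfolding x_plus_two_periodic[OF pos(1) ge] wall_pole_def assms(4)
    unfolding s_def[symmetric] t_def[symmetric]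
    using s(1) pos(2) by (simp add: s(2))
next
  define s where "s = sqrt \<alpha>"
  have s: "0 < s" "\<alpha> = s * s" using pos by (simp_all add: s_def)
  define t where "t = parity_factor \<alpha> c"
  have ge: "- int c \<le> - int c + int j" by simp
  have "exp (v - r * (real c - real j - 1 / 2)) = exp v * exp (r * (of_int (- int c + int j) + 1 / 2))"
    by (simp add: exp_add[symmetric] algebra_simps)
  then show "x_minus c (two_periodic \<alpha> r) (sqrt \<alpha> * exp (- r * (1 / 2 - real c))) (- int c + int j) = edge_zero A \<alpha> v r c j / l"
    unfolding x_minus_two_periodic[OF pos(1) ge] edge_zero_def assms(4)
    unfolding s_def[symmetric] t_def[symmetric]
    using s(1) pos(2) by (simp add: s(2))
qed

lemma admissible_right:
  assumes k: "even k" "k \<le> d" "int k \<le> t1" "int k \<le> t2" and t: "t1 = int d - int s1" "t2 = int d - int s2"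
  shows "admissible_radii (staircase k) c d q a t1 t2 (Rz, Rw) \<longleftrightarrow>
    edge_radii (wall_set c k) (x_minus c q a) (\<lambda>j. x_plus c q a (int d - 1 - int j)) s1 s2 Rz Rw"
proof -
  have 1: "(\<forall>m\<in>D_minus (staircase k) c d. m < t2 \<longrightarrow> P m) \<longleftrightarrow> (\<forall>m\<in>wall_set c k. P m)" for P
    using k t unfolding D_minus_staircase[OF k(1)] wall_set_def by auto
  have 2: "(\<forall>m\<in>D_plus (staircase k) c d. t1 \<le> m \<longrightarrow> P m) \<longleftrightarrow> (\<forall>j<s1. P (int d - 1 - int j))" for P
  proof (intro iffI allI impI ballI)
    fix j assume P: "\<forall>m\<in>D_plus (staircase k) c d. t1 \<le> m \<longrightarrow> P m" and "j < s1"
    then show "P (int d - 1 - int j)" using k t by (intro P[rule_format]) (auto simp: D_plus_staircase)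
  next
    fix m assume P: "\<forall>j<s1. P (int d - 1 - int j)" and m: "m \<in> D_plus (staircase k) c d" "t1 \<le> m"
    have "m < int d" using m k by (auto simp: D_plus_staircase)
    then have "m = int d - 1 - int (nat (int d - 1 - m))" "nat (int d - 1 - m) < s1" using m(2) t by auto
    then show "P m" using P by metis
  qed
  show ?thesis unfolding admissible_radii_def edge_radii_def prod.case 1 2 using t by auto
qed

text \<open>Taking reciprocals reverses the inequalities, so the conditions on \<open>Rz\<close>
  from \<open>D_plus\<close> become those for the poles, and the conditions on \<open>Rw\<close>
  from \<open>D_minus\<close> become those for the zeros.\<close>

lemma admissible_left:
  assumes k: "even k" "k \<le> c" "t1 \<le> - int k" "t2 \<le> - int k" and t: "t1 = - int c + int s1" "t2 = - int c + int s2"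
    and pos: "\<And>j. j < s2 \<Longrightarrow> 0 < x_minus c q a (- int c + int j)" "\<And>m. m \<in> wall_set d k \<Longrightarrow> 0 < x_plus c q a (- m - 1)"
    and d: "k < d"
  shows "admissible_radii (staircase k) c d q a t1 t2 (Rz, Rw) \<longleftrightarrow>
    edge_radii (wall_set d k) (\<lambda>m. x_plus c q a (- m - 1)) (\<lambda>j. x_minus c q a (- int c + int j)) s2 s1 (1 / Rw) (1 / Rz)"
proof -
  have 1: "(\<forall>m\<in>D_plus (staircase k) c d. t1 \<le> m \<longrightarrow> P m) \<longleftrightarrow> (\<forall>m\<in>wall_set d k. P (- m - 1))" for P
  proof (intro iffI allI impI ballI)
    fix m assume P: "\<forall>m\<in>D_plus (staircase k) c d. t1 \<le> m \<longrightarrow> P m" and m: "m \<in> wall_set d k"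
    have "- m - 1 \<in> D_plus (staircase k) c d" "t1 \<le> - m - 1" using m k t unfolding D_plus_staircase[OF k(1)] wall_set_def by auto
    then show "P (- m - 1)" using P by blast
  next
    fix m assume P: "\<forall>m\<in>wall_set d k. P (- m - 1)" and m: "m \<in> D_plus (staircase k) c d"
    have "- m - 1 \<in> wall_set d k" using m unfolding D_plus_staircase[OF k(1)] wall_set_def by auto
    then have "P (- (- m - 1) - 1)" using P by blast
    then show "P m" by simp
  qed
  have 2: "(\<forall>m\<in>D_minus (staircase k) c d. m < t2 \<longrightarrow> P m) \<longleftrightarrow> (\<forall>j<s2. P (- int c + int j))" for P
  proof (intro iffI allI impI ballI)
    fix j assume P: "\<forall>m\<in>D_minus (staircase k) c d. m < t2 \<longrightarrow> P m" and "j < s2"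
    then have "- int c + int j \<in> D_minus (staircase k) c d" "- int c + int j < t2" using k t d by (auto simp: D_minus_staircase)
    then show "P (- int c + int j)" using P by blast
  next
    fix m assume P: "\<forall>j<s2. P (- int c + int j)" and m: "m \<in> D_minus (staircase k) c d" "m < t2"
    have "- int c \<le> m" using m k by (auto simp: D_minus_staircase)
    then have "m = - int c + int (nat (m + int c))" "nat (m + int c) < s2" using m(2) t by auto
    then show "P m" using P by metis
  qed
  have 3: "R < 1 / x \<longleftrightarrow> x < 1 / R" "1 / R < 1 / x \<longleftrightarrow> x < R" if "0 < x" "0 < R" for x R :: real
    using that by (simp_all add: field_simps)
  show ?thesis
  proof (cases "0 < Rz \<and> 0 < Rw")
    case True
    have "(\<forall>m\<in>wall_set d k. Rz < 1 / x_plus c q a (- m - 1)) \<longleftrightarrow> (\<forall>m\<in>wall_set d k. x_plus c q a (- m - 1) < 1 / Rz)"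
      using 3(1)[OF pos(2)] True by blast
    moreover have "(\<forall>j<s2. x_minus c q a (- int c + int j) < Rw) \<longleftrightarrow> (\<forall>j<s2. 1 / Rw < 1 / x_minus c q a (- int c + int j))"
      using 3(2)[OF pos(1)] True by blast
    moreover have "Rz < Rw \<longleftrightarrow> 1 / Rw < 1 / Rz" "Rw < Rz \<longleftrightarrow> 1 / Rz < 1 / Rw" using True by (simp_all add: field_simps)
    ultimately show ?thesis unfolding admissible_radii_def edge_radii_def prod.case 1 2 using t True by auto
  next
    case False
    then show ?thesis by (auto simp: admissible_radii_def edge_radii_def)
  qed
qed

lemma finite_wall_set: "finite (wall_set l k)"
  by (rule finite_subset[of _ "{- int l..int k}"]) (auto simp: wall_set_def)

text \<open>The radii chosen by \<open>SOME\<close> are admissible once some admissible pair exists,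
  which \<open>ex\<close> provides. Nothing more is known of them, so the formula is asserted for
  some pair of radii.\<close>

lemma model_kernel_right:
  assumes k: "even k" "k < c" "k < d" and pos: "0 < \<alpha>" "0 < A" and "odd c" and l: "l = exp v * sqrt \<alpha> / A"
    and t: "int k \<le> t1" "int k \<le> t2" "t1 = int d - int s1" "t2 = int d - int s2"
    and H: "real_of_int H1 = h1 - of_int (back_wall (staircase k) t1) / 2 + 1 / 2"
      "real_of_int H2 = h2 - of_int (back_wall (staircase k) t2) / 2 + 1 / 2"
    and ex: "\<exists>Rz Rw. edge_radii (wall_set c k) (wall_pole A \<alpha> v r) (edge_zero A \<alpha> v r d) s1 s2 Rz Rw"
  shows "\<exists>Rz Rw. edge_radii (wall_set c k) (wall_pole A \<alpha> v r) (edge_zero A \<alpha> v r d) s1 s2 Rz Rw \<and>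
    model_kernel \<alpha> r k c d (t1, h1) (t2, h2) =
      of_real (l powi (H2 - H1)) * edge_integral (wall_set c k) (wall_pole A \<alpha> v r) (edge_zero A \<alpha> v r d) s1 s2 H1 H2 Rz Rw"
proof -
  define q where "q = two_periodic \<alpha> r"
  define a where "a = sqrt \<alpha> * exp (- r * (1 / 2 - real c))"
  have l0: "0 < l" using pos by (simp add: l)
  have s: "s1 \<le> d" "s2 \<le> d" using t by linarith+
  note w = weights_right[OF pos \<open>odd c\<close> l, where r = r, folded q_def a_def]
  have radii: "admissible_radii (staircase k) c d q a t1 t2 (Rz, Rw) \<longleftrightarrow>
      edge_radii (wall_set c k) (wall_pole A \<alpha> v r) (edge_zero A \<alpha> v r d) s1 s2 (Rz / l) (Rw / l)" for Rz Rw
  proof -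
    have "edge_radii (wall_set c k) (x_minus c q a) (\<lambda>j. x_plus c q a (int d - 1 - int j)) s1 s2 =
        edge_radii (wall_set c k) (\<lambda>m. wall_pole A \<alpha> v r m * l) (\<lambda>j. edge_zero A \<alpha> v r d j / l) s1 s2"
      by (rule edge_radii_cong) (use w s in auto)
    then show ?thesis
      unfolding admissible_right[OF k(1) less_imp_le[OF k(3)] t] edge_radii_scale[OF l0, symmetric] by simp
  qed
  have "\<exists>R. admissible_radii (staircase k) c d q a t1 t2 R"
  proof -
    obtain Rz Rw where "edge_radii (wall_set c k) (wall_pole A \<alpha> v r) (edge_zero A \<alpha> v r d) s1 s2 Rz Rw" using ex by blast
    then have "admissible_radii (staircase k) c d q a t1 t2 (Rz * l, Rw * l)" using radii[of "Rz * l" "Rw * l"] l0 by simp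
    then show ?thesis by blast
  qed
  then have adm: "admissible_radii (staircase k) c d q a t1 t2 (SOME R. admissible_radii (staircase k) c d q a t1 t2 R)"
    by (rule someI_ex)
  obtain Rz Rw where R: "(SOME R. admissible_radii (staircase k) c d q a t1 t2 R) = (Rz, Rw)" by fastforce
  have ad: "admissible_radii (staircase k) c d q a t1 t2 (Rz, Rw)" using adm unfolding R .
  then have R0: "0 < Rz" "0 < Rw" by (simp_all add: admissible_radii_def)
  have "model_kernel \<alpha> r k c d (t1, h1) (t2, h2) =
      edge_integral (wall_set c k) (x_minus c q a) (\<lambda>j. x_plus c q a (int d - 1 - int j)) s1 s2 H1 H2 Rz Rw"
    unfolding model_kernel_def corr_kernel_def q_def[symmetric] a_def[symmetric] fst_conv R
    by (rule kernel_right[OF k(1) less_imp_le[OF k(3)] t H R0])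
  also have "\<dots> = edge_integral (wall_set c k) (\<lambda>m. wall_pole A \<alpha> v r m * l) (\<lambda>j. edge_zero A \<alpha> v r d j / l) s1 s2 H1 H2 Rz Rw"
    using edge_integral_cong[where I = "wall_set c k" and b = "x_minus c q a" and b' = "\<lambda>m. wall_pole A \<alpha> v r m * l" and
        p = "\<lambda>j. x_plus c q a (int d - 1 - int j)" and p' = "\<lambda>j. edge_zero A \<alpha> v r d j / l" and ?s1.0 = s1 and ?s2.0 = s2] w s
    by fastforce
  also have "\<dots> = of_real (l powi (H2 - H1)) * edge_integral (wall_set c k) (wall_pole A \<alpha> v r) (edge_zero A \<alpha> v r d) s1 s2 H1 H2 (Rz / l) (Rw / l)"
    by (rule edge_integral_scale[OF l0 R0])
  finally show ?thesis using ad radii by blast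
qed

lemma model_kernel_left:
  assumes k: "even k" "k < c" "k < d" and pos: "0 < \<alpha>" "0 < A" and l: "l = parity_factor \<alpha> c * (exp v * sqrt \<alpha> / A)"
    and t: "t1 \<le> - int k" "t2 \<le> - int k" "t1 = - int c + int s1" "t2 = - int c + int s2"
    and H: "real_of_int H1 = h1 - of_int (back_wall (staircase k) t1) / 2 + 1 / 2"
      "real_of_int H2 = h2 - of_int (back_wall (staircase k) t2) / 2 + 1 / 2"
    and ex: "\<exists>Rz Rw. edge_radii (wall_set d k) (wall_pole A \<alpha> v r) (edge_zero A \<alpha> v r c) s2 s1 Rz Rw"
  shows "\<exists>Rz Rw. edge_radii (wall_set d k) (wall_pole A \<alpha> v r) (edge_zero A \<alpha> v r c) s2 s1 Rz Rw \<and>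
    model_kernel \<alpha> r k c d (t1, h1) (t2, h2) =
      of_real (l powi (H1 - H2)) * edge_integral (wall_set d k) (wall_pole A \<alpha> v r) (edge_zero A \<alpha> v r c) s2 s1 H2 H1 Rz Rw"
proof -
  define q where "q = two_periodic \<alpha> r"
  define a where "a = sqrt \<alpha> * exp (- r * (1 / 2 - real c))"
  have l0: "0 < l" using pos by (simp add: l parity_factor_def)
  note w = weights_left[OF pos k(2) l, where r = r, folded q_def a_def]
  have p: "0 < x_minus c q a (- int c + int j)" for j unfolding w(2) using l0 pos by (simp add: edge_zero_def)
  have b: "0 < x_plus c q a (- m - 1)" if "m \<in> wall_set d k" for m unfolding w(1)[OF that] using l0 pos by (simp add: wall_pole_def)
  have radii: "admissible_radii (staircase k) c d q a t1 t2 (Rz, Rw) \<longleftrightarrow>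
      edge_radii (wall_set d k) (wall_pole A \<alpha> v r) (edge_zero A \<alpha> v r c) s2 s1 (1 / Rw / l) (1 / Rz / l)"
    "admissible_radii (staircase k) c d q a t1 t2 (Rz, Rw) \<longleftrightarrow>
    edge_radii (wall_set d k) (\<lambda>m. x_plus c q a (- m - 1)) (\<lambda>j. x_minus c q a (- int c + int j)) s2 s1 (1 / Rw) (1 / Rz)" for Rz Rw
  proof -
    have "edge_radii (wall_set d k) (\<lambda>m. x_plus c q a (- m - 1)) (\<lambda>j. x_minus c q a (- int c + int j)) s2 s1 =
        edge_radii (wall_set d k) (\<lambda>m. wall_pole A \<alpha> v r m * l) (\<lambda>j. edge_zero A \<alpha> v r c j / l) s2 s1"
      by (rule edge_radii_cong) (use w in auto)
    moreover show *: "admissible_radii (staircase k) c d q a t1 t2 (Rz, Rw) \<longleftrightarrow>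
      edge_radii (wall_set d k) (\<lambda>m. x_plus c q a (- m - 1)) (\<lambda>j. x_minus c q a (- int c + int j)) s2 s1 (1 / Rw) (1 / Rz)"
      by (rule admissible_left[OF k(1) less_imp_le[OF k(2)] t p b k(3)])
    ultimately show "admissible_radii (staircase k) c d q a t1 t2 (Rz, Rw) \<longleftrightarrow>
      edge_radii (wall_set d k) (wall_pole A \<alpha> v r) (edge_zero A \<alpha> v r c) s2 s1 (1 / Rw / l) (1 / Rz / l)"
      unfolding edge_radii_scale[OF l0, symmetric] by simp
  qed
  have "\<exists>R. admissible_radii (staircase k) c d q a t1 t2 R"
  proof -
    obtain Rz Rw where "edge_radii (wall_set d k) (wall_pole A \<alpha> v r) (edge_zero A \<alpha> v r c) s2 s1 Rz Rw" using ex by blast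
    then have "admissible_radii (staircase k) c d q a t1 t2 (1 / (Rw * l), 1 / (Rz * l))"
      using radii(1)[of "1 / (Rw * l)" "1 / (Rz * l)"] l0 by simp
    then show ?thesis by blast
  qed
  then have adm: "admissible_radii (staircase k) c d q a t1 t2 (SOME R. admissible_radii (staircase k) c d q a t1 t2 R)"
    by (rule someI_ex)
  obtain Rz Rw where R: "(SOME R. admissible_radii (staircase k) c d q a t1 t2 R) = (Rz, Rw)" by fastforce
  have ad: "admissible_radii (staircase k) c d q a t1 t2 (Rz, Rw)" using adm unfolding R .
  then have R0: "0 < 1 / Rw" "0 < 1 / Rz" by (simp_all add: admissible_radii_def)
  have "model_kernel \<alpha> r k c d (t1, h1) (t2, h2) =
      edge_integral (wall_set d k) (\<lambda>m. x_plus c q a (- m - 1)) (\<lambda>j. x_minus c q a (- int c + int j)) s2 s1 H2 H1 (1 / Rw) (1 / Rz)"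
    unfolding model_kernel_def corr_kernel_def q_def[symmetric] a_def[symmetric] fst_conv R
    by (rule kernel_left[OF k(1) less_imp_le[OF k(2)] t H p b radii(2)[THEN iffD1, OF ad] finite_wall_set])
  also have "\<dots> = edge_integral (wall_set d k) (\<lambda>m. wall_pole A \<alpha> v r m * l) (\<lambda>j. edge_zero A \<alpha> v r c j / l) s2 s1 H2 H1 (1 / Rw) (1 / Rz)"
    using edge_integral_cong[where I = "wall_set d k" and b = "\<lambda>m. x_plus c q a (- m - 1)" and b' = "\<lambda>m. wall_pole A \<alpha> v r m * l" and
        p = "\<lambda>j. x_minus c q a (- int c + int j)" and p' = "\<lambda>j. edge_zero A \<alpha> v r c j / l" and ?s1.0 = s2 and ?s2.0 = s1] w
    by fastforce
  also have "\<dots> = of_real (l powi (H1 - H2)) * edge_integral (wall_set d k) (wall_pole A \<alpha> v r) (edge_zero A \<alpha> v r c) s2 s1 H2 H1 (1 / Rw / l) (1 / Rz / l)"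
    by (rule edge_integral_scale[OF l0 R0])
  finally show ?thesis using ad radii(1) by blast
qed

context edge_model
begin

text \<open>The poles are at most \<open>b\<close>, and the zeros tend to 1 or
  \<open>1 / \<kappa>\<close>, both larger than \<open>b\<close>. Two radii in this gap can be taken
  in whichever order is prescribed.\<close>

lemma edge_radii_exist:
  "\<forall>\<^sub>F n in sequentially. \<exists>Rz Rw. edge_radii (wall_set (l n) (k n)) (wall_pole A \<alpha> v (r n)) (edge_zero A \<alpha> v (r n) (D n)) s1 s2 Rz Rw"
proof -
  define b where "b = A / \<alpha> * exp (- ((v - u) / 2))"
  define \<kappa> where "\<kappa> = \<alpha> / A\<^sup>2"
  have b: "0 < b" "b < 1" and \<kappa>: "0 < \<kappa>" "b * \<kappa> < 1" using beta kappa unfolding b_def \<kappa>_def by blast+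
  have bk: "b < 1 / \<kappa>" using \<kappa> by (simp add: field_simps)
  obtain \<rho> where \<rho>: "b < \<rho>" "\<rho> < 1" "\<rho> < 1 / \<kappa>"
    using dense[of b "min 1 (1 / \<kappa>)"] b bk by auto
  have "\<forall>\<^sub>F n in sequentially. \<rho> < 1 / edge_zero A \<alpha> v (r n) (D n) j" for j
  proof (cases "j \<in> near_set")
    case True
    have "(\<lambda>n. 1 / edge_zero A \<alpha> v (r n) (D n) j) \<longlonglongrightarrow> 1 / 1" by (intro tendsto_intros p_lim True) simp
    from order_tendstoD(1)[OF this, of \<rho>] show ?thesis using \<rho>(2) by simp
  next
    case False
    have "(\<lambda>n. 1 / edge_zero A \<alpha> v (r n) (D n) j) \<longlonglongrightarrow> 1 / \<kappa>"
      unfolding \<kappa>_def using A alpha_pos by (intro tendsto_intros p_far False) simp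
    from order_tendstoD(1)[OF this \<rho>(3)] show ?thesis .
  qed
  then have "\<forall>\<^sub>F n in sequentially. \<forall>j\<in>{..<s1}. \<rho> < 1 / edge_zero A \<alpha> v (r n) (D n) j"
    by (intro eventually_ball_finite) auto
  then show ?thesis
  proof eventually_elim
    case (elim n)
    have w: "wall_pole A \<alpha> v (r n) m \<le> b" if "m \<in> wall_set (l n) (k n)" for m
      using wall_pole_le[OF that] by (simp add: b_def)
    obtain x where x: "b < x" "x < \<rho>" using dense[OF \<rho>(1)] by blast
    have 1: "0 < x" "0 < \<rho>" using b x by linarith+
    have 2: "\<forall>j<s1. x < 1 / edge_zero A \<alpha> v (r n) (D n) j"
    proof (intro allI impI)
      fix j assume "j < s1"
      then have "\<rho> < 1 / edge_zero A \<alpha> v (r n) (D n) j" using elim by blast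
      then show "x < 1 / edge_zero A \<alpha> v (r n) (D n) j" using x by linarith
    qed
    have 3: "\<forall>j<s1. \<rho> < 1 / edge_zero A \<alpha> v (r n) (D n) j" using elim by blast
    have 4: "\<forall>m\<in>wall_set (l n) (k n). wall_pole A \<alpha> v (r n) m < x" using w x by (meson le_less_trans)
    then have 5: "\<forall>m\<in>wall_set (l n) (k n). wall_pole A \<alpha> v (r n) m < \<rho>" using x by (meson less_trans)
    have "edge_radii (wall_set (l n) (k n)) (wall_pole A \<alpha> v (r n)) (edge_zero A \<alpha> v (r n) (D n)) s1 s2
        (if s2 < s1 then x else \<rho>) (if s2 < s1 then \<rho> else x)"
      unfolding edge_radii_def using 1 2 3 4 5 x by (cases "s2 < s1") (simp_all only: if_True if_False)
    then show ?case by blast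
  qed
qed

text \<open>The radii are only known to exist for each \<open>n\<close>; a choice turns them into
  sequences, to which the limit for arbitrary radii applies.\<close>

lemma edge_integral_convergence:
  fixes K f g :: "nat \<Rightarrow> complex"
  assumes "scaled_height H1 y1" "scaled_height H2 y2"
    and "s1 \<le> s2 \<or> y1 \<noteq> y2 \<or> edge_power odd_edge e s2 + 2 \<le> edge_power odd_edge e s1"
    and K: "\<forall>\<^sub>F n in sequentially. \<exists>Rz Rw. edge_radii (wall_set (l n) (k n)) (wall_pole A \<alpha> v (r n)) (edge_zero A \<alpha> v (r n) (D n)) s1 s2 Rz Rw \<and>
      K n = f n * edge_integral (wall_set (l n) (k n)) (wall_pole A \<alpha> v (r n)) (edge_zero A \<alpha> v (r n) (D n)) s1 s2 (H1 n) (H2 n) Rz Rw"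
    and g: "\<forall>\<^sub>F n in sequentially. g n * f n = nu s1 n / nu s2 n"
  shows "(\<lambda>n. g n * (1 / of_real (sqrt (r n)) * K n)) \<longlonglongrightarrow>
    turning_kernel (critical_curvature u v A \<alpha>) (edge_power odd_edge e s1) (edge_power odd_edge e s2) y1 y2"
proof -
  let ?R = "\<lambda>n Rz Rw. edge_radii (wall_set (l n) (k n)) (wall_pole A \<alpha> v (r n)) (edge_zero A \<alpha> v (r n) (D n)) s1 s2 Rz Rw"
  let ?E = "\<lambda>n Rz Rw. edge_integral (wall_set (l n) (k n)) (wall_pole A \<alpha> v (r n)) (edge_zero A \<alpha> v (r n) (D n)) s1 s2 (H1 n) (H2 n) Rz Rw"
  define Q where "Q = (\<lambda>n. SOME R. ?R n (fst R) (snd R) \<and> K n = f n * ?E n (fst R) (snd R))"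
  have ev: "\<forall>\<^sub>F n in sequentially. ?R n (fst (Q n)) (snd (Q n)) \<and> K n = f n * ?E n (fst (Q n)) (snd (Q n))"
    using K
  proof eventually_elim
    case (elim n)
    then have "\<exists>R. ?R n (fst R) (snd R) \<and> K n = f n * ?E n (fst R) (snd R)" by auto
    then show ?case unfolding Q_def by (rule someI_ex)
  qed
  have ne: "s1 \<le> s2 \<or> y1 \<noteq> y2 \<or> near_count s2 + 2 \<le> near_count s1" unfolding near_count_eq by (rule assms(3))
  have R: "\<forall>\<^sub>F n in sequentially. 0 < fst (Q n) \<and> 0 < snd (Q n) \<and> (\<forall>j<s1. fst (Q n) < 1 / edge_zero A \<alpha> v (r n) (D n) j) \<and>
      (\<forall>m\<in>wall_set (l n) (k n). wall_pole A \<alpha> v (r n) m < snd (Q n)) \<and> (if s2 < s1 then fst (Q n) < snd (Q n) else snd (Q n) < fst (Q n))"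
    using ev unfolding edge_radii_def by eventually_elim blast
  have "(\<lambda>n. 1 / of_real (sqrt (r n)) * (nu s1 n / nu s2 n) * ?E n (fst (Q n)) (snd (Q n))) \<longlonglongrightarrow>
    turning_kernel (critical_curvature u v A \<alpha>) (near_count s1) (near_count s2) y1 y2"
    unfolding edge_integral_def
    by (rule edge_integral_limit[OF assms(1,2) ne R])
  then show ?thesis
    unfolding near_count_eq
  proof (rule Lim_transform_eventually)
    show "\<forall>\<^sub>F n in sequentially. 1 / of_real (sqrt (r n)) * (nu s1 n / nu s2 n) * ?E n (fst (Q n)) (snd (Q n)) = g n * (1 / of_real (sqrt (r n)) * K n)"
      using ev g
    proof eventually_elim
      case (elim n)
      then have K: "K n = f n * ?E n (fst (Q n)) (snd (Q n))" by blast
      show ?case unfolding K elim(2)[symmetric] by (simp only: mult_ac)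
    qed
  qed
qed

end

section \<open>Convergence at the turning points\<close>

text \<open>The same product as \<open>nu\<close>, written as an explicit function of
  \<open>r\<close> and of the distance from the edge, because the conjugating factor must not depend
  on a chosen sequence.\<close>

definition edge_norm :: "real \<Rightarrow> nat \<Rightarrow> bool \<Rightarrow> real \<Rightarrow> nat \<Rightarrow> complex" where
  "edge_norm \<alpha> e odd_edge r s = (\<Prod>j<s. if (odd_edge \<noteq> even j) = (e = 1) then - of_real (sqrt r)
     else of_real (1 - \<alpha> / (if e = 1 then \<alpha> else 1)\<^sup>2))"

text \<open>\<open>exp (H * ln l)\<close> is the power of the rescaling factor, in a form that makes
  sense and is nonzero for every real \<open>H\<close>.\<close>

definition edge_factor :: "real \<Rightarrow> nat \<Rightarrow> bool \<Rightarrow> real \<Rightarrow> real \<Rightarrow> nat \<Rightarrow> real \<Rightarrow> complex" where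
  "edge_factor \<alpha> e odd_edge l r s H = edge_norm \<alpha> e odd_edge r s * exp (of_real (H * ln l))"

lemma edge_factor_nonzero:
  assumes "1 < \<alpha>" "r \<noteq> 0"
  shows "edge_factor \<alpha> e odd_edge l r s H \<noteq> 0"
proof -
  define x where "x = complex_of_real (1 - \<alpha> / (if e = 1 then \<alpha> else 1)\<^sup>2)"
  have "x \<noteq> 0"
    using assms(1) unfolding x_def of_real_eq_0_iff by (auto simp: power2_eq_square)
  then show ?thesis using assms(2) unfolding edge_factor_def edge_norm_def x_def[symmetric] by simp
qed

lemma of_real_power_int_exp:
  assumes "0 < l"
  shows "of_real (l powi m) = (exp (of_real (of_int m * ln l)) :: complex)"
proof -
  have "l powi m = l powr of_int m" using assms by (simp add: powr_real_of_int')
  also have "\<dots> = exp (of_int m * ln l)" using assms by (simp add: powr_def)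
  finally show ?thesis by (simp only: exp_of_real)
qed

lemma lozenge_site_exponent:
  assumes "lozenge_site mu (t, h)"
  shows "real_of_int \<lfloor>h - of_int (back_wall mu t) / 2 + 1 / 2\<rfloor> = h - of_int (back_wall mu t) / 2 + 1 / 2"
proof -
  have "h - of_int (back_wall mu t) / 2 - 1 / 2 \<in> \<int>" using assms by (simp add: lozenge_site_def)
  then obtain m where "h - of_int (back_wall mu t) / 2 - 1 / 2 = of_int m" by (rule Ints_cases)
  then have "h - of_int (back_wall mu t) / 2 + 1 / 2 = of_int (m + 1)" by simp
  then show ?thesis by (simp only: floor_of_int)
qed

context edge_model
begin

text \<open>\<open>r * (D - k - s)\<close> tends to \<open>v - u > 0\<close>, so diagonals at
  bounded distance from the edge lie beyond all corners, where the back wall has constant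
  slope.\<close>

lemma edge_far: "\<forall>\<^sub>F n in sequentially. k n + s \<le> D n"
proof -
  have conv: "(\<lambda>n. x n) \<longlonglongrightarrow> X" if "(\<lambda>n. (x n - X) / sqrt (r n)) \<longlonglongrightarrow> 0" for x X
    using scaled_difference_limit(2)[OF DERIV_ident r_pos r_lim that] .
  have "(\<lambda>n. r n * real (D n) - r n * real (k n) - r n * real s) \<longlonglongrightarrow> v - u - 0 * real s"
    by (intro tendsto_diff tendsto_mult conv[OF k_lim] conv[OF D_lim] r_lim tendsto_const)
  then have "\<forall>\<^sub>F n in sequentially. 0 < r n * real (D n) - r n * real (k n) - r n * real s"
    by (rule order_tendstoD(1)) (use uv in simp)
  then show ?thesis
  proof eventually_elim
    case (elim n)
    then have "0 < r n * (real (D n) - real (k n) - real s)" by (simp add: algebra_simps)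
    then have "0 < real (D n) - real (k n) - real s" using r_pos[of n] by (simp add: zero_less_mult_iff)
    then show ?case by linarith
  qed
qed

lemma nu_eq: "nu s n = edge_norm \<alpha> e odd_edge (r n) s"
proof -
  have "j \<in> near_set \<longleftrightarrow> (odd_edge \<noteq> even j) = (e = 1)" for j by (simp add: near_set_def)
  then show ?thesis unfolding nu_def edge_norm_def A_def[symmetric] by (simp only:)
qed

text \<open>The quotient of the conjugating factors contributes the quotient of the
  \<open>nu\<close> and the power \<open>z powi (H1 - H2)\<close>, which undoes the power created by
  rescaling the integration variables.\<close>

lemma kernel_limit_right:
  fixes h1 h2 :: "nat \<Rightarrow> real"
  defines "z \<equiv> exp v * sqrt \<alpha> / A"
  defines "H \<equiv> (\<lambda>n s h. h - of_int (back_wall (staircase (k n)) (int (D n) - int s)) / 2 + 1 / 2)"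
  assumes chi: "e = 1 \<and> chi = chi_top u v \<alpha> \<or> e = 2 \<and> chi = chi_bottom u v \<alpha>"
    and site: "\<forall>\<^sub>F n in sequentially. lozenge_site (staircase (k n)) (int (D n) - int s1, h1 n)"
      "\<forall>\<^sub>F n in sequentially. lozenge_site (staircase (k n)) (int (D n) - int s2, h2 n)"
    and lim: "(\<lambda>n. sqrt (r n) * (h1 n - real_of_int \<lfloor>chi / r n\<rfloor>)) \<longlonglongrightarrow> y1"
      "(\<lambda>n. sqrt (r n) * (h2 n - real_of_int \<lfloor>chi / r n\<rfloor>)) \<longlonglongrightarrow> y2"
    and ne: "s1 \<le> s2 \<or> y1 \<noteq> y2 \<or> edge_power odd_edge e s2 + 2 \<le> edge_power odd_edge e s1"
  shows "(\<lambda>n. edge_factor \<alpha> e odd_edge z (r n) s1 (H n s1 (h1 n)) / edge_factor \<alpha> e odd_edge z (r n) s2 (H n s2 (h2 n)) *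
      (1 / of_real (sqrt (r n)) * model_kernel \<alpha> (r n) (k n) (l n) (D n) (int (D n) - int s1, h1 n) (int (D n) - int s2, h2 n)))
    \<longlonglongrightarrow> turning_kernel (critical_curvature u v A \<alpha>) (edge_power odd_edge e s1) (edge_power odd_edge e s2) y1 y2"
proof -
  define G where "G = (\<lambda>n s h. \<lfloor>H n s h\<rfloor>)"
  have z: "0 < z" using A alpha_pos by (simp add: z_def)
  have G: "\<forall>\<^sub>F n in sequentially. real_of_int (G n s (h n)) = H n s (h n)"
    if "\<forall>\<^sub>F n in sequentially. lozenge_site (staircase (k n)) (int (D n) - int s, h n)" for h s
    using that unfolding G_def H_def by eventually_elim (rule lozenge_site_exponent)
  have height: "scaled_height (\<lambda>n. G n s (h n)) y"
    if "\<forall>\<^sub>F n in sequentially. lozenge_site (staircase (k n)) (int (D n) - int s, h n)"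
      "(\<lambda>n. sqrt (r n) * (h n - real_of_int \<lfloor>chi / r n\<rfloor>)) \<longlonglongrightarrow> y" for h s y
  proof (rule scaled_heightI[OF _ that(2) chi])
    show "\<forall>\<^sub>F n in sequentially. real_of_int (G n s (h n)) = h n + (real (D n) - real s) / 2 + 1 / 2"
      using G[OF that(1)] edge_far[of s]
    proof eventually_elim
      case (elim n)
      then have b: "back_wall (staircase (k n)) (int (D n) - int s) = - (int (D n) - int s)"
        by (auto simp: back_wall_staircase[OF even_k])
      have "real_of_int (G n s (h n)) = h n - of_int (- (int (D n) - int s)) / 2 + 1 / 2"
        using elim(1) unfolding H_def b .
      then show ?case unfolding of_int_minus of_int_diff of_int_of_nat_eq by argo
    qed
  qed
  note G1 = G[OF site(1)] and G2 = G[OF site(2)]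
  show ?thesis
  proof (rule edge_integral_convergence[OF height[OF site(1) lim(1)] height[OF site(2) lim(2)] ne,
        where f = "\<lambda>n. of_real (z powi (G n s2 (h2 n) - G n s1 (h1 n)))"])
    show "\<forall>\<^sub>F n in sequentially. \<exists>Rz Rw. edge_radii (wall_set (l n) (k n)) (wall_pole A \<alpha> v (r n)) (edge_zero A \<alpha> v (r n) (D n)) s1 s2 Rz Rw \<and>
      model_kernel \<alpha> (r n) (k n) (l n) (D n) (int (D n) - int s1, h1 n) (int (D n) - int s2, h2 n) =
      of_real (z powi (G n s2 (h2 n) - G n s1 (h1 n))) * edge_integral (wall_set (l n) (k n)) (wall_pole A \<alpha> v (r n)) (edge_zero A \<alpha> v (r n) (D n)) s1 s2 (G n s1 (h1 n)) (G n s2 (h2 n)) Rz Rw"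
      using G1 G2 edge_far[of s1] edge_far[of s2] edge_far[of 1] edge_radii_exist[of s1 s2]
    proof eventually_elim
      case (elim n)
      have t: "int (k n) \<le> int (D n) - int s1" "int (k n) \<le> int (D n) - int s2" "k n < D n" using elim by linarith+
      have z': "z = exp v * sqrt \<alpha> / A" by (simp only: z_def)
      show ?case
        by (rule model_kernel_right[OF even_k k_less t(3) alpha_pos A(3) odd_l z' t(1,2) refl refl elim(1)[unfolded H_def] elim(2)[unfolded H_def] elim(6)])
    qed
    show "\<forall>\<^sub>F n in sequentially. edge_factor \<alpha> e odd_edge z (r n) s1 (H n s1 (h1 n)) / edge_factor \<alpha> e odd_edge z (r n) s2 (H n s2 (h2 n)) *
        of_real (z powi (G n s2 (h2 n) - G n s1 (h1 n))) = nu s1 n / nu s2 n"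
      using G1 G2
    proof eventually_elim
      case (elim n)
      have "z powi (G n s2 (h2 n) - G n s1 (h1 n)) = z powi (G n s2 (h2 n)) / z powi (G n s1 (h1 n))"
        using z by (simp add: power_int_diff)
      then have eq: "complex_of_real (z powi (G n s2 (h2 n) - G n s1 (h1 n))) = of_real (z powi (G n s2 (h2 n))) / of_real (z powi (G n s1 (h1 n)))"
        by (simp only: of_real_divide)
      have key: "x * a / (y * b) * (b / a) = x / y" if "a \<noteq> 0" "b \<noteq> 0" for a b x y :: complex using that by simp
      show ?case
        unfolding edge_factor_def elim[symmetric] of_real_power_int_exp[OF z, symmetric] nu_eq eq
        by (rule key) (use z in auto)
    qed
  qed
qed

lemma kernel_limit_left:
  fixes h1 h2 :: "nat \<Rightarrow> real"
  defines "z \<equiv> (\<lambda>n. parity_factor \<alpha> (D n) * (exp v * sqrt \<alpha> / A))"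
  defines "H \<equiv> (\<lambda>n s h. h - of_int (back_wall (staircase (k n)) (- int (D n) + int s)) / 2 + 1 / 2)"
  assumes chi: "e = 1 \<and> chi = chi_top u v \<alpha> \<or> e = 2 \<and> chi = chi_bottom u v \<alpha>"
    and site: "\<forall>\<^sub>F n in sequentially. lozenge_site (staircase (k n)) (- int (D n) + int s1, h1 n)"
      "\<forall>\<^sub>F n in sequentially. lozenge_site (staircase (k n)) (- int (D n) + int s2, h2 n)"
    and lim: "(\<lambda>n. sqrt (r n) * (h1 n - real_of_int \<lfloor>chi / r n\<rfloor>)) \<longlonglongrightarrow> y1"
      "(\<lambda>n. sqrt (r n) * (h2 n - real_of_int \<lfloor>chi / r n\<rfloor>)) \<longlonglongrightarrow> y2"
    and ne: "s2 \<le> s1 \<or> y2 \<noteq> y1 \<or> edge_power odd_edge e s1 + 2 \<le> edge_power odd_edge e s2"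
  shows "(\<lambda>n. edge_factor \<alpha> e odd_edge (z n) (r n) s2 (H n s2 (h2 n)) / edge_factor \<alpha> e odd_edge (z n) (r n) s1 (H n s1 (h1 n)) *
      (1 / of_real (sqrt (r n)) * model_kernel \<alpha> (r n) (k n) (D n) (l n) (- int (D n) + int s1, h1 n) (- int (D n) + int s2, h2 n)))
    \<longlonglongrightarrow> turning_kernel (critical_curvature u v A \<alpha>) (edge_power odd_edge e s2) (edge_power odd_edge e s1) y2 y1"
proof -
  define G where "G = (\<lambda>n s h. \<lfloor>H n s h\<rfloor>)"
  have z: "0 < z n" for n using A alpha_pos by (simp add: z_def parity_factor_def)
  have G: "\<forall>\<^sub>F n in sequentially. real_of_int (G n s (h n)) = H n s (h n)"
    if "\<forall>\<^sub>F n in sequentially. lozenge_site (staircase (k n)) (- int (D n) + int s, h n)" for h s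
    using that unfolding G_def H_def by eventually_elim (rule lozenge_site_exponent)
  have height: "scaled_height (\<lambda>n. G n s (h n)) y"
    if "\<forall>\<^sub>F n in sequentially. lozenge_site (staircase (k n)) (- int (D n) + int s, h n)"
      "(\<lambda>n. sqrt (r n) * (h n - real_of_int \<lfloor>chi / r n\<rfloor>)) \<longlonglongrightarrow> y" for h s y
  proof (rule scaled_heightI[OF _ that(2) chi])
    show "\<forall>\<^sub>F n in sequentially. real_of_int (G n s (h n)) = h n + (real (D n) - real s) / 2 + 1 / 2"
      using G[OF that(1)] edge_far[of s]
    proof eventually_elim
      case (elim n)
      then have b: "back_wall (staircase (k n)) (- int (D n) + int s) = - int (D n) + int s"
        by (auto simp: back_wall_staircase[OF even_k])
      have "real_of_int (G n s (h n)) = h n - of_int (- int (D n) + int s) / 2 + 1 / 2"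
        using elim(1) unfolding H_def b .
      then show ?case unfolding of_int_minus of_int_add of_int_of_nat_eq by argo
    qed
  qed
  note G1 = G[OF site(1)] and G2 = G[OF site(2)]
  show ?thesis
  proof (rule edge_integral_convergence[OF height[OF site(2) lim(2)] height[OF site(1) lim(1)] ne,
        where f = "\<lambda>n. of_real (z n powi (G n s1 (h1 n) - G n s2 (h2 n)))"])
    show "\<forall>\<^sub>F n in sequentially. \<exists>Rz Rw. edge_radii (wall_set (l n) (k n)) (wall_pole A \<alpha> v (r n)) (edge_zero A \<alpha> v (r n) (D n)) s2 s1 Rz Rw \<and>
      model_kernel \<alpha> (r n) (k n) (D n) (l n) (- int (D n) + int s1, h1 n) (- int (D n) + int s2, h2 n) =
      of_real (z n powi (G n s1 (h1 n) - G n s2 (h2 n))) * edge_integral (wall_set (l n) (k n)) (wall_pole A \<alpha> v (r n)) (edge_zero A \<alpha> v (r n) (D n)) s2 s1 (G n s2 (h2 n)) (G n s1 (h1 n)) Rz Rw"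
      using G1 G2 edge_far[of s1] edge_far[of s2] edge_far[of 1] edge_radii_exist[of s2 s1]
    proof eventually_elim
      case (elim n)
      have t: "- int (D n) + int s1 \<le> - int (k n)" "- int (D n) + int s2 \<le> - int (k n)" "k n < D n" using elim by linarith+
      have z': "z n = parity_factor \<alpha> (D n) * (exp v * sqrt \<alpha> / A)" by (simp only: z_def)
      show ?case
        by (rule model_kernel_left[OF even_k t(3) k_less alpha_pos A(3) z' t(1,2) refl refl elim(1)[unfolded H_def] elim(2)[unfolded H_def] elim(6)])
    qed
    show "\<forall>\<^sub>F n in sequentially. edge_factor \<alpha> e odd_edge (z n) (r n) s2 (H n s2 (h2 n)) / edge_factor \<alpha> e odd_edge (z n) (r n) s1 (H n s1 (h1 n)) *
        of_real (z n powi (G n s1 (h1 n) - G n s2 (h2 n))) = nu s2 n / nu s1 n"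
      using G1 G2
    proof eventually_elim
      case (elim n)
      have "z n powi (G n s1 (h1 n) - G n s2 (h2 n)) = z n powi (G n s1 (h1 n)) / z n powi (G n s2 (h2 n))"
        using z[of n] by (simp add: power_int_diff)
      then have eq: "complex_of_real (z n powi (G n s1 (h1 n) - G n s2 (h2 n))) = of_real (z n powi (G n s1 (h1 n))) / of_real (z n powi (G n s2 (h2 n)))"
        by (simp only: of_real_divide)
      have key: "x * a / (y * b) * (b / a) = x / y" if "a \<noteq> 0" "b \<noteq> 0" for a b x y :: complex using that by simp
      show ?case
        unfolding edge_factor_def elim[symmetric] of_real_power_int_exp[OF z, symmetric] nu_eq eq
        by (rule key) (use z[of n] in auto)
    qed
  qed
qed

end

lemma edge_parity_le: "edge_parity tau odd_edge \<le> at_right 0"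
  unfolding edge_parity_def by (rule at_le) auto

text \<open>For \<open>tau = - v\<close> the limit comes with the two arguments exchanged, hence the
  inverse factor. The value 1 at \<open>r = 0\<close> makes the function nowhere zero.\<close>

definition turning_factor ::
    "real \<Rightarrow> nat \<Rightarrow> real \<Rightarrow> real \<Rightarrow> (real \<Rightarrow> nat) \<Rightarrow> (real \<Rightarrow> nat) \<Rightarrow> real \<Rightarrow> int \<times> real \<Rightarrow> complex" where
  "turning_factor \<alpha> e v tau k c r x =
     (if r = 0 then 1 else
      let s = nat \<bar>\<lfloor>tau / r\<rfloor> - fst x\<bar>;
          H = snd x - of_int (back_wall (staircase (k r)) (fst x)) / 2 + 1 / 2;
          z = exp v * sqrt \<alpha> / (if e = 1 then \<alpha> else 1)
      in if 0 < tau then edge_factor \<alpha> e (odd \<lfloor>tau / r\<rfloor>) z r s H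
         else 1 / edge_factor \<alpha> e (odd \<lfloor>tau / r\<rfloor>) (parity_factor \<alpha> (c r) * z) r s H)"

lemma turning_factor_nonzero: "1 < \<alpha> \<Longrightarrow> turning_factor \<alpha> e v tau k c r x \<noteq> 0"
  by (auto simp: turning_factor_def Let_def edge_factor_nonzero)

lemma edge_power_mono: "s \<le> s' \<Longrightarrow> edge_power odd_edge e s \<le> edge_power odd_edge e s'"
  unfolding edge_power_def by (intro div_le_mono) simp

text \<open>A limit along the filter is a limit along all sequences in the given parity class, and
  each such sequence has a tail on which the conditions of \<open>edge_model\<close> hold for every
  index.\<close>

lemma kernel_convergence:
  fixes u v \<alpha> tau chi :: real and e :: nat and k c d :: "real \<Rightarrow> nat"
  assumes uv: "0 < u" "u < v" and \<alpha>: "1 < \<alpha>" "exp (- 2 * u) * \<alpha> < 1"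
    and even_k: "\<forall>\<^sub>F r in at_right 0. even (k r)"
    and k_lim: "((\<lambda>r. (r * real (k r) - u) / sqrt r) \<longlongrightarrow> 0) (at_right 0)"
    and c_lim: "((\<lambda>r. (r * real (c r) - v) / sqrt r) \<longlongrightarrow> 0) (at_right 0)"
    and d_lim: "((\<lambda>r. (r * real (d r) - v) / sqrt r) \<longlongrightarrow> 0) (at_right 0)"
    and tau: "tau = v \<or> tau = - v"
    and right: "tau = v \<Longrightarrow> \<forall>\<^sub>F r in at_right 0. int (d r) = \<lfloor>tau / r\<rfloor> \<and> odd (c r)"
    and left: "tau = - v \<Longrightarrow> \<forall>\<^sub>F r in at_right 0. - int (c r) = \<lfloor>tau / r\<rfloor> \<and> odd (d r)"
    and chi: "e = 1 \<and> chi = chi_top u v \<alpha> \<or> e = 2 \<and> chi = chi_bottom u v \<alpha>"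
    and sep: "separated tau odd_edge e P1 P2"
    and h1: "height_approximates k tau chi (edge_parity tau odd_edge) P1 h1"
    and h2: "height_approximates k tau chi (edge_parity tau odd_edge) P2 h2"
  shows "((\<lambda>r. let x1 = (edge_time tau r (fst P1), h1 r); x2 = (edge_time tau r (fst P2), h2 r)
      in turning_factor \<alpha> e v tau k c r x1 / turning_factor \<alpha> e v tau k c r x2 *
        (of_real (r powr (- 1 / 2)) * model_kernel \<alpha> r (k r) (c r) (d r) x1 x2))
    \<longlongrightarrow> edge_kernel tau (S_second u v \<alpha> tau chi e) odd_edge e P1 P2) (edge_parity tau odd_edge)"
proof -
  define l where "l = (if tau = v then c else d)"
  define D where "D = (if tau = v then d else c)"
  define s1 where "s1 = fst P1"
  define s2 where "s2 = fst P2"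
  define y1 where "y1 = snd P1"
  define y2 where "y2 = snd P2"
  define Q where "Q = (\<lambda>r. let x1 = (edge_time tau r s1, h1 r); x2 = (edge_time tau r s2, h2 r)
      in turning_factor \<alpha> e v tau k c r x1 / turning_factor \<alpha> e v tau k c r x2 *
        (of_real (r powr (- 1 / 2)) * model_kernel \<alpha> r (k r) (c r) (d r) x1 x2))"
  define L where "L = edge_kernel tau (S_second u v \<alpha> tau chi e) odd_edge e P1 P2"
  have e: "e = 1 \<or> e = 2" using chi by blast
  have l_lim: "((\<lambda>r. (r * real (l r) - v) / sqrt r) \<longlongrightarrow> 0) (at_right 0)"
    and D_lim: "((\<lambda>r. (r * real (D r) - v) / sqrt r) \<longlongrightarrow> 0) (at_right 0)"
    using c_lim d_lim by (simp_all add: l_def D_def)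
  have edge: "\<forall>\<^sub>F r in at_right 0. (if tau = v then int (D r) else - int (D r)) = \<lfloor>tau / r\<rfloor> \<and> odd (l r)"
    using right left tau by (cases "tau = v") (simp_all add: l_def D_def)
  have "(Q \<longlongrightarrow> L) (edge_parity tau odd_edge)"
    unfolding edge_parity_def tendsto_at_iff_sequentially
  proof (intro allI impI)
    fix X :: "nat \<Rightarrow> real"
    assume X: "\<forall>i. X i \<in> {r. 0 < r \<and> odd \<lfloor>tau / r\<rfloor> = odd_edge} - {0}" "X \<longlonglongrightarrow> 0"
    have X0: "0 < X n" and Xodd: "odd \<lfloor>tau / X n\<rfloor> = odd_edge" for n using X by auto
    have "filterlim X (edge_parity tau odd_edge) sequentially"
      unfolding edge_parity_def filterlim_at
      using X by (auto intro!: always_eventually simp: order_less_imp_not_eq2)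
    note Xp = this
    have Xr: "filterlim X (at_right 0) sequentially" by (rule filterlim_mono[OF Xp edge_parity_le order_refl])
    note ev = eventually_compose_filterlim[OF _ Xr] and evp = eventually_compose_filterlim[OF _ Xp]
    note lim = filterlim_compose[OF _ Xr] and limp = filterlim_compose[OF _ Xp]
    have conv: "(\<lambda>n. X n * real (m (X n))) \<longlonglongrightarrow> w" if "((\<lambda>r. (r * real (m r) - w) / sqrt r) \<longlongrightarrow> 0) (at_right 0)" for m w
      using scaled_difference_limit(2)[OF DERIV_ident X0 X(2) lim[OF that]] .
    have kX: "\<forall>\<^sub>F n in sequentially. \<bar>X n * real (k (X n)) - u\<bar> < (v - u) / 2"
      using tendstoD[OF conv[OF k_lim], of "(v - u) / 2"] uv by (simp add: dist_real_def)
    have sX: "\<forall>\<^sub>F n in sequentially. X n * real (l (X n)) + X n * real (k (X n)) < u + v + 2"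
      using tendsto_add[OF conv[OF l_lim] conv[OF k_lim]] by (rule order_tendstoD(2)) simp
    have lX: "\<forall>\<^sub>F n in sequentially. u + (v - u) / 2 < X n * real (l (X n))"
      using conv[OF l_lim] by (rule order_tendstoD(1)) (use uv in argo)
    obtain N where N: "\<And>n. N \<le> n \<Longrightarrow> even (k (X n)) \<and> ((if tau = v then int (D (X n)) else - int (D (X n))) = \<lfloor>tau / X n\<rfloor> \<and> odd (l (X n))) \<and>
        \<bar>X n * real (k (X n)) - u\<bar> < (v - u) / 2 \<and> X n * real (l (X n)) + X n * real (k (X n)) < u + v + 2 \<and> u + (v - u) / 2 < X n * real (l (X n))"
      using eventually_conj[OF ev[OF even_k] eventually_conj[OF ev[OF edge] eventually_conj[OF kX eventually_conj[OF sX lX]]]]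
      unfolding eventually_sequentially by blast
    define r where "r = (\<lambda>n. X (n + N))"
    have Nr: "even (k (r n))" "(if tau = v then int (D (r n)) else - int (D (r n))) = \<lfloor>tau / r n\<rfloor>" "odd (l (r n))"
        "\<bar>r n * real (k (r n)) - u\<bar> < (v - u) / 2" "r n * real (l (r n)) + r n * real (k (r n)) < u + v + 2"
        "u + (v - u) / 2 < r n * real (l (r n))" for n
      using N[of "n + N"] unfolding r_def by auto
    have r: "0 < r n" "odd \<lfloor>tau / r n\<rfloor> = odd_edge" for n using X0 Xodd by (simp_all add: r_def)
    have rp: "filterlim r (edge_parity tau odd_edge) sequentially"
      unfolding r_def by (rule filterlim_compose[OF Xp filterlim_add_const_nat_at_top])
    have rr: "filterlim r (at_right 0) sequentially" by (rule filterlim_mono[OF rp edge_parity_le order_refl])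
    interpret edge_model r "\<lambda>n. k (r n)" "\<lambda>n. l (r n)" "\<lambda>n. D (r n)" u v \<alpha> e odd_edge
    proof
      fix n
      show "0 < r n" "even (k (r n))" "odd (l (r n))" by (fact r Nr)+
      show "odd (D (r n)) = odd_edge" using Nr(2)[of n] r(2)[of n] by (auto split: if_splits) (metis even_minus even_of_nat_iff)+
      show "\<bar>r n * real (k (r n)) - u\<bar> \<le> (v - u) / 2" using Nr(4)[of n] by simp
      show "r n * real (l (r n) + k (r n)) \<le> u + v + 2" using Nr(5)[of n] by (simp add: distrib_left)
      have "r n * real (k (r n)) < r n * real (l (r n))" using abs_le_D1[OF less_imp_le[OF Nr(4)[of n]]] Nr(6)[of n] by argo
      then show "k (r n) < l (r n)" using r(1)[of n] by simp
    next
      show "r \<longlonglongrightarrow> 0" using LIMSEQ_ignore_initial_segment[OF X(2), of N] by (simp add: r_def)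
    qed (use uv \<alpha> e filterlim_compose[OF k_lim rr] filterlim_compose[OF l_lim rr] filterlim_compose[OF D_lim rr] in auto)
    have site: "\<forall>\<^sub>F n in sequentially. lozenge_site (staircase (k (r n))) (edge_time tau (r n) (fst P), h (r n))"
      and ht: "(\<lambda>n. sqrt (r n) * (h (r n) - real_of_int \<lfloor>chi / r n\<rfloor>)) \<longlonglongrightarrow> snd P"
      if "height_approximates k tau chi (edge_parity tau odd_edge) P h" for P h
      using that eventually_compose_filterlim[OF _ rp] filterlim_compose[OF _ rp]
      unfolding height_approximates_def by blast+
    have powr: "of_real (r n powr (- 1 / 2)) = 1 / complex_of_real (sqrt (r n))" for n
      using r(1)[of n] by (simp add: powr_minus powr_half_sqrt inverse_eq_divide flip: minus_divide_left)
    \<comment> \<open>As \<open>edge_power\<close> is monotone in the distance from the edge, the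
      absolute value in \<open>separated\<close> becomes a one-sided difference.\<close>
    have mono: "edge_power odd_edge e s2 \<le> edge_power odd_edge e s1 \<or> s1 < s2" "edge_power odd_edge e s1 \<le> edge_power odd_edge e s2 \<or> s2 < s1"
      using edge_power_mono by (meson not_le)+
    have Aif: "(if e = 1 then \<alpha> else 1) = A" by (simp add: A_def)
    have "(\<lambda>n. Q (r n)) \<longlonglongrightarrow> L"
    proof (cases "tau = v")
      case True
      then have pos: "0 < tau" using uv by simp
      have lD: "l = c" "D = d" using True by (simp_all add: l_def D_def)
      have fl: "\<lfloor>tau / r n\<rfloor> = int (d (r n))" for n using Nr(2)[of n] True by (simp add: lD)
      have time: "edge_time tau (r n) s = int (d (r n)) - int s" for n s using pos by (simp add: edge_time_def fl)
      have ne: "s1 \<le> s2 \<or> y1 \<noteq> y2 \<or> edge_power odd_edge e s2 + 2 \<le> edge_power odd_edge e s1"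
        using sep pos mono(1) unfolding separated_def s1_def s2_def y1_def y2_def by auto
      show ?thesis
        using kernel_limit_right[OF chi site[OF h1, folded s1_def, unfolded time, folded lD] site[OF h2, folded s2_def, unfolded time, folded lD]
            ht[OF h1, folded y1_def] ht[OF h2, folded y2_def] ne]
        unfolding L_def edge_kernel_def if_P[OF pos] True S_second_eq(1)[OF chi]
          s1_def[symmetric] s2_def[symmetric] y1_def[symmetric] y2_def[symmetric]
        unfolding Q_def turning_factor_def Let_def fst_conv snd_conv True[symmetric] time powr Aif
        using r(1) pos by (simp add: fl lD parity_D[unfolded lD] less_imp_neq[THEN not_sym])
    next
      case False
      then have tv: "tau = - v" using tau by blast
      then have neg: "\<not> 0 < tau" using uv by simp
      have lD: "l = d" "D = c" using False by (simp_all add: l_def D_def)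
      have fl: "\<lfloor>tau / r n\<rfloor> = - int (c (r n))" for n using Nr(2)[of n] False by (simp add: lD)
      have time: "edge_time tau (r n) s = - int (c (r n)) + int s" for n s using neg by (simp add: edge_time_def fl)
      have ne: "s2 \<le> s1 \<or> y2 \<noteq> y1 \<or> edge_power odd_edge e s1 + 2 \<le> edge_power odd_edge e s2"
        using sep neg mono(2) unfolding separated_def s1_def s2_def y1_def y2_def by auto
      show ?thesis
        using kernel_limit_left[OF chi site[OF h1, folded s1_def, unfolded time, folded lD] site[OF h2, folded s2_def, unfolded time, folded lD]
            ht[OF h1, folded y1_def] ht[OF h2, folded y2_def] ne]
        unfolding L_def edge_kernel_def if_not_P[OF neg] tv S_second_eq(2)[OF chi] minus_minus
          s1_def[symmetric] s2_def[symmetric] y1_def[symmetric] y2_def[symmetric]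
        unfolding Q_def turning_factor_def Let_def fst_conv snd_conv tv[symmetric] time powr Aif
        using r(1) neg by (simp add: fl lD parity_D[unfolded lD] less_imp_neq[THEN not_sym])
    qed
    then show "(Q \<circ> X) \<longlonglongrightarrow> L" unfolding r_def comp_def by (rule LIMSEQ_offset)
  qed
  then show ?thesis unfolding Q_def L_def s1_def s2_def .
qed

text \<open>In each term of the Leibniz expansion the product of \<open>a i / a (p i)\<close> is 1,
  since \<open>p\<close> only permutes the factors.\<close>

lemma det_conjugate:
  fixes M :: "complex^'n^'n"
  assumes "\<And>i. a i \<noteq> 0"
  shows "det (\<chi> i j. a i / a j * (t * M $ i $ j)) = t ^ CARD('n) * det M"
proof -
  have "(\<Prod>i\<in>UNIV. a i / a (p i) * (t * M $ i $ p i)) = t ^ CARD('n) * (\<Prod>i\<in>UNIV. M $ i $ p i)"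
    if p: "p permutes UNIV" for p
  proof -
    have "(\<Prod>i\<in>UNIV. a (p i)) = (\<Prod>i\<in>UNIV. a i)" using prod.permute[OF p, of a] by (simp add: comp_def)
    moreover have "(\<Prod>i\<in>UNIV. a i) \<noteq> 0" using assms by simp
    ultimately show ?thesis by (simp add: prod.distrib prod_dividef)
  qed
  note perm_term = this
  show ?thesis
    unfolding det_def sum_distrib_left
  proof (rule sum.cong[OF refl])
    fix p :: "'n \<Rightarrow> 'n" assume "p \<in> {p. p permutes UNIV}"
    then show "of_int (sign p) * (\<Prod>i\<in>UNIV. (\<chi> i j. a i / a j * (t * M $ i $ j)) $ i $ p i) =
        t ^ CARD('n) * (of_int (sign p) * (\<Prod>i\<in>UNIV. M $ i $ p i))"
      using perm_term[of p] by (simp only: vec_lambda_beta mem_Collect_eq mult.left_commute)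
  qed
qed

lemma tendsto_det:
  fixes M :: "'a \<Rightarrow> 'n::finite \<Rightarrow> 'n \<Rightarrow> complex"
  assumes "\<And>i j. ((\<lambda>x. M x i j) \<longlongrightarrow> L i j) F"
  shows "((\<lambda>x. det (\<chi> i j. M x i j)) \<longlongrightarrow> det (\<chi> i j. L i j)) F"
  unfolding det_def by (simp, intro tendsto_intros assms)

theorem theorem5p1:
  fixes u v alpha tau chi :: real
    and e :: nat
    and k c d :: "real \<Rightarrow> nat"
  assumes "0 < u" and "u < v" and "1 < alpha" and "exp (- 2 * u) * alpha < 1"
    and staircase_even: "\<forall>\<^sub>F r in at_right 0. even (k r)"
    and staircase_limit: "((\<lambda>r. (r * real (k r) - u) / sqrt r) \<longlongrightarrow> 0) (at_right 0)"
    and left_limit: "((\<lambda>r. (r * real (c r) - v) / sqrt r) \<longlongrightarrow> 0) (at_right 0)"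
    and right_limit: "((\<lambda>r. (r * real (d r) - v) / sqrt r) \<longlongrightarrow> 0) (at_right 0)"
    and tau: "tau = v \<or> tau = - v"
    and right_edge: "tau = v \<Longrightarrow>
          \<forall>\<^sub>F r in at_right 0. int (d r) = \<lfloor>tau / r\<rfloor> \<and> odd (c r)"
    and left_edge: "tau = - v \<Longrightarrow>
          \<forall>\<^sub>F r in at_right 0. - int (c r) = \<lfloor>tau / r\<rfloor> \<and> odd (d r)"
    and chi: "e = 1 \<and> chi = chi_top u v alpha \<or> e = 2 \<and> chi = chi_bottom u v alpha"
  shows
    \<comment> \<open>convergence of the kernel, up to conjugation\<close>
    "(\<exists>f :: real \<Rightarrow> int \<times> real \<Rightarrow> complex. (\<forall>r x. f r x \<noteq> 0) \<and>
       (\<forall>odd_edge P1 P2 h1 h2.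
          1 \<le> fst P1 \<and> 1 \<le> fst P2 \<and> separated tau odd_edge e P1 P2 \<and>
          height_approximates k tau chi (edge_parity tau odd_edge) P1 h1 \<and>
          height_approximates k tau chi (edge_parity tau odd_edge) P2 h2 \<longrightarrow>
          ((\<lambda>r. let x1 = (edge_time tau r (fst P1), h1 r);
                    x2 = (edge_time tau r (fst P2), h2 r)
                in f r x1 / f r x2 *
                   (of_real (r powr (- 1 / 2)) * model_kernel alpha r (k r) (c r) (d r) x1 x2))
             \<longlongrightarrow> edge_kernel tau (S_second u v alpha tau chi e) odd_edge e P1 P2)
            (edge_parity tau odd_edge))) \<and>
     \<comment> \<open>convergence of the correlation functions of \<open>CARD('n)\<close> points, given that the
        correlation functions of the model are the determinants of its kernel\<close>
     ((\<forall>\<^sub>F r in at_right 0. \<forall>x :: 'n::finite \<Rightarrow> int \<times> real.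
        inj x \<and> (\<forall>i. lozenge_site (staircase (k r)) (x i) \<and>
                      - int (c r) < fst (x i) \<and> fst (x i) < int (d r)) \<longrightarrow>
        of_real (model_correlation alpha r (k r) (c r) (d r) x) =
        det (\<chi> i j. model_kernel alpha r (k r) (c r) (d r) (x i) (x j))) \<longrightarrow>
      (\<forall>odd_edge (P :: 'n \<Rightarrow> nat \<times> real) h.
        inj P \<and> (\<forall>i. 1 \<le> fst (P i)) \<and>
        (\<forall>i j. separated tau odd_edge e (P i) (P j)) \<and>
        (\<forall>i. height_approximates k tau chi (edge_parity tau odd_edge) (P i) (h i)) \<longrightarrow>
        ((\<lambda>r. of_real (r powr (- real CARD('n) / 2) *
                 model_correlation alpha r (k r) (c r) (d r)
                   (\<lambda>i. (edge_time tau r (fst (P i)), h i r))))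
           \<longlongrightarrow> det (\<chi> i j. edge_kernel tau (S_second u v alpha tau chi e) odd_edge e (P i) (P j)))
          (edge_parity tau odd_edge)))"
proof (intro conjI impI)
  note conv = kernel_convergence[OF assms]
  let ?f = "turning_factor alpha e v tau k c"
  show "\<exists>f :: real \<Rightarrow> int \<times> real \<Rightarrow> complex. (\<forall>r x. f r x \<noteq> 0) \<and>
       (\<forall>odd_edge P1 P2 h1 h2.
          1 \<le> fst P1 \<and> 1 \<le> fst P2 \<and> separated tau odd_edge e P1 P2 \<and>
          height_approximates k tau chi (edge_parity tau odd_edge) P1 h1 \<and>
          height_approximates k tau chi (edge_parity tau odd_edge) P2 h2 \<longrightarrow>
          ((\<lambda>r. let x1 = (edge_time tau r (fst P1), h1 r);
                    x2 = (edge_time tau r (fst P2), h2 r)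
                in f r x1 / f r x2 *
                   (of_real (r powr (- 1 / 2)) * model_kernel alpha r (k r) (c r) (d r) x1 x2))
             \<longlongrightarrow> edge_kernel tau (S_second u v alpha tau chi e) odd_edge e P1 P2)
            (edge_parity tau odd_edge))"
    by (rule exI[of _ ?f]) (use turning_factor_nonzero[OF \<open>1 < alpha\<close>] conv in blast)
  assume det: "\<forall>\<^sub>F r in at_right 0. \<forall>x :: 'n \<Rightarrow> int \<times> real.
        inj x \<and> (\<forall>i. lozenge_site (staircase (k r)) (x i) \<and>
                      - int (c r) < fst (x i) \<and> fst (x i) < int (d r)) \<longrightarrow>
        of_real (model_correlation alpha r (k r) (c r) (d r) x) =
        det (\<chi> i j. model_kernel alpha r (k r) (c r) (d r) (x i) (x j))"
  show "\<forall>odd_edge (P :: 'n \<Rightarrow> nat \<times> real) h.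
        inj P \<and> (\<forall>i. 1 \<le> fst (P i)) \<and>
        (\<forall>i j. separated tau odd_edge e (P i) (P j)) \<and>
        (\<forall>i. height_approximates k tau chi (edge_parity tau odd_edge) (P i) (h i)) \<longrightarrow>
        ((\<lambda>r. of_real (r powr (- real CARD('n) / 2) *
                 model_correlation alpha r (k r) (c r) (d r)
                   (\<lambda>i. (edge_time tau r (fst (P i)), h i r))))
           \<longlongrightarrow> det (\<chi> i j. edge_kernel tau (S_second u v alpha tau chi e) odd_edge e (P i) (P j)))
          (edge_parity tau odd_edge)"
  proof (intro allI impI, elim conjE)
    fix odd_edge and P :: "'n \<Rightarrow> nat \<times> real" and h
    assume P: "inj P" "\<forall>i. 1 \<le> fst (P i)" and sep: "\<forall>i j. separated tau odd_edge e (P i) (P j)"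
      and h: "\<forall>i. height_approximates k tau chi (edge_parity tau odd_edge) (P i) (h i)"
    define F where "F = edge_parity tau odd_edge"
    define x where "x = (\<lambda>r i. (edge_time tau r (fst (P i)), h i r))"
    define K where "K = (\<lambda>r. model_kernel alpha r (k r) (c r) (d r))"
    have site: "\<forall>\<^sub>F r in F. \<forall>i. lozenge_site (staircase (k r)) (x r i)"
      by (rule eventually_all_finite) (use h in \<open>simp add: height_approximates_def F_def x_def\<close>)
    have F0: "F \<le> at_right 0" unfolding F_def by (rule edge_parity_le)
    have rpos: "\<forall>\<^sub>F r in F. 0 < r"
      using filter_leD[OF F0 eventually_at_right_less[of 0]] by simp
    have small: "((\<lambda>r. r) \<longlongrightarrow> 0) F" using tendsto_mono[OF F0 tendsto_ident_at] .
    have size: "((\<lambda>r. r * real (m r)) \<longlongrightarrow> v) F" if "((\<lambda>r. (r * real (m r) - v) / sqrt r) \<longlongrightarrow> 0) (at_right 0)" for m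
    proof -
      have "((\<lambda>r. (r * real (m r) - v) / sqrt r * sqrt r + v) \<longlongrightarrow> 0 * sqrt 0 + v) F"
        by (intro tendsto_intros tendsto_mono[OF F0 that] small)
      then have "((\<lambda>r. (r * real (m r) - v) / sqrt r * sqrt r + v) \<longlongrightarrow> v) F" by simp
      then show ?thesis
        by (rule Lim_transform_eventually) (use rpos in eventually_elim, simp)
    qed
    \<comment> \<open>The determinantal formula is available for distinct sites strictly between the
      two ends, so these conditions are verified for small \<open>r\<close>. At the opposite end,
      \<open>r * (c + d - s)\<close> tends to \<open>2 * v > 0\<close>.\<close>
    have range: "\<forall>\<^sub>F r in F. \<forall>i. - int (c r) < fst (x r i) \<and> fst (x r i) < int (d r)"
    proof (rule eventually_all_finite)
      fix i
      define s where "s = fst (P i)"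
      have s: "1 \<le> s" using P by (simp add: s_def)
      have "((\<lambda>r. r * real (c r) + r * real (d r) - r * real s) \<longlongrightarrow> v + v - 0 * real s) F"
        by (intro tendsto_diff tendsto_add tendsto_mult size left_limit right_limit small tendsto_const)
      then have "\<forall>\<^sub>F r in F. 0 < r * real (c r) + r * real (d r) - r * real s"
        by (rule order_tendstoD(1)) (use \<open>0 < u\<close> \<open>u < v\<close> in simp)
      moreover have "\<forall>\<^sub>F r in F. edge_time tau r s = (if tau = v then int (d r) - int s else - int (c r) + int s)"
      proof (cases "tau = v")
        case True
        then show ?thesis using filter_leD[OF F0 right_edge] \<open>0 < u\<close> \<open>u < v\<close>
          by (auto elim!: eventually_mono simp: edge_time_def)
      next
        case False
        then have "tau = - v" using tau by blast
        then show ?thesis using filter_leD[OF F0 left_edge] False \<open>0 < u\<close> \<open>u < v\<close>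
          by (auto elim!: eventually_mono simp: edge_time_def)
      qed
      ultimately show "\<forall>\<^sub>F r in F. - int (c r) < fst (x r i) \<and> fst (x r i) < int (d r)"
        using rpos
      proof eventually_elim
        case (elim r)
        have "0 < r * (real (c r) + real (d r) - real s)" using elim(1) by (simp add: algebra_simps)
        then have "0 < real (c r) + real (d r) - real s" using elim(3) by (simp add: zero_less_mult_iff)
        then show ?case using s elim(2) by (auto simp: x_def s_def[symmetric])
      qed
    qed
    \<comment> \<open>Distinct limit points on one diagonal have distinct local heights, so the
      heights separate for small \<open>r\<close>; points on different diagonals are distinct for
      every \<open>r\<close>.\<close>
    have inj: "\<forall>\<^sub>F r in F. inj (x r)"
    proof -
      have "\<forall>\<^sub>F r in F. i \<noteq> j \<longrightarrow> x r i \<noteq> x r j" for i j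
      proof (cases "i = j \<or> fst (P i) \<noteq> fst (P j)")
        case True
        then show ?thesis by (auto simp: x_def edge_time_def)
      next
        case False
        then have ne: "snd (P i) - snd (P j) \<noteq> 0" using P(1) by (metis injD prod_eqI eq_iff_diff_eq_0)
        have lim: "((\<lambda>r. sqrt r * (h i r - real_of_int \<lfloor>chi / r\<rfloor>)) \<longlongrightarrow> snd (P i)) F" for i
          using h by (simp add: height_approximates_def F_def)
        have "\<forall>\<^sub>F r in F. sqrt r * (h i r - real_of_int \<lfloor>chi / r\<rfloor>) - sqrt r * (h j r - real_of_int \<lfloor>chi / r\<rfloor>) \<noteq> 0"
          by (rule tendsto_imp_eventually_ne[OF tendsto_diff[OF lim lim] ne])
        then show ?thesis by eventually_elim (auto simp: x_def)
      qed
      then have "\<forall>\<^sub>F r in F. \<forall>i j. i \<noteq> j \<longrightarrow> x r i \<noteq> x r j" by (intro eventually_all_finite)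
      then show ?thesis by eventually_elim (auto simp: inj_def)
    qed
    have "((\<lambda>r. det (\<chi> i j. ?f r (x r i) / ?f r (x r j) * (of_real (r powr (- 1 / 2)) * K r (x r i) (x r j))))
        \<longlongrightarrow> det (\<chi> i j. edge_kernel tau (S_second u v alpha tau chi e) odd_edge e (P i) (P j))) F"
      by (rule tendsto_det) (use conv[OF _ _ sep[rule_format] h[rule_format] h[rule_format]] in \<open>simp add: x_def K_def F_def Let_def\<close>)
    moreover have "\<forall>\<^sub>F r in F. det (\<chi> i j. ?f r (x r i) / ?f r (x r j) * (of_real (r powr (- 1 / 2)) * K r (x r i) (x r j))) =
        of_real (r powr (- real CARD('n) / 2) * model_correlation alpha r (k r) (c r) (d r) (x r))"
      using site range inj rpos filter_leD[OF F0 det]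
    proof eventually_elim
      case (elim r)
      have d: "of_real (model_correlation alpha r (k r) (c r) (d r) (x r)) = det (\<chi> i j. K r (x r i) (x r j))"
        using elim unfolding K_def by blast
      have "(r powr (- 1 / 2)) ^ CARD('n) = r powr (- real CARD('n) / 2)"
        using elim(4) by (simp add: powr_power)
      then have p: "complex_of_real (r powr (- 1 / 2)) ^ CARD('n) = of_real (r powr (- real CARD('n) / 2))"
        by (metis of_real_power)
      show ?case
        using det_conjugate[of "\<lambda>i. ?f r (x r i)" "of_real (r powr (- 1 / 2))" "\<chi> i j. K r (x r i) (x r j)"]
          turning_factor_nonzero[OF \<open>1 < alpha\<close>]
        by (simp only: vec_lambda_beta p d of_real_mult not_False_eq_True)
    qed
    ultimately have "((\<lambda>r. of_real (r powr (- real CARD('n) / 2) * model_correlation alpha r (k r) (c r) (d r) (x r)))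
        \<longlongrightarrow> det (\<chi> i j. edge_kernel tau (S_second u v alpha tau chi e) odd_edge e (P i) (P j))) F"
      by (rule Lim_transform_eventually)
    then show "((\<lambda>r. complex_of_real (r powr (- real CARD('n) / 2) *
                 model_correlation alpha r (k r) (c r) (d r)
                   (\<lambda>i. (edge_time tau r (fst (P i)), h i r))))
           \<longlongrightarrow> det (\<chi> i j. edge_kernel tau (S_second u v alpha tau chi e) odd_edge e (P i) (P j)))
          (edge_parity tau odd_edge)"
      by (simp only: x_def F_def)
  qed
qed

end
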